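(* Let $\mathfrak S$ be a category with a given Grothendieck topology, let $\pi:\mathscr B\to\mathfrak S$ be a category fibred in abelian tensor categories, and let $A$ be an abelian tensor category. (i) If for every $S\in\mathfrak S$ and every covering $\mathcal U$ of $S$ the functor $\delta:\mathscr B_S\to DD(\mathcal U)$ is fully faithful, then $p:\underline A\to\mathfrak S$ is a prestack. (ii) If for every $S\in\mathfrak S$ and every covering $\mathcal U$ of $S$ the functor $\delta:\mathscr B_S\to DD(\mathcal U)$ is fully faithful and essentially surjective, then $p:\underline A\to\mathfrak S$ is a stack.
   Context: An abelian tensor category is an abelian category with a symmetric monoidal structure such that for every object $y$ the functor $x\mapsto y\otimes x$ is additive and preserves (small) colimits. A tensor functor is a symmetric strong monoidal functor which preserves colimits. A category fibred in abelian tensor categories $\pi:\mathscr B\to\mathfrak S$ is a fibred category with given pull-back functors $f^*:\mathscr B_S\to\mathscr B_{S'}$ for every $f:S'\to S$ in $\mathfrak S$, such that every fibre category $\mathscr B_S$ is an abelian tensor category and every $f^*$ is a tensor functor. The category $\underline A=\underline{(A,\otimes)}(\mathscr B)$ has as objects the pairs $(S,F)$ with $S\in\mathfrak S$ and $F:A\to\mathscr B_S$ a tensor functor; a morphism $(S',F')\to(S,F)$ is a pair $(f,\phi)$ with $f:S'\to S$ a morphism in $\mathfrak S$ and $\phi:F'\to f^*\circ F$ a symmetric monoidal natural isomorphism; composition is $(f,\phi)\circ(f',\phi')=(f\circ f',f'^*(\phi)\circ\phi')$. The functor $p$ sends $(S,F)\mapsto S$ and $(f,\phi)\mapsto f$;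 it is a category fibred in groupoids. For a covering $\mathcal U=\{u_i:T_i\to S\}$, let $T_{ij}=T_i\times_ST_j$ with projections $p_1,p_2$ to $T_i,T_j$. $DD(\mathcal U)$ is the category of descent data: families $(x_i,\varphi_{ij})$ with $x_i\in\mathscr B_{T_i}$ and isomorphisms $\varphi_{ij}:p_1^*x_i\to p_2^*x_j$ in $\mathscr B_{T_{ij}}$ satisfying the cocycle condition over $T_i\times_ST_j\times_ST_k$, with compatible families of morphisms. The functor $\delta$ sends $x\mapsto(u_i^*(x),can_{ij,x})$, where $can_{ij}:p_1^*u_i^*\to p_2^*u_j^*$ is the canonical natural isomorphism. A prestack is a fibred category in groupoids whose presheaves of isomorphisms between two objects in the same fibre are sheaves; a stack is a prestack for which every descent datum is effective. *)

theory Defs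
  imports "HOL-Algebra.Group" "HOL-Library.FuncSet"
begin

section \<open>Categories and functors\<close>

record ('o, 'a) cat =
  Obj :: "'o set"
  Arr :: "'a set"
  Dom :: "'a \<Rightarrow> 'o"
  Cod :: "'a \<Rightarrow> 'o"
  Ident :: "'o \<Rightarrow> 'a"
  Comp :: "'a \<Rightarrow> 'a \<Rightarrow> 'a"  (infixl "\<cdot>\<index>" 70)

definition Hom :: "('o, 'a, 'z) cat_scheme \<Rightarrow> 'o \<Rightarrow> 'o \<Rightarrow> 'a set" where
  "Hom C x y = {f \<in> Arr C. Dom C f = x \<and> Cod C f = y}"

definition category :: "('o, 'a, 'z) cat_scheme \<Rightarrow> bool" where
  "category C \<longleftrightarrow>
     (\<forall>f\<in>Arr C. Dom C f \<in> Obj C \<and> Cod C f \<in> Obj C) \<and>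
     (\<forall>x\<in>Obj C. Ident C x \<in> Hom C x x) \<and>
     (\<forall>f\<in>Arr C. \<forall>g\<in>Arr C. Dom C g = Cod C f \<longrightarrow> g \<cdot>\<^bsub>C\<^esub> f \<in> Hom C (Dom C f) (Cod C g)) \<and>
     (\<forall>f\<in>Arr C. f \<cdot>\<^bsub>C\<^esub> Ident C (Dom C f) = f \<and> Ident C (Cod C f) \<cdot>\<^bsub>C\<^esub> f = f) \<and>
     (\<forall>f\<in>Arr C. \<forall>g\<in>Arr C. \<forall>h\<in>Arr C. Dom C g = Cod C f \<and> Dom C h = Cod C g \<longrightarrow>
        h \<cdot>\<^bsub>C\<^esub> (g \<cdot>\<^bsub>C\<^esub> f) = (h \<cdot>\<^bsub>C\<^esub> g) \<cdot>\<^bsub>C\<^esub> f)"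

definition inverse_arrows :: "('o, 'a, 'z) cat_scheme \<Rightarrow> 'a \<Rightarrow> 'a \<Rightarrow> bool" where
  "inverse_arrows C f g \<longleftrightarrow>
     f \<in> Arr C \<and> g \<in> Hom C (Cod C f) (Dom C f) \<and>
     g \<cdot>\<^bsub>C\<^esub> f = Ident C (Dom C f) \<and> f \<cdot>\<^bsub>C\<^esub> g = Ident C (Cod C f)"

definition is_iso :: "('o, 'a, 'z) cat_scheme \<Rightarrow> 'a \<Rightarrow> bool" where
  "is_iso C f \<longleftrightarrow> (\<exists>g. inverse_arrows C f g)"

definition inv_arr :: "('o, 'a, 'z) cat_scheme \<Rightarrow> 'a \<Rightarrow> 'a" where
  "inv_arr C f = (THE g. inverse_arrows C f g)"

definition groupoid :: "('o, 'a, 'z) cat_scheme \<Rightarrow> bool" where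
  "groupoid C \<longleftrightarrow> category C \<and> (\<forall>f\<in>Arr C. is_iso C f)"

record ('o, 'a, 'p, 'b) fctr =
  fobj :: "'o \<Rightarrow> 'p"
  farr :: "'a \<Rightarrow> 'b"

definition is_functor ::
    "('o, 'a, 'z) cat_scheme \<Rightarrow> ('p, 'b, 'y) cat_scheme \<Rightarrow> ('o, 'a, 'p, 'b, 'w) fctr_scheme \<Rightarrow> bool" where
  "is_functor C D F \<longleftrightarrow>
     (\<forall>x\<in>Obj C. fobj F x \<in> Obj D) \<and>
     (\<forall>f\<in>Arr C. farr F f \<in> Hom D (fobj F (Dom C f)) (fobj F (Cod C f))) \<and>
     (\<forall>x\<in>Obj C. farr F (Ident C x) = Ident D (fobj F x)) \<and>
     (\<forall>f\<in>Arr C. \<forall>g\<in>Arr C. Dom C g = Cod C f \<longrightarrow> farr F (g \<cdot>\<^bsub>C\<^esub> f) = farr F g \<cdot>\<^bsub>D\<^esub> farr F f)"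

definition comp_fctr ::
    "('p, 'b, 'r, 'c, 'v) fctr_scheme \<Rightarrow> ('o, 'a, 'p, 'b, 'w) fctr_scheme \<Rightarrow> ('o, 'a, 'r, 'c) fctr" where
  "comp_fctr G F = \<lparr>fobj = fobj G \<circ> fobj F, farr = farr G \<circ> farr F\<rparr>"

definition fully_faithful ::
    "('o, 'a, 'z) cat_scheme \<Rightarrow> ('p, 'b, 'y) cat_scheme \<Rightarrow> ('o, 'a, 'p, 'b, 'w) fctr_scheme \<Rightarrow> bool" where
  "fully_faithful C D F \<longleftrightarrow>
     (\<forall>x\<in>Obj C. \<forall>y\<in>Obj C. bij_betw (farr F) (Hom C x y) (Hom D (fobj F x) (fobj F y)))"

definition essentially_surjective ::
    "('o, 'a, 'z) cat_scheme \<Rightarrow> ('p, 'b, 'y) cat_scheme \<Rightarrow> ('o, 'a, 'p, 'b, 'w) fctr_scheme \<Rightarrow> bool" where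
  "essentially_surjective C D F \<longleftrightarrow>
     (\<forall>d\<in>Obj D. \<exists>x\<in>Obj C. \<exists>f\<in>Hom D (fobj F x) d. is_iso D f)"


section \<open>Small colimits\<close>

unbundle cardinal_syntax

text \<open>
  The role of the universe is played by an arbitrary infinite cardinal \<open>\<kappa>\<close>: a set is small if its
  cardinality is less than \<open>\<kappa>\<close>. Up to isomorphism every small category has its objects and its
  arrows in the field of \<open>\<kappa>\<close>, so it suffices to consider index categories carried by the
  type underlying \<open>\<kappa>\<close>.
\<close>

definition small_category :: "'j rel \<Rightarrow> ('j, 'j) cat \<Rightarrow> bool" where
  "small_category \<kappa> J \<longleftrightarrow> category J \<and> |Obj J| <o \<kappa> \<and> |Arr J| <o \<kappa>"

definition is_cocone ::
    "('i, 'k, 'y) cat_scheme \<Rightarrow> ('o, 'a, 'z) cat_scheme \<Rightarrow> ('i, 'k, 'o, 'a, 'w) fctr_scheme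
     \<Rightarrow> 'o \<Rightarrow> ('i \<Rightarrow> 'a) \<Rightarrow> bool" where
  "is_cocone J C D x \<iota> \<longleftrightarrow>
     x \<in> Obj C \<and> (\<forall>j\<in>Obj J. \<iota> j \<in> Hom C (fobj D j) x) \<and>
     (\<forall>h\<in>Arr J. \<iota> (Cod J h) \<cdot>\<^bsub>C\<^esub> farr D h = \<iota> (Dom J h))"

definition is_colimit ::
    "('i, 'k, 'y) cat_scheme \<Rightarrow> ('o, 'a, 'z) cat_scheme \<Rightarrow> ('i, 'k, 'o, 'a, 'w) fctr_scheme
     \<Rightarrow> 'o \<Rightarrow> ('i \<Rightarrow> 'a) \<Rightarrow> bool" where
  "is_colimit J C D x \<iota> \<longleftrightarrow>
     is_cocone J C D x \<iota> \<and>
     (\<forall>y \<iota>'. is_cocone J C D y \<iota>' \<longrightarrow>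
        (\<exists>!m. m \<in> Hom C x y \<and> (\<forall>j\<in>Obj J. m \<cdot>\<^bsub>C\<^esub> \<iota> j = \<iota>' j)))"

definition preserves_colimits ::
    "'j rel \<Rightarrow> ('o, 'a, 'z) cat_scheme \<Rightarrow> ('p, 'b, 'y) cat_scheme
     \<Rightarrow> ('o, 'a, 'p, 'b, 'w) fctr_scheme \<Rightarrow> bool" where
  "preserves_colimits \<kappa> C C' F \<longleftrightarrow>
     (\<forall>(J :: ('j, 'j) cat) (D :: ('j, 'j, 'o, 'a) fctr) x \<iota>.
        small_category \<kappa> J \<and> is_functor J C D \<and> is_colimit J C D x \<iota> \<longrightarrow>
        is_colimit J C' (comp_fctr F D) (fobj F x) (farr F \<circ> \<iota>))"


section \<open>Abelian categories\<close>

record ('o, 'a) abcat = "('o, 'a) cat" +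
  Zero :: "'o \<Rightarrow> 'o \<Rightarrow> 'a"
  Plus :: "'a \<Rightarrow> 'a \<Rightarrow> 'a"

definition preadditive :: "('o, 'a, 'z) abcat_scheme \<Rightarrow> bool" where
  "preadditive C \<longleftrightarrow>
     category C \<and>
     (\<forall>x\<in>Obj C. \<forall>y\<in>Obj C.
        comm_group \<lparr>carrier = Hom C x y, monoid.mult = Plus C, one = Zero C x y\<rparr>) \<and>
     (\<forall>x\<in>Obj C. \<forall>y\<in>Obj C. \<forall>z\<in>Obj C.
        \<forall>f\<in>Hom C x y. \<forall>f'\<in>Hom C x y. \<forall>g\<in>Hom C y z. \<forall>g'\<in>Hom C y z.
          g \<cdot>\<^bsub>C\<^esub> Plus C f f' = Plus C (g \<cdot>\<^bsub>C\<^esub> f) (g \<cdot>\<^bsub>C\<^esub> f') \<and>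
          Plus C g g' \<cdot>\<^bsub>C\<^esub> f = Plus C (g \<cdot>\<^bsub>C\<^esub> f) (g' \<cdot>\<^bsub>C\<^esub> f))"

definition is_zero_object :: "('o, 'a, 'z) cat_scheme \<Rightarrow> 'o \<Rightarrow> bool" where
  "is_zero_object C o0 \<longleftrightarrow>
     o0 \<in> Obj C \<and> (\<forall>x\<in>Obj C. (\<exists>!f. f \<in> Hom C o0 x) \<and> (\<exists>!f. f \<in> Hom C x o0))"

definition is_biproduct ::
    "('o, 'a, 'z) abcat_scheme \<Rightarrow> 'o \<Rightarrow> 'o \<Rightarrow> 'o \<Rightarrow> 'a \<Rightarrow> 'a \<Rightarrow> 'a \<Rightarrow> 'a \<Rightarrow> bool" where
  "is_biproduct C x y w i1 i2 p1 p2 \<longleftrightarrow>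
     w \<in> Obj C \<and>
     i1 \<in> Hom C x w \<and> i2 \<in> Hom C y w \<and> p1 \<in> Hom C w x \<and> p2 \<in> Hom C w y \<and>
     p1 \<cdot>\<^bsub>C\<^esub> i1 = Ident C x \<and> p2 \<cdot>\<^bsub>C\<^esub> i2 = Ident C y \<and>
     p1 \<cdot>\<^bsub>C\<^esub> i2 = Zero C y x \<and> p2 \<cdot>\<^bsub>C\<^esub> i1 = Zero C x y \<and>
     Plus C (i1 \<cdot>\<^bsub>C\<^esub> p1) (i2 \<cdot>\<^bsub>C\<^esub> p2) = Ident C w"

definition is_kernel :: "('o, 'a, 'z) abcat_scheme \<Rightarrow> 'a \<Rightarrow> 'a \<Rightarrow> bool" where
  "is_kernel C f k \<longleftrightarrow>
     f \<in> Arr C \<and> k \<in> Arr C \<and> Cod C k = Dom C f \<and> f \<cdot>\<^bsub>C\<^esub> k = Zero C (Dom C k) (Cod C f) \<and>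
     (\<forall>h\<in>Arr C. Cod C h = Dom C f \<and> f \<cdot>\<^bsub>C\<^esub> h = Zero C (Dom C h) (Cod C f) \<longrightarrow>
        (\<exists>!m. m \<in> Hom C (Dom C h) (Dom C k) \<and> k \<cdot>\<^bsub>C\<^esub> m = h))"

definition is_cokernel :: "('o, 'a, 'z) abcat_scheme \<Rightarrow> 'a \<Rightarrow> 'a \<Rightarrow> bool" where
  "is_cokernel C f c \<longleftrightarrow>
     f \<in> Arr C \<and> c \<in> Arr C \<and> Dom C c = Cod C f \<and> c \<cdot>\<^bsub>C\<^esub> f = Zero C (Dom C f) (Cod C c) \<and>
     (\<forall>h\<in>Arr C. Dom C h = Cod C f \<and> h \<cdot>\<^bsub>C\<^esub> f = Zero C (Dom C f) (Cod C h) \<longrightarrow>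
        (\<exists>!m. m \<in> Hom C (Cod C c) (Cod C h) \<and> m \<cdot>\<^bsub>C\<^esub> c = h))"

definition is_mono :: "('o, 'a, 'z) cat_scheme \<Rightarrow> 'a \<Rightarrow> bool" where
  "is_mono C f \<longleftrightarrow>
     f \<in> Arr C \<and>
     (\<forall>g\<in>Arr C. \<forall>h\<in>Arr C. Dom C g = Dom C h \<and> Cod C g = Dom C f \<and> Cod C h = Dom C f \<and>
        f \<cdot>\<^bsub>C\<^esub> g = f \<cdot>\<^bsub>C\<^esub> h \<longrightarrow> g = h)"

definition is_epi :: "('o, 'a, 'z) cat_scheme \<Rightarrow> 'a \<Rightarrow> bool" where
  "is_epi C f \<longleftrightarrow>
     f \<in> Arr C \<and>
     (\<forall>g\<in>Arr C. \<forall>h\<in>Arr C. Cod C g = Cod C h \<and> Dom C g = Cod C f \<and> Dom C h = Cod C f \<and>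
        g \<cdot>\<^bsub>C\<^esub> f = h \<cdot>\<^bsub>C\<^esub> f \<longrightarrow> g = h)"

definition abelian_category :: "('o, 'a, 'z) abcat_scheme \<Rightarrow> bool" where
  "abelian_category C \<longleftrightarrow>
     preadditive C \<and>
     (\<exists>o0. is_zero_object C o0) \<and>
     (\<forall>x\<in>Obj C. \<forall>y\<in>Obj C. \<exists>w i1 i2 p1 p2. is_biproduct C x y w i1 i2 p1 p2) \<and>
     (\<forall>f\<in>Arr C. \<exists>k. is_kernel C f k) \<and>
     (\<forall>f\<in>Arr C. \<exists>c. is_cokernel C f c) \<and>
     (\<forall>k. is_mono C k \<longrightarrow> (\<exists>f. is_kernel C f k)) \<and>
     (\<forall>c. is_epi C c \<longrightarrow> (\<exists>f. is_cokernel C f c))"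

definition additive_functor ::
    "('o, 'a, 'z) abcat_scheme \<Rightarrow> ('p, 'b, 'y) abcat_scheme \<Rightarrow> ('o, 'a, 'p, 'b, 'w) fctr_scheme \<Rightarrow> bool" where
  "additive_functor C D F \<longleftrightarrow>
     is_functor C D F \<and>
     (\<forall>x\<in>Obj C. \<forall>y\<in>Obj C. \<forall>f\<in>Hom C x y. \<forall>g\<in>Hom C x y.
        farr F (Plus C f g) = Plus D (farr F f) (farr F g))"


section \<open>Abelian tensor categories and tensor functors\<close>

record ('o, 'a) atcat = "('o, 'a) abcat" +
  TensO :: "'o \<Rightarrow> 'o \<Rightarrow> 'o"  (infixl "\<otimes>\<^sub>o\<index>" 75)
  TensA :: "'a \<Rightarrow> 'a \<Rightarrow> 'a"  (infixl "\<otimes>\<^sub>a\<index>" 75)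
  Unt :: 'o
  Asc :: "'o \<Rightarrow> 'o \<Rightarrow> 'o \<Rightarrow> 'a"
  LUn :: "'o \<Rightarrow> 'a"
  RUn :: "'o \<Rightarrow> 'a"
  Brd :: "'o \<Rightarrow> 'o \<Rightarrow> 'a"

definition tensor_bifunctor :: "('o, 'a, 'z) atcat_scheme \<Rightarrow> bool" where
  "tensor_bifunctor C \<longleftrightarrow>
     (\<forall>x\<in>Obj C. \<forall>y\<in>Obj C. x \<otimes>\<^sub>o\<^bsub>C\<^esub> y \<in> Obj C) \<and>
     (\<forall>f\<in>Arr C. \<forall>g\<in>Arr C.
        f \<otimes>\<^sub>a\<^bsub>C\<^esub> g \<in> Hom C (Dom C f \<otimes>\<^sub>o\<^bsub>C\<^esub> Dom C g) (Cod C f \<otimes>\<^sub>o\<^bsub>C\<^esub> Cod C g)) \<and>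
     (\<forall>x\<in>Obj C. \<forall>y\<in>Obj C. Ident C x \<otimes>\<^sub>a\<^bsub>C\<^esub> Ident C y = Ident C (x \<otimes>\<^sub>o\<^bsub>C\<^esub> y)) \<and>
     (\<forall>f\<in>Arr C. \<forall>f'\<in>Arr C. \<forall>g\<in>Arr C. \<forall>g'\<in>Arr C. Dom C f' = Cod C f \<and> Dom C g' = Cod C g \<longrightarrow>
        (f' \<cdot>\<^bsub>C\<^esub> f) \<otimes>\<^sub>a\<^bsub>C\<^esub> (g' \<cdot>\<^bsub>C\<^esub> g) = (f' \<otimes>\<^sub>a\<^bsub>C\<^esub> g') \<cdot>\<^bsub>C\<^esub> (f \<otimes>\<^sub>a\<^bsub>C\<^esub> g))"

definition symmetric_monoidal :: "('o, 'a, 'z) atcat_scheme \<Rightarrow> bool" where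
  "symmetric_monoidal C \<longleftrightarrow>
     category C \<and> tensor_bifunctor C \<and> Unt C \<in> Obj C \<and>
     (\<forall>x\<in>Obj C. \<forall>y\<in>Obj C. \<forall>z\<in>Obj C. is_iso C (Asc C x y z) \<and>
        Asc C x y z \<in> Hom C ((x \<otimes>\<^sub>o\<^bsub>C\<^esub> y) \<otimes>\<^sub>o\<^bsub>C\<^esub> z) (x \<otimes>\<^sub>o\<^bsub>C\<^esub> (y \<otimes>\<^sub>o\<^bsub>C\<^esub> z))) \<and>
     (\<forall>x\<in>Obj C. is_iso C (LUn C x) \<and> LUn C x \<in> Hom C (Unt C \<otimes>\<^sub>o\<^bsub>C\<^esub> x) x) \<and>
     (\<forall>x\<in>Obj C. is_iso C (RUn C x) \<and> RUn C x \<in> Hom C (x \<otimes>\<^sub>o\<^bsub>C\<^esub> Unt C) x) \<and>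
     (\<forall>x\<in>Obj C. \<forall>y\<in>Obj C. is_iso C (Brd C x y) \<and>
        Brd C x y \<in> Hom C (x \<otimes>\<^sub>o\<^bsub>C\<^esub> y) (y \<otimes>\<^sub>o\<^bsub>C\<^esub> x)) \<and>
     \<comment> \<open>naturality\<close>
     (\<forall>f\<in>Arr C. \<forall>g\<in>Arr C. \<forall>h\<in>Arr C.
        Asc C (Cod C f) (Cod C g) (Cod C h) \<cdot>\<^bsub>C\<^esub> ((f \<otimes>\<^sub>a\<^bsub>C\<^esub> g) \<otimes>\<^sub>a\<^bsub>C\<^esub> h) =
        (f \<otimes>\<^sub>a\<^bsub>C\<^esub> (g \<otimes>\<^sub>a\<^bsub>C\<^esub> h)) \<cdot>\<^bsub>C\<^esub> Asc C (Dom C f) (Dom C g) (Dom C h)) \<and>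
     (\<forall>f\<in>Arr C. LUn C (Cod C f) \<cdot>\<^bsub>C\<^esub> (Ident C (Unt C) \<otimes>\<^sub>a\<^bsub>C\<^esub> f) = f \<cdot>\<^bsub>C\<^esub> LUn C (Dom C f)) \<and>
     (\<forall>f\<in>Arr C. RUn C (Cod C f) \<cdot>\<^bsub>C\<^esub> (f \<otimes>\<^sub>a\<^bsub>C\<^esub> Ident C (Unt C)) = f \<cdot>\<^bsub>C\<^esub> RUn C (Dom C f)) \<and>
     (\<forall>f\<in>Arr C. \<forall>g\<in>Arr C.
        Brd C (Cod C f) (Cod C g) \<cdot>\<^bsub>C\<^esub> (f \<otimes>\<^sub>a\<^bsub>C\<^esub> g) = (g \<otimes>\<^sub>a\<^bsub>C\<^esub> f) \<cdot>\<^bsub>C\<^esub> Brd C (Dom C f) (Dom C g)) \<and>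
     \<comment> \<open>pentagon, triangle, symmetry, hexagon\<close>
     (\<forall>w\<in>Obj C. \<forall>x\<in>Obj C. \<forall>y\<in>Obj C. \<forall>z\<in>Obj C.
        Asc C w x (y \<otimes>\<^sub>o\<^bsub>C\<^esub> z) \<cdot>\<^bsub>C\<^esub> Asc C (w \<otimes>\<^sub>o\<^bsub>C\<^esub> x) y z =
        (Ident C w \<otimes>\<^sub>a\<^bsub>C\<^esub> Asc C x y z) \<cdot>\<^bsub>C\<^esub> Asc C w (x \<otimes>\<^sub>o\<^bsub>C\<^esub> y) z \<cdot>\<^bsub>C\<^esub> (Asc C w x y \<otimes>\<^sub>a\<^bsub>C\<^esub> Ident C z)) \<and>
     (\<forall>x\<in>Obj C. \<forall>y\<in>Obj C.
        (Ident C x \<otimes>\<^sub>a\<^bsub>C\<^esub> LUn C y) \<cdot>\<^bsub>C\<^esub> Asc C x (Unt C) y = RUn C x \<otimes>\<^sub>a\<^bsub>C\<^esub> Ident C y) \<and>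
     (\<forall>x\<in>Obj C. \<forall>y\<in>Obj C. Brd C y x \<cdot>\<^bsub>C\<^esub> Brd C x y = Ident C (x \<otimes>\<^sub>o\<^bsub>C\<^esub> y)) \<and>
     (\<forall>x\<in>Obj C. \<forall>y\<in>Obj C. \<forall>z\<in>Obj C.
        Asc C y z x \<cdot>\<^bsub>C\<^esub> Brd C x (y \<otimes>\<^sub>o\<^bsub>C\<^esub> z) \<cdot>\<^bsub>C\<^esub> Asc C x y z =
        (Ident C y \<otimes>\<^sub>a\<^bsub>C\<^esub> Brd C x z) \<cdot>\<^bsub>C\<^esub> Asc C y x z \<cdot>\<^bsub>C\<^esub> (Brd C x y \<otimes>\<^sub>a\<^bsub>C\<^esub> Ident C z))"

definition tensor_with :: "('o, 'a, 'z) atcat_scheme \<Rightarrow> 'o \<Rightarrow> ('o, 'a, 'o, 'a) fctr" where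
  "tensor_with C y = \<lparr>fobj = (\<lambda>x. y \<otimes>\<^sub>o\<^bsub>C\<^esub> x), farr = (\<lambda>f. Ident C y \<otimes>\<^sub>a\<^bsub>C\<^esub> f)\<rparr>"

definition abelian_tensor_category :: "'j rel \<Rightarrow> ('o, 'a, 'z) atcat_scheme \<Rightarrow> bool" where
  "abelian_tensor_category \<kappa> C \<longleftrightarrow>
     abelian_category C \<and> symmetric_monoidal C \<and>
     (\<forall>y\<in>Obj C. additive_functor C C (tensor_with C y) \<and>
        preserves_colimits \<kappa> C C (tensor_with C y))"

text \<open>\<open>Mu F x y : F x \<otimes> F y \<rightarrow> F (x \<otimes> y)\<close> and \<open>Eps F : 1 \<rightarrow> F 1\<close>.\<close>

record ('o, 'a, 'p, 'b) tfctr = "('o, 'a, 'p, 'b) fctr" +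
  Mu :: "'o \<Rightarrow> 'o \<Rightarrow> 'b"
  Eps :: 'b

definition symmetric_strong_monoidal ::
    "('o, 'a, 'z) atcat_scheme \<Rightarrow> ('p, 'b, 'y) atcat_scheme \<Rightarrow> ('o, 'a, 'p, 'b, 'w) tfctr_scheme \<Rightarrow> bool" where
  "symmetric_strong_monoidal C D F \<longleftrightarrow>
     is_functor C D F \<and>
     (\<forall>x\<in>Obj C. \<forall>y\<in>Obj C. is_iso D (Mu F x y) \<and>
        Mu F x y \<in> Hom D (fobj F x \<otimes>\<^sub>o\<^bsub>D\<^esub> fobj F y) (fobj F (x \<otimes>\<^sub>o\<^bsub>C\<^esub> y))) \<and>
     is_iso D (Eps F) \<and> Eps F \<in> Hom D (Unt D) (fobj F (Unt C)) \<and>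
     (\<forall>f\<in>Arr C. \<forall>g\<in>Arr C.
        Mu F (Cod C f) (Cod C g) \<cdot>\<^bsub>D\<^esub> (farr F f \<otimes>\<^sub>a\<^bsub>D\<^esub> farr F g) =
        farr F (f \<otimes>\<^sub>a\<^bsub>C\<^esub> g) \<cdot>\<^bsub>D\<^esub> Mu F (Dom C f) (Dom C g)) \<and>
     (\<forall>x\<in>Obj C. \<forall>y\<in>Obj C. \<forall>z\<in>Obj C.
        farr F (Asc C x y z) \<cdot>\<^bsub>D\<^esub> Mu F (x \<otimes>\<^sub>o\<^bsub>C\<^esub> y) z \<cdot>\<^bsub>D\<^esub> (Mu F x y \<otimes>\<^sub>a\<^bsub>D\<^esub> Ident D (fobj F z)) =
        Mu F x (y \<otimes>\<^sub>o\<^bsub>C\<^esub> z) \<cdot>\<^bsub>D\<^esub> (Ident D (fobj F x) \<otimes>\<^sub>a\<^bsub>D\<^esub> Mu F y z)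
          \<cdot>\<^bsub>D\<^esub> Asc D (fobj F x) (fobj F y) (fobj F z)) \<and>
     (\<forall>x\<in>Obj C.
        farr F (LUn C x) \<cdot>\<^bsub>D\<^esub> Mu F (Unt C) x \<cdot>\<^bsub>D\<^esub> (Eps F \<otimes>\<^sub>a\<^bsub>D\<^esub> Ident D (fobj F x)) = LUn D (fobj F x)) \<and>
     (\<forall>x\<in>Obj C.
        farr F (RUn C x) \<cdot>\<^bsub>D\<^esub> Mu F x (Unt C) \<cdot>\<^bsub>D\<^esub> (Ident D (fobj F x) \<otimes>\<^sub>a\<^bsub>D\<^esub> Eps F) = RUn D (fobj F x)) \<and>
     (\<forall>x\<in>Obj C. \<forall>y\<in>Obj C.
        farr F (Brd C x y) \<cdot>\<^bsub>D\<^esub> Mu F x y = Mu F y x \<cdot>\<^bsub>D\<^esub> Brd D (fobj F x) (fobj F y))"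

definition tensor_functor ::
    "'j rel \<Rightarrow> ('o, 'a, 'z) atcat_scheme \<Rightarrow> ('p, 'b, 'y) atcat_scheme
     \<Rightarrow> ('o, 'a, 'p, 'b, 'w) tfctr_scheme \<Rightarrow> bool" where
  "tensor_functor \<kappa> C D F \<longleftrightarrow> symmetric_strong_monoidal C D F \<and> preserves_colimits \<kappa> C D F"

definition id_tfctr :: "('o, 'a, 'z) atcat_scheme \<Rightarrow> ('o, 'a, 'o, 'a) tfctr" where
  "id_tfctr C = \<lparr>fobj = (\<lambda>x. x), farr = (\<lambda>f. f), Mu = (\<lambda>x y. Ident C (x \<otimes>\<^sub>o\<^bsub>C\<^esub> y)),
     Eps = Ident C (Unt C)\<rparr>"

text \<open>The composite \<open>G \<circ> F\<close>, where \<open>E\<close> is the target category of \<open>G\<close>.\<close>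

definition comp_tfctr ::
    "('r, 'c, 'z) cat_scheme \<Rightarrow> ('p, 'b, 'r, 'c, 'v) tfctr_scheme \<Rightarrow> ('o, 'a, 'p, 'b, 'w) tfctr_scheme
     \<Rightarrow> ('o, 'a, 'r, 'c) tfctr" where
  "comp_tfctr E G F = \<lparr>fobj = fobj G \<circ> fobj F, farr = farr G \<circ> farr F,
     Mu = (\<lambda>x y. farr G (Mu F x y) \<cdot>\<^bsub>E\<^esub> Mu G (fobj F x) (fobj F y)),
     Eps = farr G (Eps F) \<cdot>\<^bsub>E\<^esub> Eps G\<rparr>"

text \<open>
  A monoidal natural isomorphism between symmetric monoidal functors is automatically compatible
  with the symmetries.
\<close>

definition monoidal_nat_iso ::
    "('o, 'a, 'z) atcat_scheme \<Rightarrow> ('p, 'b, 'y) atcat_scheme \<Rightarrow> ('o, 'a, 'p, 'b, 'w) tfctr_scheme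
     \<Rightarrow> ('o, 'a, 'p, 'b, 'v) tfctr_scheme \<Rightarrow> ('o \<Rightarrow> 'b) \<Rightarrow> bool" where
  "monoidal_nat_iso C D F G \<phi> \<longleftrightarrow>
     (\<forall>x\<in>Obj C. is_iso D (\<phi> x) \<and> \<phi> x \<in> Hom D (fobj F x) (fobj G x)) \<and>
     (\<forall>f\<in>Arr C. \<phi> (Cod C f) \<cdot>\<^bsub>D\<^esub> farr F f = farr G f \<cdot>\<^bsub>D\<^esub> \<phi> (Dom C f)) \<and>
     (\<forall>x\<in>Obj C. \<forall>y\<in>Obj C. \<phi> (x \<otimes>\<^sub>o\<^bsub>C\<^esub> y) \<cdot>\<^bsub>D\<^esub> Mu F x y = Mu G x y \<cdot>\<^bsub>D\<^esub> (\<phi> x \<otimes>\<^sub>a\<^bsub>D\<^esub> \<phi> y)) \<and>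
     \<phi> (Unt C) \<cdot>\<^bsub>D\<^esub> Eps F = Eps G"


section \<open>Fibre products and Grothendieck topologies\<close>

definition is_pullback :: "('s, 'f, 'z) cat_scheme \<Rightarrow> 'f \<Rightarrow> 'f \<Rightarrow> 'f \<Rightarrow> 'f \<Rightarrow> bool" where
  "is_pullback S u v p q \<longleftrightarrow>
     u \<in> Arr S \<and> v \<in> Arr S \<and> Cod S u = Cod S v \<and>
     p \<in> Arr S \<and> q \<in> Arr S \<and> Dom S p = Dom S q \<and> Cod S p = Dom S u \<and> Cod S q = Dom S v \<and>
     u \<cdot>\<^bsub>S\<^esub> p = v \<cdot>\<^bsub>S\<^esub> q \<and>
     (\<forall>a\<in>Arr S. \<forall>b\<in>Arr S. Dom S a = Dom S b \<and> Cod S a = Dom S u \<and> Cod S b = Dom S v \<and>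
        u \<cdot>\<^bsub>S\<^esub> a = v \<cdot>\<^bsub>S\<^esub> b \<longrightarrow>
        (\<exists>!h. h \<in> Hom S (Dom S a) (Dom S p) \<and> p \<cdot>\<^bsub>S\<^esub> h = a \<and> q \<cdot>\<^bsub>S\<^esub> h = b))"

definition is_pullback3 ::
    "('s, 'f, 'z) cat_scheme \<Rightarrow> 'f \<Rightarrow> 'f \<Rightarrow> 'f \<Rightarrow> 'f \<Rightarrow> 'f \<Rightarrow> 'f \<Rightarrow> bool" where
  "is_pullback3 S u v w p q r \<longleftrightarrow>
     u \<in> Arr S \<and> v \<in> Arr S \<and> w \<in> Arr S \<and> Cod S u = Cod S v \<and> Cod S v = Cod S w \<and>
     p \<in> Arr S \<and> q \<in> Arr S \<and> r \<in> Arr S \<and> Dom S p = Dom S q \<and> Dom S q = Dom S r \<and>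
     Cod S p = Dom S u \<and> Cod S q = Dom S v \<and> Cod S r = Dom S w \<and>
     u \<cdot>\<^bsub>S\<^esub> p = v \<cdot>\<^bsub>S\<^esub> q \<and> v \<cdot>\<^bsub>S\<^esub> q = w \<cdot>\<^bsub>S\<^esub> r \<and>
     (\<forall>a\<in>Arr S. \<forall>b\<in>Arr S. \<forall>c\<in>Arr S. Dom S a = Dom S b \<and> Dom S b = Dom S c \<and>
        Cod S a = Dom S u \<and> Cod S b = Dom S v \<and> Cod S c = Dom S w \<and>
        u \<cdot>\<^bsub>S\<^esub> a = v \<cdot>\<^bsub>S\<^esub> b \<and> v \<cdot>\<^bsub>S\<^esub> b = w \<cdot>\<^bsub>S\<^esub> c \<longrightarrow>
        (\<exists>!h. h \<in> Hom S (Dom S a) (Dom S p) \<and> p \<cdot>\<^bsub>S\<^esub> h = a \<and> q \<cdot>\<^bsub>S\<^esub> h = b \<and> r \<cdot>\<^bsub>S\<^esub> h = c))"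

text \<open>
  A choice of the projections of the double and triple fibre products; they exist for members of a
  covering.
\<close>

definition fprod :: "('s, 'f, 'z) cat_scheme \<Rightarrow> 'f \<Rightarrow> 'f \<Rightarrow> 'f \<times> 'f" where
  "fprod S u v = (SOME (p, q). is_pullback S u v p q)"

definition pr1 :: "('s, 'f, 'z) cat_scheme \<Rightarrow> 'f \<Rightarrow> 'f \<Rightarrow> 'f" where
  "pr1 S u v = fst (fprod S u v)"

definition pr2 :: "('s, 'f, 'z) cat_scheme \<Rightarrow> 'f \<Rightarrow> 'f \<Rightarrow> 'f" where
  "pr2 S u v = snd (fprod S u v)"

definition fprod3 :: "('s, 'f, 'z) cat_scheme \<Rightarrow> 'f \<Rightarrow> 'f \<Rightarrow> 'f \<Rightarrow> 'f \<times> 'f \<times> 'f" where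
  "fprod3 S u v w = (SOME (p, q, r). is_pullback3 S u v w p q r)"

text \<open>The arrow into the double fibre product with components \<open>a\<close> and \<open>b\<close>.\<close>

definition fpair :: "('s, 'f, 'z) cat_scheme \<Rightarrow> 'f \<Rightarrow> 'f \<Rightarrow> 'f \<Rightarrow> 'f \<Rightarrow> 'f" where
  "fpair S u v a b = (THE h. h \<in> Hom S (Dom S a) (Dom S (pr1 S u v)) \<and>
     pr1 S u v \<cdot>\<^bsub>S\<^esub> h = a \<and> pr2 S u v \<cdot>\<^bsub>S\<^esub> h = b)"

text \<open>
  Grothendieck topologies are given by coverings; a covering of \<open>s\<close> is a set of arrows with target
  \<open>s\<close>, so the members of a covering serve as their own indices.
\<close>

definition grothendieck_topology :: "('s, 'f, 'z) cat_scheme \<Rightarrow> ('s \<Rightarrow> 'f set set) \<Rightarrow> bool" where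
  "grothendieck_topology S Cov \<longleftrightarrow>
     category S \<and>
     (\<forall>s\<in>Obj S. \<forall>\<U>\<in>Cov s. \<forall>u\<in>\<U>. u \<in> Arr S \<and> Cod S u = s) \<and>
     (\<forall>f. is_iso S f \<longrightarrow> {f} \<in> Cov (Cod S f)) \<and>
     (\<forall>s\<in>Obj S. \<forall>\<U>\<in>Cov s. \<forall>g\<in>Arr S. Cod S g = s \<longrightarrow>
        (\<forall>u\<in>\<U>. \<exists>p q. is_pullback S u g p q) \<and>
        (\<forall>P Q. (\<forall>u\<in>\<U>. is_pullback S u g (P u) (Q u)) \<longrightarrow> Q ` \<U> \<in> Cov (Dom S g))) \<and>
     (\<forall>s\<in>Obj S. \<forall>\<U>\<in>Cov s. \<forall>\<V>. (\<forall>u\<in>\<U>. \<V> u \<in> Cov (Dom S u)) \<longrightarrow>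
        {u \<cdot>\<^bsub>S\<^esub> v | u v. u \<in> \<U> \<and> v \<in> \<V> u} \<in> Cov s)"


section \<open>Fibred categories\<close>

definition fibre ::
    "('s, 'f, 'z) cat_scheme \<Rightarrow> ('x, 'a, 'y) cat_scheme \<Rightarrow> ('x, 'a, 's, 'f, 'w) fctr_scheme \<Rightarrow> 's
     \<Rightarrow> ('x, 'a) cat" where
  "fibre S X \<pi> s = \<lparr>Obj = {x \<in> Obj X. fobj \<pi> x = s},
     Arr = {a \<in> Arr X. fobj \<pi> (Dom X a) = s \<and> fobj \<pi> (Cod X a) = s \<and> farr \<pi> a = Ident S s},
     Dom = Dom X, Cod = Cod X, Ident = Ident X, Comp = Comp X\<rparr>"

definition cartesian ::
    "('s, 'f, 'z) cat_scheme \<Rightarrow> ('x, 'a, 'y) cat_scheme \<Rightarrow> ('x, 'a, 's, 'f, 'w) fctr_scheme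
     \<Rightarrow> 'a \<Rightarrow> bool" where
  "cartesian S X \<pi> a \<longleftrightarrow>
     a \<in> Arr X \<and>
     (\<forall>b\<in>Arr X. \<forall>h\<in>Hom S (fobj \<pi> (Dom X b)) (fobj \<pi> (Dom X a)).
        Cod X b = Cod X a \<and> farr \<pi> a \<cdot>\<^bsub>S\<^esub> h = farr \<pi> b \<longrightarrow>
        (\<exists>!c. c \<in> Hom X (Dom X b) (Dom X a) \<and> farr \<pi> c = h \<and> a \<cdot>\<^bsub>X\<^esub> c = b))"

definition fibred_category ::
    "('s, 'f, 'z) cat_scheme \<Rightarrow> ('x, 'a, 'y) cat_scheme \<Rightarrow> ('x, 'a, 's, 'f, 'w) fctr_scheme
     \<Rightarrow> bool" where
  "fibred_category S X \<pi> \<longleftrightarrow>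
     category S \<and> category X \<and> is_functor X S \<pi> \<and>
     (\<forall>f\<in>Arr S. \<forall>x\<in>Obj X. fobj \<pi> x = Cod S f \<longrightarrow>
        (\<exists>a. cartesian S X \<pi> a \<and> Cod X a = x \<and> farr \<pi> a = f))"

definition fibred_in_groupoids ::
    "('s, 'f, 'z) cat_scheme \<Rightarrow> ('x, 'a, 'y) cat_scheme \<Rightarrow> ('x, 'a, 's, 'f, 'w) fctr_scheme
     \<Rightarrow> bool" where
  "fibred_in_groupoids S X \<pi> \<longleftrightarrow>
     fibred_category S X \<pi> \<and> (\<forall>s\<in>Obj S. groupoid (fibre S X \<pi> s))"

text \<open>
  A cleavage \<open>c\<close> selects for \<open>f\<close> and \<open>x\<close> over the target of \<open>f\<close> a cartesian arrow
  \<open>c f x : f\<^sup>* x \<rightarrow> x\<close> over \<open>f\<close>; this is the same as giving the pull-back functors \<open>f\<^sup>*\<close> of a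
  fibred category.
\<close>

definition cleavage ::
    "('s, 'f, 'z) cat_scheme \<Rightarrow> ('x, 'a, 'y) cat_scheme \<Rightarrow> ('x, 'a, 's, 'f, 'w) fctr_scheme
     \<Rightarrow> ('f \<Rightarrow> 'x \<Rightarrow> 'a) \<Rightarrow> bool" where
  "cleavage S X \<pi> c \<longleftrightarrow>
     (\<forall>f\<in>Arr S. \<forall>x\<in>Obj X. fobj \<pi> x = Cod S f \<longrightarrow>
        cartesian S X \<pi> (c f x) \<and> Cod X (c f x) = x \<and> farr \<pi> (c f x) = f)"

record ('s, 'f, 'x, 'a) cloven =
  Base :: "('s, 'f) cat"
  Tot :: "('x, 'a) cat"
  Proj :: "('x, 'a, 's, 'f) fctr"
  Clv :: "'f \<Rightarrow> 'x \<Rightarrow> 'a"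

definition cloven_fibred_category :: "('s, 'f, 'x, 'a, 'z) cloven_scheme \<Rightarrow> bool" where
  "cloven_fibred_category E \<longleftrightarrow>
     fibred_category (Base E) (Tot E) (Proj E) \<and> cleavage (Base E) (Tot E) (Proj E) (Clv E)"

abbreviation fib :: "('s, 'f, 'x, 'a, 'z) cloven_scheme \<Rightarrow> 's \<Rightarrow> ('x, 'a) cat" where
  "fib E s \<equiv> fibre (Base E) (Tot E) (Proj E) s"

definition pull_obj :: "('s, 'f, 'x, 'a, 'z) cloven_scheme \<Rightarrow> 'f \<Rightarrow> 'x \<Rightarrow> 'x" where
  "pull_obj E f x = Dom (Tot E) (Clv E f x)"

definition pull_arr :: "('s, 'f, 'x, 'a, 'z) cloven_scheme \<Rightarrow> 'f \<Rightarrow> 'a \<Rightarrow> 'a" where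
  "pull_arr E f a =
     (THE b. b \<in> Hom (fib E (Dom (Base E) f))
                     (pull_obj E f (Dom (Tot E) a)) (pull_obj E f (Cod (Tot E) a)) \<and>
        Clv E f (Cod (Tot E) a) \<cdot>\<^bsub>Tot E\<^esub> b = a \<cdot>\<^bsub>Tot E\<^esub> Clv E f (Dom (Tot E) a))"

text \<open>The canonical isomorphism \<open>g\<^sup>* (f\<^sup>* x) \<rightarrow> (f \<circ> g)\<^sup>* x\<close>.\<close>

definition can :: "('s, 'f, 'x, 'a, 'z) cloven_scheme \<Rightarrow> 'f \<Rightarrow> 'f \<Rightarrow> 'x \<Rightarrow> 'a" where
  "can E f g x =
     (THE b. b \<in> Hom (fib E (Dom (Base E) g))
                     (pull_obj E g (pull_obj E f x)) (pull_obj E (f \<cdot>\<^bsub>Base E\<^esub> g) x) \<and>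
        Clv E (f \<cdot>\<^bsub>Base E\<^esub> g) x \<cdot>\<^bsub>Tot E\<^esub> b = Clv E f x \<cdot>\<^bsub>Tot E\<^esub> Clv E g (pull_obj E f x))"

text \<open>
  For \<open>a : f\<^sup>* x \<rightarrow> f'\<^sup>* y\<close> in a fibre, \<open>restr E f x f' y g a : (f \<circ> g)\<^sup>* x \<rightarrow> (f' \<circ> g)\<^sup>* y\<close> is \<open>g\<^sup>* a\<close>
  up to the canonical isomorphisms.
\<close>

definition restr ::
    "('s, 'f, 'x, 'a, 'z) cloven_scheme \<Rightarrow> 'f \<Rightarrow> 'x \<Rightarrow> 'f \<Rightarrow> 'x \<Rightarrow> 'f \<Rightarrow> 'a \<Rightarrow> 'a" where
  "restr E f x f' y g a =
     can E f' g y \<cdot>\<^bsub>Tot E\<^esub> pull_arr E g a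
       \<cdot>\<^bsub>Tot E\<^esub> inv_arr (fib E (Dom (Base E) g)) (can E f g x)"


section \<open>Descent data\<close>

text \<open>
  \<open>x u\<close> is the object over the source of \<open>u \<in> \<U>\<close> and \<open>\<phi> (u, v)\<close> the isomorphism
  \<open>p\<^sub>1\<^sup>* (x u) \<rightarrow> p\<^sub>2\<^sup>* (x v)\<close>. Families are \<^const>\<open>extensional\<close> so that they are determined by their
  members.
\<close>

definition descent_datum ::
    "('s, 'f, 'x, 'a, 'z) cloven_scheme \<Rightarrow> 'f set \<Rightarrow> ('f \<Rightarrow> 'x) \<Rightarrow> ('f \<times> 'f \<Rightarrow> 'a) \<Rightarrow> bool" where
  "descent_datum E \<U> x \<phi> \<longleftrightarrow>
     x \<in> extensional \<U> \<and> \<phi> \<in> extensional (\<U> \<times> \<U>) \<and>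
     (\<forall>u\<in>\<U>. x u \<in> Obj (fib E (Dom (Base E) u))) \<and>
     (\<forall>u\<in>\<U>. \<forall>v\<in>\<U>.
        let p = pr1 (Base E) u v; q = pr2 (Base E) u v; T = fib E (Dom (Base E) p)
        in \<phi> (u, v) \<in> Hom T (pull_obj E p (x u)) (pull_obj E q (x v)) \<and> is_iso T (\<phi> (u, v))) \<and>
     (\<forall>u\<in>\<U>. \<forall>v\<in>\<U>. \<forall>w\<in>\<U>.
        let (q1, q2, q3) = fprod3 (Base E) u v w;
            res = (\<lambda>u v h. restr E (pr1 (Base E) u v) (x u) (pr2 (Base E) u v) (x v) h (\<phi> (u, v)))
        in res u w (fpair (Base E) u w q1 q3) =
           res v w (fpair (Base E) v w q2 q3) \<cdot>\<^bsub>Tot E\<^esub> res u v (fpair (Base E) u v q1 q2))"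

definition descent_morphism ::
    "('s, 'f, 'x, 'a, 'z) cloven_scheme \<Rightarrow> 'f set \<Rightarrow> ('f \<Rightarrow> 'x) \<times> ('f \<times> 'f \<Rightarrow> 'a)
     \<Rightarrow> ('f \<Rightarrow> 'x) \<times> ('f \<times> 'f \<Rightarrow> 'a) \<Rightarrow> ('f \<Rightarrow> 'a) \<Rightarrow> bool" where
  "descent_morphism E \<U> D D' m \<longleftrightarrow>
     m \<in> extensional \<U> \<and>
     (\<forall>u\<in>\<U>. m u \<in> Hom (fib E (Dom (Base E) u)) (fst D u) (fst D' u)) \<and>
     (\<forall>u\<in>\<U>. \<forall>v\<in>\<U>.
        snd D' (u, v) \<cdot>\<^bsub>Tot E\<^esub> pull_arr E (pr1 (Base E) u v) (m u) =
        pull_arr E (pr2 (Base E) u v) (m v) \<cdot>\<^bsub>Tot E\<^esub> snd D (u, v))"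

text \<open>The arrows of this and later categories are tuples that record their source and target.\<close>

definition DD ::
    "('s, 'f, 'x, 'a, 'z) cloven_scheme \<Rightarrow> 'f set \<Rightarrow>
     (('f \<Rightarrow> 'x) \<times> ('f \<times> 'f \<Rightarrow> 'a),
      (('f \<Rightarrow> 'x) \<times> ('f \<times> 'f \<Rightarrow> 'a)) \<times> (('f \<Rightarrow> 'x) \<times> ('f \<times> 'f \<Rightarrow> 'a)) \<times> ('f \<Rightarrow> 'a)) cat" where
  "DD E \<U> =
     \<lparr>Obj = {(x, \<phi>). descent_datum E \<U> x \<phi>},
      Arr = {(D, D', m). descent_datum E \<U> (fst D) (snd D) \<and> descent_datum E \<U> (fst D') (snd D') \<and>
               descent_morphism E \<U> D D' m},
      Dom = (\<lambda>(D, D', m). D),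
      Cod = (\<lambda>(D, D', m). D'),
      Ident = (\<lambda>D. (D, D, \<lambda>u\<in>\<U>. Ident (Tot E) (fst D u))),
      Comp = (\<lambda>(D', D'', n) (D, _, m). (D, D'', \<lambda>u\<in>\<U>. n u \<cdot>\<^bsub>Tot E\<^esub> m u))\<rparr>"

text \<open>The canonical isomorphism \<open>p\<^sub>1\<^sup>* (u\<^sup>* x) \<rightarrow> (u \<circ> p\<^sub>1)\<^sup>* x = (v \<circ> p\<^sub>2)\<^sup>* x \<rightarrow> p\<^sub>2\<^sup>* (v\<^sup>* x)\<close>.\<close>

definition can2 :: "('s, 'f, 'x, 'a, 'z) cloven_scheme \<Rightarrow> 'f \<Rightarrow> 'f \<Rightarrow> 'x \<Rightarrow> 'a" where
  "can2 E u v x =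
     (let p = pr1 (Base E) u v; q = pr2 (Base E) u v
      in inv_arr (fib E (Dom (Base E) q)) (can E v q x) \<cdot>\<^bsub>Tot E\<^esub> can E u p x)"

definition delta_obj ::
    "('s, 'f, 'x, 'a, 'z) cloven_scheme \<Rightarrow> 'f set \<Rightarrow> 'x \<Rightarrow> ('f \<Rightarrow> 'x) \<times> ('f \<times> 'f \<Rightarrow> 'a)" where
  "delta_obj E \<U> x = ((\<lambda>u\<in>\<U>. pull_obj E u x), (\<lambda>(u, v)\<in>\<U> \<times> \<U>. can2 E u v x))"

definition delta ::
    "('s, 'f, 'x, 'a, 'z) cloven_scheme \<Rightarrow> 'f set \<Rightarrow>
     ('x, 'a, ('f \<Rightarrow> 'x) \<times> ('f \<times> 'f \<Rightarrow> 'a),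
      (('f \<Rightarrow> 'x) \<times> ('f \<times> 'f \<Rightarrow> 'a)) \<times> (('f \<Rightarrow> 'x) \<times> ('f \<times> 'f \<Rightarrow> 'a)) \<times> ('f \<Rightarrow> 'a)) fctr" where
  "delta E \<U> =
     \<lparr>fobj = delta_obj E \<U>,
      farr = (\<lambda>a. (delta_obj E \<U> (Dom (Tot E) a), delta_obj E \<U> (Cod (Tot E) a),
                   \<lambda>u\<in>\<U>. pull_arr E u a))\<rparr>"


section \<open>Prestacks and stacks\<close>

text \<open>
  A presheaf on the slice category \<open>S/s\<close>: \<open>Sec f\<close> is the set of sections over \<open>f : t \<rightarrow> s\<close>, and
  \<open>Res f g : Sec f \<rightarrow> Sec (f \<circ> g)\<close> is the restriction along the arrow \<open>g : f \<circ> g \<rightarrow> f\<close> of \<open>S/s\<close>.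
\<close>

definition slice_presheaf ::
    "('s, 'f, 'z) cat_scheme \<Rightarrow> 's \<Rightarrow> ('f \<Rightarrow> 'e set) \<Rightarrow> ('f \<Rightarrow> 'f \<Rightarrow> 'e \<Rightarrow> 'e) \<Rightarrow> bool" where
  "slice_presheaf S s Sec Res \<longleftrightarrow>
     (\<forall>f\<in>Arr S. Cod S f = s \<longrightarrow> (\<forall>a\<in>Sec f.
        Res f (Ident S (Dom S f)) a = a \<and>
        (\<forall>g\<in>Arr S. Cod S g = Dom S f \<longrightarrow>
           Res f g a \<in> Sec (f \<cdot>\<^bsub>S\<^esub> g) \<and>
           (\<forall>h\<in>Arr S. Cod S h = Dom S g \<longrightarrow> Res f (g \<cdot>\<^bsub>S\<^esub> h) a = Res (f \<cdot>\<^bsub>S\<^esub> g) h (Res f g a)))))"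

text \<open>\<open>S/s\<close> carries the induced topology: the coverings of \<open>f : t \<rightarrow> s\<close> are those of \<open>t\<close>.\<close>

definition slice_sheaf ::
    "('s, 'f, 'z) cat_scheme \<Rightarrow> ('s \<Rightarrow> 'f set set) \<Rightarrow> 's \<Rightarrow> ('f \<Rightarrow> 'e set) \<Rightarrow> ('f \<Rightarrow> 'f \<Rightarrow> 'e \<Rightarrow> 'e)
     \<Rightarrow> bool" where
  "slice_sheaf S Cov s Sec Res \<longleftrightarrow>
     slice_presheaf S s Sec Res \<and>
     (\<forall>f\<in>Arr S. Cod S f = s \<longrightarrow> (\<forall>\<U>\<in>Cov (Dom S f). \<forall>a.
        (\<forall>u\<in>\<U>. a u \<in> Sec (f \<cdot>\<^bsub>S\<^esub> u)) \<and>
        (\<forall>u\<in>\<U>. \<forall>v\<in>\<U>. Res (f \<cdot>\<^bsub>S\<^esub> u) (pr1 S u v) (a u) = Res (f \<cdot>\<^bsub>S\<^esub> v) (pr2 S u v) (a v)) \<longrightarrow>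
        (\<exists>!b. b \<in> Sec f \<and> (\<forall>u\<in>\<U>. Res f u b = a u))))"

definition isom_sections :: "('s, 'f, 'x, 'a, 'z) cloven_scheme \<Rightarrow> 'x \<Rightarrow> 'x \<Rightarrow> 'f \<Rightarrow> 'a set" where
  "isom_sections E x y f =
     {a \<in> Hom (fib E (Dom (Base E) f)) (pull_obj E f x) (pull_obj E f y).
        is_iso (fib E (Dom (Base E) f)) a}"

definition isom_restriction ::
    "('s, 'f, 'x, 'a, 'z) cloven_scheme \<Rightarrow> 'x \<Rightarrow> 'x \<Rightarrow> 'f \<Rightarrow> 'f \<Rightarrow> 'a \<Rightarrow> 'a" where
  "isom_restriction E x y f g a = restr E f x f y g a"

text \<open>
  The conditions defining prestacks and stacks do not depend on the cleavage; they are required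
  for all of them.
\<close>

definition prestack ::
    "('s, 'f) cat \<Rightarrow> ('s \<Rightarrow> 'f set set) \<Rightarrow> ('x, 'a) cat \<Rightarrow> ('x, 'a, 's, 'f) fctr \<Rightarrow> bool" where
  "prestack S Cov X \<pi> \<longleftrightarrow>
     fibred_in_groupoids S X \<pi> \<and>
     (\<forall>c. cleavage S X \<pi> c \<longrightarrow>
        (\<forall>s\<in>Obj S. \<forall>x\<in>Obj (fibre S X \<pi> s). \<forall>y\<in>Obj (fibre S X \<pi> s).
           let E = \<lparr>Base = S, Tot = X, Proj = \<pi>, Clv = c\<rparr>
           in slice_sheaf S Cov s (isom_sections E x y) (isom_restriction E x y)))"

definition effective ::
    "('s, 'f, 'x, 'a, 'z) cloven_scheme \<Rightarrow> 's \<Rightarrow> 'f set \<Rightarrow> ('f \<Rightarrow> 'x) \<times> ('f \<times> 'f \<Rightarrow> 'a) \<Rightarrow> bool" where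
  "effective E s \<U> D \<longleftrightarrow>
     (\<exists>x\<in>Obj (fib E s). \<exists>m\<in>Hom (DD E \<U>) (fobj (delta E \<U>) x) D. is_iso (DD E \<U>) m)"

definition stack ::
    "('s, 'f) cat \<Rightarrow> ('s \<Rightarrow> 'f set set) \<Rightarrow> ('x, 'a) cat \<Rightarrow> ('x, 'a, 's, 'f) fctr \<Rightarrow> bool" where
  "stack S Cov X \<pi> \<longleftrightarrow>
     prestack S Cov X \<pi> \<and>
     (\<forall>c. cleavage S X \<pi> c \<longrightarrow>
        (\<forall>s\<in>Obj S. \<forall>\<U>\<in>Cov s.
           let E = \<lparr>Base = S, Tot = X, Proj = \<pi>, Clv = c\<rparr>
           in \<forall>D\<in>Obj (DD E \<U>). effective E s \<U> D))"


section \<open>Categories fibred in abelian tensor categories\<close>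

text \<open>
  \<open>Fib B s\<close> is the fibre over \<open>s\<close> with its abelian tensor structure, \<open>PMu B f\<close> and \<open>PEps B f\<close> are the
  monoidal structure isomorphisms of \<open>f\<^sup>*\<close>.
\<close>

record ('s, 'f, 'x, 'a) fatcat = "('s, 'f, 'x, 'a) cloven" +
  Fib :: "'s \<Rightarrow> ('x, 'a) atcat"
  PMu :: "'f \<Rightarrow> 'x \<Rightarrow> 'x \<Rightarrow> 'a"
  PEps :: "'f \<Rightarrow> 'a"

definition pull :: "('s, 'f, 'x, 'a, 'z) fatcat_scheme \<Rightarrow> 'f \<Rightarrow> ('x, 'a, 'x, 'a) tfctr" where
  "pull B f = \<lparr>fobj = pull_obj B f, farr = pull_arr B f, Mu = PMu B f, Eps = PEps B f\<rparr>"

text \<open>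
  The canonical isomorphisms \<open>g\<^sup>* f\<^sup>* \<rightarrow> (f \<circ> g)\<^sup>*\<close> and \<open>id\<^sup>* \<rightarrow> id\<close> are part of the fibred structure
  and hence required to be monoidal; otherwise the composition of pairs \<open>(f, \<phi>)\<close> below would leave
  the monoidal transformations.
\<close>

definition fibred_in_abelian_tensor_categories ::
    "'j rel \<Rightarrow> ('s, 'f) cat \<Rightarrow> ('s, 'f, 'x, 'a, 'z) fatcat_scheme \<Rightarrow> bool" where
  "fibred_in_abelian_tensor_categories \<kappa> S B \<longleftrightarrow>
     Base B = S \<and> cloven_fibred_category B \<and>
     (\<forall>s\<in>Obj S. cat.truncate (Fib B s) = fib B s \<and> abelian_tensor_category \<kappa> (Fib B s)) \<and>
     (\<forall>f\<in>Arr S. tensor_functor \<kappa> (Fib B (Cod S f)) (Fib B (Dom S f)) (pull B f)) \<and>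
     (\<forall>f\<in>Arr S. \<forall>g\<in>Arr S. Cod S g = Dom S f \<longrightarrow>
        monoidal_nat_iso (Fib B (Cod S f)) (Fib B (Dom S g))
          (comp_tfctr (Fib B (Dom S g)) (pull B g) (pull B f)) (pull B (f \<cdot>\<^bsub>S\<^esub> g)) (can B f g)) \<and>
     (\<forall>s\<in>Obj S.
        monoidal_nat_iso (Fib B s) (Fib B s)
          (pull B (Ident S s)) (id_tfctr (Fib B s)) (Clv B (Ident S s)))"


section \<open>The category of tensor functors from \<open>A\<close>\<close>

definition extensional_tfctr ::
    "('o, 'a, 'z) cat_scheme \<Rightarrow> ('o, 'a, 'p, 'b, 'w) tfctr_scheme \<Rightarrow> bool" where
  "extensional_tfctr A F \<longleftrightarrow>
     fobj F \<in> extensional (Obj A) \<and> farr F \<in> extensional (Arr A) \<and>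
     (\<lambda>(x, y). Mu F x y) \<in> extensional (Obj A \<times> Obj A)"

type_synonym ('s, 'x, 'a, 'p, 'q) tf_obj = "'s \<times> ('p, 'q, 'x, 'a) tfctr"
type_synonym ('s, 'f, 'x, 'a, 'p, 'q) tf_arr =
  "('s, 'x, 'a, 'p, 'q) tf_obj \<times> ('s, 'x, 'a, 'p, 'q) tf_obj \<times> 'f \<times> ('p \<Rightarrow> 'a)"

definition tf_objects ::
    "'j rel \<Rightarrow> ('p, 'q, 'y) atcat_scheme \<Rightarrow> ('s, 'f, 'x, 'a, 'z) fatcat_scheme
     \<Rightarrow> ('s, 'x, 'a, 'p, 'q) tf_obj set" where
  "tf_objects \<kappa> A B =
     {(s, F). s \<in> Obj (Base B) \<and> tensor_functor \<kappa> A (Fib B s) F \<and> extensional_tfctr A F}"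

text \<open>
  In the composition below \<open>can B f f'\<close> is the identification \<open>f'\<^sup>* f\<^sup>* F \<rightarrow> (f \<circ> f')\<^sup>* F\<close> which is
  suppressed in the formula \<open>(f, \<phi>) \<circ> (f', \<phi>') = (f \<circ> f', f'\<^sup>*(\<phi>) \<circ> \<phi>')\<close>. The identity of \<open>(s, F)\<close> is
  accordingly given by the canonical isomorphism \<open>F \<rightarrow> id\<^sup>* F\<close>.
\<close>

definition tf_cat ::
    "'j rel \<Rightarrow> ('p, 'q, 'y) atcat_scheme \<Rightarrow> ('s, 'f, 'x, 'a, 'z) fatcat_scheme
     \<Rightarrow> (('s, 'x, 'a, 'p, 'q) tf_obj, ('s, 'f, 'x, 'a, 'p, 'q) tf_arr) cat" where
  "tf_cat \<kappa> A B =
     \<lparr>Obj = tf_objects \<kappa> A B,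
      Arr = {((s', F'), (s, F), f, \<phi>).
               (s', F') \<in> tf_objects \<kappa> A B \<and> (s, F) \<in> tf_objects \<kappa> A B \<and>
               f \<in> Hom (Base B) s' s \<and> \<phi> \<in> extensional (Obj A) \<and>
               monoidal_nat_iso A (Fib B s') F' (comp_tfctr (Fib B s') (pull B f) F) \<phi>},
      Dom = (\<lambda>(X', X, f, \<phi>). X'),
      Cod = (\<lambda>(X', X, f, \<phi>). X),
      Ident = (\<lambda>(s, F). ((s, F), (s, F), Ident (Base B) s,
                 \<lambda>x\<in>Obj A. inv_arr (fib B s) (Clv B (Ident (Base B) s) (fobj F x)))),
      Comp = (\<lambda>(X', X, f, \<phi>) (X'', _, f', \<phi>'). (X'', X, f \<cdot>\<^bsub>Base B\<^esub> f',
                 \<lambda>x\<in>Obj A. can B f f' (fobj (snd X) x) \<cdot>\<^bsub>Tot B\<^esub> pull_arr B f' (\<phi> x) \<cdot>\<^bsub>Tot B\<^esub> \<phi>' x))\<rparr>"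

definition tf_proj ::
    "(('s, 'x, 'a, 'p, 'q) tf_obj, ('s, 'f, 'x, 'a, 'p, 'q) tf_arr, 's, 'f) fctr" where
  "tf_proj = \<lparr>fobj = fst, farr = (\<lambda>(X', X, f, \<phi>). f)\<rparr>"

end

theory Submission
  imports Defs
begin

text \<open>
  A tensor functor \<open>F : A \<rightarrow> B\<^sub>s\<close> consists of objects and arrows of a fibre of \<open>B\<close>, subject to equations
  between arrows and to a universal property. Objects, arrows, equations and universal properties can
  all be glued along a covering once descent data in \<open>B\<close> can, so tensor functors can be glued as well.
  The work lies in organising this so that the canonical isomorphisms between iterated pull-backs do
  not have to be carried along. All arguments therefore take place in the total categories, where
  pull-backs appear only as cartesian arrows.

  Firstly, the hypotheses on \<open>\<delta>\<close> are restated without a cleavage. If \<open>\<delta>\<close> is fully faithful then an object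
  over \<open>s\<close> is glued from its restrictions to the members of a covering, in the sense that arrows out of
  it, over any base arrow, are the same as compatible arrows out of the restrictions
  (\<open>hom_descent_of_fully_faithful\<close>). If \<open>\<delta>\<close> is essentially surjective then objects given over the members
  and identified over the overlaps by spans of cartesian arrows can be glued
  (\<open>obj_descent_of_essentially_surjective\<close>). Conversely, these two forms of gluing in a fibration in
  groupoids imply that it is a prestack or stack (\<open>isom_sheaf\<close>, \<open>effective_of_obj_descent\<close>). So it remains
  to pass from gluing in \<open>B\<close> to gluing in the category of tensor functors.

  Secondly, that category is described without pull-backs. Since the pull-back functors and the
  canonical isomorphisms are monoidal, the tensor products of the fibres extend to a tensor product
  \<open>a \<odot> b\<close> of arrows over a common base arrow, which respects composition (\<open>tens_comp\<close>) and for which the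
  structure isomorphisms are natural (\<open>asc_natural\<close> and its companions). A morphism \<open>(f, \<phi>)\<close> from \<open>F'\<close> to
  \<open>F\<close> is then the same as a family of cartesian arrows \<open>F' p \<rightarrow> F p\<close> over \<open>f\<close> which is natural and monoidal
  for \<open>\<odot>\<close> (\<open>monoidal_nat_iso_iff\<close>), and such families are composed memberwise (\<open>tf_comp\<close>).

  Gluing is now done object by object. For morphisms (\<open>tf_hom_descent\<close>) the members of the family are
  glued in \<open>B\<close>; the result is cartesian because this is a local property (\<open>hom_descent_cartesian\<close>), and
  natural and monoidal because equations may be tested locally (\<open>hom_descent_unique\<close>). For tensor functors
  (\<open>tf_obj_descent\<close>) the values on objects are glued first, then the values on arrows and the structure
  isomorphisms. Each law of a symmetric monoidal functor compares two arrows that are natural along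
  such families (\<open>law_natural\<close>), so that it holds for the glued functor because it holds locally. The
  glued functor preserves colimits because the factorisation of a cocone exists uniquely over each member and
  over each overlap, hence glues (\<open>glued_colimits\<close>).
\<close>

section \<open>Cartesian arrows\<close>

locale fibration =
  fixes S :: "('s, 'f) cat" and X :: "('x, 'a) cat" and \<pi> :: "('x, 'a, 's, 'f) fctr"
  assumes fibred: "fibred_category S X \<pi>"
begin

abbreviation base_comp (infixr "\<star>" 70) where "g \<star> f \<equiv> Comp S g f"
abbreviation tot_comp (infixr "\<bullet>" 70) where "b \<bullet> a \<equiv> Comp X b a"

lemma categories: "category S" "category X" and projection: "is_functor X S \<pi>"
  using fibred by (auto simp: fibred_category_def)

lemma base_simps [simp]:
  "f \<in> Arr S \<Longrightarrow> Dom S f \<in> Obj S" "f \<in> Arr S \<Longrightarrow> Cod S f \<in> Obj S"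
  "s \<in> Obj S \<Longrightarrow> Ident S s \<in> Arr S" "s \<in> Obj S \<Longrightarrow> Dom S (Ident S s) = s"
  "s \<in> Obj S \<Longrightarrow> Cod S (Ident S s) = s"
  "f \<in> Arr S \<Longrightarrow> g \<in> Arr S \<Longrightarrow> Dom S g = Cod S f \<Longrightarrow> g \<star> f \<in> Arr S"
  "f \<in> Arr S \<Longrightarrow> g \<in> Arr S \<Longrightarrow> Dom S g = Cod S f \<Longrightarrow> Dom S (g \<star> f) = Dom S f"
  "f \<in> Arr S \<Longrightarrow> g \<in> Arr S \<Longrightarrow> Dom S g = Cod S f \<Longrightarrow> Cod S (g \<star> f) = Cod S g"
  "f \<in> Arr S \<Longrightarrow> Dom S f = s \<Longrightarrow> f \<star> Ident S s = f"
  "f \<in> Arr S \<Longrightarrow> Cod S f = s \<Longrightarrow> Ident S s \<star> f = f"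
  "f \<in> Arr S \<Longrightarrow> g \<in> Arr S \<Longrightarrow> h \<in> Arr S \<Longrightarrow> Dom S g = Cod S f \<Longrightarrow> Dom S h = Cod S g \<Longrightarrow>
     (h \<star> g) \<star> f = h \<star> g \<star> f"
  using categories(1) unfolding category_def Hom_def by auto

lemma tot_simps [simp]:
  "f \<in> Arr X \<Longrightarrow> Dom X f \<in> Obj X" "f \<in> Arr X \<Longrightarrow> Cod X f \<in> Obj X"
  "s \<in> Obj X \<Longrightarrow> Ident X s \<in> Arr X" "s \<in> Obj X \<Longrightarrow> Dom X (Ident X s) = s"
  "s \<in> Obj X \<Longrightarrow> Cod X (Ident X s) = s"
  "f \<in> Arr X \<Longrightarrow> g \<in> Arr X \<Longrightarrow> Dom X g = Cod X f \<Longrightarrow> g \<bullet> f \<in> Arr X"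
  "f \<in> Arr X \<Longrightarrow> g \<in> Arr X \<Longrightarrow> Dom X g = Cod X f \<Longrightarrow> Dom X (g \<bullet> f) = Dom X f"
  "f \<in> Arr X \<Longrightarrow> g \<in> Arr X \<Longrightarrow> Dom X g = Cod X f \<Longrightarrow> Cod X (g \<bullet> f) = Cod X g"
  "f \<in> Arr X \<Longrightarrow> Dom X f = s \<Longrightarrow> f \<bullet> Ident X s = f"
  "f \<in> Arr X \<Longrightarrow> Cod X f = s \<Longrightarrow> Ident X s \<bullet> f = f"
  "f \<in> Arr X \<Longrightarrow> g \<in> Arr X \<Longrightarrow> h \<in> Arr X \<Longrightarrow> Dom X g = Cod X f \<Longrightarrow> Dom X h = Cod X g \<Longrightarrow>
     (h \<bullet> g) \<bullet> f = h \<bullet> g \<bullet> f"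
  using categories(2) unfolding category_def Hom_def by auto

lemma proj_simps [simp]:
  "x \<in> Obj X \<Longrightarrow> fobj \<pi> x \<in> Obj S"
  "f \<in> Arr X \<Longrightarrow> farr \<pi> f \<in> Arr S"
  "f \<in> Arr X \<Longrightarrow> Dom S (farr \<pi> f) = fobj \<pi> (Dom X f)"
  "f \<in> Arr X \<Longrightarrow> Cod S (farr \<pi> f) = fobj \<pi> (Cod X f)"
  "x \<in> Obj X \<Longrightarrow> farr \<pi> (Ident X x) = Ident S (fobj \<pi> x)"
  "f \<in> Arr X \<Longrightarrow> g \<in> Arr X \<Longrightarrow> Dom X g = Cod X f \<Longrightarrow> farr \<pi> (g \<bullet> f) = farr \<pi> g \<star> farr \<pi> f"
  using projection unfolding is_functor_def Hom_def by auto

text \<open>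
  Composites are kept in right-associated form, where an equation \<open>g \<bullet> f = k\<close> no longer matches inside
  a longer chain. This rule provides the form of the equation that does.
\<close>

lemma chain:
  assumes "g \<bullet> f = k" "f \<in> Arr X" "g \<in> Arr X" "Dom X g = Cod X f" "h \<in> Arr X" "Dom X f = Cod X h"
  shows "g \<bullet> f \<bullet> h = k \<bullet> h"
  using assms tot_simps(11)[of h f g] by simp

lemma base_chain:
  assumes "g \<star> f = k" "f \<in> Arr S" "g \<in> Arr S" "Dom S g = Cod S f" "h \<in> Arr S" "Dom S f = Cod S h"
  shows "g \<star> f \<star> h = k \<star> h"
  using assms base_simps(11)[of h f g] by simp

definition arrs :: "'f \<Rightarrow> 'x \<Rightarrow> 'x \<Rightarrow> 'a set" where
  "arrs f x y = {a \<in> Hom X x y. farr \<pi> a = f}"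

definition carts :: "'f \<Rightarrow> 'x \<Rightarrow> 'x \<Rightarrow> 'a set" where
  "carts f x y = {a \<in> arrs f x y. cartesian S X \<pi> a}"

abbreviation "varrs s \<equiv> arrs (Ident S s)"
abbreviation "isos s \<equiv> carts (Ident S s)"

lemma arrsI: "a \<in> Arr X \<Longrightarrow> Dom X a = x \<Longrightarrow> Cod X a = y \<Longrightarrow> farr \<pi> a = f \<Longrightarrow> a \<in> arrs f x y"
  by (simp add: arrs_def Hom_def)

lemma arrsD:
  assumes "a \<in> arrs f x y"
  shows "a \<in> Arr X" "Dom X a = x" "Cod X a = y" "farr \<pi> a = f" "x \<in> Obj X" "y \<in> Obj X"
    "f \<in> Arr S" "Dom S f = fobj \<pi> x" "Cod S f = fobj \<pi> y" "fobj \<pi> x \<in> Obj S" "fobj \<pi> y \<in> Obj S"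
  using assms by (auto simp: arrs_def Hom_def)

lemma carts_arrs: "a \<in> carts f x y \<Longrightarrow> a \<in> arrs f x y"
  by (simp add: carts_def)

lemmas typing = arrsD(1-3)
lemmas cartsD = arrsD[OF carts_arrs]
lemmas cart_typing = arrsD(1-3)[OF carts_arrs]

lemma arrs_comp: "a \<in> arrs f x y \<Longrightarrow> b \<in> arrs g y z \<Longrightarrow> b \<bullet> a \<in> arrs (g \<star> f) x z"
  by (simp add: arrs_def Hom_def)

lemma arrs_ident: "x \<in> Obj X \<Longrightarrow> Ident X x \<in> varrs (fobj \<pi> x) x x"
  by (simp add: arrs_def Hom_def)

lemma cart_ex1:
  assumes "c \<in> carts f x y" "b \<in> arrs (f \<star> h) z y" "h \<in> Arr S" "Dom S h = fobj \<pi> z" "Cod S h = fobj \<pi> x"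
  shows "\<exists>!d. d \<in> arrs h z x \<and> c \<bullet> d = b"
proof -
  note c = cartsD[OF assms(1)] and b = arrsD[OF assms(2)]
  have "h \<in> Hom S (fobj \<pi> (Dom X b)) (fobj \<pi> (Dom X c))" "Cod X b = Cod X c" "farr \<pi> c \<star> h = farr \<pi> b"
    using assms(3-5) by (simp_all add: Hom_def b(2,3,4) c(2,3,4))
  then have "\<exists>!d. d \<in> Hom X (Dom X b) (Dom X c) \<and> farr \<pi> d = h \<and> c \<bullet> d = b"
    using assms(1) b(1) unfolding carts_def cartesian_def by blast
  then show ?thesis
    by (simp add: arrs_def b(2) c(2) conj_ac)
qed

lemma cart_factor:
  assumes "c \<in> carts f x y" "b \<in> arrs k z y" "h \<in> Arr S" "Dom S h = fobj \<pi> z" "Cod S h = fobj \<pi> x"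
    and "f \<star> h = k"
  shows "\<exists>d. d \<in> arrs h z x \<and> c \<bullet> d = b"
  using cart_ex1[of c f x y b h z] assms by blast

lemma cart_cancel:
  assumes "c \<in> carts f x y" "d \<in> arrs h z x" "d' \<in> arrs h z x" "c \<bullet> d = c \<bullet> d'"
  shows "d = d'"
proof -
  have "c \<bullet> d \<in> arrs (f \<star> h) z y"
    using assms(1,2) by (blast intro: arrs_comp carts_arrs)
  moreover have "h \<in> Arr S" "Dom S h = fobj \<pi> z" "Cod S h = fobj \<pi> x"
    using arrsD[OF assms(2)] by auto
  ultimately have "\<exists>!e. e \<in> arrs h z x \<and> c \<bullet> e = c \<bullet> d"
    by (rule cart_ex1[OF assms(1)])
  then show ?thesis
    using assms(2,3,4) by auto
qed

lemma cart_lift_ex: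
  assumes "f \<in> Arr S" "x \<in> Obj X" "fobj \<pi> x = Cod S f"
  obtains c where "c \<in> carts f (Dom X c) x"
proof -
  obtain a where "cartesian S X \<pi> a" "Cod X a = x" "farr \<pi> a = f"
    using fibred assms by (auto simp: fibred_category_def)
  then show thesis
    using that[of a] by (simp add: carts_def arrs_def Hom_def cartesian_def)
qed

lemma cartsI:
  assumes "c \<in> arrs f x y"
    and "\<And>z b h. b \<in> arrs (f \<star> h) z y \<Longrightarrow> h \<in> Arr S \<Longrightarrow> Dom S h = fobj \<pi> z \<Longrightarrow> Cod S h = fobj \<pi> x \<Longrightarrow>
           \<exists>d. d \<in> arrs h z x \<and> c \<bullet> d = b"
    and "\<And>z h d d'. d \<in> arrs h z x \<Longrightarrow> d' \<in> arrs h z x \<Longrightarrow> c \<bullet> d = c \<bullet> d' \<Longrightarrow> d = d'"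
  shows "c \<in> carts f x y"
proof -
  note c = arrsD[OF assms(1)]
  have "\<exists>!d. d \<in> Hom X (Dom X b) (Dom X c) \<and> farr \<pi> d = h \<and> c \<bullet> d = b"
    if b: "b \<in> Arr X" and h: "h \<in> Hom S (fobj \<pi> (Dom X b)) (fobj \<pi> (Dom X c))"
      and e: "Cod X b = Cod X c" "farr \<pi> c \<star> h = farr \<pi> b" for b h
  proof -
    have h': "h \<in> Arr S" "Dom S h = fobj \<pi> (Dom X b)" "Cod S h = fobj \<pi> x"
      using h c by (auto simp: Hom_def)
    have "b \<in> arrs (f \<star> h) (Dom X b) y"
      using b c e by (simp add: arrs_def Hom_def)
    then obtain d where d: "d \<in> arrs h (Dom X b) x" "c \<bullet> d = b"
      using assms(2) h' by blast
    moreover have "d' = d" if "d' \<in> Hom X (Dom X b) (Dom X c)" "farr \<pi> d' = h" "c \<bullet> d' = b" for d'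
      using assms(3)[of d' h "Dom X b" d] d that c by (simp add: arrs_def)
    ultimately show ?thesis
      using c by (intro ex1I[of _ d]) (auto simp: arrs_def)
  qed
  then show ?thesis
    using assms(1) c by (simp add: carts_def cartesian_def)
qed

lemma carts_comp:
  assumes c: "c \<in> carts f x y" and d: "d \<in> carts g y z"
  shows "d \<bullet> c \<in> carts (g \<star> f) x z"
proof (rule cartsI)
  note cA = carts_arrs[OF c] and dA = carts_arrs[OF d]
  note cD = arrsD[OF cA] and dD = arrsD[OF dA]
  show "d \<bullet> c \<in> arrs (g \<star> f) x z"
    using cA dA by (rule arrs_comp)
  show "\<exists>e. e \<in> arrs h w x \<and> (d \<bullet> c) \<bullet> e = b"
    if b: "b \<in> arrs ((g \<star> f) \<star> h) w z" and h: "h \<in> Arr S" "Dom S h = fobj \<pi> w" "Cod S h = fobj \<pi> x"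
    for w b h
  proof -
    have "f \<star> h \<in> Arr S" "Dom S (f \<star> h) = fobj \<pi> w" "Cod S (f \<star> h) = fobj \<pi> y" "g \<star> f \<star> h = (g \<star> f) \<star> h"
      using h cD(7-9) dD(7-9) by simp_all
    then obtain e1 where e1: "e1 \<in> arrs (f \<star> h) w y" "d \<bullet> e1 = b"
      using cart_factor[OF d b] by blast
    obtain e2 where e2: "e2 \<in> arrs h w x" "c \<bullet> e2 = e1"
      using cart_factor[OF c e1(1) h refl] by blast
    have "(d \<bullet> c) \<bullet> e2 = b"
      using e1 e2 typing[OF e2(1)] cD(1-3) dD(1-3) by simp
    then show ?thesis
      using e2 by blast
  qed
  show "e = e'" if e: "e \<in> arrs h w x" and e': "e' \<in> arrs h w x" and eq: "(d \<bullet> c) \<bullet> e = (d \<bullet> c) \<bullet> e'" for w h e e'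
  proof -
    have "d \<bullet> c \<bullet> e = d \<bullet> c \<bullet> e'"
      using eq typing[OF e] typing[OF e'] cD(1-3) dD(1-3) by simp
    then have "c \<bullet> e = c \<bullet> e'"
      using cart_cancel[OF d arrs_comp[OF e cA] arrs_comp[OF e' cA]] by blast
    then show ?thesis
      using cart_cancel[OF c e e'] by blast
  qed
qed

text \<open>
  If \<open>d\<close> and \<open>d \<bullet> c\<close> are cartesian then a factorisation through \<open>d \<bullet> c\<close> is one through \<open>c\<close> after cancelling
  \<open>d\<close>. Nearly every arrow constructed below is a factorisation through a cartesian arrow and is
  recognised as cartesian in this way.
\<close>

lemma carts_right_factor:
  assumes c: "c \<in> arrs f x y" and d: "d \<in> carts g y z" and dc: "d \<bullet> c \<in> carts k x z"
  shows "c \<in> carts f x y"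
proof (rule cartsI[OF c])
  note dA = carts_arrs[OF d]
  note cD = arrsD[OF c] and dD = arrsD[OF dA]
  have k: "k = g \<star> f"
    using cartsD(4)[OF dc] cD(1-4) dD(1-4) by simp
  show "\<exists>e. e \<in> arrs h w x \<and> c \<bullet> e = b"
    if b: "b \<in> arrs (f \<star> h) w y" and h: "h \<in> Arr S" "Dom S h = fobj \<pi> w" "Cod S h = fobj \<pi> x" for w b h
  proof -
    have "k \<star> h = g \<star> f \<star> h"
      using h cD(7-9) dD(7-9) k by simp
    then obtain e where e: "e \<in> arrs h w x" "(d \<bullet> c) \<bullet> e = d \<bullet> b"
      using cart_factor[OF dc arrs_comp[OF b dA] h] by blast
    have "d \<bullet> c \<bullet> e = d \<bullet> b"
      using e(2) typing[OF e(1)] cD(1-3) dD(1-3) by simp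
    then have "c \<bullet> e = b"
      using cart_cancel[OF d arrs_comp[OF e(1) c] b] by blast
    then show ?thesis
      using e by blast
  qed
  show "e = e'" if e: "e \<in> arrs h w x" and e': "e' \<in> arrs h w x" and eq: "c \<bullet> e = c \<bullet> e'" for w h e e'
  proof -
    have "(d \<bullet> c) \<bullet> e = (d \<bullet> c) \<bullet> e'"
      using eq typing[OF e] typing[OF e'] cD(1-3) dD(1-3) by simp
    then show ?thesis
      using cart_cancel[OF dc e e'] by blast
  qed
qed

lemma vertD:
  assumes "a \<in> varrs s x y" "s \<in> Obj S"
  shows "a \<in> Arr X" "Dom X a = x" "Cod X a = y" "farr \<pi> a = Ident S s" "x \<in> Obj X" "y \<in> Obj X"
    "fobj \<pi> x = s" "fobj \<pi> y = s"
proof -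
  note aD = arrsD[OF assms(1)]
  show "a \<in> Arr X" "Dom X a = x" "Cod X a = y" "farr \<pi> a = Ident S s" "x \<in> Obj X" "y \<in> Obj X"
    by (fact aD)+
  show "fobj \<pi> x = s" "fobj \<pi> y = s"
    using base_simps(4,5)[OF assms(2)] aD(8,9) by argo+
qed

lemma inverse_carts:
  assumes a: "a \<in> varrs s x y" and b: "b \<in> varrs s y x" and s: "s \<in> Obj S"
    and ba: "b \<bullet> a = Ident X x" and ab: "a \<bullet> b = Ident X y"
  shows "a \<in> isos s x y"
proof (rule cartsI[OF a])
  note aD = vertD[OF a s] and bD = vertD[OF b s]
  show "\<exists>e. e \<in> arrs h w x \<and> a \<bullet> e = c"
    if c: "c \<in> arrs (Ident S s \<star> h) w y" and h: "h \<in> Arr S" "Dom S h = fobj \<pi> w" "Cod S h = fobj \<pi> x" for w c h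
  proof -
    have "Ident S s \<star> h = h"
      using h(1,3) aD(7) by simp
    then have "b \<bullet> c \<in> arrs h w x"
      using arrs_comp[OF c b] by simp
    moreover have "a \<bullet> b \<bullet> c = c"
      using chain[OF ab, of c] typing[OF c] aD bD by simp
    ultimately show ?thesis by blast
  qed
  show "e = e'" if "e \<in> arrs h w x" "e' \<in> arrs h w x" "a \<bullet> e = a \<bullet> e'" for w h e e'
  proof -
    have "b \<bullet> a \<bullet> e = e" "b \<bullet> a \<bullet> e' = e'"
      using chain[OF ba, of e] chain[OF ba, of e'] typing[OF that(1)] typing[OF that(2)] aD bD
      by simp_all
    then show ?thesis using that(3) by metis
  qed
qed

lemma vert_carts_inverse:
  assumes a: "a \<in> isos s x y" and s: "s \<in> Obj S"
  obtains b where "b \<in> isos s y x" "b \<bullet> a = Ident X x" "a \<bullet> b = Ident X y"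
proof -
  note aD = vertD[OF carts_arrs[OF a] s]
  have i: "Ident X y \<in> varrs s y y" "Ident X x \<in> varrs s x x"
    using arrs_ident[OF aD(5)] arrs_ident[OF aD(6)] by (simp_all add: aD(7,8))
  obtain b where b: "b \<in> varrs s y x" "a \<bullet> b = Ident X y"
    using cart_factor[OF a i(1), of "Ident S s"] aD(7,8) s by auto
  note bD = vertD[OF b(1) s]
  have "b \<bullet> a \<in> varrs s x x"
    using arrs_comp[OF carts_arrs[OF a] b(1)] s by simp
  then have ba: "b \<bullet> a = Ident X x"
    by (rule cart_cancel[OF a _ i(2)]) (use aD bD b chain[OF b(2), of a] in simp)
  then show thesis
    using that[of b] inverse_carts[OF b(1) carts_arrs[OF a] s b(2)] b by blast
qed

text \<open>
  The next facts replace the categories of the fibres by sets of arrows of the total category. A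
  vertical arrow is invertible iff it is cartesian, so \<^const>\<open>is_iso\<close> and \<^const>\<open>inv_arr\<close> disappear
  in favour of cartesian arrows over identities.
\<close>

lemma Hom_fibre:
  "s \<in> Obj S \<Longrightarrow> Hom (fibre S X \<pi> s) x y = varrs s x y"
  unfolding Hom_def fibre_def arrs_def by (auto dest: proj_simps(3,4))

lemma fibre_simps [simp]:
  "Dom (fibre S X \<pi> s) = Dom X" "Cod (fibre S X \<pi> s) = Cod X" "Ident (fibre S X \<pi> s) = Ident X"
  "Comp (fibre S X \<pi> s) = Comp X" "x \<in> Obj (fibre S X \<pi> s) \<longleftrightarrow> x \<in> Obj X \<and> fobj \<pi> x = s"
  by (simp_all add: fibre_def)

lemma category_fibre:
  assumes s: "s \<in> Obj S"
  shows "category (fibre S X \<pi> s)"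
proof -
  have "a \<in> Arr (fibre S X \<pi> s) \<longleftrightarrow>
      a \<in> Arr X \<and> fobj \<pi> (Dom X a) = s \<and> fobj \<pi> (Cod X a) = s \<and> farr \<pi> a = Ident S s" for a
    by (simp add: fibre_def)
  then show ?thesis
    using s by (simp add: category_def Hom_def)
qed

lemma Arr_fibre: "s \<in> Obj S \<Longrightarrow> a \<in> Arr (fibre S X \<pi> s) \<longleftrightarrow> a \<in> varrs s (Dom X a) (Cod X a)"
  using Hom_fibre[of s "Dom X a" "Cod X a"] by (auto simp: Hom_def)

lemma inverse_arrows_fibre:
  assumes "s \<in> Obj S" "a \<in> varrs s x y"
  shows "inverse_arrows (fibre S X \<pi> s) a b \<longleftrightarrow>
    b \<in> varrs s y x \<and> b \<bullet> a = Ident X x \<and> a \<bullet> b = Ident X y"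
  using assms vertD[OF assms(2,1)] by (auto simp: inverse_arrows_def Hom_fibre Arr_fibre)

lemma is_iso_fibre:
  assumes "s \<in> Obj S" "a \<in> varrs s x y"
  shows "is_iso (fibre S X \<pi> s) a \<longleftrightarrow> a \<in> isos s x y"
  unfolding is_iso_def inverse_arrows_fibre[OF assms]
  using inverse_carts[OF assms(2)] vert_carts_inverse[of a s x y] assms(1) carts_arrs by metis

lemma inv_arr_fibre:
  assumes "s \<in> Obj S" "a \<in> isos s x y"
  shows "inv_arr (fibre S X \<pi> s) a \<in> isos s y x"
    "inv_arr (fibre S X \<pi> s) a \<bullet> a = Ident X x" "a \<bullet> inv_arr (fibre S X \<pi> s) a = Ident X y"
proof -
  obtain b where b: "b \<in> isos s y x" "b \<bullet> a = Ident X x" "a \<bullet> b = Ident X y"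
    using vert_carts_inverse[OF assms(2,1)] by blast
  have "inv_arr (fibre S X \<pi> s) a = b"
    unfolding inv_arr_def inverse_arrows_fibre[OF assms(1) carts_arrs[OF assms(2)]]
  proof (rule the_equality)
    show "b \<in> varrs s y x \<and> b \<bullet> a = Ident X x \<and> a \<bullet> b = Ident X y"
      using b carts_arrs by blast
    show "b' = b" if "b' \<in> varrs s y x \<and> b' \<bullet> a = Ident X x \<and> a \<bullet> b' = Ident X y" for b'
      using that b cart_cancel[OF assms(2), of b' "Ident S s" y b] carts_arrs by auto
  qed
  then show "inv_arr (fibre S X \<pi> s) a \<in> isos s y x"
    "inv_arr (fibre S X \<pi> s) a \<bullet> a = Ident X x" "a \<bullet> inv_arr (fibre S X \<pi> s) a = Ident X y"
    using b by simp_all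
qed

end

section \<open>Gluing along a covering\<close>

text \<open>
  What the gluing arguments use about a covering of \<open>s\<close>: the chosen double and triple fibre products
  of its members are fibre products indeed.
\<close>

definition covering :: "('s, 'f, 'z) cat_scheme \<Rightarrow> 's \<Rightarrow> 'f set \<Rightarrow> bool" where
  "covering S s \<U> \<longleftrightarrow> s \<in> Obj S \<and> (\<forall>u\<in>\<U>. u \<in> Arr S \<and> Cod S u = s) \<and>
     (\<forall>u\<in>\<U>. \<forall>v\<in>\<U>. is_pullback S u v (pr1 S u v) (pr2 S u v)) \<and>
     (\<forall>u\<in>\<U>. \<forall>v\<in>\<U>. \<forall>w\<in>\<U>. case fprod3 S u v w of (q1, q2, q3) \<Rightarrow> is_pullback3 S u v w q1 q2 q3)"

text \<open>
  The axioms of a topology give fibre products of a member with any arrow, so a triple fibre product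
  is obtained as the pull-back of \<open>u\<close> along the double fibre product of \<open>v\<close> and \<open>w\<close>.
\<close>

lemma (in fibration) pullback3_ex:
  assumes vw: "is_pullback S v w p q" and ug: "is_pullback S u (v \<star> p) a b"
  shows "is_pullback3 S u v w a (p \<star> b) (q \<star> b)"
proof -
  have V: "v \<in> Arr S" "w \<in> Arr S" "Cod S v = Cod S w" "p \<in> Arr S" "q \<in> Arr S" "Dom S p = Dom S q"
    "Cod S p = Dom S v" "Cod S q = Dom S w" "v \<star> p = w \<star> q"
    using vw unfolding is_pullback_def by auto
  have W: "u \<in> Arr S" "Cod S u = Cod S (v \<star> p)" "a \<in> Arr S" "b \<in> Arr S" "Dom S a = Dom S b"
    "Cod S a = Dom S u" "Cod S b = Dom S (v \<star> p)" "u \<star> a = (v \<star> p) \<star> b"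
    using ug unfolding is_pullback_def by auto
  have b: "Cod S b = Dom S q" "Cod S u = Cod S v"
    using W V by simp_all
  have univ: "\<exists>!h. h \<in> Hom S (Dom S \<alpha>) (Dom S a) \<and> a \<star> h = \<alpha> \<and> (p \<star> b) \<star> h = \<beta> \<and> (q \<star> b) \<star> h = \<gamma>"
    if A: "\<alpha> \<in> Arr S" "\<beta> \<in> Arr S" "\<gamma> \<in> Arr S" "Dom S \<alpha> = Dom S \<beta>" "Dom S \<beta> = Dom S \<gamma>"
      "Cod S \<alpha> = Dom S u" "Cod S \<beta> = Dom S v" "Cod S \<gamma> = Dom S w"
      "u \<star> \<alpha> = v \<star> \<beta>" "v \<star> \<beta> = w \<star> \<gamma>" for \<alpha> \<beta> \<gamma>
  proof -
    have "\<exists>!h. h \<in> Hom S (Dom S \<beta>) (Dom S p) \<and> p \<star> h = \<beta> \<and> q \<star> h = \<gamma>"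
      using vw A(2,3,5,7,8,10) unfolding is_pullback_def by blast
    then obtain h where h: "h \<in> Hom S (Dom S \<beta>) (Dom S p)" "p \<star> h = \<beta>" "q \<star> h = \<gamma>"
      and hu: "\<And>h'. h' \<in> Hom S (Dom S \<beta>) (Dom S p) \<Longrightarrow> p \<star> h' = \<beta> \<Longrightarrow> q \<star> h' = \<gamma> \<Longrightarrow> h' = h"
      by blast
    have h': "h \<in> Arr S" "Dom S h = Dom S \<beta>" "Cod S h = Dom S q"
      using h(1) by (simp_all add: Hom_def V(6))
    have "u \<star> \<alpha> = (v \<star> p) \<star> h"
      by (simp add: h(2) h' V(1-7) A(9))
    moreover have "Dom S \<alpha> = Dom S h" "Cod S h = Dom S (v \<star> p)"
      by (simp_all add: h' A(4) V(1-7))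
    ultimately have "\<exists>!k. k \<in> Hom S (Dom S \<alpha>) (Dom S a) \<and> a \<star> k = \<alpha> \<and> b \<star> k = h"
      using ug A(1,6) h'(1) unfolding is_pullback_def by blast
    then obtain k where k: "k \<in> Hom S (Dom S \<alpha>) (Dom S a)" "a \<star> k = \<alpha>" "b \<star> k = h"
      and ku: "\<And>k'. k' \<in> Hom S (Dom S \<alpha>) (Dom S a) \<Longrightarrow> a \<star> k' = \<alpha> \<Longrightarrow> b \<star> k' = h \<Longrightarrow> k' = k"
      by blast
    show ?thesis
    proof (rule ex1I[of _ k])
      show "k \<in> Hom S (Dom S \<alpha>) (Dom S a) \<and> a \<star> k = \<alpha> \<and> (p \<star> b) \<star> k = \<beta> \<and> (q \<star> b) \<star> k = \<gamma>"
        using k by (simp add: Hom_def h(2,3) V(1-8) W(1-7))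
      fix k' assume k': "k' \<in> Hom S (Dom S \<alpha>) (Dom S a) \<and> a \<star> k' = \<alpha> \<and> (p \<star> b) \<star> k' = \<beta> \<and> (q \<star> b) \<star> k' = \<gamma>"
      then have K: "k' \<in> Arr S" "Dom S k' = Dom S \<alpha>" "Cod S k' = Dom S b"
        by (simp_all add: Hom_def W(5))
      have "b \<star> k' = h"
      proof (rule hu)
        show "b \<star> k' \<in> Hom S (Dom S \<beta>) (Dom S p)"
          by (simp add: Hom_def K W(4) b(1) V(6) A(4))
        show "p \<star> b \<star> k' = \<beta>" "q \<star> b \<star> k' = \<gamma>"
          using k' by (simp_all add: K W(4) b(1) V(4-6))
      qed
      with k' ku show "k' = k" by blast
    qed
  qed
  have "u \<star> a = v \<star> p \<star> b" "v \<star> p \<star> b = w \<star> q \<star> b"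
    using W(8) base_chain[OF V(9)[symmetric], of b]
    by (simp_all add: V(1-8) W(4,5) b(1))
  then show ?thesis
    unfolding is_pullback3_def using univ by (simp add: V(1-8) W(1-6) b)
qed

lemma (in fibration) covering_of_topology:
  assumes top: "grothendieck_topology S Cov" and s: "s \<in> Obj S" "\<U> \<in> Cov s"
  shows "covering S s \<U>"
proof -
  note G = top[unfolded grothendieck_topology_def, THEN conjunct2]
  have arr: "u \<in> Arr S" "Cod S u = s" if "u \<in> \<U>" for u
    using G[THEN conjunct1] s that by simp_all
  have pb: "\<exists>p q. is_pullback S u g p q" if "u \<in> \<U>" "g \<in> Arr S" "Cod S g = s" for u g
    using G[THEN conjunct2, THEN conjunct2, THEN conjunct1] s that by simp
  have fp: "is_pullback S u v (pr1 S u v) (pr2 S u v)" if "u \<in> \<U>" "v \<in> \<U>" for u v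
  proof -
    have "\<exists>c. case c of (p, q) \<Rightarrow> is_pullback S u v p q"
      using pb[OF that(1) arr[OF that(2)]] by simp
    from someI_ex[OF this] show ?thesis
      unfolding pr1_def pr2_def fprod_def by (simp add: case_prod_unfold)
  qed
  have fp3: "case fprod3 S u v w of (q1, q2, q3) \<Rightarrow> is_pullback3 S u v w q1 q2 q3"
    if uvw: "u \<in> \<U>" "v \<in> \<U>" "w \<in> \<U>" for u v w
  proof -
    let ?p = "pr1 S v w" and ?q = "pr2 S v w"
    have p: "?p \<in> Arr S" "Cod S ?p = Dom S v"
      using fp[OF uvw(2,3)] unfolding is_pullback_def by blast+
    have "v \<star> ?p \<in> Arr S" "Cod S (v \<star> ?p) = s"
      by (simp_all add: p arr[OF uvw(2)])
    then obtain a b where ab: "is_pullback S u (v \<star> ?p) a b"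
      using pb[OF uvw(1)] by blast
    have "case (a, ?p \<star> b, ?q \<star> b) of (q1, q2, q3) \<Rightarrow> is_pullback3 S u v w q1 q2 q3"
      using pullback3_ex[OF fp[OF uvw(2,3)] ab] by simp
    then show ?thesis
      unfolding fprod3_def by (rule someI)
  qed
  show ?thesis
    unfolding covering_def using s(1) arr fp fp3 by (intro conjI ballI)
qed

locale covered_fibration = fibration S X \<pi>
  for S :: "('s, 'f) cat" and X :: "('x, 'a) cat" and \<pi> :: "('x, 'a, 's, 'f) fctr" +
  fixes s :: 's and \<U> :: "'f set"
  assumes covering: "covering S s \<U>"
begin

lemma s: "s \<in> Obj S"
  using covering by (simp add: covering_def)

lemma member: "u \<in> \<U> \<Longrightarrow> u \<in> Arr S" "u \<in> \<U> \<Longrightarrow> Cod S u = s"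
  using covering by (simp_all add: covering_def)

lemma overlap:
  assumes "u \<in> \<U>" "v \<in> \<U>"
  shows "pr1 S u v \<in> Arr S" "pr2 S u v \<in> Arr S" "Dom S (pr2 S u v) = Dom S (pr1 S u v)"
    "Cod S (pr1 S u v) = Dom S u" "Cod S (pr2 S u v) = Dom S v" "u \<star> pr1 S u v = v \<star> pr2 S u v"
  using covering assms by (auto simp: covering_def is_pullback_def)

lemma overlap_ex1:
  assumes "u \<in> \<U>" "v \<in> \<U>" "g \<in> Arr S" "h \<in> Arr S" "Dom S g = Dom S h" "Cod S g = Dom S u"
    "Cod S h = Dom S v" "u \<star> g = v \<star> h"
  shows "\<exists>!k. k \<in> Hom S (Dom S g) (Dom S (pr1 S u v)) \<and> pr1 S u v \<star> k = g \<and> pr2 S u v \<star> k = h"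
  using covering assms unfolding covering_def is_pullback_def by blast

lemma fpair:
  assumes "u \<in> \<U>" "v \<in> \<U>" "g \<in> Arr S" "h \<in> Arr S" "Dom S g = Dom S h" "Cod S g = Dom S u"
    "Cod S h = Dom S v" "u \<star> g = v \<star> h"
  shows "fpair S u v g h \<in> Arr S" "Dom S (fpair S u v g h) = Dom S g"
    "Cod S (fpair S u v g h) = Dom S (pr1 S u v)"
    "pr1 S u v \<star> fpair S u v g h = g" "pr2 S u v \<star> fpair S u v g h = h"
  using theI'[OF overlap_ex1[OF assms]] unfolding fpair_def Hom_def by simp_all

lemma overlap_eqI:
  assumes "u \<in> \<U>" "v \<in> \<U>" "k \<in> Arr S" "l \<in> Arr S" "Dom S k = Dom S l" "Cod S k = Dom S (pr1 S u v)"
    "Cod S l = Dom S (pr1 S u v)" "pr1 S u v \<star> k = pr1 S u v \<star> l" "pr2 S u v \<star> k = pr2 S u v \<star> l"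
  shows "k = l"
proof -
  note o = overlap[OF assms(1,2)]
  let ?g = "pr1 S u v \<star> k" and ?h = "pr2 S u v \<star> k"
  have "u \<star> ?g = v \<star> ?h"
    using base_chain[OF o(6), of k] by (simp add: o assms(3,6) member[OF assms(1)] member[OF assms(2)])
  then have "\<exists>!k'. k' \<in> Hom S (Dom S ?g) (Dom S (pr1 S u v)) \<and> pr1 S u v \<star> k' = ?g \<and> pr2 S u v \<star> k' = ?h"
    using assms(1-3,6) by (intro overlap_ex1) (simp_all add: o)
  moreover have "k \<in> Hom S (Dom S ?g) (Dom S (pr1 S u v))" "l \<in> Hom S (Dom S ?g) (Dom S (pr1 S u v))"
    using o(1) assms(3-7) by (simp_all add: Hom_def)
  ultimately show ?thesis
    using assms(8,9) by metis
qed

lemma triple: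
  assumes "u \<in> \<U>" "v \<in> \<U>" "w \<in> \<U>" "fprod3 S u v w = (q1, q2, q3)"
  shows "q1 \<in> Arr S" "q2 \<in> Arr S" "q3 \<in> Arr S" "Dom S q2 = Dom S q1" "Dom S q3 = Dom S q1"
    "Cod S q1 = Dom S u" "Cod S q2 = Dom S v" "Cod S q3 = Dom S w" "u \<star> q1 = v \<star> q2" "v \<star> q2 = w \<star> q3"
proof -
  have "is_pullback3 S u v w q1 q2 q3"
    using covering assms unfolding covering_def by (metis (no_types, lifting) case_prod_conv)
  then show "q1 \<in> Arr S" "q2 \<in> Arr S" "q3 \<in> Arr S" "Dom S q2 = Dom S q1" "Dom S q3 = Dom S q1"
    "Cod S q1 = Dom S u" "Cod S q2 = Dom S v" "Cod S q3 = Dom S w" "u \<star> q1 = v \<star> q2" "v \<star> q2 = w \<star> q3"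
    unfolding is_pullback3_def by simp_all
qed

text \<open>
  The isomorphism \<open>p\<^sub>1\<^sup>* x \<rightarrow> p\<^sub>2\<^sup>* y\<close> of a descent datum amounts to a common pull-back of \<open>x\<close> and \<open>y\<close> to
  the overlap, that is, to a pair of cartesian arrows with the same source. In this form it does not
  mention a cleavage, and pairs can be mapped along functors that do not preserve cleavages.
\<close>

definition span_over :: "'f \<Rightarrow> 'f \<Rightarrow> 'x \<Rightarrow> 'x \<Rightarrow> 'a \<Rightarrow> 'a \<Rightarrow> bool" where
  "span_over u v x y a b \<longleftrightarrow>
     a \<in> carts (pr1 S u v) (Dom X a) x \<and> b \<in> carts (pr2 S u v) (Dom X a) y"

text \<open>
  The span identifies \<open>\<alpha>\<close> and \<open>\<beta>\<close>: they are the restrictions of its legs along a common arrow. For a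
  span over an overlap, \<open>\<beta>\<close> is determined by \<open>\<alpha>\<close> and its base arrow, by \<open>factors_unique\<close> below.
\<close>

definition factors :: "'a \<Rightarrow> 'a \<Rightarrow> 'a \<Rightarrow> 'a \<Rightarrow> bool" where
  "factors a b \<alpha> \<beta> \<longleftrightarrow> (\<exists>\<zeta>\<in>Arr X. Cod X \<zeta> = Dom X a \<and> a \<bullet> \<zeta> = \<alpha> \<and> b \<bullet> \<zeta> = \<beta>)"

text \<open>
  Identifying first over \<open>u\<close>, \<open>v\<close> and then over \<open>v\<close>, \<open>w\<close> is the same as identifying over \<open>u\<close>, \<open>w\<close>. One
  triple of cartesian arrows is enough to express this: any other arrow into \<open>x u\<close> over the triple
  fibre product factors through \<open>\<alpha>\<close>, and \<open>factors\<close> is stable under composition. The existential form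
  passes to images under functors.
\<close>

definition cocycle :: "('f \<Rightarrow> 'x) \<Rightarrow> ('f \<Rightarrow> 'f \<Rightarrow> 'a) \<Rightarrow> ('f \<Rightarrow> 'f \<Rightarrow> 'a) \<Rightarrow> bool" where
  "cocycle x a b \<longleftrightarrow> (\<forall>u\<in>\<U>. \<forall>v\<in>\<U>. \<forall>w\<in>\<U>. case fprod3 S u v w of (q1, q2, q3) \<Rightarrow>
     \<exists>z \<alpha> \<beta> \<gamma>. \<alpha> \<in> carts q1 z (x u) \<and> \<beta> \<in> carts q2 z (x v) \<and> \<gamma> \<in> carts q3 z (x w) \<and>
       factors (a u v) (b u v) \<alpha> \<beta> \<and> factors (a v w) (b v w) \<beta> \<gamma> \<and> factors (a u w) (b u w) \<alpha> \<gamma>)"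

text \<open>
  An object \<open>x\<close> over \<open>s\<close> is glued from its restrictions \<open>x' u\<close>: arrows out of \<open>x\<close> over \<open>f\<close> are the same as
  compatible arrows out of the \<open>x' u\<close>. Compatibility is required on some span over each overlap only;
  all such spans with \<open>c u \<bullet> a = c v \<bullet> b\<close> are isomorphic.
\<close>

definition hom_descent :: bool where
  "hom_descent \<longleftrightarrow> (\<forall>x x' c y f h.
     (\<forall>u\<in>\<U>. c u \<in> carts u (x' u) x) \<and> x \<in> Obj X \<and> fobj \<pi> x = s \<and> y \<in> Obj X \<and>
     f \<in> Arr S \<and> Dom S f = s \<and> Cod S f = fobj \<pi> y \<and> (\<forall>u\<in>\<U>. h u \<in> arrs (f \<star> u) (x' u) y) \<and>
     (\<forall>u\<in>\<U>. \<forall>v\<in>\<U>. \<exists>a b. span_over u v (x' u) (x' v) a b \<and> c u \<bullet> a = c v \<bullet> b \<and> h u \<bullet> a = h v \<bullet> b) \<longrightarrow>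
     (\<exists>!g. g \<in> arrs f x y \<and> (\<forall>u\<in>\<U>. g \<bullet> c u = h u)))"

definition obj_descent :: bool where
  "obj_descent \<longleftrightarrow> (\<forall>x a b.
     (\<forall>u\<in>\<U>. \<forall>v\<in>\<U>. span_over u v (x u) (x v) (a u v) (b u v)) \<and> cocycle x a b \<longrightarrow>
     (\<exists>y c. y \<in> Obj X \<and> fobj \<pi> y = s \<and> (\<forall>u\<in>\<U>. c u \<in> carts u (x u) y) \<and>
        (\<forall>u\<in>\<U>. \<forall>v\<in>\<U>. c u \<bullet> a u v = c v \<bullet> b u v)))"

lemma factors_comp:
  assumes "factors a b \<alpha> \<beta>" "a \<in> Arr X" "b \<in> Arr X" "Dom X a = Dom X b" "\<xi> \<in> Arr X" "Dom X \<alpha> = Cod X \<xi>"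
  shows "factors a b (\<alpha> \<bullet> \<xi>) (\<beta> \<bullet> \<xi>)"
proof -
  obtain \<zeta> where z: "\<zeta> \<in> Arr X" "Cod X \<zeta> = Dom X a" "a \<bullet> \<zeta> = \<alpha>" "b \<bullet> \<zeta> = \<beta>"
    using assms(1) by (auto simp: factors_def)
  moreover have "Dom X \<zeta> = Cod X \<xi>"
    using z(1,2) assms(2,6) z(3)[symmetric] by simp
  ultimately show ?thesis
    unfolding factors_def using assms(2-5)
      chain[OF z(3) z(1) assms(2), of \<xi>] chain[OF z(4) z(1) assms(3), of \<xi>]
    by (intro bexI[of _ "\<zeta> \<bullet> \<xi>"]) auto
qed

lemma factors_unique:
  assumes uv: "u \<in> \<U>" "v \<in> \<U>" and sp: "span_over u v x y a b"
    and f: "factors a b \<alpha> \<beta>" "factors a b \<alpha> \<beta>'" and e: "farr \<pi> \<beta> = farr \<pi> \<beta>'"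
  shows "\<beta> = \<beta>'"
proof -
  have a: "a \<in> carts (pr1 S u v) (Dom X a) x" and b: "b \<in> carts (pr2 S u v) (Dom X a) y"
    using sp by (auto simp: span_over_def)
  note aD = cartsD[OF a] and bD = cartsD[OF b]
  obtain \<zeta> \<zeta>' where z: "\<zeta> \<in> Arr X" "Cod X \<zeta> = Dom X a" "a \<bullet> \<zeta> = \<alpha>" "b \<bullet> \<zeta> = \<beta>"
    and z': "\<zeta>' \<in> Arr X" "Cod X \<zeta>' = Dom X a" "a \<bullet> \<zeta>' = \<alpha>" "b \<bullet> \<zeta>' = \<beta>'"
    using f by (auto simp: factors_def)
  have d: "Dom X \<zeta>' = Dom X \<zeta>"
    using tot_simps(7)[OF z(1) aD(1)] tot_simps(7)[OF z'(1) aD(1)] z z' by metis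
  have eq: "farr \<pi> \<zeta> = farr \<pi> \<zeta>'"
  proof (rule overlap_eqI[OF uv])
    show "pr1 S u v \<star> farr \<pi> \<zeta> = pr1 S u v \<star> farr \<pi> \<zeta>'"
      using proj_simps(6)[OF z(1) aD(1)] proj_simps(6)[OF z'(1) aD(1)] z z' aD(4) by metis
    show "pr2 S u v \<star> farr \<pi> \<zeta> = pr2 S u v \<star> farr \<pi> \<zeta>'"
      using proj_simps(6)[OF z(1) bD(1)] proj_simps(6)[OF z'(1) bD(1)] z z' bD(2,4) e by metis
  qed (simp_all add: z z' d aD(8))
  have "\<zeta> = \<zeta>'"
    by (rule cart_cancel[OF a, of \<zeta> "farr \<pi> \<zeta>" "Dom X \<zeta>"]) (simp_all add: arrs_def Hom_def z z' d eq)
  then show ?thesis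
    using z z' by simp
qed

text \<open>
  Two restrictions of one object have a common restriction to the overlap: lift \<open>p\<^sub>1\<close> to \<open>a\<close> and factor
  \<open>c \<bullet> a\<close> through \<open>d\<close>.
\<close>

lemma span_exists:
  assumes uv: "u \<in> \<U>" "v \<in> \<U>" and c: "c \<in> carts u x z" and d: "d \<in> carts v y z"
  shows "\<exists>a b. span_over u v x y a b \<and> c \<bullet> a = d \<bullet> b"
proof -
  note o = overlap[OF uv] and cD = cartsD[OF c] and dD = cartsD[OF d]
  obtain a where a: "a \<in> carts (pr1 S u v) (Dom X a) x"
    using cart_lift_ex[OF o(1) cD(5)] o(4) cD(8) by metis
  note aD = cartsD[OF a]
  have ca: "c \<bullet> a \<in> carts (u \<star> pr1 S u v) (Dom X a) z"
    by (rule carts_comp[OF a c])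
  obtain b where b: "b \<in> arrs (pr2 S u v) (Dom X a) y" "d \<bullet> b = c \<bullet> a"
    using cart_factor[OF d carts_arrs[OF ca] o(2)] o dD(8) aD(8) by auto
  have "b \<in> carts (pr2 S u v) (Dom X a) y"
    by (rule carts_right_factor[OF b(1) d]) (use b ca in simp)
  then show ?thesis
    using a b(2)[symmetric] unfolding span_over_def by blast
qed

lemma span_overD:
  assumes "span_over u v x y a b"
  shows "a \<in> carts (pr1 S u v) (Dom X a) x" "b \<in> carts (pr2 S u v) (Dom X a) y"
    "a \<in> Arr X" "b \<in> Arr X" "Dom X b = Dom X a" "Cod X a = x" "Cod X b = y"
    "farr \<pi> a = pr1 S u v" "farr \<pi> b = pr2 S u v"
proof -
  show a: "a \<in> carts (pr1 S u v) (Dom X a) x" and b: "b \<in> carts (pr2 S u v) (Dom X a) y"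
    using assms by (auto simp: span_over_def)
  show "a \<in> Arr X" "b \<in> Arr X" "Dom X b = Dom X a" "Cod X a = x" "Cod X b = y"
    "farr \<pi> a = pr1 S u v" "farr \<pi> b = pr2 S u v"
    by (fact cartsD[OF a] cartsD[OF b])+
qed

lemma hom_descent_ex1:
  assumes hom_descent "\<And>u. u \<in> \<U> \<Longrightarrow> c u \<in> carts u (x' u) x" "x \<in> Obj X" "fobj \<pi> x = s" "y \<in> Obj X"
    "f \<in> Arr S" "Dom S f = s" "Cod S f = fobj \<pi> y" "\<And>u. u \<in> \<U> \<Longrightarrow> h u \<in> arrs (f \<star> u) (x' u) y"
    "\<And>u v. u \<in> \<U> \<Longrightarrow> v \<in> \<U> \<Longrightarrow>
       \<exists>a b. span_over u v (x' u) (x' v) a b \<and> c u \<bullet> a = c v \<bullet> b \<and> h u \<bullet> a = h v \<bullet> b"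
  shows "\<exists>!g. g \<in> arrs f x y \<and> (\<forall>u\<in>\<U>. g \<bullet> c u = h u)"
  using assms(1)[unfolded hom_descent_def, rule_format, of c x' x y f h] assms(2-) by blast

text \<open>
  The restrictions of one and the same arrow are compatible, so the uniqueness part of gluing applies
  to any two arrows that agree locally. All equations between glued arrows are proved by this rule.
\<close>

lemma hom_descent_unique:
  assumes hd: hom_descent and c: "\<And>u. u \<in> \<U> \<Longrightarrow> c u \<in> carts u (x' u) x" and x: "fobj \<pi> x = s"
    and g: "g \<in> arrs f x y" and g': "g' \<in> arrs f x y" and eq: "\<And>u. u \<in> \<U> \<Longrightarrow> g \<bullet> c u = g' \<bullet> c u"
  shows "g = g'"
proof -
  note gD = arrsD[OF g]
  have "\<exists>!k. k \<in> arrs f x y \<and> (\<forall>u\<in>\<U>. k \<bullet> c u = g \<bullet> c u)"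
  proof (rule hom_descent_ex1[OF hd c])
    show "g \<bullet> c u \<in> arrs (f \<star> u) (x' u) y" if "u \<in> \<U>" for u
      using arrs_comp[OF carts_arrs[OF c[OF that]] g] .
    show "\<exists>a b. span_over u v (x' u) (x' v) a b \<and> c u \<bullet> a = c v \<bullet> b \<and> (g \<bullet> c u) \<bullet> a = (g \<bullet> c v) \<bullet> b"
      if uv: "u \<in> \<U>" "v \<in> \<U>" for u v
    proof -
      obtain a b where ab: "span_over u v (x' u) (x' v) a b" "c u \<bullet> a = c v \<bullet> b"
        using span_exists[OF uv c[OF uv(1)] c[OF uv(2)]] by blast
      moreover have "(g \<bullet> c u) \<bullet> a = (g \<bullet> c v) \<bullet> b"
        using ab(2) span_overD(3-7)[OF ab(1)] gD(1-3)
          cart_typing[OF c[OF uv(1)]] cart_typing[OF c[OF uv(2)]] by simp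
      ultimately show ?thesis by blast
    qed
  qed (use gD x in simp_all)
  then show ?thesis
    using g g' eq by metis
qed

text \<open>
  Being cartesian is a local property. Write \<open>g\<close> as a lift of \<open>f\<close> after a vertical arrow \<open>m\<close>. The
  composites \<open>m \<bullet> c u\<close> are cartesian as well, so they also exhibit the target of \<open>m\<close> as glued from the
  \<open>x' u\<close>, and gluing the \<open>c u\<close> along them gives the inverse of \<open>m\<close>.
\<close>

lemma hom_descent_cartesian:
  assumes hd: hom_descent and c: "\<And>u. u \<in> \<U> \<Longrightarrow> c u \<in> carts u (x' u) x" and x: "fobj \<pi> x = s"
    and g: "g \<in> arrs f x y" and gc: "\<And>u. u \<in> \<U> \<Longrightarrow> g \<bullet> c u \<in> carts (f \<star> u) (x' u) y"
  shows "g \<in> carts f x y"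
proof -
  note gD = arrsD[OF g]
  obtain l where l: "l \<in> carts f (Dom X l) y"
    using cart_lift_ex[OF gD(7,6)] gD(9) by metis
  note lD = cartsD[OF l]
  define z where "z = Dom X l"
  have z: "z \<in> Obj X" "fobj \<pi> z = s"
    using lD(5,8) gD(8) x by (simp_all add: z_def)
  obtain m where m: "m \<in> varrs s x z" "l \<bullet> m = g"
    using cart_factor[OF l g, of "Ident S s"] gD(7-9) lD(8) s x z by (auto simp: z_def)
  note mD = vertD[OF m(1) s]
  have d: "m \<bullet> c u \<in> carts u (x' u) z" if "u \<in> \<U>" for u
  proof (rule carts_right_factor[OF _ l[folded z_def]])
    show "m \<bullet> c u \<in> arrs u (x' u) z"
      using arrs_comp[OF carts_arrs[OF c[OF that]] m(1)] member[OF that] by simp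
    show "l \<bullet> m \<bullet> c u \<in> carts (f \<star> u) (x' u) y"
      using gc[OF that] chain[OF m(2), of "c u"] mD lD(1,2) z_def cart_typing[OF c[OF that]]
      by simp
  qed
  have "\<exists>!n. n \<in> varrs s z x \<and> (\<forall>u\<in>\<U>. n \<bullet> m \<bullet> c u = c u)"
  proof (rule hom_descent_ex1[OF hd d])
    show "c u \<in> arrs (Ident S s \<star> u) (x' u) x" if "u \<in> \<U>" for u
      using carts_arrs[OF c[OF that]] member[OF that] by simp
    show "\<exists>a b. span_over u v (x' u) (x' v) a b \<and> (m \<bullet> c u) \<bullet> a = (m \<bullet> c v) \<bullet> b \<and> c u \<bullet> a = c v \<bullet> b"
      if uv: "u \<in> \<U>" "v \<in> \<U>" for u v
    proof -
      obtain a b where ab: "span_over u v (x' u) (x' v) a b" "c u \<bullet> a = c v \<bullet> b"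
        using span_exists[OF uv c[OF uv(1)] c[OF uv(2)]] by blast
      moreover have "(m \<bullet> c u) \<bullet> a = (m \<bullet> c v) \<bullet> b"
        using ab(2) span_overD(3-7)[OF ab(1)] mD
          cart_typing[OF c[OF uv(1)]] cart_typing[OF c[OF uv(2)]] by simp
      ultimately show ?thesis by blast
    qed
  qed (use s x z mD(5) in simp_all)
  then obtain n where n: "n \<in> varrs s z x" "\<And>u. u \<in> \<U> \<Longrightarrow> n \<bullet> m \<bullet> c u = c u"
    by blast
  note nD = vertD[OF n(1) s]
  have "n \<bullet> m = Ident X x"
  proof (rule hom_descent_unique[OF hd c x, of _ "Ident S s"])
    show "n \<bullet> m \<in> varrs s x x" "Ident X x \<in> varrs s x x"
      using arrs_comp[OF m(1) n(1)] arrs_ident[of x] mD(5) x s by simp_all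
    show "(n \<bullet> m) \<bullet> c u = Ident X x \<bullet> c u" if "u \<in> \<U>" for u
      using n(2)[OF that] mD nD cart_typing[OF c[OF that]] by simp
  qed
  moreover have "m \<bullet> n = Ident X z"
  proof (rule hom_descent_unique[OF hd d z(2), of _ "Ident S s"])
    show "m \<bullet> n \<in> varrs s z z" "Ident X z \<in> varrs s z z"
      using arrs_comp[OF n(1) m(1)] arrs_ident[of z] z s by simp_all
    show "(m \<bullet> n) \<bullet> m \<bullet> c u = Ident X z \<bullet> m \<bullet> c u" if "u \<in> \<U>" for u
      using n(2)[OF that] mD nD cart_typing[OF c[OF that]] by simp
  qed
  ultimately have "m \<in> isos s x z"
    using inverse_carts[OF m(1) n(1) s] by blast
  then show ?thesis
    using carts_comp[OF _ l[folded z_def]] m(2) gD(7,8) x by fastforce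
qed

text \<open>
  If the spans come from an object \<open>y\<close> over the base, arrows are identified by the spans as soon as they
  agree in \<open>y\<close>, and agreement in \<open>y\<close> is transitive. The triple that witnesses the cocycle condition
  consists of the factorisations of one lift of \<open>u \<star> q1\<close> to \<open>y\<close>.
\<close>

lemma cocycle_of_cone:
  assumes sp: "\<And>u v. u \<in> \<U> \<Longrightarrow> v \<in> \<U> \<Longrightarrow> span_over u v (x u) (x v) (a u v) (b u v)"
    and c: "\<And>u. u \<in> \<U> \<Longrightarrow> c u \<in> carts u (x u) y"
    and eq: "\<And>u v. u \<in> \<U> \<Longrightarrow> v \<in> \<U> \<Longrightarrow> c u \<bullet> a u v = c v \<bullet> b u v"
  shows "cocycle x a b"
proof -
  have fac: "factors (a u v) (b u v) \<alpha> \<beta>"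
    if uv: "u \<in> \<U>" "v \<in> \<U>" and al: "\<alpha> \<in> arrs g z (x u)" and be: "\<beta> \<in> arrs h z (x v)"
      and e: "c u \<bullet> \<alpha> = c v \<bullet> \<beta>" for u v g h z \<alpha> \<beta>
  proof -
    note AD = arrsD[OF al] and BD = arrsD[OF be]
    note S = span_overD[OF sp[OF uv]] and cu = cartsD[OF c[OF uv(1)]] and cv = cartsD[OF c[OF uv(2)]]
    note aD = cartsD[OF S(1)]
    have gh: "g \<in> Arr S" "h \<in> Arr S" "Dom S g = Dom S h" "Cod S g = Dom S u" "Cod S h = Dom S v"
      by (simp_all add: AD(7-9) BD(7-9) cu(8) cv(8))
    have "farr \<pi> (c u \<bullet> \<alpha>) = u \<star> g" "farr \<pi> (c v \<bullet> \<beta>) = v \<star> h"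
      by (simp_all add: AD(1-4) BD(1-4) cu(1-4) cv(1-4))
    then have "u \<star> g = v \<star> h"
      using e by simp
    note k = fpair[OF uv gh this]
    obtain \<zeta> where z: "\<zeta> \<in> arrs (fpair S u v g h) z (Dom X (a u v))" "a u v \<bullet> \<zeta> = \<alpha>"
      using cart_factor[OF S(1) al k(1) _ _ k(4)] k(2,3) AD(8) aD(8) by auto
    note zD = arrsD[OF z(1)]
    have "b u v \<bullet> \<zeta> = \<beta>"
    proof (rule cart_cancel[OF c[OF uv(2)]])
      show "b u v \<bullet> \<zeta> \<in> arrs h z (x v)"
        using arrs_comp[OF z(1) carts_arrs[OF S(2)]] k(5) by simp
      show "\<beta> \<in> arrs h z (x v)" by (rule be)
      have "c u \<bullet> a u v \<bullet> \<zeta> = c v \<bullet> b u v \<bullet> \<zeta>"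
        using chain[OF eq[OF uv], of \<zeta>] by (simp add: S(3-7) zD(1-3) cu(1-3) cv(1-3))
      then show "c v \<bullet> b u v \<bullet> \<zeta> = c v \<bullet> \<beta>"
        by (simp add: z(2) e)
    qed
    then show ?thesis
      unfolding factors_def using z(2) zD(1,3) by blast
  qed
  show ?thesis
    unfolding cocycle_def
  proof (intro ballI)
    fix u v w assume uvw: "u \<in> \<U>" "v \<in> \<U>" "w \<in> \<U>"
    obtain q1 q2 q3 where q: "fprod3 S u v w = (q1, q2, q3)"
      by (metis prod_cases3)
    note Q = triple[OF uvw q]
    note cu = cartsD[OF c[OF uvw(1)]]
    have k: "u \<star> q1 \<in> Arr S" "fobj \<pi> y = Cod S (u \<star> q1)"
      using Q(1,6) cu(7,9) by simp_all
    obtain l where l: "l \<in> carts (u \<star> q1) (Dom X l) y"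
      using cart_lift_ex[OF k(1) cu(6) k(2)] by blast
    have ld: "fobj \<pi> (Dom X l) = Dom S q1"
      using cartsD(8)[OF l] Q(1,6) cu(7) by simp
    have lift: "\<exists>\<alpha>. \<alpha> \<in> carts g (Dom X l) (x t) \<and> c t \<bullet> \<alpha> = l"
      if t: "t \<in> \<U>" and g: "g \<in> Arr S" "Dom S g = Dom S q1" "Cod S g = Dom S t" "t \<star> g = u \<star> q1" for t g
    proof -
      obtain \<alpha> where "\<alpha> \<in> arrs g (Dom X l) (x t)" "c t \<bullet> \<alpha> = l"
        using cart_factor[OF c[OF t] carts_arrs[OF l] g(1) _ _ g(4)] g(2,3) ld cartsD(8)[OF c[OF t]] by auto
      then show ?thesis
        using carts_right_factor[OF _ c[OF t]] l by metis
    qed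
    obtain \<alpha> where al: "\<alpha> \<in> carts q1 (Dom X l) (x u)" "c u \<bullet> \<alpha> = l"
      using lift[OF uvw(1), of q1] Q by auto
    obtain \<beta> where be: "\<beta> \<in> carts q2 (Dom X l) (x v)" "c v \<bullet> \<beta> = l"
      using lift[OF uvw(2), of q2] Q by auto
    obtain \<gamma> where ga: "\<gamma> \<in> carts q3 (Dom X l) (x w)" "c w \<bullet> \<gamma> = l"
      using lift[OF uvw(3), of q3] Q by auto
    show "case fprod3 S u v w of (q1, q2, q3) \<Rightarrow>
        \<exists>z \<alpha> \<beta> \<gamma>. \<alpha> \<in> carts q1 z (x u) \<and> \<beta> \<in> carts q2 z (x v) \<and> \<gamma> \<in> carts q3 z (x w) \<and>
         factors (a u v) (b u v) \<alpha> \<beta> \<and> factors (a v w) (b v w) \<beta> \<gamma> \<and> factors (a u w) (b u w) \<alpha> \<gamma>"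
      unfolding q using al be ga fac[OF uvw(1,2) carts_arrs[OF al(1)] carts_arrs[OF be(1)]]
        fac[OF uvw(2,3) carts_arrs[OF be(1)] carts_arrs[OF ga(1)]]
        fac[OF uvw(1,3) carts_arrs[OF al(1)] carts_arrs[OF ga(1)]] by auto
  qed
qed

end

section \<open>Cleavages\<close>

locale cloven_fibration =
  fixes E :: "('s, 'f, 'x, 'a, 'z) cloven_scheme"
  assumes cloven: "cloven_fibred_category E"
begin

sublocale fibration "Base E" "Tot E" "Proj E"
  using cloven by unfold_locales (simp add: cloven_fibred_category_def)

abbreviation "S \<equiv> Base E"
abbreviation "X \<equiv> Tot E"
abbreviation "\<pi> \<equiv> Proj E"
abbreviation pull_comp (infixr "\<star>" 70) where "g \<star> f \<equiv> Comp (Base E) g f"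
abbreviation total_comp (infixr "\<bullet>" 70) where "b \<bullet> a \<equiv> Comp (Tot E) b a"

lemma Clv:
  assumes "f \<in> Arr S" "x \<in> Obj X" "fobj \<pi> x = Cod S f"
  shows "Clv E f x \<in> carts f (pull_obj E f x) x"
  using cloven assms
  by (simp add: cloven_fibred_category_def cleavage_def carts_def arrs_def Hom_def pull_obj_def cartesian_def)

lemma pull_obj:
  assumes "f \<in> Arr S" "x \<in> Obj X" "fobj \<pi> x = Cod S f"
  shows "pull_obj E f x \<in> Obj X" "fobj \<pi> (pull_obj E f x) = Dom S f"
  using cartsD[OF Clv[OF assms]] by simp_all

lemma the_vertical_factor:
  assumes c: "c \<in> carts f x y" and b: "b \<in> arrs f z y"
  shows "(THE d. d \<in> Hom (fib E (Dom S f)) z x \<and> c \<bullet> d = b) \<in> varrs (Dom S f) z x"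
    "c \<bullet> (THE d. d \<in> Hom (fib E (Dom S f)) z x \<and> c \<bullet> d = b) = b"
proof -
  note cD = cartsD[OF c] and bD = arrsD[OF b]
  have s: "Dom S f \<in> Obj S"
    using cD(7) by simp
  have "\<exists>!d. d \<in> varrs (Dom S f) z x \<and> c \<bullet> d = b"
    by (rule cart_ex1[OF c]) (use b s cD(7,8) bD(8) in \<open>simp_all del: proj_simps(1)\<close>)
  from theI'[OF this] show "(THE d. d \<in> Hom (fib E (Dom S f)) z x \<and> c \<bullet> d = b) \<in> varrs (Dom S f) z x"
    "c \<bullet> (THE d. d \<in> Hom (fib E (Dom S f)) z x \<and> c \<bullet> d = b) = b"
    unfolding Hom_fibre[OF s] by blast+
qed

lemma pull_arr:
  assumes f: "f \<in> Arr S" and a: "a \<in> varrs (Cod S f) x y"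
  shows "pull_arr E f a \<in> varrs (Dom S f) (pull_obj E f x) (pull_obj E f y)"
    "Clv E f y \<bullet> pull_arr E f a = a \<bullet> Clv E f x"
proof -
  note aD = vertD[OF a base_simps(2)[OF f]]
  have "a \<bullet> Clv E f x \<in> arrs f (pull_obj E f x) y"
    using arrs_comp[OF carts_arrs[OF Clv[OF f aD(5,7)]] a] f by simp
  from the_vertical_factor[OF Clv[OF f aD(6,8)] this]
  show "pull_arr E f a \<in> varrs (Dom S f) (pull_obj E f x) (pull_obj E f y)"
    "Clv E f y \<bullet> pull_arr E f a = a \<bullet> Clv E f x"
    unfolding pull_arr_def aD(2,3) by blast+
qed

lemma can:
  assumes f: "f \<in> Arr S" "g \<in> Arr S" "Dom S f = Cod S g" and x: "x \<in> Obj X" "fobj \<pi> x = Cod S f"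
  shows "can E f g x \<in> isos (Dom S g) (pull_obj E g (pull_obj E f x)) (pull_obj E (f \<star> g) x)"
    "Clv E (f \<star> g) x \<bullet> can E f g x = Clv E f x \<bullet> Clv E g (pull_obj E f x)"
proof -
  note p = pull_obj[OF f(1) x]
  have fg: "f \<star> g \<in> Arr S" "Dom S (f \<star> g) = Dom S g" "Cod S (f \<star> g) = Cod S f"
    using f by simp_all
  have cc: "Clv E f x \<bullet> Clv E g (pull_obj E f x) \<in> carts (f \<star> g) (pull_obj E g (pull_obj E f x)) x"
    by (rule carts_comp[OF Clv Clv]) (use f x p in simp_all)
  have c: "Clv E (f \<star> g) x \<in> carts (f \<star> g) (pull_obj E (f \<star> g) x) x"
    by (rule Clv) (use fg x in simp_all)
  note v = the_vertical_factor[OF c carts_arrs[OF cc], unfolded fg(2), folded can_def]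
  show eq: "Clv E (f \<star> g) x \<bullet> can E f g x = Clv E f x \<bullet> Clv E g (pull_obj E f x)"
    by (rule v(2))
  show "can E f g x \<in> isos (Dom S g) (pull_obj E g (pull_obj E f x)) (pull_obj E (f \<star> g) x)"
    by (rule carts_right_factor[OF v(1) c, where k = "f \<star> g"]) (simp add: eq cc)
qed

text \<open>
  Composed with the chosen lift of \<open>f' \<star> g\<close>, the canonical isomorphisms in the definition of
  \<^const>\<open>restr\<close> cancel. This equation characterises the restriction by the lifts alone.
\<close>

lemma restr:
  assumes g: "g \<in> Arr S" and f: "f \<in> Arr S" "Dom S f = Cod S g" and f': "f' \<in> Arr S" "Dom S f' = Cod S g"
    and x: "x \<in> Obj X" "fobj \<pi> x = Cod S f" and y: "y \<in> Obj X" "fobj \<pi> y = Cod S f'"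
    and a: "a \<in> varrs (Cod S g) (pull_obj E f x) (pull_obj E f' y)"
    and l: "l \<in> arrs g (pull_obj E (f \<star> g) x) (pull_obj E f x)" "Clv E f x \<bullet> l = Clv E (f \<star> g) x"
  shows "restr E f x f' y g a \<in> varrs (Dom S g) (pull_obj E (f \<star> g) x) (pull_obj E (f' \<star> g) y)"
    "Clv E (f' \<star> g) y \<bullet> restr E f x f' y g a = Clv E f' y \<bullet> a \<bullet> l"
proof -
  have s: "Dom S g \<in> Obj S"
    using g by simp
  note px = pull_obj[OF f(1) x] and py = pull_obj[OF f'(1) y]
  note cx = Clv[OF f(1) x] and cy = Clv[OF f'(1) y]
  have cgx: "Clv E g (pull_obj E f x) \<in> carts g (pull_obj E g (pull_obj E f x)) (pull_obj E f x)"
    and cgy: "Clv E g (pull_obj E f' y) \<in> carts g (pull_obj E g (pull_obj E f' y)) (pull_obj E f' y)"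
    using px py f(2) f'(2) g by (simp_all add: Clv)
  note canx = can[OF f(1) g f(2) x] and cany = can[OF f'(1) g f'(2) y]
  note inv = inv_arr_fibre[OF s canx(1)]
  note pa = pull_arr[OF g a]
  define i where "i = inv_arr (fib E (Dom S g)) (can E f g x)"
  note iA = carts_arrs[OF inv(1), folded i_def]
  note D = cart_typing[OF cx] cart_typing[OF cy] cart_typing[OF cgx]
    cart_typing[OF cgy] cart_typing[OF canx(1)] cart_typing[OF cany(1)]
    typing[OF pa(1)] typing[OF a] typing[OF iA]
  have fg: "Clv E (f \<star> g) x \<in> carts (f \<star> g) (pull_obj E (f \<star> g) x) x"
    "Clv E (f' \<star> g) y \<in> carts (f' \<star> g) (pull_obj E (f' \<star> g) y) y"
    using f f' g x y by (simp_all add: Clv)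
  note D' = cart_typing[OF fg(1)] cart_typing[OF fg(2)]
  have li: "Clv E g (pull_obj E f x) \<bullet> i = l"
  proof (rule cart_cancel[OF cx])
    show "Clv E g (pull_obj E f x) \<bullet> i \<in> arrs g (pull_obj E (f \<star> g) x) (pull_obj E f x)"
      using arrs_comp[OF iA carts_arrs[OF cgx]] g by simp
    show "l \<in> arrs g (pull_obj E (f \<star> g) x) (pull_obj E f x)"
      by (rule l)
    have "Clv E f x \<bullet> Clv E g (pull_obj E f x) \<bullet> i = Clv E (f \<star> g) x \<bullet> can E f g x \<bullet> i"
      using chain[OF canx(2)[symmetric], of i]
      by (simp add: D D')
    also have "\<dots> = Clv E (f \<star> g) x"
      using inv(3) by (simp add: i_def D')
    finally show "Clv E f x \<bullet> Clv E g (pull_obj E f x) \<bullet> i = Clv E f x \<bullet> l"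
      by (simp add: l(2))
  qed
  have r: "restr E f x f' y g a = can E f' g y \<bullet> pull_arr E g a \<bullet> i"
    unfolding restr_def i_def[symmetric] by (simp add: D)
  show "restr E f x f' y g a \<in> varrs (Dom S g) (pull_obj E (f \<star> g) x) (pull_obj E (f' \<star> g) y)"
    unfolding r using arrs_comp[OF arrs_comp[OF iA pa(1)] carts_arrs[OF cany(1)]] s by simp
  have "Clv E (f' \<star> g) y \<bullet> restr E f x f' y g a = Clv E f' y \<bullet> Clv E g (pull_obj E f' y) \<bullet> pull_arr E g a \<bullet> i"
    unfolding r using chain[OF cany(2), of "pull_arr E g a \<bullet> i"] by (simp add: D D')
  also have "\<dots> = Clv E f' y \<bullet> a \<bullet> Clv E g (pull_obj E f x) \<bullet> i"
    using chain[OF pa(2), of i] by (simp add: D)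
  finally show "Clv E (f' \<star> g) y \<bullet> restr E f x f' y g a = Clv E f' y \<bullet> a \<bullet> l"
    by (simp add: li)
qed

lemma restr_cart:
  assumes g: "g \<in> Arr S" and f: "f \<in> Arr S" "Dom S f = Cod S g" and f': "f' \<in> Arr S" "Dom S f' = Cod S g"
    and x: "x \<in> Obj X" "fobj \<pi> x = Cod S f" and y: "y \<in> Obj X" "fobj \<pi> y = Cod S f'"
    and a: "a \<in> isos (Cod S g) (pull_obj E f x) (pull_obj E f' y)"
  obtains l where "l \<in> carts g (pull_obj E (f \<star> g) x) (pull_obj E f x)" "Clv E f x \<bullet> l = Clv E (f \<star> g) x"
    "restr E f x f' y g a \<in> isos (Dom S g) (pull_obj E (f \<star> g) x) (pull_obj E (f' \<star> g) y)"
    "Clv E (f' \<star> g) y \<bullet> restr E f x f' y g a = Clv E f' y \<bullet> a \<bullet> l"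
proof -
  note cx = Clv[OF f(1) x] and cy = Clv[OF f'(1) y]
  have fg: "Clv E (f \<star> g) x \<in> carts (f \<star> g) (pull_obj E (f \<star> g) x) x"
    "Clv E (f' \<star> g) y \<in> carts (f' \<star> g) (pull_obj E (f' \<star> g) y) y"
    using f f' g x y by (simp_all add: Clv)
  have p: "fobj \<pi> (pull_obj E (f \<star> g) x) = Dom S g" "fobj \<pi> (pull_obj E f x) = Cod S g"
    using f g x by (simp_all add: pull_obj)
  obtain l where l: "l \<in> arrs g (pull_obj E (f \<star> g) x) (pull_obj E f x)" "Clv E f x \<bullet> l = Clv E (f \<star> g) x"
    using cart_factor[OF cx carts_arrs[OF fg(1)] g] p by auto
  have lc: "l \<in> carts g (pull_obj E (f \<star> g) x) (pull_obj E f x)"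
    by (rule carts_right_factor[OF l(1) cx, where k = "f \<star> g"]) (simp add: l fg)
  note r = restr[OF g f f' x y carts_arrs[OF a] l]
  have "Clv E f' y \<bullet> a \<bullet> l \<in> carts (f' \<star> Ident S (Cod S g) \<star> g) (pull_obj E (f \<star> g) x) y"
    using carts_comp[OF carts_comp[OF lc a] cy] .
  then have "restr E f x f' y g a \<in> isos (Dom S g) (pull_obj E (f \<star> g) x) (pull_obj E (f' \<star> g) y)"
    by (intro carts_right_factor[OF r(1) fg(2), where k = "f' \<star> Ident S (Cod S g) \<star> g"]) (simp add: r(2))
  with that lc l r show thesis by blast
qed

end

section \<open>Descent data as spans\<close>

locale covered_cloven_fibration = cloven_fibration E
  for E :: "('s, 'f, 'x, 'a, 'z) cloven_scheme" +
  fixes s :: 's and \<U> :: "'f set"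
  assumes is_covering: "covering S s \<U>"
begin

sublocale covered_fibration "Base E" "Tot E" "Proj E" s \<U>
  by unfold_locales (rule is_covering)

abbreviation p1 where "p1 u v \<equiv> pr1 S u v"
abbreviation p2 where "p2 u v \<equiv> pr2 S u v"

text \<open>
  The span attached to an isomorphism \<open>\<phi> (u, v) : p\<^sub>1\<^sup>* (x u) \<rightarrow> p\<^sub>2\<^sup>* (x v)\<close>.
\<close>

abbreviation leg1 where "leg1 x u v \<equiv> Clv E (p1 u v) (x u)"
abbreviation leg2 where "leg2 x \<phi> u v \<equiv> Clv E (p2 u v) (x v) \<bullet> \<phi> (u, v)"

lemma leg1:
  assumes "u \<in> \<U>" "v \<in> \<U>" "x u \<in> Obj X" "fobj \<pi> (x u) = Dom S u"
  shows "leg1 x u v \<in> carts (p1 u v) (pull_obj E (p1 u v) (x u)) (x u)"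
  using overlap[OF assms(1,2)] assms(3,4) by (simp add: Clv)

lemma legs_span:
  assumes uv: "u \<in> \<U>" "v \<in> \<U>" and x: "x u \<in> Obj X" "fobj \<pi> (x u) = Dom S u" "x v \<in> Obj X" "fobj \<pi> (x v) = Dom S v"
    and \<phi>: "\<phi> (u, v) \<in> isos (Dom S (p1 u v)) (pull_obj E (p1 u v) (x u)) (pull_obj E (p2 u v) (x v))"
  shows "span_over u v (x u) (x v) (leg1 x u v) (leg2 x \<phi> u v)"
proof -
  note o = overlap[OF uv]
  have c2: "Clv E (p2 u v) (x v) \<in> carts (p2 u v) (pull_obj E (p2 u v) (x v)) (x v)"
    by (rule Clv) (simp_all add: o x)
  have "leg2 x \<phi> u v \<in> carts (p2 u v \<star> Ident S (Dom S (p1 u v))) (pull_obj E (p1 u v) (x u)) (x v)"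
    by (rule carts_comp[OF \<phi> c2])
  moreover have "p2 u v \<star> Ident S (Dom S (p1 u v)) = p2 u v"
    using o by simp
  ultimately show ?thesis
    using leg1[where x = x, OF uv x(1,2)] cartsD(2)[OF leg1[where x = x, OF uv x(1,2)]] by (simp add: span_over_def)
qed

text \<open>
  The restriction of \<open>\<phi> (u, v)\<close> to \<open>(g1, g2)\<close> relates the chosen lifts of \<open>g1\<close> and \<open>g2\<close> in exactly the way in
  which the span of \<open>\<phi> (u, v)\<close> does. This turns the cocycle condition into a statement about spans.
\<close>

abbreviation transition where
  "transition x \<phi> u v g1 g2 \<equiv>
     restr E (p1 u v) (x u) (p2 u v) (x v) (fpair S u v g1 g2) (\<phi> (u, v))"

lemma transition:
  assumes uv: "u \<in> \<U>" "v \<in> \<U>" and x: "x u \<in> Obj X" "fobj \<pi> (x u) = Dom S u" "x v \<in> Obj X" "fobj \<pi> (x v) = Dom S v"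
    and \<phi>: "\<phi> (u, v) \<in> isos (Dom S (p1 u v)) (pull_obj E (p1 u v) (x u)) (pull_obj E (p2 u v) (x v))"
    and g: "g1 \<in> Arr S" "g2 \<in> Arr S" "Dom S g1 = Dom S g2" "Cod S g1 = Dom S u" "Cod S g2 = Dom S v" "u \<star> g1 = v \<star> g2"
  shows "transition x \<phi> u v g1 g2 \<in> isos (Dom S g1) (pull_obj E g1 (x u)) (pull_obj E g2 (x v))"
    "factors (leg1 x u v) (leg2 x \<phi> u v) (Clv E g1 (x u)) (Clv E g2 (x v) \<bullet> transition x \<phi> u v g1 g2)"
proof -
  note o = overlap[OF uv]
  note c1 = leg1[where x = x, OF uv x(1,2)]
  have c2: "Clv E (p2 u v) (x v) \<in> carts (p2 u v) (pull_obj E (p2 u v) (x v)) (x v)"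
    by (rule Clv) (simp_all add: o x)
  define h where "h = fpair S u v g1 g2"
  note h = fpair[OF uv g, folded h_def]
  obtain l where l: "l \<in> carts h (pull_obj E g1 (x u)) (pull_obj E (p1 u v) (x u))" "leg1 x u v \<bullet> l = Clv E g1 (x u)"
    and R: "restr E (p1 u v) (x u) (p2 u v) (x v) h (\<phi> (u, v)) \<in>
        isos (Dom S g1) (pull_obj E g1 (x u)) (pull_obj E g2 (x v))"
      "Clv E g2 (x v) \<bullet> restr E (p1 u v) (x u) (p2 u v) (x v) h (\<phi> (u, v)) = Clv E (p2 u v) (x v) \<bullet> \<phi> (u, v) \<bullet> l"
    using restr_cart[of h "p1 u v" "p2 u v" "x u" "x v" "\<phi> (u, v)"] \<phi>
    by (simp add: h o x) blast
  show "transition x \<phi> u v g1 g2 \<in> isos (Dom S g1) (pull_obj E g1 (x u)) (pull_obj E g2 (x v))"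
    using R(1) by (simp add: h_def)
  note lD = cartsD[OF l(1)]
  have "leg2 x \<phi> u v \<bullet> l = Clv E g2 (x v) \<bullet> transition x \<phi> u v g1 g2"
    using R(2) by (simp add: h_def cart_typing[OF c2] cart_typing[OF \<phi>] lD(1-3))
  then show "factors (leg1 x u v) (leg2 x \<phi> u v) (Clv E g1 (x u)) (Clv E g2 (x v) \<bullet> transition x \<phi> u v g1 g2)"
    unfolding factors_def using l(2) lD(1,3) cartsD(2)[OF c1] by auto
qed

text \<open>
A descent datum without the cocycle condition.
\<close>

definition predatum :: "('f \<Rightarrow> 'x) \<Rightarrow> ('f \<times> 'f \<Rightarrow> 'a) \<Rightarrow> bool" where
  "predatum x \<phi> \<longleftrightarrow> x \<in> extensional \<U> \<and> \<phi> \<in> extensional (\<U> \<times> \<U>) \<and>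
     (\<forall>u\<in>\<U>. x u \<in> Obj X \<and> fobj \<pi> (x u) = Dom S u) \<and>
     (\<forall>u\<in>\<U>. \<forall>v\<in>\<U>. \<phi> (u, v) \<in> isos (Dom S (p1 u v)) (pull_obj E (p1 u v) (x u)) (pull_obj E (p2 u v) (x v)))"

lemma predatumD:
  assumes "predatum x \<phi>"
  shows "u \<in> \<U> \<Longrightarrow> x u \<in> Obj X" "u \<in> \<U> \<Longrightarrow> fobj \<pi> (x u) = Dom S u"
    "u \<in> \<U> \<Longrightarrow> v \<in> \<U> \<Longrightarrow>
       \<phi> (u, v) \<in> isos (Dom S (p1 u v)) (pull_obj E (p1 u v) (x u)) (pull_obj E (p2 u v) (x v))"
    "u \<in> \<U> \<Longrightarrow> v \<in> \<U> \<Longrightarrow> span_over u v (x u) (x v) (leg1 x u v) (leg2 x \<phi> u v)"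
    "u \<in> \<U> \<Longrightarrow> v \<in> \<U> \<Longrightarrow> Clv E (p2 u v) (x v) \<in> carts (p2 u v) (pull_obj E (p2 u v) (x v)) (x v)"
    "u \<in> \<U> \<Longrightarrow> v \<in> \<U> \<Longrightarrow> leg1 x u v \<in> carts (p1 u v) (pull_obj E (p1 u v) (x u)) (x u)"
proof -
  show 1: "u \<in> \<U> \<Longrightarrow> x u \<in> Obj X" "u \<in> \<U> \<Longrightarrow> fobj \<pi> (x u) = Dom S u"
    "u \<in> \<U> \<Longrightarrow> v \<in> \<U> \<Longrightarrow>
       \<phi> (u, v) \<in> isos (Dom S (p1 u v)) (pull_obj E (p1 u v) (x u)) (pull_obj E (p2 u v) (x v))" for u v
    using assms unfolding predatum_def by blast+
  show "u \<in> \<U> \<Longrightarrow> v \<in> \<U> \<Longrightarrow> span_over u v (x u) (x v) (leg1 x u v) (leg2 x \<phi> u v)"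
    by (rule legs_span[where x = x and \<phi> = \<phi>]) (simp_all add: 1)
  show "u \<in> \<U> \<Longrightarrow> v \<in> \<U> \<Longrightarrow> Clv E (p2 u v) (x v) \<in> carts (p2 u v) (pull_obj E (p2 u v) (x v)) (x v)"
    by (rule Clv) (simp_all add: overlap 1)
  show "u \<in> \<U> \<Longrightarrow> v \<in> \<U> \<Longrightarrow> leg1 x u v \<in> carts (p1 u v) (pull_obj E (p1 u v) (x u)) (x u)"
    by (rule leg1[where x = x]) (simp_all add: 1)
qed

lemma descent_datum_iff_transitions:
  "descent_datum E \<U> x \<phi> \<longleftrightarrow> predatum x \<phi> \<and>
     (\<forall>u\<in>\<U>. \<forall>v\<in>\<U>. \<forall>w\<in>\<U>. case fprod3 S u v w of (q1, q2, q3) \<Rightarrow>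
        transition x \<phi> u w q1 q3 = transition x \<phi> v w q2 q3 \<bullet> transition x \<phi> u v q1 q2)"
proof -
  have iso: "(\<phi> (u, v) \<in> Hom (fib E (Dom S (p1 u v))) (pull_obj E (p1 u v) (x u)) (pull_obj E (p2 u v) (x v)) \<and>
      is_iso (fib E (Dom S (p1 u v))) (\<phi> (u, v))) \<longleftrightarrow>
     \<phi> (u, v) \<in> isos (Dom S (p1 u v)) (pull_obj E (p1 u v) (x u)) (pull_obj E (p2 u v) (x v))"
    if "u \<in> \<U>" "v \<in> \<U>" for u v
  proof -
    have s: "Dom S (p1 u v) \<in> Obj S"
      using overlap[OF that] by simp
    show ?thesis
      unfolding Hom_fibre[OF s] using is_iso_fibre[OF s] carts_arrs by blast
  qed
  have ob: "x u \<in> Obj (fib E (Dom S u)) \<longleftrightarrow> x u \<in> Obj X \<and> fobj \<pi> (x u) = Dom S u" for u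
    by simp
  show ?thesis
    unfolding descent_datum_def predatum_def Let_def ob
    by (simp add: iso case_prod_unfold conj_assoc cong: conj_cong ball_cong)
qed

text \<open>
  Everything that the proof of the next equivalence uses about the three restrictions of \<open>\<phi>\<close> to a triple
  fibre product: their types, and the pairs identified by the three spans.
\<close>

lemma triple_transitions:
  assumes x: "predatum x \<phi>" and uvw: "u \<in> \<U>" "v \<in> \<U>" "w \<in> \<U>" and q: "fprod3 S u v w = (q1, q2, q3)"
  shows "q1 \<in> Arr S" "q2 \<in> Arr S" "q3 \<in> Arr S" "Dom S q2 = Dom S q1" "Dom S q3 = Dom S q1"
    "Cod S q1 = Dom S u" "Cod S q2 = Dom S v" "Cod S q3 = Dom S w"
    "transition x \<phi> u v q1 q2 \<in> isos (Dom S q1) (pull_obj E q1 (x u)) (pull_obj E q2 (x v))"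
    "transition x \<phi> v w q2 q3 \<in> isos (Dom S q1) (pull_obj E q2 (x v)) (pull_obj E q3 (x w))"
    "transition x \<phi> u w q1 q3 \<in> isos (Dom S q1) (pull_obj E q1 (x u)) (pull_obj E q3 (x w))"
    "factors (leg1 x u v) (leg2 x \<phi> u v) (Clv E q1 (x u)) (Clv E q2 (x v) \<bullet> transition x \<phi> u v q1 q2)"
    "factors (leg1 x v w) (leg2 x \<phi> v w) (Clv E q2 (x v) \<bullet> transition x \<phi> u v q1 q2)
       (Clv E q3 (x w) \<bullet> transition x \<phi> v w q2 q3 \<bullet> transition x \<phi> u v q1 q2)"
    "factors (leg1 x u w) (leg2 x \<phi> u w) (Clv E q1 (x u)) (Clv E q3 (x w) \<bullet> transition x \<phi> u w q1 q3)"
    "Clv E q1 (x u) \<in> carts q1 (pull_obj E q1 (x u)) (x u)"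
    "Clv E q2 (x v) \<in> carts q2 (pull_obj E q2 (x v)) (x v)"
    "Clv E q3 (x w) \<in> carts q3 (pull_obj E q3 (x w)) (x w)"
proof -
  show Q: "q1 \<in> Arr S" "q2 \<in> Arr S" "q3 \<in> Arr S" "Dom S q2 = Dom S q1" "Dom S q3 = Dom S q1"
    "Cod S q1 = Dom S u" "Cod S q2 = Dom S v" "Cod S q3 = Dom S w"
    by (fact triple[OF uvw q])+
  note Q' = triple(9,10)[OF uvw q]
  note X = predatumD[OF x]
  have "Dom S q1 = Dom S q2" "Dom S q2 = Dom S q3" "Dom S q1 = Dom S q3" "u \<star> q1 = w \<star> q3"
    using Q Q' by simp_all
  note T = transition[where x = x and \<phi> = \<phi>]
  show t1: "transition x \<phi> u v q1 q2 \<in> isos (Dom S q1) (pull_obj E q1 (x u)) (pull_obj E q2 (x v))"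
    and "factors (leg1 x u v) (leg2 x \<phi> u v) (Clv E q1 (x u)) (Clv E q2 (x v) \<bullet> transition x \<phi> u v q1 q2)"
    by (rule T; simp add: X uvw Q Q')+
  show t2: "transition x \<phi> v w q2 q3 \<in> isos (Dom S q1) (pull_obj E q2 (x v)) (pull_obj E q3 (x w))"
    using T(1)[OF uvw(2,3), of q2 q3] by (simp add: X uvw Q Q')
  have f2: "factors (leg1 x v w) (leg2 x \<phi> v w) (Clv E q2 (x v)) (Clv E q3 (x w) \<bullet> transition x \<phi> v w q2 q3)"
    by (rule T; simp add: X uvw Q Q')
  show t3: "transition x \<phi> u w q1 q3 \<in> isos (Dom S q1) (pull_obj E q1 (x u)) (pull_obj E q3 (x w))"
    and "factors (leg1 x u w) (leg2 x \<phi> u w) (Clv E q1 (x u)) (Clv E q3 (x w) \<bullet> transition x \<phi> u w q1 q3)"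
    by (rule T; simp add: X uvw Q Q')+
  show "Clv E q1 (x u) \<in> carts q1 (pull_obj E q1 (x u)) (x u)"
    and c2: "Clv E q2 (x v) \<in> carts q2 (pull_obj E q2 (x v)) (x v)"
    and c3: "Clv E q3 (x w) \<in> carts q3 (pull_obj E q3 (x w)) (x w)"
    by (rule Clv; simp add: X uvw Q)+
  note D = cart_typing[OF t1] cart_typing[OF t2] cart_typing[OF c2]
    cart_typing[OF c3]
  note sp = span_overD[OF X(4)[OF uvw(2,3)]]
  show "factors (leg1 x v w) (leg2 x \<phi> v w) (Clv E q2 (x v) \<bullet> transition x \<phi> u v q1 q2)
       (Clv E q3 (x w) \<bullet> transition x \<phi> v w q2 q3 \<bullet> transition x \<phi> u v q1 q2)"
    using factors_comp[OF f2 sp(3,4) sp(5)[symmetric] D(1)] by (simp add: D)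
qed

text \<open>
  For the restrictions of \<open>\<phi>\<close>, the triple consisting of the chosen lift of \<open>q1\<close> and its images under the
  transitions witnesses the cocycle condition for spans. Conversely every witnessing triple is
  isomorphic to one that starts with the chosen lift of \<open>q1\<close>; its other members are then forced by
  \<open>factors_unique\<close>, which gives the equation between the transitions.
\<close>

lemma descent_datum_iff_cocycle:
  "descent_datum E \<U> x \<phi> \<longleftrightarrow> predatum x \<phi> \<and> cocycle x (leg1 x) (leg2 x \<phi>)"
proof -
  have eq: "(case fprod3 S u v w of (q1, q2, q3) \<Rightarrow>
        transition x \<phi> u w q1 q3 = transition x \<phi> v w q2 q3 \<bullet> transition x \<phi> u v q1 q2) \<longleftrightarrow>
      (case fprod3 S u v w of (q1, q2, q3) \<Rightarrow>
        \<exists>z \<alpha> \<beta> \<gamma>. \<alpha> \<in> carts q1 z (x u) \<and> \<beta> \<in> carts q2 z (x v) \<and> \<gamma> \<in> carts q3 z (x w) \<and>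
         factors (leg1 x u v) (leg2 x \<phi> u v) \<alpha> \<beta> \<and> factors (leg1 x v w) (leg2 x \<phi> v w) \<beta> \<gamma> \<and>
         factors (leg1 x u w) (leg2 x \<phi> u w) \<alpha> \<gamma>)" (is "?L \<longleftrightarrow> ?R")
    if x: "predatum x \<phi>" and uvw: "u \<in> \<U>" "v \<in> \<U>" "w \<in> \<U>" for u v w
  proof -
    obtain q1 q2 q3 where q: "fprod3 S u v w = (q1, q2, q3)"
      by (metis prod_cases3)
    note X = predatumD[OF x]
    note T = triple_transitions[OF x uvw q]
    let ?t1 = "transition x \<phi> u v q1 q2" and ?t2 = "transition x \<phi> v w q2 q3" and ?t3 = "transition x \<phi> u w q1 q3"
    note D = cartsD(1-4)[OF T(9)] cartsD(1-4)[OF T(10)] cartsD(1-4)[OF T(11)]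
      cartsD(1-4)[OF T(15)] cartsD(1-4)[OF T(16)] cartsD(1-4)[OF T(17)]
    show ?thesis
    proof
      assume ?L
      then have eq: "?t3 = ?t2 \<bullet> ?t1"
        by (simp add: q)
      have "Clv E q2 (x v) \<bullet> ?t1 \<in> carts (q2 \<star> Ident S (Dom S q1)) (pull_obj E q1 (x u)) (x v)"
        by (rule carts_comp[OF T(9) T(16)])
      moreover have "Clv E q3 (x w) \<bullet> ?t3 \<in> carts (q3 \<star> Ident S (Dom S q1)) (pull_obj E q1 (x u)) (x w)"
        by (rule carts_comp[OF T(11) T(17)])
      ultimately show ?R
        using T(12,13,14,15) T(2-5) unfolding q eq by auto
    next
      assume ?R
      then obtain z \<alpha> \<beta> \<gamma> where A: "\<alpha> \<in> carts q1 z (x u)" "\<beta> \<in> carts q2 z (x v)" "\<gamma> \<in> carts q3 z (x w)"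
        and F: "factors (leg1 x u v) (leg2 x \<phi> u v) \<alpha> \<beta>" "factors (leg1 x v w) (leg2 x \<phi> v w) \<beta> \<gamma>"
          "factors (leg1 x u w) (leg2 x \<phi> u w) \<alpha> \<gamma>"
        by (auto simp: q)
      note AD = cartsD[OF A(1)] and BD = cartsD[OF A(2)] and CD = cartsD[OF A(3)]
      have s: "Dom S q1 \<in> Obj S"
        using T(1) by simp
      obtain i where i: "i \<in> varrs (Dom S q1) (pull_obj E q1 (x u)) z" "\<alpha> \<bullet> i = Clv E q1 (x u)"
        using cart_factor[OF A(1) carts_arrs[OF T(15)], of "Ident S (Dom S q1)"] s T(1) AD(8)
          vertD(7)[OF carts_arrs[OF T(9)] s] by auto
      note iD = vertD[OF i(1) s]
      have FI: "factors (leg1 x u v) (leg2 x \<phi> u v) (Clv E q1 (x u)) (\<beta> \<bullet> i)"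
        "factors (leg1 x v w) (leg2 x \<phi> v w) (\<beta> \<bullet> i) (\<gamma> \<bullet> i)"
        "factors (leg1 x u w) (leg2 x \<phi> u w) (Clv E q1 (x u)) (\<gamma> \<bullet> i)"
        using factors_comp[OF F(1) span_overD(3,4)[OF X(4)[OF uvw(1,2)]] span_overD(5)[OF X(4)[OF uvw(1,2)], symmetric] iD(1)]
          factors_comp[OF F(2) span_overD(3,4)[OF X(4)[OF uvw(2,3)]] span_overD(5)[OF X(4)[OF uvw(2,3)], symmetric] iD(1)]
          factors_comp[OF F(3) span_overD(3,4)[OF X(4)[OF uvw(1,3)]] span_overD(5)[OF X(4)[OF uvw(1,3)], symmetric] iD(1)]
        by (simp_all add: iD(3) AD(2) BD(2) i(2))
      have b: "\<beta> \<bullet> i = Clv E q2 (x v) \<bullet> ?t1"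
        by (rule factors_unique[OF uvw(1,2) X(4)[OF uvw(1,2)] FI(1) T(12)]) (simp add: BD(1-4) iD(1-4) D)
      have c: "\<gamma> \<bullet> i = Clv E q3 (x w) \<bullet> ?t3"
        by (rule factors_unique[OF uvw(1,3) X(4)[OF uvw(1,3)] FI(3) T(14)]) (simp add: CD(1-4) iD(1-4) D)
      have "\<gamma> \<bullet> i = Clv E q3 (x w) \<bullet> ?t2 \<bullet> ?t1"
        by (rule factors_unique[OF uvw(2,3) X(4)[OF uvw(2,3)] FI(2)[unfolded b] T(13)])
          (use s T(3,5) in \<open>simp add: CD(1-4) iD(1-4) D\<close>)
      with c have "Clv E q3 (x w) \<bullet> ?t3 = Clv E q3 (x w) \<bullet> ?t2 \<bullet> ?t1"
        by simp
      then have "?t3 = ?t2 \<bullet> ?t1"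
        by (rule cart_cancel[OF T(17) carts_arrs[OF T(11)], rotated])
          (use arrs_comp[OF carts_arrs[OF T(9)] carts_arrs[OF T(10)]] s in simp)
      then show ?L
        by (simp add: q)
    qed
  qed
  show ?thesis
    unfolding descent_datum_iff_transitions cocycle_def
    by (intro conj_cong refl ball_cong) (rule eq; assumption)
qed

lemma can2:
  assumes uv: "u \<in> \<U>" "v \<in> \<U>" and x: "x \<in> Obj X" "fobj \<pi> x = s"
  shows "can2 E u v x \<in> isos (Dom S (p1 u v)) (pull_obj E (p1 u v) (pull_obj E u x)) (pull_obj E (p2 u v) (pull_obj E v x))"
    "Clv E v x \<bullet> Clv E (p2 u v) (pull_obj E v x) \<bullet> can2 E u v x = Clv E u x \<bullet> Clv E (p1 u v) (pull_obj E u x)"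
proof -
  note o = overlap[OF uv]
  note mu = member[OF uv(1)] and mv = member[OF uv(2)]
  have s': "Dom S (p1 u v) \<in> Obj S"
    using o by simp
  note px = pull_obj[OF mu(1) x(1)] pull_obj[OF mv(1) x(1)]
  have c1: "Clv E u x \<in> carts u (pull_obj E u x) x" and c2: "Clv E v x \<in> carts v (pull_obj E v x) x"
    and d1: "Clv E (p1 u v) (pull_obj E u x) \<in> carts (p1 u v) (pull_obj E (p1 u v) (pull_obj E u x)) (pull_obj E u x)"
    and d2: "Clv E (p2 u v) (pull_obj E v x) \<in> carts (p2 u v) (pull_obj E (p2 u v) (pull_obj E v x)) (pull_obj E v x)"
    by (rule Clv; simp add: mu mv x o px)+
  have k: "can E u (p1 u v) x \<in> isos (Dom S (p1 u v)) (pull_obj E (p1 u v) (pull_obj E u x)) (pull_obj E (u \<star> p1 u v) x)"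
     "Clv E (u \<star> p1 u v) x \<bullet> can E u (p1 u v) x = Clv E u x \<bullet> Clv E (p1 u v) (pull_obj E u x)"
    by (rule can; simp add: mu o x)+
  have l: "can E v (p2 u v) x \<in> isos (Dom S (p2 u v)) (pull_obj E (p2 u v) (pull_obj E v x)) (pull_obj E (v \<star> p2 u v) x)"
     "Clv E (v \<star> p2 u v) x \<bullet> can E v (p2 u v) x = Clv E v x \<bullet> Clv E (p2 u v) (pull_obj E v x)"
    by (rule can; simp add: mv o x)+
  define w where "w = v \<star> p2 u v"
  define i where "i = inv_arr (fib E (Dom S (p2 u v))) (can E v (p2 u v) x)"
  note K = k[unfolded o(6), folded w_def] and L = l[unfolded o(3), folded w_def]
  note I = inv_arr_fibre[OF s' L(1), folded i_def[unfolded o(3)]]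
  have cw: "Clv E w x \<in> carts w (pull_obj E w x) x"
    by (rule Clv) (simp_all add: w_def mv o x)
  have e: "can2 E u v x = i \<bullet> can E u (p1 u v) x"
    by (simp add: can2_def Let_def i_def)
  show "can2 E u v x \<in> isos (Dom S (p1 u v)) (pull_obj E (p1 u v) (pull_obj E u x)) (pull_obj E (p2 u v) (pull_obj E v x))"
    using carts_comp[OF K(1) I(1)] s' unfolding e by simp
  note D = cart_typing[OF c2] cart_typing[OF d2] cart_typing[OF K(1)]
    cart_typing[OF L(1)] cart_typing[OF I(1)] cart_typing[OF cw]
  have "Clv E v x \<bullet> Clv E (p2 u v) (pull_obj E v x) \<bullet> can2 E u v x = Clv E w x \<bullet> can E v (p2 u v) x \<bullet> i \<bullet> can E u (p1 u v) x"
    unfolding e using chain[OF L(2), of "i \<bullet> can E u (p1 u v) x"] by (simp add: D)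
  also have "\<dots> = Clv E w x \<bullet> can E u (p1 u v) x"
    using chain[OF I(3), of "can E u (p1 u v) x"] cartsD(6)[OF K(1)] by (simp add: D)
  finally show "Clv E v x \<bullet> Clv E (p2 u v) (pull_obj E v x) \<bullet> can2 E u v x = Clv E u x \<bullet> Clv E (p1 u v) (pull_obj E u x)"
    by (simp add: K(2))
qed

text \<open>
  An object over the base from which the datum arises by restriction. A datum is effective iff it has
  a cone.
\<close>

definition cone :: "('f \<Rightarrow> 'x) \<Rightarrow> ('f \<times> 'f \<Rightarrow> 'a) \<Rightarrow> 'x \<Rightarrow> ('f \<Rightarrow> 'a) \<Rightarrow> bool" where
  "cone x \<phi> y c \<longleftrightarrow> (\<forall>u\<in>\<U>. c u \<in> carts u (x u) y) \<and>
     (\<forall>u\<in>\<U>. \<forall>v\<in>\<U>. c u \<bullet> leg1 x u v = c v \<bullet> leg2 x \<phi> u v)"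

lemma descent_datum_of_cone:
  assumes "predatum x \<phi>" "cone x \<phi> y c"
  shows "descent_datum E \<U> x \<phi>"
  using assms cocycle_of_cone[of x "leg1 x" "leg2 x \<phi>" c y] predatumD(4)[OF assms(1)]
  unfolding descent_datum_iff_cocycle cone_def by blast

lemma delta_cone:
  assumes x: "x \<in> Obj X" "fobj \<pi> x = s"
  shows "predatum (fst (delta_obj E \<U> x)) (snd (delta_obj E \<U> x))"
    "cone (fst (delta_obj E \<U> x)) (snd (delta_obj E \<U> x)) x (\<lambda>u. Clv E u x)"
    "descent_datum E \<U> (fst (delta_obj E \<U> x)) (snd (delta_obj E \<U> x))"
proof -
  have m: "u \<in> Arr S" "Cod S u = fobj \<pi> x" if "u \<in> \<U>" for u
    using member[OF that] x by simp_all
  show p: "predatum (fst (delta_obj E \<U> x)) (snd (delta_obj E \<U> x))"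
    unfolding predatum_def by (auto simp: delta_obj_def pull_obj m x can2)
  show "cone (fst (delta_obj E \<U> x)) (snd (delta_obj E \<U> x)) x (\<lambda>u. Clv E u x)"
    unfolding cone_def by (simp add: delta_obj_def m x Clv can2)
  with p show "descent_datum E \<U> (fst (delta_obj E \<U> x)) (snd (delta_obj E \<U> x))"
    by (rule descent_datum_of_cone)
qed

text \<open>
  Composing with the cartesian arrow over \<open>p\<^sub>2\<close> turns the compatibility of a morphism of descent data with
  \<open>\<phi>\<close> into its compatibility with the legs of the spans.
\<close>

lemma descent_morphism_iff:
  assumes D: "predatum (fst D) (snd D)" and D': "predatum (fst D') (snd D')"
  shows "descent_morphism E \<U> D D' m \<longleftrightarrow> m \<in> extensional \<U> \<and>
     (\<forall>u\<in>\<U>. m u \<in> varrs (Dom S u) (fst D u) (fst D' u)) \<and>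
     (\<forall>u\<in>\<U>. \<forall>v\<in>\<U>. leg2 (fst D') (snd D') u v \<bullet> pull_arr E (p1 u v) (m u) = m v \<bullet> leg2 (fst D) (snd D) u v)"
proof -
  have hom: "m u \<in> Hom (fib E (Dom S u)) (fst D u) (fst D' u) \<longleftrightarrow> m u \<in> varrs (Dom S u) (fst D u) (fst D' u)"
    if "u \<in> \<U>" for u
    using Hom_fibre[of "Dom S u"] member[OF that] by simp
  have "snd D' (u, v) \<bullet> pull_arr E (p1 u v) (m u) = pull_arr E (p2 u v) (m v) \<bullet> snd D (u, v) \<longleftrightarrow>
        leg2 (fst D') (snd D') u v \<bullet> pull_arr E (p1 u v) (m u) = m v \<bullet> leg2 (fst D) (snd D) u v"
    if m: "\<And>u. u \<in> \<U> \<Longrightarrow> m u \<in> varrs (Dom S u) (fst D u) (fst D' u)" and uv: "u \<in> \<U>" "v \<in> \<U>" for u v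
  proof -
    note o = overlap[OF uv]
    note A = predatumD[OF D] and B = predatumD[OF D']
    have mu: "m u \<in> varrs (Cod S (p1 u v)) (fst D u) (fst D' u)"
      and mv: "m v \<in> varrs (Cod S (p2 u v)) (fst D v) (fst D' v)"
      using m uv o by simp_all
    note pu = pull_arr[OF o(1) mu] and pv = pull_arr[OF o(2) mv]
    have s': "Dom S (p1 u v) \<in> Obj S"
      using o by simp
    note T = cart_typing[OF A(5)[OF uv]] cart_typing[OF B(5)[OF uv]]
      cart_typing[OF A(3)[OF uv]] cart_typing[OF B(3)[OF uv]]
      typing[OF pu(1)] typing[OF pv(1)] typing[OF mv]
    have pv': "pull_arr E (p2 u v) (m v) \<in> varrs (Dom S (p1 u v)) (pull_obj E (p2 u v) (fst D v)) (pull_obj E (p2 u v) (fst D' v))"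
      using pv(1) o(3) by simp
    have l: "snd D' (u, v) \<bullet> pull_arr E (p1 u v) (m u) \<in> varrs (Dom S (p1 u v)) (pull_obj E (p1 u v) (fst D u)) (pull_obj E (p2 u v) (fst D' v))"
      using arrs_comp[OF pu(1) carts_arrs[OF B(3)[OF uv]]] s' by simp
    have r: "pull_arr E (p2 u v) (m v) \<bullet> snd D (u, v) \<in> varrs (Dom S (p1 u v)) (pull_obj E (p1 u v) (fst D u)) (pull_obj E (p2 u v) (fst D' v))"
      using arrs_comp[OF carts_arrs[OF A(3)[OF uv]] pv'] s' by simp
    have "snd D' (u, v) \<bullet> pull_arr E (p1 u v) (m u) = pull_arr E (p2 u v) (m v) \<bullet> snd D (u, v) \<longleftrightarrow>
      Clv E (p2 u v) (fst D' v) \<bullet> snd D' (u, v) \<bullet> pull_arr E (p1 u v) (m u) =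
      Clv E (p2 u v) (fst D' v) \<bullet> pull_arr E (p2 u v) (m v) \<bullet> snd D (u, v)"
      using cart_cancel[OF B(5)[OF uv] l r] by metis
    then show ?thesis
      using chain[OF pv(2), of "snd D (u, v)"] by (simp add: T)
  qed
  then show ?thesis
    unfolding descent_morphism_def by (simp add: hom cong: conj_cong)
qed

text \<open>
  Compatibility with the isomorphisms \<open>\<phi>\<close> may be tested after composing with the cone \<open>c'\<close>, whose members
  are cartesian, and there it follows from the equations \<open>c' u \<bullet> m u = c u\<close>.
\<close>

lemma cone_morphism:
  assumes D: "predatum (fst D) (snd D)" and D': "predatum (fst D') (snd D')"
    and c: "cone (fst D) (snd D) y c" and c': "cone (fst D') (snd D') y c'" and m: "m \<in> extensional \<U>"
      "\<And>u. u \<in> \<U> \<Longrightarrow> m u \<in> varrs (Dom S u) (fst D u) (fst D' u)"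
      "\<And>u. u \<in> \<U> \<Longrightarrow> c' u \<bullet> m u = c u"
  shows "descent_morphism E \<U> D D' m"
proof -
  have "leg2 (fst D') (snd D') u v \<bullet> pull_arr E (p1 u v) (m u) = m v \<bullet> leg2 (fst D) (snd D) u v"
    if uv: "u \<in> \<U>" "v \<in> \<U>" for u v
  proof -
    note o = overlap[OF uv]
    note A = predatumD[OF D] and B = predatumD[OF D']
    have mu: "m u \<in> varrs (Cod S (p1 u v)) (fst D u) (fst D' u)"
      using m uv o by simp
    note pu = pull_arr[OF o(1) mu]
    have cu: "c u \<in> carts u (fst D u) y" "c v \<in> carts v (fst D v) y" "c' u \<in> carts u (fst D' u) y" "c' v \<in> carts v (fst D' v) y"
      and ce: "c u \<bullet> leg1 (fst D) u v = c v \<bullet> leg2 (fst D) (snd D) u v"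
         "c' u \<bullet> leg1 (fst D') u v = c' v \<bullet> leg2 (fst D') (snd D') u v"
      using c c' uv unfolding cone_def by blast+
    note SA = span_overD[OF A(4)[OF uv]] and SB = span_overD[OF B(4)[OF uv]]
    note DA = cartsD(2)[OF A(6)[OF uv]] and DB = cartsD(2)[OF B(6)[OF uv]]
    note T = cart_typing[OF cu(1)] cart_typing[OF cu(2)]
      cart_typing[OF cu(3)] cart_typing[OF cu(4)]
      typing[OF m(2)[OF uv(1)]] typing[OF m(2)[OF uv(2)]] typing[OF pu(1)]
    define a where "a = leg1 (fst D) u v"
    define a' where "a' = leg1 (fst D') u v"
    define b where "b = leg2 (fst D) (snd D) u v"
    define b' where "b' = leg2 (fst D') (snd D') u v"
    define p where "p = pull_arr E (p1 u v) (m u)"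
    note F = a_def[symmetric] a'_def[symmetric] b_def[symmetric] b'_def[symmetric] p_def[symmetric]
    note T' = T[unfolded F] SA[unfolded F] SB[unfolded F] DA[unfolded F] DB[unfolded F]
    note ce' = ce[unfolded F] and pu' = pu[unfolded F] and bA = carts_arrs[OF SA(2)[unfolded F]]
      and bB = carts_arrs[OF SB(2)[unfolded F]]
    have "b' \<bullet> p = m v \<bullet> b"
    proof (rule cart_cancel[OF cu(4)])
      show "b' \<bullet> p \<in> arrs (p2 u v) (pull_obj E (p1 u v) (fst D u)) (fst D' v)"
        using arrs_comp[OF pu'(1) bB[unfolded T']] o by simp
      show "m v \<bullet> b \<in> arrs (p2 u v) (pull_obj E (p1 u v) (fst D u)) (fst D' v)"
        using arrs_comp[OF bA m(2)[OF uv(2)]] o by (simp add: T')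
      have "c' v \<bullet> b' \<bullet> p = c' u \<bullet> a' \<bullet> p"
        using chain[OF ce'(2), of p] by (simp add: T')
      also have "\<dots> = c' u \<bullet> m u \<bullet> a"
        by (simp add: pu'(2))
      also have "\<dots> = c u \<bullet> a"
        using chain[OF m(3)[OF uv(1)], of a] by (simp add: T')
      also have "\<dots> = c' v \<bullet> m v \<bullet> b"
        using chain[OF m(3)[OF uv(2)], of b] by (simp add: T' ce')
      finally show "c' v \<bullet> b' \<bullet> p = c' v \<bullet> m v \<bullet> b" .
    qed
    then show ?thesis
      by (simp add: a_def a'_def b_def b'_def p_def)
  qed
  then show ?thesis
    unfolding descent_morphism_iff[OF D D'] using m by blast
qed

lemma Hom_DD:
  "Hom (DD E \<U>) D D' = {(D, D', m) | m. descent_datum E \<U> (fst D) (snd D) \<and> descent_datum E \<U> (fst D') (snd D') \<and>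
     descent_morphism E \<U> D D' m}"
  by (auto simp: Hom_def DD_def)

text \<open>
  Gluing along the spans of a datum gives a cone on it. The comparison of this cone with the cone of
  chosen lifts is a family of isomorphisms in both directions, compatible by \<open>cone_morphism\<close>.
\<close>

lemma effective_of_obj_descent:
  assumes od: obj_descent and D: "D \<in> Obj (DD E \<U>)"
  shows "effective E s \<U> D"
proof -
  obtain x \<phi> where Dx: "D = (x, \<phi>)" by (cases D)
  have dd: "descent_datum E \<U> x \<phi>"
    using D by (simp add: DD_def Dx)
  then have pd: "predatum x \<phi>" and co: "cocycle x (leg1 x) (leg2 x \<phi>)"
    by (simp_all add: descent_datum_iff_cocycle)
  obtain y c where y: "y \<in> Obj X" "fobj \<pi> y = s" and c: "cone x \<phi> y c"
    using od[unfolded obj_descent_def, rule_format, of x "leg1 x" "leg2 x \<phi>"] predatumD(4)[OF pd] co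
    unfolding cone_def by blast
  have cc: "c u \<in> carts u (x u) y" if "u \<in> \<U>" for u
    using c that by (simp add: cone_def)
  note Y = delta_cone[OF y]
  let ?D = "delta_obj E \<U> y"
  have dy: "Clv E u y \<in> carts u (pull_obj E u y) y" if "u \<in> \<U>" for u
    using Y(2) that by (simp add: cone_def delta_obj_def)
  have "\<exists>m. m \<in> varrs (Dom S u) (pull_obj E u y) (x u) \<and> c u \<bullet> m = Clv E u y" if u: "u \<in> \<U>" for u
    using cart_factor[OF cc[OF u] carts_arrs[OF dy[OF u]], of "Ident S (Dom S u)"] member[OF u]
      cartsD(8)[OF cc[OF u]] cartsD(8)[OF dy[OF u]]
      cartsD(10)[OF cc[OF u]] by simp
  then obtain m0 where m0: "\<And>u. u \<in> \<U> \<Longrightarrow> m0 u \<in> varrs (Dom S u) (pull_obj E u y) (x u)"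
    "\<And>u. u \<in> \<U> \<Longrightarrow> c u \<bullet> m0 u = Clv E u y"
    by metis
  have m0c: "m0 u \<in> isos (Dom S u) (pull_obj E u y) (x u)" if "u \<in> \<U>" for u
    by (rule carts_right_factor[OF m0(1) cc, OF that that, where k = u]) (simp add: m0 dy that)
  have "\<exists>n. n \<in> isos (Dom S u) (x u) (pull_obj E u y) \<and> n \<bullet> m0 u = Ident X (pull_obj E u y) \<and> m0 u \<bullet> n = Ident X (x u)"
    if u: "u \<in> \<U>" for u
    using vert_carts_inverse[OF m0c[OF u]] member[OF u] by (metis base_simps(1))
  then obtain n0 where n0: "\<And>u. u \<in> \<U> \<Longrightarrow> n0 u \<in> isos (Dom S u) (x u) (pull_obj E u y)"
    "\<And>u. u \<in> \<U> \<Longrightarrow> n0 u \<bullet> m0 u = Ident X (pull_obj E u y)" "\<And>u. u \<in> \<U> \<Longrightarrow> m0 u \<bullet> n0 u = Ident X (x u)"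
    by metis
  define m where "m = restrict m0 \<U>"
  define n where "n = restrict n0 \<U>"
  have "descent_morphism E \<U> ?D (x, \<phi>) m"
    by (rule cone_morphism[OF Y(1) _ Y(2), where c' = c]) (simp_all add: pd c m_def m0 delta_obj_def)
  then have M: "(?D, D, m) \<in> Hom (DD E \<U>) ?D D"
    using Y(3) dd by (simp add: Hom_DD Dx)
  have cn: "Clv E u y \<bullet> n0 u = c u" if u: "u \<in> \<U>" for u
    using chain[OF m0(2)[OF u], of "n0 u"] n0(3)[OF u] typing[OF m0(1)[OF u]] cart_typing[OF n0(1)[OF u]]
      cart_typing[OF cc[OF u]] by simp
  have "descent_morphism E \<U> (x, \<phi>) ?D n"
    by (rule cone_morphism[OF _ Y(1) _ Y(2), where c = c])
      (simp_all add: pd c n_def n0 cn carts_arrs delta_obj_def)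
  then have N: "(D, ?D, n) \<in> Hom (DD E \<U>) D ?D"
    using Y(3) dd by (simp add: Hom_DD Dx)
  have "inverse_arrows (DD E \<U>) (?D, D, m) (D, ?D, n)"
    using M N n0(2,3) unfolding inverse_arrows_def
    by (auto simp: DD_def Dx m_def n_def Hom_def delta_obj_def restrict_def)
  then have "is_iso (DD E \<U>) (?D, D, m)"
    unfolding is_iso_def by blast
  moreover have "y \<in> Obj (fib E s)" "fobj (delta E \<U>) y = ?D"
    using y by (simp_all add: delta_def)
  ultimately show ?thesis
    unfolding effective_def using M by metis
qed

section \<open>Gluing from the comparison functor with descent data\<close>

text \<open>
  Arrows \<open>x \<rightarrow> y\<close> over \<open>f\<close> are vertical arrows \<open>x \<rightarrow> f\<^sup>* y\<close>, so full faithfulness between fibres also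
  controls arrows over an arbitrary base arrow. After replacing the given \<open>x' u\<close> by the chosen \<open>u\<^sup>* x\<close>
  through the isomorphisms \<open>i u\<close>, a compatible family is the same as a morphism of descent data
  \<open>\<delta> x \<rightarrow> \<delta> (f\<^sup>* y)\<close>.
\<close>

lemma hom_descent_of_fully_faithful:
  assumes ff: "fully_faithful (fib E s) (DD E \<U>) (delta E \<U>)"
  shows hom_descent
  unfolding hom_descent_def
proof (intro allI impI, elim conjE)
  fix x x' c y f h
  assume c: "\<forall>u\<in>\<U>. c u \<in> carts u (x' u) x" and x: "x \<in> Obj X" "fobj \<pi> x = s" and y: "y \<in> Obj X"
    and f: "f \<in> Arr S" "Dom S f = s" "Cod S f = fobj \<pi> y" and h: "\<forall>u\<in>\<U>. h u \<in> arrs (f \<star> u) (x' u) y"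
    and sp: "\<forall>u\<in>\<U>. \<forall>v\<in>\<U>. \<exists>a b. span_over u v (x' u) (x' v) a b \<and> c u \<bullet> a = c v \<bullet> b \<and> h u \<bullet> a = h v \<bullet> b"
  define z where "z = pull_obj E f y"
  define l where "l = Clv E f y"
  have l: "l \<in> carts f z y"
    unfolding l_def z_def by (rule Clv) (simp_all add: f y)
  note lD = cartsD[OF l]
  have z: "z \<in> Obj X" "fobj \<pi> z = s"
    using lD(5,8) f by simp_all
  have cx: "Clv E u x \<in> carts u (pull_obj E u x) x" and cz: "Clv E u z \<in> carts u (pull_obj E u z) z" if "u \<in> \<U>" for u
    using member[OF that] x z by (simp_all add: Clv)
  have lz: "l \<bullet> Clv E u z \<in> carts (f \<star> u) (pull_obj E u z) y" if "u \<in> \<U>" for u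
    by (rule carts_comp[OF cz[OF that] l])
  have iex: "\<exists>i. i \<in> varrs (Dom S u) (pull_obj E u x) (x' u) \<and> c u \<bullet> i = Clv E u x" if u: "u \<in> \<U>" for u
    using cart_factor[OF c[rule_format, OF u] carts_arrs[OF cx[OF u]], of "Ident S (Dom S u)"] member[OF u]
      cartsD(8,10)[OF c[rule_format, OF u]] cartsD(8)[OF cx[OF u]] by simp
  have "\<exists>i j. i \<in> isos (Dom S u) (pull_obj E u x) (x' u) \<and> c u \<bullet> i = Clv E u x \<and>
      j \<in> isos (Dom S u) (x' u) (pull_obj E u x) \<and> i \<bullet> j = Ident X (x' u)" if u: "u \<in> \<U>" for u
  proof -
    obtain i where i: "i \<in> varrs (Dom S u) (pull_obj E u x) (x' u)" "c u \<bullet> i = Clv E u x"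
      using iex[OF u] by blast
    have ic: "i \<in> isos (Dom S u) (pull_obj E u x) (x' u)"
      by (rule carts_right_factor[OF i(1) c[rule_format, OF u], where k = u]) (simp add: i cx u)
    obtain j where "j \<in> isos (Dom S u) (x' u) (pull_obj E u x)" "i \<bullet> j = Ident X (x' u)"
      using vert_carts_inverse[OF ic base_simps(1)[OF member(1)[OF u]]] by blast
    with i ic show ?thesis by blast
  qed
  then obtain i j where i: "\<And>u. u \<in> \<U> \<Longrightarrow> i u \<in> isos (Dom S u) (pull_obj E u x) (x' u)"
      "\<And>u. u \<in> \<U> \<Longrightarrow> c u \<bullet> i u = Clv E u x"
    and j: "\<And>u. u \<in> \<U> \<Longrightarrow> j u \<in> isos (Dom S u) (x' u) (pull_obj E u x)"
      "\<And>u. u \<in> \<U> \<Longrightarrow> i u \<bullet> j u = Ident X (x' u)"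
    by metis
  have hi: "h u \<bullet> i u \<in> arrs (f \<star> u) (pull_obj E u x) y" if "u \<in> \<U>" for u
    using arrs_comp[OF carts_arrs[OF i(1)[OF that]] h[rule_format, OF that]] member[OF that] f by simp
  have "\<exists>m. m \<in> varrs (Dom S u) (pull_obj E u x) (pull_obj E u z) \<and> (l \<bullet> Clv E u z) \<bullet> m = h u \<bullet> i u"
    if u: "u \<in> \<U>" for u
    using cart_factor[OF lz[OF u] hi[OF u], of "Ident S (Dom S u)"] member[OF u] f
      cartsD(8,10)[OF cz[OF u]] cartsD(8)[OF cx[OF u]] by simp
  then obtain m0 where m0: "\<And>u. u \<in> \<U> \<Longrightarrow> m0 u \<in> varrs (Dom S u) (pull_obj E u x) (pull_obj E u z)"
    "\<And>u. u \<in> \<U> \<Longrightarrow> (l \<bullet> Clv E u z) \<bullet> m0 u = h u \<bullet> i u"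
    by metis
  define m where "m = restrict m0 \<U>"
  note X = delta_cone[OF x] and Z = delta_cone[OF z]
  have "descent_morphism E \<U> (delta_obj E \<U> x) (delta_obj E \<U> z) m"
    unfolding descent_morphism_iff[OF X(1) Z(1)]
  proof (intro conjI ballI)
    show "m \<in> extensional \<U>" by (simp add: m_def)
    show "m u \<in> varrs (Dom S u) (fst (delta_obj E \<U> x) u) (fst (delta_obj E \<U> z) u)" if "u \<in> \<U>" for u
      using m0 that by (simp add: m_def delta_obj_def)
    fix u v assume uv: "u \<in> \<U>" "v \<in> \<U>"
    note o = overlap[OF uv]
    obtain a b where ab: "span_over u v (x' u) (x' v) a b" "c u \<bullet> a = c v \<bullet> b" "h u \<bullet> a = h v \<bullet> b"
      using sp uv by blast
    note AB = span_overD[OF ab(1)]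
    define r where "r = Clv E (p1 u v) (pull_obj E u x)"
    define t where "t = Clv E (p2 u v) (pull_obj E v x) \<bullet> can2 E u v x"
    define r' where "r' = Clv E (p1 u v) (pull_obj E u z)"
    define t' where "t' = Clv E (p2 u v) (pull_obj E v z) \<bullet> can2 E u v z"
    define p where "p = pull_arr E (p1 u v) (m0 u)"
    have sr: "span_over u v (pull_obj E u x) (pull_obj E v x) r t" and sr': "span_over u v (pull_obj E u z) (pull_obj E v z) r' t'"
      using predatumD(4)[OF X(1) uv] predatumD(4)[OF Z(1) uv] uv by (simp_all add: delta_obj_def r_def t_def r'_def t'_def)
    have cr: "Clv E u x \<bullet> r = Clv E v x \<bullet> t" and cr': "Clv E u z \<bullet> r' = Clv E v z \<bullet> t'"
      using X(2) Z(2) uv by (simp_all add: cone_def delta_obj_def r_def t_def r'_def t'_def)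
    have dr: "Dom X r = pull_obj E (p1 u v) (pull_obj E u x)" "Dom X r' = pull_obj E (p1 u v) (pull_obj E u z)"
      by (simp_all add: r_def r'_def pull_obj_def)
    have mu: "m0 u \<in> varrs (Cod S (p1 u v)) (pull_obj E u x) (pull_obj E u z)"
      using m0 uv o by simp
    note p = pull_arr[OF o(1) mu, folded p_def r_def r'_def dr]
    note R = span_overD[OF sr] and R' = span_overD[OF sr']
    note D = cart_typing[OF cx[OF uv(1)]] cart_typing[OF cx[OF uv(2)]]
      cart_typing[OF cz[OF uv(1)]] cart_typing[OF cz[OF uv(2)]]
      typing[OF m0(1)[OF uv(1)]] typing[OF m0(1)[OF uv(2)]] typing[OF p(1)] lD(1-3)
      cart_typing[OF i(1)[OF uv(1)]] cart_typing[OF i(1)[OF uv(2)]]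
      typing[OF h[rule_format, OF uv(1)]] typing[OF h[rule_format, OF uv(2)]]
      cart_typing[OF c[rule_format, OF uv(1)]] cart_typing[OF c[rule_format, OF uv(2)]]
      R(3-7) R'(3-7) AB(3-7)
    have pz: "fobj \<pi> (Dom X r) = fobj \<pi> (Dom X a)" "Dom S (p1 u v) = fobj \<pi> (Dom X a)"
      using cartsD(8)[OF AB(1)] cartsD(8)[OF R(1)] by simp_all
    have s': "fobj \<pi> (Dom X a) \<in> Obj S"
      using cartsD(10)[OF AB(1)] .
    have ir: "i u \<bullet> r \<in> arrs (p1 u v) (Dom X r) (x' u)" "i v \<bullet> t \<in> arrs (p2 u v) (Dom X r) (x' v)"
      using arrs_comp[OF carts_arrs[OF R(1)] carts_arrs[OF i(1)[OF uv(1)]]]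
        arrs_comp[OF carts_arrs[OF R(2)] carts_arrs[OF i(1)[OF uv(2)]]] o by simp_all
    obtain \<zeta> where ze: "\<zeta> \<in> varrs (fobj \<pi> (Dom X a)) (Dom X r) (Dom X a)" "a \<bullet> \<zeta> = i u \<bullet> r"
      using cart_factor[OF AB(1) ir(1), of "Ident S (fobj \<pi> (Dom X a))"] s' o(1) pz by auto
    note zD = typing[OF ze(1)]
    have bz: "b \<bullet> \<zeta> = i v \<bullet> t"
    proof (rule cart_cancel[OF c[rule_format, OF uv(2)] _ ir(2)])
      show "b \<bullet> \<zeta> \<in> arrs (p2 u v) (Dom X r) (x' v)"
        using arrs_comp[OF ze(1) carts_arrs[OF AB(2)]] o(2,3) pz(2) by simp
      have "c v \<bullet> b \<bullet> \<zeta> = c u \<bullet> i u \<bullet> r"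
        using chain[OF ab(2), of \<zeta>] ze(2) by (simp add: D zD)
      also have "\<dots> = c v \<bullet> i v \<bullet> t"
        using chain[OF i(2)[OF uv(1)], of r] chain[OF i(2)[OF uv(2)], of t] cr by (simp add: D)
      finally show "c v \<bullet> b \<bullet> \<zeta> = c v \<bullet> i v \<bullet> t" .
    qed
    have "t' \<bullet> p = m0 v \<bullet> t"
    proof (rule cart_cancel[OF lz[OF uv(2)]])
      show "t' \<bullet> p \<in> arrs (p2 u v) (Dom X r) (pull_obj E v z)"
        using arrs_comp[OF p(1) carts_arrs[OF R'(2)]] o by simp
      show "m0 v \<bullet> t \<in> arrs (p2 u v) (Dom X r) (pull_obj E v z)"
        using arrs_comp[OF carts_arrs[OF R(2)] m0(1)[OF uv(2)]] o by simp
      have "(l \<bullet> Clv E v z) \<bullet> t' \<bullet> p = l \<bullet> Clv E u z \<bullet> r' \<bullet> p"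
        using chain[OF cr', of p] by (simp add: D)
      also have "\<dots> = l \<bullet> Clv E u z \<bullet> m0 u \<bullet> r"
        by (simp add: p(2))
      also have "\<dots> = h u \<bullet> i u \<bullet> r"
        using chain[OF m0(2)[OF uv(1)], of r] by (simp add: D)
      also have "\<dots> = h u \<bullet> a \<bullet> \<zeta>"
        by (simp add: ze(2))
      also have "\<dots> = h v \<bullet> b \<bullet> \<zeta>"
        using chain[OF ab(3), of \<zeta>] by (simp add: D zD)
      also have "\<dots> = h v \<bullet> i v \<bullet> t"
        by (simp add: bz)
      also have "\<dots> = (l \<bullet> Clv E v z) \<bullet> m0 v \<bullet> t"
        using chain[OF m0(2)[OF uv(2)], of t] by (simp add: D)
      finally show "(l \<bullet> Clv E v z) \<bullet> t' \<bullet> p = (l \<bullet> Clv E v z) \<bullet> m0 v \<bullet> t" .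
    qed
    then show "leg2 (fst (delta_obj E \<U> z)) (snd (delta_obj E \<U> z)) u v \<bullet> pull_arr E (p1 u v) (m u) =
      m v \<bullet> leg2 (fst (delta_obj E \<U> x)) (snd (delta_obj E \<U> x)) u v"
      using uv by (simp add: m_def delta_obj_def t_def t'_def p_def)
  qed
  then have M: "(delta_obj E \<U> x, delta_obj E \<U> z, m) \<in> Hom (DD E \<U>) (fobj (delta E \<U>) x) (fobj (delta E \<U>) z)"
    using X(3) Z(3) by (simp add: Hom_DD delta_def)
  have bij: "bij_betw (farr (delta E \<U>)) (varrs s x z) (Hom (DD E \<U>) (fobj (delta E \<U>) x) (fobj (delta E \<U>) z))"
    using ff x z Hom_fibre[OF s] unfolding fully_faithful_def by simp
  \<comment> \<open>the image of \<open>g\<close> under \<open>\<delta>\<close> is the given morphism iff \<open>g\<close>, composed with the lift \<open>l\<close>, restricts to the \<open>h u\<close>\<close>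
  have farr: "farr (delta E \<U>) g = (delta_obj E \<U> x, delta_obj E \<U> z, m) \<longleftrightarrow> (\<forall>u\<in>\<U>. (l \<bullet> g) \<bullet> c u = h u)"
    if g: "g \<in> varrs s x z" for g
  proof -
    note gD = typing[OF g]
    have "pull_arr E u g = m0 u \<longleftrightarrow> (l \<bullet> g) \<bullet> c u = h u" if u: "u \<in> \<U>" for u
    proof -
      have g': "g \<in> varrs (Cod S u) x z"
        using g member[OF u] by simp
      note p = pull_arr[OF member(1)[OF u] g']
      note D = cart_typing[OF cx[OF u]] cart_typing[OF cz[OF u]]
        typing[OF p(1)] lD(1-3) gD cart_typing[OF i(1)[OF u]]
        cart_typing[OF j(1)[OF u]] typing[OF h[rule_format, OF u]]
        cart_typing[OF c[rule_format, OF u]]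
      have "pull_arr E u g = m0 u \<longleftrightarrow> (l \<bullet> Clv E u z) \<bullet> pull_arr E u g = (l \<bullet> Clv E u z) \<bullet> m0 u"
        using cart_cancel[OF lz[OF u] p(1) m0(1)[OF u]] by metis
      also have "(l \<bullet> Clv E u z) \<bullet> pull_arr E u g = ((l \<bullet> g) \<bullet> c u) \<bullet> i u"
        by (simp add: D p(2) i(2)[OF u])
      also have "(l \<bullet> Clv E u z) \<bullet> m0 u = h u \<bullet> i u"
        by (rule m0(2)[OF u])
      also have "((l \<bullet> g) \<bullet> c u) \<bullet> i u = h u \<bullet> i u \<longleftrightarrow> (l \<bullet> g) \<bullet> c u = h u"
      proof
        assume "((l \<bullet> g) \<bullet> c u) \<bullet> i u = h u \<bullet> i u"
        then have "(((l \<bullet> g) \<bullet> c u) \<bullet> i u) \<bullet> j u = (h u \<bullet> i u) \<bullet> j u"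
          by simp
        then show "(l \<bullet> g) \<bullet> c u = h u"
          by (simp add: D j(2)[OF u])
      qed simp
      finally show ?thesis .
    qed
    then show ?thesis
      using gD by (auto simp: delta_def m_def restrict_def fun_eq_iff)
  qed
  have ex: "\<exists>g. g \<in> varrs s x z \<and> farr (delta E \<U>) g = (delta_obj E \<U> x, delta_obj E \<U> z, m)"
  proof -
    have "(delta_obj E \<U> x, delta_obj E \<U> z, m) \<in> farr (delta E \<U>) ` varrs s x z"
      using M bij_betw_imp_surj_on[OF bij] by simp
    then obtain g where g: "(delta_obj E \<U> x, delta_obj E \<U> z, m) = farr (delta E \<U>) g" "g \<in> varrs s x z"
      by (rule imageE)
    show ?thesis
      by (intro exI conjI, rule g(2), rule g(1)[symmetric])
  qed
  have uni: "g = g'" if "g \<in> varrs s x z" "g' \<in> varrs s x z" "farr (delta E \<U>) g = farr (delta E \<U>) g'" for g g'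
    by (rule inj_onD[OF bij_betw_imp_inj_on[OF bij] that(3,1,2)])
  show "\<exists>!g. g \<in> arrs f x y \<and> (\<forall>u\<in>\<U>. g \<bullet> c u = h u)"
  proof (rule ex_ex1I)
    obtain g where g: "g \<in> varrs s x z" "\<forall>u\<in>\<U>. (l \<bullet> g) \<bullet> c u = h u"
      using ex farr by blast
    have "l \<bullet> g \<in> arrs f x y"
      using arrs_comp[OF g(1) carts_arrs[OF l]] f by simp
    with g show "\<exists>g. g \<in> arrs f x y \<and> (\<forall>u\<in>\<U>. g \<bullet> c u = h u)"
      by blast
  next
    fix g1 g2 assume g1: "g1 \<in> arrs f x y \<and> (\<forall>u\<in>\<U>. g1 \<bullet> c u = h u)" and g2: "g2 \<in> arrs f x y \<and> (\<forall>u\<in>\<U>. g2 \<bullet> c u = h u)"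
    have fac: "\<exists>g. g \<in> varrs s x z \<and> l \<bullet> g = k" if "k \<in> arrs f x y" for k
      using cart_factor[OF l that, of "Ident S s"] f x z s by simp
    obtain k1 where k1: "k1 \<in> varrs s x z" "l \<bullet> k1 = g1"
      using fac[of g1] g1 by blast
    obtain k2 where k2: "k2 \<in> varrs s x z" "l \<bullet> k2 = g2"
      using fac[of g2] g2 by blast
    have "k1 = k2"
      using uni[OF k1(1) k2(1)] farr[OF k1(1)] farr[OF k2(1)] g1 g2 k1(2) k2(2) by simp
    then show "g1 = g2"
      using k1 k2 by simp
  qed
qed

text \<open>
  The spans determine isomorphisms \<open>\<phi>0 u v\<close> between the chosen pull-backs, through the comparison \<open>\<zeta> u v\<close>
  of the chosen lift of \<open>p\<^sub>1\<close> with the leg \<open>a u v\<close>. The resulting datum satisfies the cocycle condition, and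
  the inverse \<open>n\<close> of an isomorphism from some \<open>\<delta> r\<close> turns the chosen lifts to \<open>r\<close> into a cone.
\<close>

lemma obj_descent_of_essentially_surjective:
  assumes es: "essentially_surjective (fib E s) (DD E \<U>) (delta E \<U>)"
  shows obj_descent
  unfolding obj_descent_def
proof (intro allI impI, elim conjE)
  fix x a b
  assume sp: "\<forall>u\<in>\<U>. \<forall>v\<in>\<U>. span_over u v (x u) (x v) (a u v) (b u v)" and co: "cocycle x a b"
  define y where "y = restrict x \<U>"
  have yx [simp]: "y u = x u" if "u \<in> \<U>" for u
    using that by (simp add: y_def)
  have xo: "x u \<in> Obj X" "fobj \<pi> (x u) = Dom S u" if "u \<in> \<U>" for u
    using cartsD(6,9)[OF span_overD(1)[OF sp[rule_format, OF that that]]] overlap[OF that that] by simp_all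
  define P where "P u v t \<longleftrightarrow> (case t of (\<zeta>, \<phi>, \<xi>) \<Rightarrow>
      \<zeta> \<in> isos (Dom S (p1 u v)) (pull_obj E (p1 u v) (x u)) (Dom X (a u v)) \<and> a u v \<bullet> \<zeta> = leg1 x u v \<and>
      \<phi> \<in> isos (Dom S (p1 u v)) (pull_obj E (p1 u v) (x u)) (pull_obj E (p2 u v) (x v)) \<and>
      b u v \<bullet> \<zeta> = Clv E (p2 u v) (x v) \<bullet> \<phi> \<and>
      \<xi> \<in> isos (Dom S (p1 u v)) (Dom X (a u v)) (pull_obj E (p1 u v) (x u)) \<and> \<zeta> \<bullet> \<xi> = Ident X (Dom X (a u v)))" for u v t
  have Pex: "\<exists>t. P u v t"
    if uv: "u \<in> \<U>" "v \<in> \<U>" for u v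
  proof -
    note o = overlap[OF uv] and A = span_overD[OF sp[rule_format, OF uv]]
    have s': "Dom S (p1 u v) \<in> Obj S"
      using o by simp
    have l1: "leg1 x u v \<in> carts (p1 u v) (pull_obj E (p1 u v) (x u)) (x u)"
      and l2: "Clv E (p2 u v) (x v) \<in> carts (p2 u v) (pull_obj E (p2 u v) (x v)) (x v)"
      by (rule Clv; simp add: o xo uv)+
    have d: "fobj \<pi> (Dom X (a u v)) = Dom S (p1 u v)" "fobj \<pi> (pull_obj E (p1 u v) (x u)) = Dom S (p1 u v)"
       "fobj \<pi> (pull_obj E (p2 u v) (x v)) = Dom S (p1 u v)"
      using cartsD(8)[OF A(1)] cartsD(8)[OF l1] cartsD(8)[OF l2] o by simp_all
    obtain \<zeta> where z: "\<zeta> \<in> varrs (Dom S (p1 u v)) (pull_obj E (p1 u v) (x u)) (Dom X (a u v))" "a u v \<bullet> \<zeta> = leg1 x u v"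
      using cart_factor[OF A(1) carts_arrs[OF l1], of "Ident S (Dom S (p1 u v))"] s' d o by auto
    have zc: "\<zeta> \<in> isos (Dom S (p1 u v)) (pull_obj E (p1 u v) (x u)) (Dom X (a u v))"
      by (rule carts_right_factor[OF z(1) A(1), where k = "p1 u v"]) (simp add: z l1)
    have bz: "b u v \<bullet> \<zeta> \<in> carts (p2 u v) (pull_obj E (p1 u v) (x u)) (x v)"
      using carts_comp[OF zc A(2)] o by simp
    obtain \<phi> where ph: "\<phi> \<in> varrs (Dom S (p1 u v)) (pull_obj E (p1 u v) (x u)) (pull_obj E (p2 u v) (x v))"
      "Clv E (p2 u v) (x v) \<bullet> \<phi> = b u v \<bullet> \<zeta>"
      using cart_factor[OF l2 carts_arrs[OF bz], of "Ident S (Dom S (p1 u v))"] s' d o by auto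
    have "\<phi> \<in> isos (Dom S (p1 u v)) (pull_obj E (p1 u v) (x u)) (pull_obj E (p2 u v) (x v))"
      by (rule carts_right_factor[OF ph(1) l2, where k = "p2 u v"]) (simp add: ph bz)
    moreover obtain \<xi> where "\<xi> \<in> isos (Dom S (p1 u v)) (Dom X (a u v)) (pull_obj E (p1 u v) (x u))"
      "\<zeta> \<bullet> \<xi> = Ident X (Dom X (a u v))"
      using vert_carts_inverse[OF zc s'] by blast
    ultimately have "P u v (\<zeta>, \<phi>, \<xi>)"
      unfolding P_def using z zc ph by simp
    then show ?thesis by blast
  qed
  define T where "T u v = (SOME t. P u v t)" for u v
  define \<zeta> where "\<zeta> u v = fst (T u v)" for u v
  define \<phi>0 where "\<phi>0 u v = fst (snd (T u v))" for u v
  define \<xi> where "\<xi> u v = snd (snd (T u v))" for u v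
  have "P u v (\<zeta> u v, \<phi>0 u v, \<xi> u v)" if "u \<in> \<U>" "v \<in> \<U>" for u v
    using someI_ex[OF Pex[OF that]] by (simp add: \<zeta>_def \<phi>0_def \<xi>_def T_def)
  then have
    z: "\<And>u v. u \<in> \<U> \<Longrightarrow> v \<in> \<U> \<Longrightarrow> \<zeta> u v \<in> isos (Dom S (p1 u v)) (pull_obj E (p1 u v) (x u)) (Dom X (a u v))"
      "\<And>u v. u \<in> \<U> \<Longrightarrow> v \<in> \<U> \<Longrightarrow> a u v \<bullet> \<zeta> u v = leg1 x u v"
    and p: "\<And>u v. u \<in> \<U> \<Longrightarrow> v \<in> \<U> \<Longrightarrow> \<phi>0 u v \<in> isos (Dom S (p1 u v)) (pull_obj E (p1 u v) (x u)) (pull_obj E (p2 u v) (x v))"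
      "\<And>u v. u \<in> \<U> \<Longrightarrow> v \<in> \<U> \<Longrightarrow> b u v \<bullet> \<zeta> u v = Clv E (p2 u v) (x v) \<bullet> \<phi>0 u v"
    and xi: "\<And>u v. u \<in> \<U> \<Longrightarrow> v \<in> \<U> \<Longrightarrow> \<xi> u v \<in> isos (Dom S (p1 u v)) (Dom X (a u v)) (pull_obj E (p1 u v) (x u))"
      "\<And>u v. u \<in> \<U> \<Longrightarrow> v \<in> \<U> \<Longrightarrow> \<zeta> u v \<bullet> \<xi> u v = Ident X (Dom X (a u v))"
    unfolding P_def by blast+
  define \<phi> where "\<phi> = restrict (\<lambda>(u, v). \<phi>0 u v) (\<U> \<times> \<U>)"
  have pd: "predatum y \<phi>"
    unfolding predatum_def using p(1) xo by (auto simp: y_def \<phi>_def)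
  have tr: "factors (leg1 y u v) (leg2 y \<phi> u v) \<alpha> \<beta>" if uv: "u \<in> \<U>" "v \<in> \<U>" and f: "factors (a u v) (b u v) \<alpha> \<beta>" for u v \<alpha> \<beta>
  proof -
    note A = span_overD[OF sp[rule_format, OF uv]]
    note D = cart_typing[OF z(1)[OF uv]] cart_typing[OF xi(1)[OF uv]] A(3-7)
    obtain \<eta> where e: "\<eta> \<in> Arr X" "Cod X \<eta> = Dom X (a u v)" "a u v \<bullet> \<eta> = \<alpha>" "b u v \<bullet> \<eta> = \<beta>"
      using f by (auto simp: factors_def)
    have zx: "\<zeta> u v \<bullet> \<xi> u v \<bullet> \<eta> = \<eta>"
      using chain[OF xi(2)[OF uv], of \<eta>] e by (simp add: D)
    have "leg1 y u v \<bullet> \<xi> u v \<bullet> \<eta> = \<alpha>"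
      using chain[OF z(2)[OF uv], of "\<xi> u v \<bullet> \<eta>"] e uv by (simp add: D zx)
    moreover have "leg2 y \<phi> u v \<bullet> \<xi> u v \<bullet> \<eta> = \<beta>"
      using chain[OF p(2)[OF uv], of "\<xi> u v \<bullet> \<eta>"] e uv by (simp add: D zx \<phi>_def)
    ultimately show ?thesis
      unfolding factors_def using e uv
      by (intro bexI[of _ "\<xi> u v \<bullet> \<eta>"]) (simp_all add: D pull_obj_def[symmetric])
  qed
  have "cocycle y (leg1 y) (leg2 y \<phi>)"
    unfolding cocycle_def
  proof (intro ballI)
    fix u v w assume uvw: "u \<in> \<U>" "v \<in> \<U>" "w \<in> \<U>"
    obtain q1 q2 q3 where q: "fprod3 S u v w = (q1, q2, q3)"
      by (metis prod_cases3)
    obtain t \<alpha> \<beta> \<gamma> where "\<alpha> \<in> carts q1 t (x u)" "\<beta> \<in> carts q2 t (x v)" "\<gamma> \<in> carts q3 t (x w)"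
       "factors (a u v) (b u v) \<alpha> \<beta>" "factors (a v w) (b v w) \<beta> \<gamma>" "factors (a u w) (b u w) \<alpha> \<gamma>"
      using co[unfolded cocycle_def, rule_format, OF uvw] q by auto
    then have "\<alpha> \<in> carts q1 t (y u)" "\<beta> \<in> carts q2 t (y v)" "\<gamma> \<in> carts q3 t (y w)"
       "factors (leg1 y u v) (leg2 y \<phi> u v) \<alpha> \<beta>" "factors (leg1 y v w) (leg2 y \<phi> v w) \<beta> \<gamma>"
       "factors (leg1 y u w) (leg2 y \<phi> u w) \<alpha> \<gamma>"
      using tr uvw by simp_all
    then show "case fprod3 S u v w of (q1, q2, q3) \<Rightarrow>
        \<exists>z \<alpha> \<beta> \<gamma>. \<alpha> \<in> carts q1 z (y u) \<and> \<beta> \<in> carts q2 z (y v) \<and> \<gamma> \<in> carts q3 z (y w) \<and>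
         factors (leg1 y u v) (leg2 y \<phi> u v) \<alpha> \<beta> \<and> factors (leg1 y v w) (leg2 y \<phi> v w) \<beta> \<gamma> \<and>
         factors (leg1 y u w) (leg2 y \<phi> u w) \<alpha> \<gamma>"
      unfolding q by auto
  qed
  with pd have dd: "descent_datum E \<U> y \<phi>"
    by (simp add: descent_datum_iff_cocycle)
  then have "(y, \<phi>) \<in> Obj (DD E \<U>)"
    by (simp add: DD_def)
  with es obtain r k where r: "r \<in> Obj (fib E s)" and k: "k \<in> Hom (DD E \<U>) (fobj (delta E \<U>) r) (y, \<phi>)" "is_iso (DD E \<U>) k"
    unfolding essentially_surjective_def by blast
  have r': "r \<in> Obj X" "fobj \<pi> r = s"
    using r by simp_all
  note R = delta_cone[OF r']
  obtain m where m: "k = (delta_obj E \<U> r, (y, \<phi>), m)" "descent_morphism E \<U> (delta_obj E \<U> r) (y, \<phi>) m"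
    using k(1) by (auto simp: Hom_DD delta_def)
  obtain k' where k': "inverse_arrows (DD E \<U>) k k'"
    using k(2) by (auto simp: is_iso_def)
  then have "k' \<in> Hom (DD E \<U>) (y, \<phi>) (delta_obj E \<U> r)"
    by (auto simp: inverse_arrows_def m(1) DD_def)
  then obtain n where n: "k' = ((y, \<phi>), delta_obj E \<U> r, n)" "descent_morphism E \<U> (y, \<phi>) (delta_obj E \<U> r) n"
    by (auto simp: Hom_DD)
  have inv: "restrict (\<lambda>u. n u \<bullet> m u) \<U> = restrict (\<lambda>u. Ident X (fst (delta_obj E \<U> r) u)) \<U>"
     "restrict (\<lambda>u. m u \<bullet> n u) \<U> = restrict (\<lambda>u. Ident X (y u)) \<U>"
    using k' unfolding inverse_arrows_def by (simp_all add: m(1) n(1) DD_def)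
  have M: "m u \<in> varrs (Dom S u) (pull_obj E u r) (x u)" if "u \<in> \<U>" for u
    using m(2) that descent_morphism_iff[of "delta_obj E \<U> r" "(y, \<phi>)"] R(1) pd by (simp add: delta_obj_def)
  have N: "n u \<in> varrs (Dom S u) (x u) (pull_obj E u r)" if "u \<in> \<U>" for u
    using n(2) that descent_morphism_iff[of "(y, \<phi>)" "delta_obj E \<U> r"] R(1) pd by (simp add: delta_obj_def)
  have NL: "leg2 (fst (delta_obj E \<U> r)) (snd (delta_obj E \<U> r)) u v \<bullet> pull_arr E (p1 u v) (n u) = n v \<bullet> leg2 y \<phi> u v"
    if "u \<in> \<U>" "v \<in> \<U>" for u v
    using n(2) that descent_morphism_iff[of "(y, \<phi>)" "delta_obj E \<U> r"] R(1) pd by simp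
  have nc: "n u \<in> isos (Dom S u) (x u) (pull_obj E u r)" if u: "u \<in> \<U>" for u
  proof (rule inverse_carts[OF N[OF u] M[OF u]])
    show "Dom S u \<in> Obj S"
      using member[OF u] by simp
    show "m u \<bullet> n u = Ident X (x u)" "n u \<bullet> m u = Ident X (pull_obj E u r)"
      using fun_cong[OF inv(1), of u] fun_cong[OF inv(2), of u] u by (simp_all add: delta_obj_def)
  qed
  have cr: "Clv E u r \<in> carts u (pull_obj E u r) r" if "u \<in> \<U>" for u
    using R(2) that by (simp add: cone_def delta_obj_def)
  define c where "c u = Clv E u r \<bullet> n u" for u
  have c: "c u \<in> carts u (x u) r" if "u \<in> \<U>" for u
    using carts_comp[OF nc[OF that] cr[OF that]] member[OF that] by (simp add: c_def)
  have "c u \<bullet> a u v = c v \<bullet> b u v" if uv: "u \<in> \<U>" "v \<in> \<U>" for u v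
  proof -
    note o = overlap[OF uv]
    note A = span_overD[OF sp[rule_format, OF uv]]
    define p' where "p' = pull_arr E (p1 u v) (n u)"
    define t where "t = leg2 (fst (delta_obj E \<U> r)) (snd (delta_obj E \<U> r)) u v"
    define w where "w = Clv E (p1 u v) (pull_obj E u r)"
    have nu: "n u \<in> varrs (Cod S (p1 u v)) (x u) (pull_obj E u r)"
      using N uv o by simp
    note P = pull_arr[OF o(1) nu, folded p'_def w_def]
    have sw: "span_over u v (pull_obj E u r) (pull_obj E v r) w t"
      using predatumD(4)[OF R(1) uv] uv by (simp add: w_def t_def delta_obj_def)
    note W = span_overD[OF sw]
    have dw: "Dom X w = pull_obj E (p1 u v) (pull_obj E u r)"
      by (simp add: w_def pull_obj_def)
    have cw: "Clv E u r \<bullet> w = Clv E v r \<bullet> t"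
      using R(2) uv by (simp add: cone_def w_def t_def delta_obj_def)
    have l1: "leg1 x u v \<in> carts (p1 u v) (pull_obj E (p1 u v) (x u)) (x u)"
      by (rule Clv; simp add: o xo uv)
    have nl: "t \<bullet> p' = n v \<bullet> b u v \<bullet> \<zeta> u v"
      using NL[OF uv] uv p(2)[OF uv] by (simp add: \<phi>_def t_def p'_def)
    note D = cart_typing[OF z(1)[OF uv]] cart_typing[OF xi(1)[OF uv]] A(3-7) W(3-7) dw
      typing[OF P(1)] typing[OF N[OF uv(1)]] typing[OF N[OF uv(2)]]
      cart_typing[OF cr[OF uv(1)]] cart_typing[OF cr[OF uv(2)]]
      cart_typing[OF c[OF uv(1)]] cart_typing[OF c[OF uv(2)]]
      cart_typing[OF l1]
    have "c u \<bullet> a u v \<bullet> \<zeta> u v = Clv E u r \<bullet> n u \<bullet> leg1 x u v"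
      by (simp add: z(2)[OF uv] c_def D)
    also have "\<dots> = Clv E u r \<bullet> w \<bullet> p'"
      by (simp add: P(2))
    also have "\<dots> = Clv E v r \<bullet> t \<bullet> p'"
      using chain[OF cw, of p'] by (simp add: D)
    also have "\<dots> = c v \<bullet> b u v \<bullet> \<zeta> u v"
      by (simp add: nl c_def D)
    finally have "(c u \<bullet> a u v \<bullet> \<zeta> u v) \<bullet> \<xi> u v = (c v \<bullet> b u v \<bullet> \<zeta> u v) \<bullet> \<xi> u v"
      by simp
    then show ?thesis
      by (simp add: D xi(2)[OF uv])
  qed
  then show "\<exists>y c. y \<in> Obj X \<and> fobj \<pi> y = s \<and> (\<forall>u\<in>\<U>. c u \<in> carts u (x u) y) \<and>
      (\<forall>u\<in>\<U>. \<forall>v\<in>\<U>. c u \<bullet> a u v = c v \<bullet> b u v)"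
    using r' c by blast
qed

end

section \<open>Sheaves of isomorphisms\<close>

context cloven_fibration
begin

lemma isom_sections:
  assumes "f \<in> Arr S"
  shows "isom_sections E x y f = isos (Dom S f) (pull_obj E f x) (pull_obj E f y)"
proof -
  have s: "Dom S f \<in> Obj S"
    using assms by simp
  show ?thesis
    unfolding isom_sections_def Hom_fibre[OF s] using is_iso_fibre[OF s] carts_arrs by blast
qed

lemma vertical_eqI:
  assumes k: "k \<in> Arr S" and y: "y \<in> Obj X" "fobj \<pi> y = Cod S k"
    and r: "r \<in> varrs (Dom S k) z (pull_obj E k y)" "r' \<in> varrs (Dom S k) z (pull_obj E k y)"
    and eq: "Clv E k y \<bullet> r = Clv E k y \<bullet> r'"
  shows "r = r'"
  using cart_cancel[OF Clv[OF k y] r eq] .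

text \<open>
  A section over \<open>f\<close> is a vertical isomorphism \<open>f\<^sup>* x \<rightarrow> f\<^sup>* y\<close>, equivalently a cartesian arrow
  \<open>f\<^sup>* x \<rightarrow> y\<close> over \<open>f\<close>. In the latter form restricting to \<open>f \<star> u\<close> is composing with the cartesian arrow
  \<open>l u : (f \<star> u)\<^sup>* x \<rightarrow> f\<^sup>* x\<close>, so the sheaf condition is gluing along the \<open>l u\<close>, together with
  \<open>hom_descent_cartesian\<close>.
\<close>

lemma isom_sheaf:
  assumes top: "grothendieck_topology S Cov"
    and hd: "\<And>t \<U>. t \<in> Obj S \<Longrightarrow> \<U> \<in> Cov t \<Longrightarrow> covered_fibration.hom_descent S X \<pi> t \<U>"
    and x: "x \<in> Obj X" "fobj \<pi> x = s" and y: "y \<in> Obj X" "fobj \<pi> y = s"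
  shows "slice_sheaf S Cov s (isom_sections E x y) (isom_restriction E x y)"
proof -
  have res: "\<exists>l. l \<in> carts g (pull_obj E (f \<star> g) x) (pull_obj E f x) \<and> Clv E f x \<bullet> l = Clv E (f \<star> g) x \<and>
      isom_restriction E x y f g a \<in> isos (Dom S g) (pull_obj E (f \<star> g) x) (pull_obj E (f \<star> g) y) \<and>
      Clv E (f \<star> g) y \<bullet> isom_restriction E x y f g a = Clv E f y \<bullet> a \<bullet> l"
    if f: "f \<in> Arr S" "Cod S f = s" and g: "g \<in> Arr S" "Cod S g = Dom S f"
      and a: "a \<in> isos (Dom S f) (pull_obj E f x) (pull_obj E f y)" for f g a
    using restr_cart[of g f f x y a] f g a x y unfolding isom_restriction_def by metis
  have res_eq: "Clv E (f \<star> g) y \<bullet> isom_restriction E x y f g a = Clv E f y \<bullet> a \<bullet> l"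
    if f: "f \<in> Arr S" "Cod S f = s" and g: "g \<in> Arr S" "Cod S g = Dom S f"
      and a: "a \<in> isos (Dom S f) (pull_obj E f x) (pull_obj E f y)"
      and l: "l \<in> arrs g (pull_obj E (f \<star> g) x) (pull_obj E f x)" "Clv E f x \<bullet> l = Clv E (f \<star> g) x" for f g a l
  proof -
    have "fobj \<pi> x = Cod S f"
      using f x by simp
    moreover obtain l' where l': "l' \<in> carts g (pull_obj E (f \<star> g) x) (pull_obj E f x)" "Clv E f x \<bullet> l' = Clv E (f \<star> g) x"
      "Clv E (f \<star> g) y \<bullet> isom_restriction E x y f g a = Clv E f y \<bullet> a \<bullet> l'"
      using res[OF f g a] by blast
    ultimately have "l = l'"
      using cart_cancel[OF Clv[OF f(1) x(1)] l(1) carts_arrs[OF l'(1)]] l(2) by simp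
    with l' show ?thesis by simp
  qed
  have res_sec: "isom_restriction E x y f g a \<in> isos (Dom S g) (pull_obj E (f \<star> g) x) (pull_obj E (f \<star> g) y)"
    if "f \<in> Arr S" "Cod S f = s" "g \<in> Arr S" "Cod S g = Dom S f"
      "a \<in> isos (Dom S f) (pull_obj E f x) (pull_obj E f y)" for f g a
    using res[OF that] by blast
  have pre: "slice_presheaf S s (isom_sections E x y) (isom_restriction E x y)"
    unfolding slice_presheaf_def
  proof (intro ballI impI conjI)
    fix f a assume f: "f \<in> Arr S" "Cod S f = s" and a': "a \<in> isom_sections E x y f"
    have a: "a \<in> isos (Dom S f) (pull_obj E f x) (pull_obj E f y)"
      using a' isom_sections[OF f(1)] by simp
    have fx: "fobj \<pi> x = Cod S f" "fobj \<pi> y = Cod S f"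
      using f x y by simp_all
    note cx = Clv[OF f(1) x(1) fx(1)] and px = pull_obj[OF f(1) x(1) fx(1)]
    note D = cart_typing[OF a] cart_typing[OF cx]
      cart_typing[OF Clv[OF f(1) y(1) fx(2)]]
    have i: "Ident S (Dom S f) \<in> Arr S" "Cod S (Ident S (Dom S f)) = Dom S f" "f \<star> Ident S (Dom S f) = f"
      "Dom S (Ident S (Dom S f)) = Dom S f"
      using f by simp_all
    show "isom_restriction E x y f (Ident S (Dom S f)) a = a"
    proof (rule vertical_eqI[OF f(1) y(1) fx(2)])
      show "isom_restriction E x y f (Ident S (Dom S f)) a \<in> varrs (Dom S f) (pull_obj E f x) (pull_obj E f y)"
        using carts_arrs[OF res_sec[OF f i(1,2) a]] by (simp add: i(3,4))
      show "a \<in> varrs (Dom S f) (pull_obj E f x) (pull_obj E f y)"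
        by (rule carts_arrs[OF a])
      have "Clv E f y \<bullet> isom_restriction E x y f (Ident S (Dom S f)) a = Clv E f y \<bullet> a \<bullet> Ident X (pull_obj E f x)"
        using res_eq[OF f i(1,2) a, of "Ident X (pull_obj E f x)"] arrs_ident[OF px(1)]
        by (simp add: i(3) px(2) D)
      then show "Clv E f y \<bullet> isom_restriction E x y f (Ident S (Dom S f)) a = Clv E f y \<bullet> a"
        by (simp add: D)
    qed
    fix g assume g: "g \<in> Arr S" "Cod S g = Dom S f"
    have fg: "f \<star> g \<in> Arr S" "Cod S (f \<star> g) = s" "Dom S (f \<star> g) = Dom S g"
      using f g by simp_all
    show "isom_restriction E x y f g a \<in> isom_sections E x y (f \<star> g)"
      using res_sec[OF f g a] isom_sections[OF fg(1)] fg(3) by simp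
    fix h assume h: "h \<in> Arr S" "Cod S h = Dom S g"
    have gh: "g \<star> h \<in> Arr S" "Cod S (g \<star> h) = Dom S f" "f \<star> g \<star> h = (f \<star> g) \<star> h" "Dom S (g \<star> h) = Dom S h"
      using f g h by simp_all
    have fgh: "(f \<star> g) \<star> h \<in> Arr S" "fobj \<pi> y = Cod S ((f \<star> g) \<star> h)" "Dom S ((f \<star> g) \<star> h) = Dom S h" "Cod S h = Dom S (f \<star> g)"
      using f g h y by simp_all
    let ?b = "isom_restriction E x y f g a"
    have b: "?b \<in> isos (Dom S (f \<star> g)) (pull_obj E (f \<star> g) x) (pull_obj E (f \<star> g) y)"
      using res_sec[OF f g a] by (simp add: fg)
    obtain l where l: "l \<in> carts g (pull_obj E (f \<star> g) x) (pull_obj E f x)" "Clv E f x \<bullet> l = Clv E (f \<star> g) x"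
      "Clv E (f \<star> g) y \<bullet> ?b = Clv E f y \<bullet> a \<bullet> l"
      using res[OF f g a] by blast
    obtain k where k: "k \<in> carts h (pull_obj E ((f \<star> g) \<star> h) x) (pull_obj E (f \<star> g) x)"
      "Clv E (f \<star> g) x \<bullet> k = Clv E ((f \<star> g) \<star> h) x"
      "Clv E ((f \<star> g) \<star> h) y \<bullet> isom_restriction E x y (f \<star> g) h ?b = Clv E (f \<star> g) y \<bullet> ?b \<bullet> k"
      using res[OF fg(1,2) h(1) fgh(4) b] by blast
    have cy: "Clv E (f \<star> g) y \<in> carts (f \<star> g) (pull_obj E (f \<star> g) y) y"
      by (rule Clv) (simp_all add: y fg)
    note D' = D cart_typing[OF l(1)] cart_typing[OF k(1)] cart_typing[OF b]
      cart_typing[OF cy]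
    have lk: "l \<bullet> k \<in> arrs (g \<star> h) (pull_obj E ((f \<star> g) \<star> h) x) (pull_obj E f x)"
      by (rule arrs_comp[OF carts_arrs[OF k(1)] carts_arrs[OF l(1)]])
    have e1: "Clv E ((f \<star> g) \<star> h) y \<bullet> isom_restriction E x y f (g \<star> h) a = Clv E f y \<bullet> a \<bullet> l \<bullet> k"
      using res_eq[OF f gh(1,2) a, of "l \<bullet> k", unfolded gh(3), OF lk] chain[OF l(2), of k] k(2) by (simp add: D')
    show "isom_restriction E x y f (g \<star> h) a = isom_restriction E x y (f \<star> g) h ?b"
    proof (rule vertical_eqI[OF fgh(1) y(1) fgh(2), unfolded fgh(3)])
      show "isom_restriction E x y f (g \<star> h) a \<in> varrs (Dom S h) (pull_obj E ((f \<star> g) \<star> h) x) (pull_obj E ((f \<star> g) \<star> h) y)"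
        using carts_arrs[OF res_sec[OF f gh(1,2) a], unfolded gh(3,4)] .
      show "isom_restriction E x y (f \<star> g) h ?b \<in> varrs (Dom S h) (pull_obj E ((f \<star> g) \<star> h) x) (pull_obj E ((f \<star> g) \<star> h) y)"
        using carts_arrs[OF res_sec[OF fg(1,2) h(1) fgh(4) b]] .
      show "Clv E ((f \<star> g) \<star> h) y \<bullet> isom_restriction E x y f (g \<star> h) a = Clv E ((f \<star> g) \<star> h) y \<bullet> isom_restriction E x y (f \<star> g) h ?b"
        using e1 k(3) chain[OF l(3), of k] by (simp add: D')
    qed
  qed
  moreover have "\<exists>!b. b \<in> isom_sections E x y f \<and> (\<forall>u\<in>\<U>. isom_restriction E x y f u b = a u)"
    if f: "f \<in> Arr S" "Cod S f = s" and U: "\<U> \<in> Cov (Dom S f)" and a': "\<And>u. u \<in> \<U> \<Longrightarrow> a u \<in> isom_sections E x y (f \<star> u)"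
      and comp: "\<And>u v. u \<in> \<U> \<Longrightarrow> v \<in> \<U> \<Longrightarrow>
        isom_restriction E x y (f \<star> u) (pr1 S u v) (a u) = isom_restriction E x y (f \<star> v) (pr2 S u v) (a v)"
    for f \<U> a
  proof -
    have df: "Dom S f \<in> Obj S" using f by simp
    interpret C: covered_cloven_fibration E "Dom S f" \<U>
      by unfold_locales (rule covering_of_topology[OF top df U])
    have hd': C.hom_descent
      by (rule hd[OF df U])
    have fx: "fobj \<pi> x = Cod S f" "fobj \<pi> y = Cod S f"
      using f x y by simp_all
    note cx = Clv[OF f(1) x(1) fx(1)] and px = pull_obj[OF f(1) x(1) fx(1)] and cy = Clv[OF f(1) y(1) fx(2)]
      and py = pull_obj[OF f(1) y(1) fx(2)]
    have fu: "f \<star> u \<in> Arr S" "Dom S (f \<star> u) = Dom S u" "Cod S (f \<star> u) = s" "u \<in> Arr S" "Cod S u = Dom S f" if "u \<in> \<U>" for u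
      using C.member[OF that] f by simp_all
    have a: "a u \<in> isos (Dom S u) (pull_obj E (f \<star> u) x) (pull_obj E (f \<star> u) y)" if "u \<in> \<U>" for u
      using a'[OF that] isom_sections fu[OF that] by simp
    have cux: "Clv E (f \<star> u) x \<in> carts (f \<star> u) (pull_obj E (f \<star> u) x) x"
      and cuy: "Clv E (f \<star> u) y \<in> carts (f \<star> u) (pull_obj E (f \<star> u) y) y" if "u \<in> \<U>" for u
      by (rule Clv; simp add: x y fu that)+
    have "\<exists>l. l \<in> carts u (pull_obj E (f \<star> u) x) (pull_obj E f x) \<and> Clv E f x \<bullet> l = Clv E (f \<star> u) x" if u: "u \<in> \<U>" for u
    proof -
      have d: "fobj \<pi> (pull_obj E (f \<star> u) x) = Dom S u"
        using cartsD(8)[OF cux[OF u]] fu[OF u] by simp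
      obtain l where l: "l \<in> arrs u (pull_obj E (f \<star> u) x) (pull_obj E f x)" "Clv E f x \<bullet> l = Clv E (f \<star> u) x"
        using cart_factor[OF cx carts_arrs[OF cux[OF u]] fu(4)[OF u]] fu(5)[OF u] px d by auto
      moreover have "l \<in> carts u (pull_obj E (f \<star> u) x) (pull_obj E f x)"
        by (rule carts_right_factor[OF l(1) cx, where k = "f \<star> u"]) (simp add: l cux u)
      ultimately show ?thesis by blast
    qed
    then obtain l where l: "\<And>u. u \<in> \<U> \<Longrightarrow> l u \<in> carts u (pull_obj E (f \<star> u) x) (pull_obj E f x)"
      "\<And>u. u \<in> \<U> \<Longrightarrow> Clv E f x \<bullet> l u = Clv E (f \<star> u) x"
      by metis
    define h where "h u = Clv E (f \<star> u) y \<bullet> a u" for u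
    have h: "h u \<in> carts (f \<star> u) (pull_obj E (f \<star> u) x) y" if u: "u \<in> \<U>" for u
    proof -
      have "(f \<star> u) \<star> Ident S (Dom S u) = f \<star> u"
        using fu[OF u] by simp
      then show ?thesis
        using carts_comp[OF a[OF u] cuy[OF u]] by (simp add: h_def)
    qed
    have key: "isom_restriction E x y f u b = a u \<longleftrightarrow> (Clv E f y \<bullet> b) \<bullet> l u = h u"
      if b: "b \<in> isos (Dom S f) (pull_obj E f x) (pull_obj E f y)" and u: "u \<in> \<U>" for b u
    proof -
      note r = res_sec[OF f fu(4,5)[OF u] b]
      have "isom_restriction E x y f u b = a u \<longleftrightarrow> Clv E (f \<star> u) y \<bullet> isom_restriction E x y f u b = Clv E (f \<star> u) y \<bullet> a u"
        using cart_cancel[OF cuy[OF u] carts_arrs[OF r] carts_arrs[OF a[OF u]]] by metis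
      also have "Clv E (f \<star> u) y \<bullet> isom_restriction E x y f u b = Clv E f y \<bullet> b \<bullet> l u"
        by (rule res_eq[OF f fu(4,5)[OF u] b carts_arrs[OF l(1)[OF u]] l(2)[OF u]])
      finally show ?thesis
        by (simp add: h_def cart_typing[OF b] cart_typing[OF cy] cart_typing[OF l(1)[OF u]])
    qed
    have glue: "\<exists>!g. g \<in> arrs f (pull_obj E f x) y \<and> (\<forall>u\<in>\<U>. g \<bullet> l u = h u)"
    proof (rule C.hom_descent_ex1[OF hd' l(1)])
      show "h u \<in> arrs (f \<star> u) (pull_obj E (f \<star> u) x) y" if "u \<in> \<U>" for u
        by (rule carts_arrs[OF h[OF that]])
      fix u v assume uv: "u \<in> \<U>" "v \<in> \<U>"
      note o = C.overlap[OF uv]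
      define k where "k = (f \<star> u) \<star> pr1 S u v"
      have k2: "(f \<star> v) \<star> pr2 S u v = k"
        unfolding k_def using f(1) fu[OF uv(1)] fu[OF uv(2)] o by simp
      define r where "r = isom_restriction E x y (f \<star> u) (pr1 S u v) (a u)"
      have r2: "isom_restriction E x y (f \<star> v) (pr2 S u v) (a v) = r"
        using comp[OF uv] by (simp add: r_def)
      obtain l1 where l1: "l1 \<in> carts (pr1 S u v) (pull_obj E k x) (pull_obj E (f \<star> u) x)"
          "Clv E (f \<star> u) x \<bullet> l1 = Clv E k x" "Clv E k y \<bullet> r = Clv E (f \<star> u) y \<bullet> a u \<bullet> l1"
        using res[of "f \<star> u" "pr1 S u v" "a u"] a uv fu o unfolding k_def[symmetric] r_def[symmetric] by auto
      obtain l2 where l2: "l2 \<in> carts (pr2 S u v) (pull_obj E k x) (pull_obj E (f \<star> v) x)"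
          "Clv E (f \<star> v) x \<bullet> l2 = Clv E k x" "Clv E k y \<bullet> r = Clv E (f \<star> v) y \<bullet> a v \<bullet> l2"
        using res[of "f \<star> v" "pr2 S u v" "a v"] a uv fu o unfolding k2 r2 by auto
      note D = cart_typing[OF l1(1)] cart_typing[OF l2(1)]
        cart_typing[OF l(1)[OF uv(1)]] cart_typing[OF l(1)[OF uv(2)]]
        cart_typing[OF a[OF uv(1)]] cart_typing[OF a[OF uv(2)]]
        cart_typing[OF cuy[OF uv(1)]] cart_typing[OF cuy[OF uv(2)]]
        cart_typing[OF cx]
      have "C.span_over u v (pull_obj E (f \<star> u) x) (pull_obj E (f \<star> v) x) l1 l2"
        using l1(1) l2(1) by (simp add: C.span_over_def D)
      moreover have "l u \<bullet> l1 = l v \<bullet> l2"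
      proof (rule cart_cancel[OF cx])
        show "l u \<bullet> l1 \<in> arrs (u \<star> pr1 S u v) (pull_obj E k x) (pull_obj E f x)"
          by (rule arrs_comp[OF carts_arrs[OF l1(1)] carts_arrs[OF l(1)[OF uv(1)]]])
        show "l v \<bullet> l2 \<in> arrs (u \<star> pr1 S u v) (pull_obj E k x) (pull_obj E f x)"
          unfolding o(6) by (rule arrs_comp[OF carts_arrs[OF l2(1)] carts_arrs[OF l(1)[OF uv(2)]]])
        show "Clv E f x \<bullet> l u \<bullet> l1 = Clv E f x \<bullet> l v \<bullet> l2"
          using chain[OF l(2)[OF uv(1)], of l1] chain[OF l(2)[OF uv(2)], of l2] l1(2) l2(2) by (simp add: D)
      qed
      moreover have "h u \<bullet> l1 = h v \<bullet> l2"
        using l1(3) l2(3) by (simp add: h_def D)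
      ultimately show "\<exists>a b. C.span_over u v (pull_obj E (f \<star> u) x) (pull_obj E (f \<star> v) x) a b \<and>
         l u \<bullet> a = l v \<bullet> b \<and> h u \<bullet> a = h v \<bullet> b"
        by blast
    qed (simp_all add: px y f)
    have Df: "Ident S (Dom S f) \<in> Arr S" "Dom S (Ident S (Dom S f)) = Dom S f" "Cod S (Ident S (Dom S f)) = Dom S f"
      "f \<star> Ident S (Dom S f) = f"
      using f by simp_all
    show ?thesis
      unfolding isom_sections[OF f(1)]
    proof (rule ex_ex1I)
      obtain g where g: "g \<in> arrs f (pull_obj E f x) y" "\<And>u. u \<in> \<U> \<Longrightarrow> g \<bullet> l u = h u"
        using glue by blast
      have gc: "g \<in> carts f (pull_obj E f x) y"
        by (rule C.hom_descent_cartesian[OF hd' l(1) px(2) g(1)]) (simp_all add: g(2) h)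
      obtain b where b: "b \<in> varrs (Dom S f) (pull_obj E f x) (pull_obj E f y)" "Clv E f y \<bullet> b = g"
        using cart_factor[OF cy g(1) Df(1)] px(2) py(2) Df by auto
      have bc: "b \<in> isos (Dom S f) (pull_obj E f x) (pull_obj E f y)"
        by (rule carts_right_factor[OF b(1) cy, where k = f]) (simp add: b gc)
      then show "\<exists>b. b \<in> isos (Dom S f) (pull_obj E f x) (pull_obj E f y) \<and>
          (\<forall>u\<in>\<U>. isom_restriction E x y f u b = a u)"
        using key[OF bc] b(2) g(2) by metis
    next
      fix b b' assume B: "b \<in> isos (Dom S f) (pull_obj E f x) (pull_obj E f y) \<and> (\<forall>u\<in>\<U>. isom_restriction E x y f u b = a u)"
        and B': "b' \<in> isos (Dom S f) (pull_obj E f x) (pull_obj E f y) \<and> (\<forall>u\<in>\<U>. isom_restriction E x y f u b' = a u)"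
      have "Clv E f y \<bullet> b = Clv E f y \<bullet> b'"
      proof (rule C.hom_descent_unique[OF hd' l(1) px(2)])
        show "Clv E f y \<bullet> b \<in> arrs f (pull_obj E f x) y" "Clv E f y \<bullet> b' \<in> arrs f (pull_obj E f x) y"
          using arrs_comp[OF carts_arrs carts_arrs[OF cy], of b] arrs_comp[OF carts_arrs carts_arrs[OF cy], of b'] B B' Df(4)
          by metis+
        show "(Clv E f y \<bullet> b) \<bullet> l u = (Clv E f y \<bullet> b') \<bullet> l u" if "u \<in> \<U>" for u
          using key[of b u] key[of b' u] B B' that by simp
      qed
      then show "b = b'"
        using cart_cancel[OF cy] B B' carts_arrs by blast
    qed
  qed
  ultimately show ?thesis
    unfolding slice_sheaf_def by blast
qed

end

context fibration
begin

lemma cloven_of_cleavage: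
  assumes "cleavage S X \<pi> c"
  shows "cloven_fibration \<lparr>Base = S, Tot = X, Proj = \<pi>, Clv = c\<rparr>"
  using assms fibred by unfold_locales (simp add: cloven_fibred_category_def)

text \<open>
  Neither form of gluing refers to a cleavage, so the conditions on a prestack and on a stack follow
  for all cleavages at once.
\<close>

lemma prestackI:
  assumes top: "grothendieck_topology S Cov" and gr: "fibred_in_groupoids S X \<pi>"
    and hd: "\<And>t \<U>. t \<in> Obj S \<Longrightarrow> \<U> \<in> Cov t \<Longrightarrow> covered_fibration.hom_descent S X \<pi> t \<U>"
  shows "prestack S Cov X \<pi>"
  unfolding prestack_def Let_def
proof (intro conjI allI impI ballI gr)
  fix c s x y assume c: "cleavage S X \<pi> c" and "x \<in> Obj (fibre S X \<pi> s)" "y \<in> Obj (fibre S X \<pi> s)"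
  then show "slice_sheaf S Cov s (isom_sections \<lparr>Base = S, Tot = X, Proj = \<pi>, Clv = c\<rparr> x y)
      (isom_restriction \<lparr>Base = S, Tot = X, Proj = \<pi>, Clv = c\<rparr> x y)"
    using cloven_fibration.isom_sheaf[OF cloven_of_cleavage[OF c], of Cov x s y] top hd by simp
qed

lemma stackI:
  assumes top: "grothendieck_topology S Cov" and pre: "prestack S Cov X \<pi>"
    and od: "\<And>t \<U>. t \<in> Obj S \<Longrightarrow> \<U> \<in> Cov t \<Longrightarrow> covered_fibration.obj_descent S X \<pi> t \<U>"
  shows "stack S Cov X \<pi>"
  unfolding stack_def Let_def
proof (intro conjI allI impI ballI pre)
  fix c s \<U> D assume c: "cleavage S X \<pi> c" and s: "s \<in> Obj S" "\<U> \<in> Cov s"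
    and D: "D \<in> Obj (DD \<lparr>Base = S, Tot = X, Proj = \<pi>, Clv = c\<rparr> \<U>)"
  interpret E: cloven_fibration "\<lparr>Base = S, Tot = X, Proj = \<pi>, Clv = c\<rparr>"
    by (rule cloven_of_cleavage[OF c])
  interpret C: covered_cloven_fibration "\<lparr>Base = S, Tot = X, Proj = \<pi>, Clv = c\<rparr>" s \<U>
    using covering_of_topology[OF top s] by unfold_locales simp
  show "effective \<lparr>Base = S, Tot = X, Proj = \<pi>, Clv = c\<rparr> s \<U> D"
    using C.effective_of_obj_descent[OF _ D] od[OF s] by simp
qed

end

section \<open>Tensor products in the fibres\<close>

locale tensor_fibration = cloven_fibration B
  for B :: "('s, 'f, 'x, 'a) fatcat" +
  fixes \<kappa> :: "'j rel"
  assumes tensor_fibred: "fibred_in_abelian_tensor_categories \<kappa> (Base B) B"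
begin

notation pull_comp (infixr "\<star>" 70) and total_comp (infixr "\<bullet>" 70)

lemma Fib_structure:
  assumes "s \<in> Obj S"
  shows "Obj (Fib B s) = Obj (fib B s)" "Arr (Fib B s) = Arr (fib B s)" "Dom (Fib B s) = Dom X"
    "Cod (Fib B s) = Cod X" "Ident (Fib B s) = Ident X" "Comp (Fib B s) = Comp X"
    "symmetric_monoidal (Fib B s)"
proof -
  have t: "cat.truncate (Fib B s) = fib B s" and ab: "abelian_tensor_category \<kappa> (Fib B s)"
    using tensor_fibred assms by (auto simp: fibred_in_abelian_tensor_categories_def)
  show "Obj (Fib B s) = Obj (fib B s)" "Arr (Fib B s) = Arr (fib B s)" "Dom (Fib B s) = Dom X"
    "Cod (Fib B s) = Cod X" "Ident (Fib B s) = Ident X" "Comp (Fib B s) = Comp X"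
    using arg_cong[OF t, of Obj] arg_cong[OF t, of Arr] arg_cong[OF t, of Dom] arg_cong[OF t, of Cod]
      arg_cong[OF t, of Ident] arg_cong[OF t, of Comp]
    by (simp_all add: cat.truncate_def)
  show "symmetric_monoidal (Fib B s)"
    using ab by (simp add: abelian_tensor_category_def)
qed

lemma Obj_Fib: "s \<in> Obj S \<Longrightarrow> x \<in> Obj (Fib B s) \<longleftrightarrow> x \<in> Obj X \<and> fobj \<pi> x = s"
  by (simp add: Fib_structure)

lemma Hom_Fib: "s \<in> Obj S \<Longrightarrow> Hom (Fib B s) x y = varrs s x y"
  using Hom_fibre[of s x y] by (simp add: Hom_def Fib_structure)

lemma Arr_Fib: "s \<in> Obj S \<Longrightarrow> a \<in> varrs s x y \<Longrightarrow> a \<in> Arr (Fib B s)"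
  using Arr_fibre[of s a] by (simp add: Fib_structure arrsD)

lemma is_iso_Fib:
  assumes "s \<in> Obj S"
  shows "is_iso (Fib B s) a \<and> a \<in> Hom (Fib B s) x y \<longleftrightarrow> a \<in> isos s x y"
proof -
  have "is_iso (Fib B s) a \<longleftrightarrow> is_iso (fib B s) a"
    using assms by (simp add: is_iso_def inverse_arrows_def Hom_def Fib_structure)
  then show ?thesis
    unfolding Hom_Fib[OF assms] using is_iso_fibre[OF assms] carts_arrs by blast
qed

text \<open>
  The fibre is read off from the left factor, so that the base object need not be an argument; the value
  is meaningful if both factors lie over the same object.
\<close>

definition tens_obj :: "'x \<Rightarrow> 'x \<Rightarrow> 'x"  (infixr "\<otimes>" 75) where
  "x \<otimes> y = TensO (Fib B (fobj \<pi> x)) x y"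

lemma tens_obj:
  assumes "x \<in> Obj X" "y \<in> Obj X" "fobj \<pi> y = fobj \<pi> x"
  shows "x \<otimes> y \<in> Obj X" "fobj \<pi> (x \<otimes> y) = fobj \<pi> x"
proof -
  have s: "fobj \<pi> x \<in> Obj S"
    using assms by simp
  have "tensor_bifunctor (Fib B (fobj \<pi> x))"
    using Fib_structure(7)[OF s] by (simp add: symmetric_monoidal_def)
  then have "x \<otimes> y \<in> Obj (Fib B (fobj \<pi> x))"
    using assms Obj_Fib[OF s] by (simp add: tens_obj_def tensor_bifunctor_def)
  then show "x \<otimes> y \<in> Obj X" "fobj \<pi> (x \<otimes> y) = fobj \<pi> x"
    using Obj_Fib[OF s] by auto
qed

lemma TensO: "s \<in> Obj S \<Longrightarrow> fobj \<pi> x = s \<Longrightarrow> TensO (Fib B s) x y = x \<otimes> y"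
  by (simp add: tens_obj_def)

lemma vtens:
  assumes s: "s \<in> Obj S" and f: "f \<in> varrs s x x'" and g: "g \<in> varrs s y y'"
  shows "TensA (Fib B s) f g \<in> varrs s (x \<otimes> y) (x' \<otimes> y')"
proof -
  have t: "tensor_bifunctor (Fib B s)"
    using Fib_structure(7)[OF s] by (simp add: symmetric_monoidal_def)
  have "TensA (Fib B s) f g \<in> Hom (Fib B s) (TensO (Fib B s) (Dom (Fib B s) f) (Dom (Fib B s) g))
      (TensO (Fib B s) (Cod (Fib B s) f) (Cod (Fib B s) g))"
    using t Arr_Fib[OF s f] Arr_Fib[OF s g] unfolding tensor_bifunctor_def by blast
  then show ?thesis
    using vertD[OF f s] vertD[OF g s] by (simp add: Hom_Fib s Fib_structure(3,4) tens_obj_def)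
qed

lemma vtens_ident:
  assumes s: "s \<in> Obj S" and x: "x \<in> Obj X" "fobj \<pi> x = s" and y: "y \<in> Obj X" "fobj \<pi> y = s"
  shows "TensA (Fib B s) (Ident X x) (Ident X y) = Ident X (x \<otimes> y)"
proof -
  have t: "tensor_bifunctor (Fib B s)"
    using Fib_structure(7)[OF s] by (simp add: symmetric_monoidal_def)
  then have "TensA (Fib B s) (Ident (Fib B s) x) (Ident (Fib B s) y) = Ident (Fib B s) (TensO (Fib B s) x y)"
    using x y Obj_Fib[OF s] unfolding tensor_bifunctor_def by blast
  then show ?thesis
    by (simp add: Fib_structure(5) s x TensO)
qed

lemma vtens_comp:
  assumes s: "s \<in> Obj S" and f: "f \<in> varrs s x x'" "f' \<in> varrs s x' x''"
    and g: "g \<in> varrs s y y'" "g' \<in> varrs s y' y''"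
  shows "TensA (Fib B s) (f' \<bullet> f) (g' \<bullet> g) = TensA (Fib B s) f' g' \<bullet> TensA (Fib B s) f g"
proof -
  have t: "tensor_bifunctor (Fib B s)"
    using Fib_structure(7)[OF s] by (simp add: symmetric_monoidal_def)
  have "Dom (Fib B s) f' = Cod (Fib B s) f" "Dom (Fib B s) g' = Cod (Fib B s) g"
    by (simp_all add: Fib_structure(3,4) s arrsD(2,3)[OF f(1)] arrsD(2,3)[OF g(1)] arrsD(2,3)[OF f(2)] arrsD(2,3)[OF g(2)])
  then have "TensA (Fib B s) (Comp (Fib B s) f' f) (Comp (Fib B s) g' g) =
      Comp (Fib B s) (TensA (Fib B s) f' g') (TensA (Fib B s) f g)"
    using t Arr_Fib[OF s f(1)] Arr_Fib[OF s g(1)] Arr_Fib[OF s f(2)] Arr_Fib[OF s g(2)]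
    unfolding tensor_bifunctor_def by blast
  then show ?thesis
    by (simp add: Fib_structure(6) s)
qed

lemma vtens_cart:
  assumes s: "s \<in> Obj S" and f: "f \<in> isos s x x'" and g: "g \<in> isos s y y'"
  shows "TensA (Fib B s) f g \<in> isos s (x \<otimes> y) (x' \<otimes> y')"
proof -
  obtain f' where f': "f' \<in> isos s x' x" "f' \<bullet> f = Ident X x" "f \<bullet> f' = Ident X x'"
    using vert_carts_inverse[OF f s] by blast
  obtain g' where g': "g' \<in> isos s y' y" "g' \<bullet> g = Ident X y" "g \<bullet> g' = Ident X y'"
    using vert_carts_inverse[OF g s] by blast
  note A = carts_arrs[OF f] carts_arrs[OF g] carts_arrs[OF f'(1)] carts_arrs[OF g'(1)]
  show ?thesis
  proof (rule inverse_carts[OF vtens[OF s A(1,2)] vtens[OF s A(3,4)] s])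
    show "TensA (Fib B s) f' g' \<bullet> TensA (Fib B s) f g = Ident X (x \<otimes> y)"
      using vtens_comp[OF s A(1,3,2,4)] vtens_ident[OF s] vertD[OF A(1) s] vertD[OF A(2) s] f' g' by simp
    show "TensA (Fib B s) f g \<bullet> TensA (Fib B s) f' g' = Ident X (x' \<otimes> y')"
      using vtens_comp[OF s A(3,1,4,2)] vtens_ident[OF s] vertD[OF A(1) s] vertD[OF A(2) s] f' g' by simp
  qed
qed

definition unit_obj :: "'s \<Rightarrow> 'x" where
  "unit_obj s = Unt (Fib B s)"

definition asc :: "'x \<Rightarrow> 'x \<Rightarrow> 'x \<Rightarrow> 'a" where "asc x y z = Asc (Fib B (fobj \<pi> x)) x y z"
definition lun :: "'x \<Rightarrow> 'a" where "lun x = LUn (Fib B (fobj \<pi> x)) x"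
definition run :: "'x \<Rightarrow> 'a" where "run x = RUn (Fib B (fobj \<pi> x)) x"
definition brd :: "'x \<Rightarrow> 'x \<Rightarrow> 'a" where "brd x y = Brd (Fib B (fobj \<pi> x)) x y"

lemma structure_arrs:
  assumes s: "s \<in> Obj S"
  shows "unit_obj s \<in> Obj X" "fobj \<pi> (unit_obj s) = s"
    "x \<in> Obj X \<Longrightarrow> fobj \<pi> x = s \<Longrightarrow> y \<in> Obj X \<Longrightarrow> fobj \<pi> y = s \<Longrightarrow> z \<in> Obj X \<Longrightarrow> fobj \<pi> z = s \<Longrightarrow>
       asc x y z \<in> isos s ((x \<otimes> y) \<otimes> z) (x \<otimes> y \<otimes> z)"
    "x \<in> Obj X \<Longrightarrow> fobj \<pi> x = s \<Longrightarrow> lun x \<in> isos s (unit_obj s \<otimes> x) x"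
    "x \<in> Obj X \<Longrightarrow> fobj \<pi> x = s \<Longrightarrow> run x \<in> isos s (x \<otimes> unit_obj s) x"
    "x \<in> Obj X \<Longrightarrow> fobj \<pi> x = s \<Longrightarrow> y \<in> Obj X \<Longrightarrow> fobj \<pi> y = s \<Longrightarrow>
       brd x y \<in> isos s (x \<otimes> y) (y \<otimes> x)"
proof -
  note sm = Fib_structure(7)[OF s, unfolded symmetric_monoidal_def]
  have "Unt (Fib B s) \<in> Obj (Fib B s)"
    using sm by simp
  then show u: "unit_obj s \<in> Obj X" "fobj \<pi> (unit_obj s) = s"
    using Obj_Fib[OF s] by (auto simp: unit_obj_def)
  show "asc x y z \<in> isos s ((x \<otimes> y) \<otimes> z) (x \<otimes> y \<otimes> z)"
    if "x \<in> Obj X" "fobj \<pi> x = s" "y \<in> Obj X" "fobj \<pi> y = s" "z \<in> Obj X" "fobj \<pi> z = s"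
  proof -
    have o: "x \<in> Obj (Fib B s)" "y \<in> Obj (Fib B s)" "z \<in> Obj (Fib B s)"
      using that Obj_Fib[OF s] by blast+
    have "is_iso (Fib B s) (Asc (Fib B s) x y z) \<and> Asc (Fib B s) x y z \<in>
      Hom (Fib B s) (TensO (Fib B s) (TensO (Fib B s) x y) z) (TensO (Fib B s) x (TensO (Fib B s) y z))"
      using sm o by simp
    then show ?thesis
      unfolding is_iso_Fib[OF s] using that by (simp add: asc_def TensO s tens_obj)
  qed
  show "lun x \<in> isos s (unit_obj s \<otimes> x) x" if "x \<in> Obj X" "fobj \<pi> x = s"
  proof -
    have "x \<in> Obj (Fib B s)"
      using that Obj_Fib[OF s] by blast
    then have "is_iso (Fib B s) (LUn (Fib B s) x) \<and> LUn (Fib B s) x \<in> Hom (Fib B s) (TensO (Fib B s) (Unt (Fib B s)) x) x"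
      using sm by simp
    then show ?thesis
      unfolding is_iso_Fib[OF s] using that u by (simp add: lun_def unit_obj_def[symmetric] TensO s)
  qed
  show "run x \<in> isos s (x \<otimes> unit_obj s) x" if "x \<in> Obj X" "fobj \<pi> x = s"
  proof -
    have "x \<in> Obj (Fib B s)"
      using that Obj_Fib[OF s] by blast
    then have "is_iso (Fib B s) (RUn (Fib B s) x) \<and> RUn (Fib B s) x \<in> Hom (Fib B s) (TensO (Fib B s) x (Unt (Fib B s))) x"
      using sm by simp
    then show ?thesis
      unfolding is_iso_Fib[OF s] using that u by (simp add: run_def unit_obj_def[symmetric] TensO s)
  qed
  show "brd x y \<in> isos s (x \<otimes> y) (y \<otimes> x)"
    if "x \<in> Obj X" "fobj \<pi> x = s" "y \<in> Obj X" "fobj \<pi> y = s"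
  proof -
    have "x \<in> Obj (Fib B s)" "y \<in> Obj (Fib B s)"
      using that Obj_Fib[OF s] by blast+
    then have "is_iso (Fib B s) (Brd (Fib B s) x y) \<and> Brd (Fib B s) x y \<in> Hom (Fib B s) (TensO (Fib B s) x y) (TensO (Fib B s) y x)"
      using sm by simp
    then show ?thesis
      unfolding is_iso_Fib[OF s] using that by (simp add: brd_def TensO s)
  qed
qed

lemma vertical_naturality:
  assumes s: "s \<in> Obj S" and f: "f \<in> varrs s x x'"
  shows "g \<in> varrs s y y' \<Longrightarrow> h \<in> varrs s z z' \<Longrightarrow>
      asc x' y' z' \<bullet> TensA (Fib B s) (TensA (Fib B s) f g) h = TensA (Fib B s) f (TensA (Fib B s) g h) \<bullet> asc x y z"
    "lun x' \<bullet> TensA (Fib B s) (Ident X (unit_obj s)) f = f \<bullet> lun x"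
    "run x' \<bullet> TensA (Fib B s) f (Ident X (unit_obj s)) = f \<bullet> run x"
    "g \<in> varrs s y y' \<Longrightarrow> brd x' y' \<bullet> TensA (Fib B s) f g = TensA (Fib B s) g f \<bullet> brd x y"
proof -
  note sm = Fib_structure(7)[OF s, unfolded symmetric_monoidal_def]
  note fD = vertD[OF f s] and fA = Arr_Fib[OF s f]
  show "asc x' y' z' \<bullet> TensA (Fib B s) (TensA (Fib B s) f g) h = TensA (Fib B s) f (TensA (Fib B s) g h) \<bullet> asc x y z"
    if g: "g \<in> varrs s y y'" and h: "h \<in> varrs s z z'"
  proof -
    have "Comp (Fib B s) (Asc (Fib B s) (Cod (Fib B s) f) (Cod (Fib B s) g) (Cod (Fib B s) h)) (TensA (Fib B s) (TensA (Fib B s) f g) h) =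
      Comp (Fib B s) (TensA (Fib B s) f (TensA (Fib B s) g h)) (Asc (Fib B s) (Dom (Fib B s) f) (Dom (Fib B s) g) (Dom (Fib B s) h))"
      using sm fA Arr_Fib[OF s g] Arr_Fib[OF s h] by blast
    then show ?thesis
      by (simp add: Fib_structure(3,4,6) s fD arrsD(2,3)[OF g] arrsD(2,3)[OF h] asc_def)
  qed
  have "Comp (Fib B s) (LUn (Fib B s) (Cod (Fib B s) f)) (TensA (Fib B s) (Ident (Fib B s) (Unt (Fib B s))) f) =
      Comp (Fib B s) f (LUn (Fib B s) (Dom (Fib B s) f))"
    using sm fA by blast
  then show "lun x' \<bullet> TensA (Fib B s) (Ident X (unit_obj s)) f = f \<bullet> lun x"
    by (simp add: Fib_structure(3-6) s fD lun_def unit_obj_def)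
  have "Comp (Fib B s) (RUn (Fib B s) (Cod (Fib B s) f)) (TensA (Fib B s) f (Ident (Fib B s) (Unt (Fib B s)))) =
      Comp (Fib B s) f (RUn (Fib B s) (Dom (Fib B s) f))"
    using sm fA by blast
  then show "run x' \<bullet> TensA (Fib B s) f (Ident X (unit_obj s)) = f \<bullet> run x"
    by (simp add: Fib_structure(3-6) s fD run_def unit_obj_def)
  show "brd x' y' \<bullet> TensA (Fib B s) f g = TensA (Fib B s) g f \<bullet> brd x y" if g: "g \<in> varrs s y y'"
  proof -
    have "Comp (Fib B s) (Brd (Fib B s) (Cod (Fib B s) f) (Cod (Fib B s) g)) (TensA (Fib B s) f g) =
      Comp (Fib B s) (TensA (Fib B s) g f) (Brd (Fib B s) (Dom (Fib B s) f) (Dom (Fib B s) g))"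
      using sm fA Arr_Fib[OF s g] by blast
    then show ?thesis
      by (simp add: Fib_structure(3,4,6) s fD arrsD(2,3)[OF g] brd_def)
  qed
qed

text \<open>
  The monoidal structure of the pull-back functors and the compatibility of the canonical
  isomorphisms with it, in terms of arrows of the total category.
\<close>

lemma pull_tensor_functor:
  assumes f: "f \<in> Arr S"
  shows "symmetric_strong_monoidal (Fib B (Cod S f)) (Fib B (Dom S f)) (pull B f)"
    "preserves_colimits \<kappa> (Fib B (Cod S f)) (Fib B (Dom S f)) (pull B f)"
  using tensor_fibred f by (auto simp: fibred_in_abelian_tensor_categories_def tensor_functor_def)

lemma PMu:
  assumes f: "f \<in> Arr S" and x: "x \<in> Obj X" "fobj \<pi> x = Cod S f" and y: "y \<in> Obj X" "fobj \<pi> y = Cod S f"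
  shows "PMu B f x y \<in> isos (Dom S f) (pull_obj B f x \<otimes> pull_obj B f y) (pull_obj B f (x \<otimes> y))"
proof -
  have s: "Cod S f \<in> Obj S" "Dom S f \<in> Obj S"
    using f by simp_all
  have o: "x \<in> Obj (Fib B (Cod S f))" "y \<in> Obj (Fib B (Cod S f))"
    using x y Obj_Fib[OF s(1)] by blast+
  have "is_iso (Fib B (Dom S f)) (Mu (pull B f) x y) \<and> Mu (pull B f) x y \<in> Hom (Fib B (Dom S f))
      (TensO (Fib B (Dom S f)) (fobj (pull B f) x) (fobj (pull B f) y)) (fobj (pull B f) (TensO (Fib B (Cod S f)) x y))"
    using pull_tensor_functor(1)[OF f] o unfolding symmetric_strong_monoidal_def by simp
  then show ?thesis
    unfolding is_iso_Fib[OF s(2)] using x pull_obj[OF f x] by (simp add: pull_def TensO s)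
qed

lemma PEps:
  assumes f: "f \<in> Arr S"
  shows "PEps B f \<in> isos (Dom S f) (unit_obj (Dom S f)) (pull_obj B f (unit_obj (Cod S f)))"
proof -
  have s: "Dom S f \<in> Obj S"
    using f by simp
  have "is_iso (Fib B (Dom S f)) (Eps (pull B f)) \<and> Eps (pull B f) \<in> Hom (Fib B (Dom S f))
      (Unt (Fib B (Dom S f))) (fobj (pull B f) (Unt (Fib B (Cod S f))))"
    using pull_tensor_functor(1)[OF f] unfolding symmetric_strong_monoidal_def by simp
  then show ?thesis
    unfolding is_iso_Fib[OF s] by (simp add: pull_def unit_obj_def)
qed

lemma PMu_natural:
  assumes f: "f \<in> Arr S" and a: "a \<in> varrs (Cod S f) x x'" and b: "b \<in> varrs (Cod S f) y y'"
  shows "PMu B f x' y' \<bullet> TensA (Fib B (Dom S f)) (pull_arr B f a) (pull_arr B f b) =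
    pull_arr B f (TensA (Fib B (Cod S f)) a b) \<bullet> PMu B f x y"
proof -
  have s: "Cod S f \<in> Obj S" "Dom S f \<in> Obj S"
    using f by simp_all
  let ?C = "Fib B (Cod S f)" and ?D = "Fib B (Dom S f)"
  have "Comp ?D (Mu (pull B f) (Cod ?C a) (Cod ?C b)) (TensA ?D (farr (pull B f) a) (farr (pull B f) b)) =
    Comp ?D (farr (pull B f) (TensA ?C a b)) (Mu (pull B f) (Dom ?C a) (Dom ?C b))"
    using pull_tensor_functor(1)[OF f] Arr_Fib[OF s(1) a] Arr_Fib[OF s(1) b] unfolding symmetric_strong_monoidal_def by blast
  then show ?thesis
    by (simp add: Fib_structure s pull_def arrsD(2,3)[OF a] arrsD(2,3)[OF b])
qed

lemma PMu_coherence: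
  assumes f: "f \<in> Arr S" and x: "x \<in> Obj X" "fobj \<pi> x = Cod S f"
  shows "y \<in> Obj X \<Longrightarrow> fobj \<pi> y = Cod S f \<Longrightarrow> z \<in> Obj X \<Longrightarrow> fobj \<pi> z = Cod S f \<Longrightarrow>
      (pull_arr B f (asc x y z) \<bullet> PMu B f (x \<otimes> y) z) \<bullet> TensA (Fib B (Dom S f)) (PMu B f x y) (Ident X (pull_obj B f z)) =
      (PMu B f x (y \<otimes> z) \<bullet> TensA (Fib B (Dom S f)) (Ident X (pull_obj B f x)) (PMu B f y z)) \<bullet>
        asc (pull_obj B f x) (pull_obj B f y) (pull_obj B f z)"
    "(pull_arr B f (lun x) \<bullet> PMu B f (unit_obj (Cod S f)) x) \<bullet>
       TensA (Fib B (Dom S f)) (PEps B f) (Ident X (pull_obj B f x)) = lun (pull_obj B f x)"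
    "(pull_arr B f (run x) \<bullet> PMu B f x (unit_obj (Cod S f))) \<bullet>
       TensA (Fib B (Dom S f)) (Ident X (pull_obj B f x)) (PEps B f) = run (pull_obj B f x)"
    "y \<in> Obj X \<Longrightarrow> fobj \<pi> y = Cod S f \<Longrightarrow>
       pull_arr B f (brd x y) \<bullet> PMu B f x y = PMu B f y x \<bullet> brd (pull_obj B f x) (pull_obj B f y)"
proof -
  have s: "Cod S f \<in> Obj S" "Dom S f \<in> Obj S"
    using f by simp_all
  let ?C = "Fib B (Cod S f)" and ?D = "Fib B (Dom S f)" and ?P = "pull B f"
  note M = pull_tensor_functor(1)[OF f, unfolded symmetric_strong_monoidal_def]
  have xo: "x \<in> Obj ?C"
    using x Obj_Fib[OF s(1)] by blast
  note px = pull_obj[OF f x]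
  show "(pull_arr B f (asc x y z) \<bullet> PMu B f (x \<otimes> y) z) \<bullet> TensA (Fib B (Dom S f)) (PMu B f x y) (Ident X (pull_obj B f z)) =
      (PMu B f x (y \<otimes> z) \<bullet> TensA (Fib B (Dom S f)) (Ident X (pull_obj B f x)) (PMu B f y z)) \<bullet>
        asc (pull_obj B f x) (pull_obj B f y) (pull_obj B f z)"
    if y: "y \<in> Obj X" "fobj \<pi> y = Cod S f" and z: "z \<in> Obj X" "fobj \<pi> z = Cod S f"
  proof -
    have o: "y \<in> Obj ?C" "z \<in> Obj ?C"
      using y z Obj_Fib[OF s(1)] by blast+
    have "Comp ?D (Comp ?D (farr ?P (Asc ?C x y z)) (Mu ?P (TensO ?C x y) z)) (TensA ?D (Mu ?P x y) (Ident ?D (fobj ?P z))) =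
        Comp ?D (Comp ?D (Mu ?P x (TensO ?C y z)) (TensA ?D (Ident ?D (fobj ?P x)) (Mu ?P y z))) (Asc ?D (fobj ?P x) (fobj ?P y) (fobj ?P z))"
      using M xo o by blast
    then show ?thesis
      by (simp add: Fib_structure(5,6) s pull_def asc_def x y px TensO)
  qed
  have "Comp ?D (Comp ?D (farr ?P (LUn ?C x)) (Mu ?P (Unt ?C) x)) (TensA ?D (Eps ?P) (Ident ?D (fobj ?P x))) = LUn ?D (fobj ?P x)"
    using M xo by blast
  then show "(pull_arr B f (lun x) \<bullet> PMu B f (unit_obj (Cod S f)) x) \<bullet>
       TensA (Fib B (Dom S f)) (PEps B f) (Ident X (pull_obj B f x)) = lun (pull_obj B f x)"
    by (simp add: Fib_structure(5,6) s pull_def lun_def unit_obj_def x px)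
  have "Comp ?D (Comp ?D (farr ?P (RUn ?C x)) (Mu ?P x (Unt ?C))) (TensA ?D (Ident ?D (fobj ?P x)) (Eps ?P)) = RUn ?D (fobj ?P x)"
    using M xo by blast
  then show "(pull_arr B f (run x) \<bullet> PMu B f x (unit_obj (Cod S f))) \<bullet>
       TensA (Fib B (Dom S f)) (Ident X (pull_obj B f x)) (PEps B f) = run (pull_obj B f x)"
    by (simp add: Fib_structure(5,6) s pull_def run_def unit_obj_def x px)
  show "pull_arr B f (brd x y) \<bullet> PMu B f x y = PMu B f y x \<bullet> brd (pull_obj B f x) (pull_obj B f y)"
    if y: "y \<in> Obj X" "fobj \<pi> y = Cod S f"
  proof -
    have o: "y \<in> Obj ?C"
      using y Obj_Fib[OF s(1)] by blast
    have "Comp ?D (farr ?P (Brd ?C x y)) (Mu ?P x y) = Comp ?D (Mu ?P y x) (Brd ?D (fobj ?P x) (fobj ?P y))"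
      using M xo o by blast
    then show ?thesis
      by (simp add: Fib_structure(6) s pull_def brd_def x px)
  qed
qed

lemma can_monoidal:
  assumes f: "f \<in> Arr S" and g: "g \<in> Arr S" "Cod S g = Dom S f"
  shows "x \<in> Obj X \<Longrightarrow> fobj \<pi> x = Cod S f \<Longrightarrow> y \<in> Obj X \<Longrightarrow> fobj \<pi> y = Cod S f \<Longrightarrow>
      can B f g (x \<otimes> y) \<bullet> pull_arr B g (PMu B f x y) \<bullet> PMu B g (pull_obj B f x) (pull_obj B f y) =
      PMu B (f \<star> g) x y \<bullet> TensA (Fib B (Dom S g)) (can B f g x) (can B f g y)"
    "can B f g (unit_obj (Cod S f)) \<bullet> pull_arr B g (PEps B f) \<bullet> PEps B g = PEps B (f \<star> g)"
proof -
  have s: "Cod S f \<in> Obj S" "Dom S g \<in> Obj S"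
    using f g by simp_all
  let ?C = "Fib B (Cod S f)" and ?D = "Fib B (Dom S g)"
  have M: "monoidal_nat_iso ?C ?D (comp_tfctr ?D (pull B g) (pull B f)) (pull B (f \<star> g)) (can B f g)"
    using tensor_fibred f g by (auto simp: fibred_in_abelian_tensor_categories_def)
  show "can B f g (x \<otimes> y) \<bullet> pull_arr B g (PMu B f x y) \<bullet> PMu B g (pull_obj B f x) (pull_obj B f y) =
      PMu B (f \<star> g) x y \<bullet> TensA (Fib B (Dom S g)) (can B f g x) (can B f g y)"
    if x: "x \<in> Obj X" "fobj \<pi> x = Cod S f" and y: "y \<in> Obj X" "fobj \<pi> y = Cod S f"
  proof -
    have "x \<in> Obj ?C" "y \<in> Obj ?C"
      using x y Obj_Fib[OF s(1)] by blast+
    then have "Comp ?D (can B f g (TensO ?C x y)) (Mu (comp_tfctr ?D (pull B g) (pull B f)) x y) =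
      Comp ?D (Mu (pull B (f \<star> g)) x y) (TensA ?D (can B f g x) (can B f g y))"
      using M unfolding monoidal_nat_iso_def by blast
    then show ?thesis
      by (simp add: Fib_structure(6) s pull_def comp_tfctr_def x TensO)
  qed
  have "Comp ?D (can B f g (Unt ?C)) (Eps (comp_tfctr ?D (pull B g) (pull B f))) = Eps (pull B (f \<star> g))"
    using M unfolding monoidal_nat_iso_def by blast
  then show "can B f g (unit_obj (Cod S f)) \<bullet> pull_arr B g (PEps B f) \<bullet> PEps B g = PEps B (f \<star> g)"
    by (simp add: Fib_structure(6) s pull_def comp_tfctr_def unit_obj_def)
qed

lemma Clv_ident_monoidal:
  assumes s: "s \<in> Obj S"
  shows "x \<in> Obj X \<Longrightarrow> fobj \<pi> x = s \<Longrightarrow> y \<in> Obj X \<Longrightarrow> fobj \<pi> y = s \<Longrightarrow>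
      Clv B (Ident S s) (x \<otimes> y) \<bullet> PMu B (Ident S s) x y =
      TensA (Fib B s) (Clv B (Ident S s) x) (Clv B (Ident S s) y)"
    "Clv B (Ident S s) (unit_obj s) \<bullet> PEps B (Ident S s) = Ident X (unit_obj s)"
proof -
  let ?C = "Fib B s"
  have i: "Ident S s \<in> Arr S" "Dom S (Ident S s) = s" "Cod S (Ident S s) = s"
    using s by simp_all
  have M: "monoidal_nat_iso ?C ?C (pull B (Ident S s)) (id_tfctr ?C) (Clv B (Ident S s))"
    using tensor_fibred s by (auto simp: fibred_in_abelian_tensor_categories_def)
  show "Clv B (Ident S s) (x \<otimes> y) \<bullet> PMu B (Ident S s) x y =
      TensA (Fib B s) (Clv B (Ident S s) x) (Clv B (Ident S s) y)"
    if x: "x \<in> Obj X" "fobj \<pi> x = s" and y: "y \<in> Obj X" "fobj \<pi> y = s"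
  proof -
    have "x \<in> Obj ?C" "y \<in> Obj ?C"
      using x y Obj_Fib[OF s] by blast+
    then have "Comp ?C (Clv B (Ident S s) (TensO ?C x y)) (Mu (pull B (Ident S s)) x y) =
      Comp ?C (Mu (id_tfctr ?C) x y) (TensA ?C (Clv B (Ident S s) x) (Clv B (Ident S s) y))"
      using M unfolding monoidal_nat_iso_def by blast
    then have e: "Clv B (Ident S s) (x \<otimes> y) \<bullet> PMu B (Ident S s) x y =
       Ident X (x \<otimes> y) \<bullet> TensA ?C (Clv B (Ident S s) x) (Clv B (Ident S s) y)"
      by (simp add: Fib_structure(5,6) s pull_def id_tfctr_def x TensO)
    have "Clv B (Ident S s) x \<in> varrs s (pull_obj B (Ident S s) x) x"
      "Clv B (Ident S s) y \<in> varrs s (pull_obj B (Ident S s) y) y"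
      using i x y by (auto intro!: carts_arrs Clv)
    from vtens[OF s this] e show ?thesis
      by (simp add: arrsD)
  qed
  have "Comp ?C (Clv B (Ident S s) (Unt ?C)) (Eps (pull B (Ident S s))) = Eps (id_tfctr ?C)"
    using M unfolding monoidal_nat_iso_def by blast
  then show "Clv B (Ident S s) (unit_obj s) \<bullet> PEps B (Ident S s) = Ident X (unit_obj s)"
    by (simp add: Fib_structure(5,6) s pull_def id_tfctr_def unit_obj_def)
qed

section \<open>Tensor products of arrows over a base arrow\<close>

text \<open>
The factor of an arrow through the chosen lift of its base arrow.
\<close>

definition vert :: "'a \<Rightarrow> 'a" where
  "vert a = (THE d. d \<in> Hom (fib B (Dom S (farr \<pi> a))) (Dom X a) (pull_obj B (farr \<pi> a) (Cod X a)) \<and>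
     Clv B (farr \<pi> a) (Cod X a) \<bullet> d = a)"

lemma Clv_cod: "a \<in> arrs f x y \<Longrightarrow> Clv B f y \<in> carts f (pull_obj B f y) y"
  by (rule Clv) (simp_all add: arrsD)

lemma vert:
  assumes a: "a \<in> arrs f x y"
  shows "vert a \<in> varrs (Dom S f) x (pull_obj B f y)" "Clv B f y \<bullet> vert a = a"
  using the_vertical_factor[OF Clv_cod[OF a] a] by (simp_all add: vert_def arrsD(2-4)[OF a])

lemma vert_eqI:
  assumes a: "\<alpha> \<in> varrs (Dom S f) x (pull_obj B f y)" "Clv B f y \<bullet> \<alpha> = a" and "a \<in> arrs f x y"
  shows "vert a = \<alpha>"
  using cart_cancel[OF Clv_cod[OF assms(3)] vert(1)[OF assms(3)] a(1)] vert(2)[OF assms(3)] a(2) by simp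

lemma vert_cart:
  assumes a: "a \<in> carts f x y"
  shows "vert a \<in> isos (Dom S f) x (pull_obj B f y)"
  by (rule carts_right_factor[OF vert(1)[OF carts_arrs[OF a]] Clv_cod[OF carts_arrs[OF a]], where k = f])
    (simp add: vert(2)[OF carts_arrs[OF a]] a)

text \<open>
  For arrows \<open>a : x' \<rightarrow> x\<close> and \<open>b : y' \<rightarrow> y\<close> over the same \<open>f\<close>, their vertical parts have a tensor product
  \<open>x' \<otimes> y' \<rightarrow> f\<^sup>* x \<otimes> f\<^sup>* y\<close>, and \<open>f\<^sup>* x \<otimes> f\<^sup>* y \<cong> f\<^sup>* (x \<otimes> y)\<close> leads on to \<open>x \<otimes> y\<close>. So the total category is
  itself monoidal relative to the base; \<open>unit_arr f\<close> is its unit on arrows over \<open>f\<close>.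
\<close>

definition tens :: "'a \<Rightarrow> 'a \<Rightarrow> 'a"  (infixr "\<odot>" 75) where
  "a \<odot> b = Clv B (farr \<pi> a) (Cod X a \<otimes> Cod X b) \<bullet> PMu B (farr \<pi> a) (Cod X a) (Cod X b) \<bullet>
     TensA (Fib B (Dom S (farr \<pi> a))) (vert a) (vert b)"

definition unit_arr :: "'f \<Rightarrow> 'a" where
  "unit_arr f = Clv B f (unit_obj (Cod S f)) \<bullet> PEps B f"

lemma tens_eq:
  assumes "a \<in> arrs f x' x" "b \<in> arrs f y' y"
  shows "a \<odot> b = Clv B f (x \<otimes> y) \<bullet> PMu B f x y \<bullet> TensA (Fib B (Dom S f)) (vert a) (vert b)"
  by (simp add: tens_def arrsD(3,4)[OF assms(1)] arrsD(3)[OF assms(2)])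

lemma tens_parts:
  assumes a: "a \<in> arrs f x' x" and b: "b \<in> arrs f y' y"
  shows "Clv B f (x \<otimes> y) \<in> carts f (pull_obj B f (x \<otimes> y)) (x \<otimes> y)"
    "PMu B f x y \<in> isos (Dom S f) (pull_obj B f x \<otimes> pull_obj B f y) (pull_obj B f (x \<otimes> y))"
    "TensA (Fib B (Dom S f)) (vert a) (vert b) \<in> varrs (Dom S f) (x' \<otimes> y') (pull_obj B f x \<otimes> pull_obj B f y)"
    "f \<star> Ident S (Dom S f) = f" "Ident S (Dom S f) \<star> Ident S (Dom S f) = Ident S (Dom S f)"
proof -
  note aD = arrsD[OF a] and bD = arrsD[OF b]
  have e: "fobj \<pi> y = fobj \<pi> x"
    using aD(9) bD(9) by simp
  show "Clv B f (x \<otimes> y) \<in> carts f (pull_obj B f (x \<otimes> y)) (x \<otimes> y)"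
    by (rule Clv) (simp_all add: aD(6,7,9) bD(6) tens_obj e)
  show "PMu B f x y \<in> isos (Dom S f) (pull_obj B f x \<otimes> pull_obj B f y) (pull_obj B f (x \<otimes> y))"
    by (rule PMu) (simp_all add: aD(6,7,9) bD(6) e)
  show "TensA (Fib B (Dom S f)) (vert a) (vert b) \<in> varrs (Dom S f) (x' \<otimes> y') (pull_obj B f x \<otimes> pull_obj B f y)"
    by (rule vtens[OF _ vert(1)[OF a] vert(1)[OF b]]) (simp add: aD(7))
  show "f \<star> Ident S (Dom S f) = f" "Ident S (Dom S f) \<star> Ident S (Dom S f) = Ident S (Dom S f)"
    using aD(7) by simp_all
qed

lemma tens_arrs:
  assumes a: "a \<in> arrs f x' x" and b: "b \<in> arrs f y' y"
  shows "a \<odot> b \<in> arrs f (x' \<otimes> y') (x \<otimes> y)"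
proof -
  note P = tens_parts[OF a b]
  have "Clv B f (x \<otimes> y) \<bullet> PMu B f x y \<bullet> TensA (Fib B (Dom S f)) (vert a) (vert b) \<in>
     arrs (f \<star> Ident S (Dom S f) \<star> Ident S (Dom S f)) (x' \<otimes> y') (x \<otimes> y)"
    by (rule arrs_comp arrs_comp[OF arrs_comp] P(3) carts_arrs[OF P(1)] carts_arrs[OF P(2)])+
  then show ?thesis
    by (simp only: tens_eq[OF a b] P(4,5))
qed

lemmas tens_typing = typing[OF tens_arrs]

lemma tens_carts:
  assumes a: "a \<in> carts f x' x" and b: "b \<in> carts f y' y"
  shows "a \<odot> b \<in> carts f (x' \<otimes> y') (x \<otimes> y)"
proof -
  note aA = carts_arrs[OF a] and bA = carts_arrs[OF b]
  note P = tens_parts[OF aA bA]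
  have "TensA (Fib B (Dom S f)) (vert a) (vert b) \<in> isos (Dom S f) (x' \<otimes> y') (pull_obj B f x \<otimes> pull_obj B f y)"
    by (rule vtens_cart[OF _ vert_cart[OF a] vert_cart[OF b]]) (simp add: arrsD(7)[OF aA])
  from carts_comp[OF carts_comp[OF this P(2)] P(1)] show ?thesis
    by (simp only: tens_eq[OF aA bA] P(4,5))
qed

lemma Clv_Ident:
  assumes s: "s \<in> Obj S" and x: "x \<in> Obj X" "fobj \<pi> x = s"
  shows "Clv B (Ident S s) x \<in> isos s (pull_obj B (Ident S s) x) x"
  by (rule Clv) (simp_all add: s x)

text \<open>
  On vertical arrows the new tensor product is that of the fibre, because \<open>id\<^sup>* \<cong> id\<close> is monoidal.
\<close>

lemma tens_vertical:
  assumes s: "s \<in> Obj S" and a: "a \<in> varrs s x x'" and b: "b \<in> varrs s y y'"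
  shows "TensA (Fib B s) a b = a \<odot> b"
proof -
  note aD = vertD[OF a s] and bD = vertD[OF b s]
  have s': "Dom S (Ident S s) = s" using s by simp
  note va = vert[OF a, unfolded s'] and vb = vert[OF b, unfolded s']
  note P = tens_parts[OF a b, unfolded s']
  have e: "Clv B (Ident S s) (x' \<otimes> y') \<bullet> PMu B (Ident S s) x' y' =
      TensA (Fib B s) (Clv B (Ident S s) x') (Clv B (Ident S s) y')"
    using Clv_ident_monoidal(1)[OF s aD(6,8) bD(6,8)] .
  have "a \<odot> b = TensA (Fib B s) (Clv B (Ident S s) x') (Clv B (Ident S s) y') \<bullet> TensA (Fib B s) (vert a) (vert b)"
    using chain[OF e, of "TensA (Fib B s) (vert a) (vert b)"]
    by (simp add: tens_eq[OF a b] s' cart_typing[OF P(1)] cart_typing[OF P(2)] typing[OF P(3)])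
  also have "\<dots> = TensA (Fib B s) a b"
    using vtens_comp[OF s va(1) carts_arrs[OF Clv_Ident[OF s aD(6,8)]] vb(1) carts_arrs[OF Clv_Ident[OF s bD(6,8)]]] va(2) vb(2)
    by simp
  finally show ?thesis ..
qed

text \<open>
  The vertical part of a composite is given by the formula for the composition of pairs \<open>(f, \<phi>)\<close> in the
  category of tensor functors. Hence that composition becomes plain composition of arrows.
\<close>

lemma vert_comp:
  assumes a: "a \<in> arrs f x' x" and a': "a' \<in> arrs g x'' x'"
  shows "vert (a \<bullet> a') = can B f g x \<bullet> pull_arr B g (vert a) \<bullet> vert a'"
    "can B f g x \<in> isos (Dom S g) (pull_obj B g (pull_obj B f x)) (pull_obj B (f \<star> g) x)"
    "pull_arr B g (vert a) \<in> varrs (Dom S g) (pull_obj B g x') (pull_obj B g (pull_obj B f x))"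
    "Clv B g (pull_obj B f x) \<bullet> pull_arr B g (vert a) = vert a \<bullet> Clv B g x'"
proof -
  note aD = arrsD[OF a] and a'D = arrsD[OF a']
  have g: "Cod S g = Dom S f"
    using aD(8) a'D(9) by simp
  have va: "vert a \<in> varrs (Cod S g) x' (pull_obj B f x)"
    using vert(1)[OF a] by (simp add: g)
  note c = can[OF aD(7) a'D(7) g[symmetric] aD(6) aD(9)[symmetric]]
  show cc: "can B f g x \<in> isos (Dom S g) (pull_obj B g (pull_obj B f x)) (pull_obj B (f \<star> g) x)"
    by (rule c(1))
  note p = pull_arr[OF a'D(7) va]
  show pp: "pull_arr B g (vert a) \<in> varrs (Dom S g) (pull_obj B g x') (pull_obj B g (pull_obj B f x))"
    by (rule p(1))
  show "Clv B g (pull_obj B f x) \<bullet> pull_arr B g (vert a) = vert a \<bullet> Clv B g x'"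
    by (rule p(2))
  have fg: "Dom S (f \<star> g) = Dom S g"
    using aD(7) a'D(7) g by simp
  have i: "Ident S (Dom S g) \<star> Ident S (Dom S g) = Ident S (Dom S g)"
    using a'D(7) by simp
  have comp: "a \<bullet> a' \<in> arrs (f \<star> g) x'' x"
    by (rule arrs_comp[OF a' a])
  have cx: "Clv B f x \<in> carts f (pull_obj B f x) x" and cfg: "Clv B (f \<star> g) x \<in> carts (f \<star> g) (pull_obj B (f \<star> g) x) x"
    and cg: "Clv B g x' \<in> carts g (pull_obj B g x') x'"
    by (rule Clv_cod[OF a] Clv_cod[OF comp] Clv_cod[OF a'])+
  have cgf: "Clv B g (pull_obj B f x) \<in> carts g (pull_obj B g (pull_obj B f x)) (pull_obj B f x)"
    by (rule Clv) (use a'D(7) pull_obj[OF aD(7,6) aD(9)[symmetric]] g in simp_all)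
  note D = cart_typing[OF cx] cart_typing[OF cfg] cart_typing[OF cg]
    cart_typing[OF cgf] cart_typing[OF cc] typing[OF pp] typing[OF va]
    typing[OF vert(1)[OF a']]
  show "vert (a \<bullet> a') = can B f g x \<bullet> pull_arr B g (vert a) \<bullet> vert a'"
  proof (rule vert_eqI[OF _ _ comp])
    show "can B f g x \<bullet> pull_arr B g (vert a) \<bullet> vert a' \<in> varrs (Dom S (f \<star> g)) x'' (pull_obj B (f \<star> g) x)"
      using arrs_comp[OF arrs_comp[OF vert(1)[OF a'] pp] carts_arrs[OF cc]] by (simp add: fg i)
    have "Clv B (f \<star> g) x \<bullet> can B f g x \<bullet> pull_arr B g (vert a) \<bullet> vert a' =
        Clv B f x \<bullet> Clv B g (pull_obj B f x) \<bullet> pull_arr B g (vert a) \<bullet> vert a'"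
      using chain[OF c(2), of "pull_arr B g (vert a) \<bullet> vert a'"] by (simp add: D)
    also have "\<dots> = Clv B f x \<bullet> vert a \<bullet> Clv B g x' \<bullet> vert a'"
      using chain[OF p(2), of "vert a'"] by (simp add: D)
    also have "\<dots> = a \<bullet> a'"
      using chain[OF vert(2)[OF a], of a'] by (simp add: D vert(2)[OF a'] a'D(1-3))
    finally show "Clv B (f \<star> g) x \<bullet> can B f g x \<bullet> pull_arr B g (vert a) \<bullet> vert a' = a \<bullet> a'" .
  qed
qed

text \<open>
  Interchange over a composite base arrow. It combines the monoidality of \<open>g\<^sup>* f\<^sup>* \<cong> (f \<star> g)\<^sup>*\<close> with
  the naturality of the structure isomorphism of \<open>g\<^sup>*\<close>.
\<close>

lemma tens_comp:
  assumes a: "a \<in> arrs f x' x" "a' \<in> arrs g x'' x'" and b: "b \<in> arrs f y' y" "b' \<in> arrs g y'' y'"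
  shows "(a \<bullet> a') \<odot> (b \<bullet> b') = (a \<odot> b) \<bullet> (a' \<odot> b')"
proof -
  note aD = arrsD[OF a(1)] and a'D = arrsD[OF a(2)] and bD = arrsD[OF b(1)] and b'D = arrsD[OF b(2)]
  have g: "Cod S g = Dom S f" and s: "Dom S g \<in> Obj S" "Dom S f \<in> Obj S"
    using aD(7,8,10) a'D(7,9) by simp_all
  have fg: "f \<star> g \<in> Arr S" "Dom S (f \<star> g) = Dom S g"
    using aD(7) a'D(7) g by simp_all
  have xo: "x \<in> Obj X" "fobj \<pi> x = Cod S f" and yo: "y \<in> Obj X" "fobj \<pi> y = Cod S f"
    using aD(6,9) bD(6,9) by simp_all
  have ab: "a \<bullet> a' \<in> arrs (f \<star> g) x'' x" "b \<bullet> b' \<in> arrs (f \<star> g) y'' y"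
    by (rule arrs_comp[OF a(2,1)] arrs_comp[OF b(2,1)])+
  note V = vert_comp[OF a] and W = vert_comp[OF b]
  let ?Dg = "Fib B (Dom S g)" and ?Df = "Fib B (Dom S f)"
  let ?t1 = "TensA ?Dg (can B f g x) (can B f g y)"
  let ?t2 = "TensA ?Dg (pull_arr B g (vert a)) (pull_arr B g (vert b))"
  let ?t3 = "TensA ?Dg (vert a') (vert b')"
  let ?t4 = "TensA ?Df (vert a) (vert b)"
  note va' = vert(1)[OF a(2)] and vb' = vert(1)[OF b(2)]
  have t1: "?t1 \<in> varrs (Dom S g) (pull_obj B g (pull_obj B f x) \<otimes> pull_obj B g (pull_obj B f y)) (pull_obj B (f \<star> g) x \<otimes> pull_obj B (f \<star> g) y)"
    and t2: "?t2 \<in> varrs (Dom S g) (pull_obj B g x' \<otimes> pull_obj B g y') (pull_obj B g (pull_obj B f x) \<otimes> pull_obj B g (pull_obj B f y))"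
    and t3: "?t3 \<in> varrs (Dom S g) (x'' \<otimes> y'') (pull_obj B g x' \<otimes> pull_obj B g y')"
    by (rule vtens[OF s(1) carts_arrs[OF V(2)] carts_arrs[OF W(2)]] vtens[OF s(1) V(3) W(3)] vtens[OF s(1) va' vb'])+
  have i: "Ident S (Dom S g) \<star> Ident S (Dom S g) = Ident S (Dom S g)"
    using s by simp
  have "TensA ?Dg (vert (a \<bullet> a')) (vert (b \<bullet> b')) = ?t1 \<bullet> TensA ?Dg (pull_arr B g (vert a) \<bullet> vert a') (pull_arr B g (vert b) \<bullet> vert b')"
    unfolding V(1) W(1)
    by (rule vtens_comp[OF s(1) arrs_comp[OF va' V(3), unfolded i] carts_arrs[OF V(2)]
        arrs_comp[OF vb' W(3), unfolded i] carts_arrs[OF W(2)]])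
  also have "\<dots> = ?t1 \<bullet> ?t2 \<bullet> ?t3"
    using vtens_comp[OF s(1) va' V(3) vb' W(3)] by simp
  finally have e1: "TensA ?Dg (vert (a \<bullet> a')) (vert (b \<bullet> b')) = ?t1 \<bullet> ?t2 \<bullet> ?t3" .
  note P = tens_parts[OF ab, unfolded fg(2)] and Q = tens_parts[OF a(1) b(1)] and R = tens_parts[OF a(2) b(2)]
  have e: "fobj \<pi> y = fobj \<pi> x"
    using aD(9) bD(9) by simp
  have xy: "x \<otimes> y \<in> Obj X" "fobj \<pi> (x \<otimes> y) = Cod S f"
    using tens_obj[OF aD(6) bD(6) e] aD(9) by simp_all
  note c = can[OF aD(7) a'D(7) g[symmetric] xy]
  have pm: "PMu B f x y \<in> varrs (Cod S g) (pull_obj B f x \<otimes> pull_obj B f y) (pull_obj B f (x \<otimes> y))"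
    using carts_arrs[OF Q(2)] by (simp add: g)
  have q4: "?t4 \<in> varrs (Cod S g) (x' \<otimes> y') (pull_obj B f x \<otimes> pull_obj B f y)"
    using Q(3) by (simp add: g)
  note pp = pull_arr[OF a'D(7) pm] and pq = pull_arr[OF a'D(7) q4]
  have va: "vert a \<in> varrs (Cod S g) x' (pull_obj B f x)" and vb: "vert b \<in> varrs (Cod S g) y' (pull_obj B f y)"
    using vert(1)[OF a(1)] vert(1)[OF b(1)] by (simp_all add: g)
  note px = pull_obj[OF aD(7) xo] and py = pull_obj[OF aD(7) yo]
  have pmg: "PMu B g (pull_obj B f x) (pull_obj B f y) \<in> isos (Dom S g) (pull_obj B g (pull_obj B f x) \<otimes> pull_obj B g (pull_obj B f y)) (pull_obj B g (pull_obj B f x \<otimes> pull_obj B f y))"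
    by (rule PMu) (simp_all add: a'D(7) px py g)
  have cg1: "Clv B g (pull_obj B f (x \<otimes> y)) \<in> carts g (pull_obj B g (pull_obj B f (x \<otimes> y))) (pull_obj B f (x \<otimes> y))"
    by (rule Clv) (simp_all add: a'D(7) pull_obj[OF aD(7) xy] g)
  have cg2: "Clv B g (pull_obj B f x \<otimes> pull_obj B f y) \<in> carts g (pull_obj B g (pull_obj B f x \<otimes> pull_obj B f y)) (pull_obj B f x \<otimes> pull_obj B f y)"
    by (rule Clv) (simp_all add: a'D(7) px py g tens_obj)
  note D = cart_typing[OF P(1)] cart_typing[OF P(2)] cart_typing[OF Q(1)]
    cart_typing[OF Q(2)] typing[OF Q(3)] cart_typing[OF R(1)] cart_typing[OF R(2)]
    typing[OF t1] typing[OF t2] typing[OF t3] cart_typing[OF c(1)] typing[OF pp(1)]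
    typing[OF pq(1)] cart_typing[OF pmg] cart_typing[OF cg1] cart_typing[OF cg2]
  have "(a \<bullet> a') \<odot> (b \<bullet> b') = Clv B (f \<star> g) (x \<otimes> y) \<bullet> PMu B (f \<star> g) x y \<bullet> ?t1 \<bullet> ?t2 \<bullet> ?t3"
    unfolding tens_eq[OF ab] fg(2) e1 ..
  also have "\<dots> = Clv B (f \<star> g) (x \<otimes> y) \<bullet> can B f g (x \<otimes> y) \<bullet> pull_arr B g (PMu B f x y) \<bullet>
      PMu B g (pull_obj B f x) (pull_obj B f y) \<bullet> ?t2 \<bullet> ?t3"
    using chain[OF can_monoidal(1)[OF aD(7) a'D(7) g xo yo, symmetric], of "?t2 \<bullet> ?t3"] by (simp add: D)
  also have "\<dots> = Clv B f (x \<otimes> y) \<bullet> Clv B g (pull_obj B f (x \<otimes> y)) \<bullet> pull_arr B g (PMu B f x y) \<bullet>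
      PMu B g (pull_obj B f x) (pull_obj B f y) \<bullet> ?t2 \<bullet> ?t3"
    using chain[OF c(2), of "pull_arr B g (PMu B f x y) \<bullet> PMu B g (pull_obj B f x) (pull_obj B f y) \<bullet> ?t2 \<bullet> ?t3"] by (simp add: D)
  also have "\<dots> = Clv B f (x \<otimes> y) \<bullet> PMu B f x y \<bullet> Clv B g (pull_obj B f x \<otimes> pull_obj B f y) \<bullet>
      PMu B g (pull_obj B f x) (pull_obj B f y) \<bullet> ?t2 \<bullet> ?t3"
    using chain[OF pp(2), of "PMu B g (pull_obj B f x) (pull_obj B f y) \<bullet> ?t2 \<bullet> ?t3"] by (simp add: D)
  also have "\<dots> = Clv B f (x \<otimes> y) \<bullet> PMu B f x y \<bullet> Clv B g (pull_obj B f x \<otimes> pull_obj B f y) \<bullet>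
      pull_arr B g ?t4 \<bullet> PMu B g x' y' \<bullet> ?t3"
    using chain[OF PMu_natural[OF a'D(7) va vb], of ?t3] by (simp add: D g)
  also have "\<dots> = Clv B f (x \<otimes> y) \<bullet> PMu B f x y \<bullet> ?t4 \<bullet> Clv B g (x' \<otimes> y') \<bullet> PMu B g x' y' \<bullet> ?t3"
    using chain[OF pq(2), of "PMu B g x' y' \<bullet> ?t3"] by (simp add: D)
  also have "\<dots> = (a \<odot> b) \<bullet> (a' \<odot> b')"
    unfolding tens_eq[OF a(1) b(1)] tens_eq[OF a(2) b(2)] by (simp add: D)
  finally show ?thesis .
qed

lemma tens_ident:
  assumes "x \<in> Obj X" "y \<in> Obj X" "fobj \<pi> y = fobj \<pi> x"
  shows "Ident X x \<odot> Ident X y = Ident X (x \<otimes> y)"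
proof -
  have s: "fobj \<pi> x \<in> Obj S" using assms by simp
  show ?thesis
    using tens_vertical[OF s arrs_ident[OF assms(1)], of "Ident X y" y y] arrs_ident[OF assms(2)]
      vtens_ident[OF s assms(1) refl assms(2,3)] assms(3) by simp
qed

lemma unit_arr:
  assumes f: "f \<in> Arr S"
  shows "unit_arr f \<in> carts f (unit_obj (Dom S f)) (unit_obj (Cod S f))" "vert (unit_arr f) = PEps B f"
proof -
  have s: "Cod S f \<in> Obj S" using f by simp
  have c: "Clv B f (unit_obj (Cod S f)) \<in> carts f (pull_obj B f (unit_obj (Cod S f))) (unit_obj (Cod S f))"
    by (rule Clv) (simp_all add: f structure_arrs(1,2)[OF s])
  show u: "unit_arr f \<in> carts f (unit_obj (Dom S f)) (unit_obj (Cod S f))"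
    using carts_comp[OF PEps[OF f] c] f by (simp add: unit_arr_def)
  show "vert (unit_arr f) = PEps B f"
    by (rule vert_eqI[OF carts_arrs[OF PEps[OF f]] _ carts_arrs[OF u]]) (simp add: unit_arr_def)
qed

lemma unit_arr_ident: "s \<in> Obj S \<Longrightarrow> unit_arr (Ident S s) = Ident X (unit_obj s)"
  using Clv_ident_monoidal(2)[of s] by (simp add: unit_arr_def)

lemma unit_arr_comp:
  assumes f: "f \<in> Arr S" and g: "g \<in> Arr S" "Cod S g = Dom S f"
  shows "unit_arr (f \<star> g) = unit_arr f \<bullet> unit_arr g"
proof -
  have s: "Cod S f \<in> Obj S" "Cod S g \<in> Obj S" using f g by simp_all
  note u = structure_arrs(1,2)[OF s(1)]
  have fg: "f \<star> g \<in> Arr S" "Dom S (f \<star> g) = Dom S g" "Cod S (f \<star> g) = Cod S f"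
    using f g by simp_all
  have ef: "PEps B f \<in> varrs (Cod S g) (unit_obj (Cod S g)) (pull_obj B f (unit_obj (Cod S f)))"
    using carts_arrs[OF PEps[OF f]] by (simp add: g)
  note eg = carts_arrs[OF PEps[OF g(1)]]
  note p = pull_arr[OF g(1) ef]
  note c = can[OF f g(1) g(2)[symmetric] u]
  have c1: "Clv B f (unit_obj (Cod S f)) \<in> carts f (pull_obj B f (unit_obj (Cod S f))) (unit_obj (Cod S f))"
    and c2: "Clv B (f \<star> g) (unit_obj (Cod S f)) \<in> carts (f \<star> g) (pull_obj B (f \<star> g) (unit_obj (Cod S f))) (unit_obj (Cod S f))"
    and c3: "Clv B g (unit_obj (Cod S g)) \<in> carts g (pull_obj B g (unit_obj (Cod S g))) (unit_obj (Cod S g))"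
    by (rule Clv; simp add: f g fg u structure_arrs(1,2)[OF s(2)[unfolded g(2)]])+
  have c4: "Clv B g (pull_obj B f (unit_obj (Cod S f))) \<in> carts g (pull_obj B g (pull_obj B f (unit_obj (Cod S f)))) (pull_obj B f (unit_obj (Cod S f)))"
    by (rule Clv) (simp_all add: g pull_obj[OF f u])
  note D = typing[OF ef] typing[OF eg] typing[OF p(1)] cart_typing[OF c(1)]
    cart_typing[OF c1] cart_typing[OF c2] cart_typing[OF c3] cart_typing[OF c4]
  have "unit_arr (f \<star> g) = Clv B (f \<star> g) (unit_obj (Cod S f)) \<bullet> can B f g (unit_obj (Cod S f)) \<bullet> pull_arr B g (PEps B f) \<bullet> PEps B g"
    using can_monoidal(2)[OF f g] by (simp add: unit_arr_def fg)
  also have "\<dots> = Clv B f (unit_obj (Cod S f)) \<bullet> Clv B g (pull_obj B f (unit_obj (Cod S f))) \<bullet> pull_arr B g (PEps B f) \<bullet> PEps B g"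
    using chain[OF c(2), of "pull_arr B g (PEps B f) \<bullet> PEps B g"] by (simp add: D)
  also have "\<dots> = Clv B f (unit_obj (Cod S f)) \<bullet> PEps B f \<bullet> Clv B g (unit_obj (Cod S g)) \<bullet> PEps B g"
    using chain[OF p(2), of "PEps B g"] by (simp add: D)
  also have "\<dots> = unit_arr f \<bullet> unit_arr g"
    unfolding unit_arr_def by (simp add: D)
  finally show ?thesis .
qed

lemma vert_tens:
  assumes a: "a \<in> arrs f x' x" and b: "b \<in> arrs f y' y"
  shows "vert (a \<odot> b) = PMu B f x y \<bullet> TensA (Fib B (Dom S f)) (vert a) (vert b)"
proof -
  note P = tens_parts[OF a b]
  have "PMu B f x y \<bullet> TensA (Fib B (Dom S f)) (vert a) (vert b) \<in> varrs (Dom S f) (x' \<otimes> y') (pull_obj B f (x \<otimes> y))"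
    using arrs_comp[OF P(3) carts_arrs[OF P(2)]] by (simp only: P(5))
  then show ?thesis
    by (rule vert_eqI[OF _ _ tens_arrs[OF a b]]) (simp add: tens_eq[OF a b])
qed

lemma vertical_pull:
  assumes f: "f \<in> Arr S" and k: "k \<in> varrs (Cod S f) x y" and h: "h \<in> varrs (Dom S f) z (pull_obj B f x)"
  shows "k \<bullet> Clv B f x \<bullet> h = Clv B f y \<bullet> pull_arr B f k \<bullet> h"
proof -
  have s: "Cod S f \<in> Obj S" using f by simp
  note kD = vertD[OF k s] and p = pull_arr[OF f k]
  note D = cart_typing[OF Clv[OF f kD(5,7)]] cart_typing[OF Clv[OF f kD(6,8)]]
    typing[OF p(1)] typing[OF h] kD(1-3)
  show ?thesis
    using chain[OF p(2), of h] by (simp add: D)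
qed

text \<open>
  The structure isomorphisms of the fibres are natural for all arrows of the total category. Over \<open>f\<close>
  this is naturality in the fibre together with the corresponding axiom of the monoidal functor \<open>f\<^sup>*\<close>.
\<close>

lemma asc_natural:
  assumes a: "a \<in> arrs f x' x" and b: "b \<in> arrs f y' y" and c: "c \<in> arrs f z' z"
  shows "asc x y z \<bullet> ((a \<odot> b) \<odot> c) = (a \<odot> b \<odot> c) \<bullet> asc x' y' z'"
proof -
  note aD = arrsD[OF a] and bD = arrsD[OF b] and cD = arrsD[OF c]
  have f: "f \<in> Arr S" and s: "Dom S f \<in> Obj S" "Cod S f \<in> Obj S" and i: "Ident S (Dom S f) \<star> Ident S (Dom S f) = Ident S (Dom S f)"
    using aD(7) by simp_all
  let ?D = "Fib B (Dom S f)"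
  have o: "fobj \<pi> x = Cod S f" "fobj \<pi> y = Cod S f" "fobj \<pi> z = Cod S f"
    "fobj \<pi> x' = Dom S f" "fobj \<pi> y' = Dom S f" "fobj \<pi> z' = Dom S f"
    using aD(8,9) bD(8,9) cD(8,9) by simp_all
  note px = pull_obj[OF f aD(6) o(1)] and py = pull_obj[OF f bD(6) o(2)] and pz = pull_obj[OF f cD(6) o(3)]
  note va = vert(1)[OF a] and vb = vert(1)[OF b] and vc = vert(1)[OF c]
  note P = tens_parts[OF a b] and Q = tens_parts[OF b c] and R = tens_parts[OF tens_arrs[OF a b] c]
    and T = tens_parts[OF a tens_arrs[OF b c]]
  have ix: "Ident X (pull_obj B f x) \<in> varrs (Dom S f) (pull_obj B f x) (pull_obj B f x)"
    and iz: "Ident X (pull_obj B f z) \<in> varrs (Dom S f) (pull_obj B f z) (pull_obj B f z)"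
    using arrs_ident[OF px(1)] arrs_ident[OF pz(1)] px(2) pz(2) by simp_all
  let ?ab = "TensA ?D (vert a) (vert b)" and ?bc = "TensA ?D (vert b) (vert c)"
  let ?m1 = "TensA ?D (PMu B f x y) (Ident X (pull_obj B f z))" and ?m2 = "TensA ?D (Ident X (pull_obj B f x)) (PMu B f y z)"
  let ?l = "TensA ?D ?ab (vert c)" and ?r = "TensA ?D (vert a) ?bc"
  have m1: "?m1 \<in> varrs (Dom S f) ((pull_obj B f x \<otimes> pull_obj B f y) \<otimes> pull_obj B f z) (pull_obj B f (x \<otimes> y) \<otimes> pull_obj B f z)"
    and m2: "?m2 \<in> varrs (Dom S f) (pull_obj B f x \<otimes> pull_obj B f y \<otimes> pull_obj B f z) (pull_obj B f x \<otimes> pull_obj B f (y \<otimes> z))"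
    and l: "?l \<in> varrs (Dom S f) ((x' \<otimes> y') \<otimes> z') ((pull_obj B f x \<otimes> pull_obj B f y) \<otimes> pull_obj B f z)"
    and r: "?r \<in> varrs (Dom S f) (x' \<otimes> y' \<otimes> z') (pull_obj B f x \<otimes> pull_obj B f y \<otimes> pull_obj B f z)"
    by (rule vtens[OF s(1) carts_arrs[OF P(2)] iz] vtens[OF s(1) ix carts_arrs[OF Q(2)]] vtens[OF s(1) P(3) vc] vtens[OF s(1) va Q(3)])+
  have e1: "TensA ?D (vert (a \<odot> b)) (vert c) = ?m1 \<bullet> ?l"
    using vtens_comp[OF s(1) P(3) carts_arrs[OF P(2)] vc iz] typing[OF vc] by (simp add: vert_tens[OF a b])
  have e2: "TensA ?D (vert a) (vert (b \<odot> c)) = ?m2 \<bullet> ?r"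
    using vtens_comp[OF s(1) va ix Q(3) carts_arrs[OF Q(2)]] typing[OF va] by (simp add: vert_tens[OF b c])
  note A = structure_arrs(3)[OF s(2) aD(6) o(1) bD(6) o(2) cD(6) o(3)]
  note A' = structure_arrs(3)[OF s(1) aD(5) o(4) bD(5) o(5) cD(5) o(6)]
  note A'' = structure_arrs(3)[OF s(1) px py pz]
  note pA = pull_arr[OF f carts_arrs[OF A]]
  note D = cart_typing[OF P(2)] cart_typing[OF Q(2)] cart_typing[OF R(1)]
    cart_typing[OF R(2)] cart_typing[OF T(1)] cart_typing[OF T(2)]
    typing[OF m1] typing[OF m2] typing[OF l] typing[OF r] cart_typing[OF A]
    cart_typing[OF A'] cart_typing[OF A''] typing[OF pA(1)]
  have h: "PMu B f (x \<otimes> y) z \<bullet> ?m1 \<bullet> ?l \<in> varrs (Dom S f) ((x' \<otimes> y') \<otimes> z') (pull_obj B f ((x \<otimes> y) \<otimes> z))"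
    using arrs_comp[OF arrs_comp[OF l m1] carts_arrs[OF R(2)]] by (simp add: D i)
  have "asc x y z \<bullet> ((a \<odot> b) \<odot> c) = asc x y z \<bullet> Clv B f ((x \<otimes> y) \<otimes> z) \<bullet> PMu B f (x \<otimes> y) z \<bullet> ?m1 \<bullet> ?l"
    unfolding tens_eq[OF tens_arrs[OF a b] c] e1 ..
  also have "\<dots> = Clv B f (x \<otimes> y \<otimes> z) \<bullet> pull_arr B f (asc x y z) \<bullet> PMu B f (x \<otimes> y) z \<bullet> ?m1 \<bullet> ?l"
    by (rule vertical_pull[OF f carts_arrs[OF A] h])
  also have "\<dots> = Clv B f (x \<otimes> y \<otimes> z) \<bullet> PMu B f x (y \<otimes> z) \<bullet> ?m2 \<bullet> asc (pull_obj B f x) (pull_obj B f y) (pull_obj B f z) \<bullet> ?l"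
    using chain[OF PMu_coherence(1)[OF f aD(6) o(1) bD(6) o(2) cD(6) o(3)], of ?l] by (simp add: D)
  also have "\<dots> = Clv B f (x \<otimes> y \<otimes> z) \<bullet> PMu B f x (y \<otimes> z) \<bullet> ?m2 \<bullet> ?r \<bullet> asc x' y' z'"
    using vertical_naturality(1)[OF s(1) va vb vc] by simp
  also have "\<dots> = (a \<odot> b \<odot> c) \<bullet> asc x' y' z'"
    unfolding tens_eq[OF a tens_arrs[OF b c]] e2 by (simp add: D)
  finally show ?thesis .
qed

lemma unit_natural:
  assumes a: "a \<in> arrs f x' x"
  shows "lun x \<bullet> (unit_arr f \<odot> a) = a \<bullet> lun x'" "run x \<bullet> (a \<odot> unit_arr f) = a \<bullet> run x'"
proof -
  note aD = arrsD[OF a]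
  have f: "f \<in> Arr S" and s: "Dom S f \<in> Obj S" "Cod S f \<in> Obj S" and i: "Ident S (Dom S f) \<star> Ident S (Dom S f) = Ident S (Dom S f)"
    using aD(7) by simp_all
  let ?D = "Fib B (Dom S f)" and ?u = "unit_obj (Dom S f)"
  have o: "fobj \<pi> x = Cod S f" "fobj \<pi> x' = Dom S f"
    using aD(8,9) by simp_all
  note px = pull_obj[OF f aD(6) o(1)]
  note va = vert(1)[OF a]
  note u = carts_arrs[OF unit_arr(1)[OF f]] and pe = carts_arrs[OF PEps[OF f]]
  note us = structure_arrs(1,2)[OF s(1)]
  note P = tens_parts[OF u a, unfolded unit_arr(2)[OF f]] and Q = tens_parts[OF a u, unfolded unit_arr(2)[OF f]]
  have ix: "Ident X (pull_obj B f x) \<in> varrs (Dom S f) (pull_obj B f x) (pull_obj B f x)"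
    and iu: "Ident X ?u \<in> varrs (Dom S f) ?u ?u"
    using arrs_ident[OF px(1)] arrs_ident[OF us(1)] px(2) us(2) by simp_all
  let ?m1 = "TensA ?D (PEps B f) (Ident X (pull_obj B f x))" and ?m2 = "TensA ?D (Ident X (pull_obj B f x)) (PEps B f)"
  let ?l = "TensA ?D (Ident X ?u) (vert a)" and ?r = "TensA ?D (vert a) (Ident X ?u)"
  note m1 = vtens[OF s(1) pe ix] and m2 = vtens[OF s(1) ix pe] and l = vtens[OF s(1) iu va] and r = vtens[OF s(1) va iu]
  have e1: "TensA ?D (PEps B f) (vert a) = ?m1 \<bullet> ?l"
    using vtens_comp[OF s(1) iu pe va ix] typing[OF va] typing[OF pe] by simp
  have e2: "TensA ?D (vert a) (PEps B f) = ?m2 \<bullet> ?r"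
    using vtens_comp[OF s(1) va ix iu pe] typing[OF va] typing[OF pe] by simp
  note L = carts_arrs[OF structure_arrs(4)[OF s(2) aD(6) o(1)]] and R = carts_arrs[OF structure_arrs(5)[OF s(2) aD(6) o(1)]]
  note L' = carts_arrs[OF structure_arrs(4)[OF s(1) aD(5) o(2)]] and R' = carts_arrs[OF structure_arrs(5)[OF s(1) aD(5) o(2)]]
  note L'' = carts_arrs[OF structure_arrs(4)[OF s(1) px]] and R'' = carts_arrs[OF structure_arrs(5)[OF s(1) px]]
  note pL = pull_arr[OF f L] and pR = pull_arr[OF f R]
  note cx = carts_arrs[OF Clv_cod[OF a]]
  note D = cart_typing[OF P(1)] cart_typing[OF P(2)] cart_typing[OF Q(1)]
    cart_typing[OF Q(2)] typing[OF m1] typing[OF m2] typing[OF l] typing[OF r]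
    typing[OF L] typing[OF R] typing[OF L'] typing[OF R'] typing[OF L''] typing[OF R'']
    typing[OF pL(1)] typing[OF pR(1)] typing[OF cx] typing[OF va]
  have h1: "PMu B f (unit_obj (Cod S f)) x \<bullet> ?m1 \<bullet> ?l \<in> varrs (Dom S f) (?u \<otimes> x') (pull_obj B f (unit_obj (Cod S f) \<otimes> x))"
    using arrs_comp[OF arrs_comp[OF l m1] carts_arrs[OF P(2)]] by (simp add: D i)
  have h2: "PMu B f x (unit_obj (Cod S f)) \<bullet> ?m2 \<bullet> ?r \<in> varrs (Dom S f) (x' \<otimes> ?u) (pull_obj B f (x \<otimes> unit_obj (Cod S f)))"
    using arrs_comp[OF arrs_comp[OF r m2] carts_arrs[OF Q(2)]] by (simp add: D i)
  have "lun x \<bullet> (unit_arr f \<odot> a) = lun x \<bullet> Clv B f (unit_obj (Cod S f) \<otimes> x) \<bullet> PMu B f (unit_obj (Cod S f)) x \<bullet> ?m1 \<bullet> ?l"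
    unfolding tens_eq[OF u a] unit_arr(2)[OF f] e1 ..
  also have "\<dots> = Clv B f x \<bullet> pull_arr B f (lun x) \<bullet> PMu B f (unit_obj (Cod S f)) x \<bullet> ?m1 \<bullet> ?l"
    by (rule vertical_pull[OF f L h1])
  also have "\<dots> = Clv B f x \<bullet> lun (pull_obj B f x) \<bullet> ?l"
    using chain[OF PMu_coherence(2)[OF f aD(6) o(1)], of ?l] by (simp add: D)
  also have "\<dots> = Clv B f x \<bullet> vert a \<bullet> lun x'"
    using vertical_naturality(2)[OF s(1) va] by simp
  also have "\<dots> = a \<bullet> lun x'"
    using chain[OF vert(2)[OF a], of "lun x'"] by (simp add: D)
  finally show "lun x \<bullet> (unit_arr f \<odot> a) = a \<bullet> lun x'" .
  have "run x \<bullet> (a \<odot> unit_arr f) = run x \<bullet> Clv B f (x \<otimes> unit_obj (Cod S f)) \<bullet> PMu B f x (unit_obj (Cod S f)) \<bullet> ?m2 \<bullet> ?r"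
    unfolding tens_eq[OF a u] unit_arr(2)[OF f] e2 ..
  also have "\<dots> = Clv B f x \<bullet> pull_arr B f (run x) \<bullet> PMu B f x (unit_obj (Cod S f)) \<bullet> ?m2 \<bullet> ?r"
    by (rule vertical_pull[OF f R h2])
  also have "\<dots> = Clv B f x \<bullet> run (pull_obj B f x) \<bullet> ?r"
    using chain[OF PMu_coherence(3)[OF f aD(6) o(1)], of ?r] by (simp add: D)
  also have "\<dots> = Clv B f x \<bullet> vert a \<bullet> run x'"
    using vertical_naturality(3)[OF s(1) va] by simp
  also have "\<dots> = a \<bullet> run x'"
    using chain[OF vert(2)[OF a], of "run x'"] by (simp add: D)
  finally show "run x \<bullet> (a \<odot> unit_arr f) = a \<bullet> run x'" .
qed

lemma brd_natural:
  assumes a: "a \<in> arrs f x' x" and b: "b \<in> arrs f y' y"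
  shows "brd x y \<bullet> (a \<odot> b) = (b \<odot> a) \<bullet> brd x' y'"
proof -
  note aD = arrsD[OF a] and bD = arrsD[OF b]
  have f: "f \<in> Arr S" and s: "Dom S f \<in> Obj S" "Cod S f \<in> Obj S" and i: "Ident S (Dom S f) \<star> Ident S (Dom S f) = Ident S (Dom S f)"
    using aD(7) by simp_all
  have o: "fobj \<pi> x = Cod S f" "fobj \<pi> y = Cod S f" "fobj \<pi> x' = Dom S f" "fobj \<pi> y' = Dom S f"
    using aD(8,9) bD(8,9) by simp_all
  note px = pull_obj[OF f aD(6) o(1)] and py = pull_obj[OF f bD(6) o(2)]
  note va = vert(1)[OF a] and vb = vert(1)[OF b]
  note P = tens_parts[OF a b] and Q = tens_parts[OF b a]
  note R = carts_arrs[OF structure_arrs(6)[OF s(2) aD(6) o(1) bD(6) o(2)]]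
  note R' = carts_arrs[OF structure_arrs(6)[OF s(1) aD(5) o(3) bD(5) o(4)]]
  note R'' = carts_arrs[OF structure_arrs(6)[OF s(1) px py]]
  note p = pull_arr[OF f R]
  let ?l = "TensA (Fib B (Dom S f)) (vert a) (vert b)"
  have h: "PMu B f x y \<bullet> ?l \<in> varrs (Dom S f) (x' \<otimes> y') (pull_obj B f (x \<otimes> y))"
    using arrs_comp[OF P(3) carts_arrs[OF P(2)]] by (simp only: i)
  note D = cart_typing[OF P(1)] cart_typing[OF P(2)] typing[OF P(3)]
    cart_typing[OF Q(1)] cart_typing[OF Q(2)] typing[OF Q(3)]
    typing[OF R] typing[OF R'] typing[OF R''] typing[OF p(1)]
  have "brd x y \<bullet> (a \<odot> b) = Clv B f (y \<otimes> x) \<bullet> pull_arr B f (brd x y) \<bullet> PMu B f x y \<bullet> ?l"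
    unfolding tens_eq[OF a b] by (rule vertical_pull[OF f R h])
  also have "\<dots> = Clv B f (y \<otimes> x) \<bullet> PMu B f y x \<bullet> brd (pull_obj B f x) (pull_obj B f y) \<bullet> ?l"
    using chain[OF PMu_coherence(4)[OF f aD(6) o(1) bD(6) o(2)], of ?l] by (simp add: D)
  also have "\<dots> = (b \<odot> a) \<bullet> brd x' y'"
    unfolding tens_eq[OF b a] using vertical_naturality(4)[OF s(1) va vb] by (simp add: D)
  finally show ?thesis .
qed

end

section \<open>Colimits and functors\<close>

text \<open>
  Functors here are only determined on the objects and arrows of their source, so properties are
  transported between functors which agree there.
\<close>

lemma is_colimit_cong:
  assumes J: "category J" and D: "\<And>j. j \<in> Obj J \<Longrightarrow> fobj D j = fobj D' j" "\<And>h. h \<in> Arr J \<Longrightarrow> farr D h = farr D' h"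
    and \<iota>: "\<And>j. j \<in> Obj J \<Longrightarrow> \<iota> j = \<iota>' j"
  shows "is_colimit J C D x \<iota> \<longleftrightarrow> is_colimit J C D' x \<iota>'"
proof -
  have o: "Dom J h \<in> Obj J" "Cod J h \<in> Obj J" if "h \<in> Arr J" for h
    using J that unfolding category_def by blast+
  have "is_cocone J C D y k \<longleftrightarrow> is_cocone J C D' y k" for y k
    by (simp add: is_cocone_def D cong: ball_cong)
  moreover have "is_cocone J C D' x \<iota> \<longleftrightarrow> is_cocone J C D' x \<iota>'"
    by (simp add: is_cocone_def \<iota> o cong: ball_cong)
  ultimately show ?thesis
    by (simp add: is_colimit_def \<iota> cong: ball_cong)
qed

lemma is_functor_comp_fctr:
  assumes J: "category J" and D: "is_functor J C D" and F: "is_functor C C' F"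
  shows "is_functor J C' (comp_fctr F D)"
proof -
  have "Dom J h \<in> Obj J" "Cod J h \<in> Obj J" if "h \<in> Arr J" for h
    using J that unfolding category_def by blast+
  then show ?thesis
    using D F by (simp add: is_functor_def comp_fctr_def Hom_def)
qed

lemma functor_preserves_cocones:
  assumes J: "category J" and D: "is_functor J C D" and F: "is_functor C C' F" and k: "is_cocone J C D x \<iota>"
  shows "is_cocone J C' (comp_fctr F D) (fobj F x) (farr F \<circ> \<iota>)"
proof -
  have o: "Dom J h \<in> Obj J" "Cod J h \<in> Obj J" if "h \<in> Arr J" for h
    using J that unfolding category_def by blast+
  have "Comp C' (farr F (\<iota> (Cod J h))) (farr F (farr D h)) = farr F (\<iota> (Dom J h))" if h: "h \<in> Arr J" for h
  proof -
    have "\<iota> (Cod J h) \<in> Arr C" "Dom C (\<iota> (Cod J h)) = Cod C (farr D h)" "farr D h \<in> Arr C"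
      using k D h o[OF h] by (auto simp: is_cocone_def is_functor_def Hom_def)
    then have "farr F (Comp C (\<iota> (Cod J h)) (farr D h)) = Comp C' (farr F (\<iota> (Cod J h))) (farr F (farr D h))"
      using F by (simp add: is_functor_def)
    then show ?thesis
      using k h by (simp add: is_cocone_def)
  qed
  then show ?thesis
    using k F by (simp add: is_cocone_def is_functor_def comp_fctr_def Hom_def)
qed

section \<open>Tensor functors as models of a list of laws\<close>

text \<open>
  The equations in the definition of a symmetric monoidal functor, one constructor for each kind, with
  the objects or arrows that it speaks about. For a functor \<open>F\<close> into a fibre each law is an equation
  \<open>lhs F l = rhs F l\<close> between vertical arrows with the same source and with a value of \<open>F\<close> as target. Both
  restriction and gluing treat all laws alike, through \<open>law_natural\<close>.
\<close>

datatype ('p, 'q) law = Identity 'p | Composition 'q 'q | Naturality 'q 'q | Associativity 'p 'p 'p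
  | Left_Unit 'p | Right_Unit 'p | Symmetry 'p 'p

locale tensor_functors = tensor_fibration B \<kappa>
  for B :: "('s, 'f, 'x, 'a) fatcat" and \<kappa> :: "'j rel" +
  fixes A :: "('p, 'q) atcat"
  assumes source: "abelian_tensor_category \<kappa> A"
begin

lemma A_monoidal: "symmetric_monoidal A"
  using source by (simp add: abelian_tensor_category_def)

lemma A_category: "category A" and A_tensor: "tensor_bifunctor A"
  using A_monoidal by (simp_all add: symmetric_monoidal_def)

lemma A_simps [simp]:
  "k \<in> Arr A \<Longrightarrow> Dom A k \<in> Obj A" "k \<in> Arr A \<Longrightarrow> Cod A k \<in> Obj A"
  "p \<in> Obj A \<Longrightarrow> Ident A p \<in> Arr A" "p \<in> Obj A \<Longrightarrow> Dom A (Ident A p) = p" "p \<in> Obj A \<Longrightarrow> Cod A (Ident A p) = p"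
  "k \<in> Arr A \<Longrightarrow> l \<in> Arr A \<Longrightarrow> Dom A l = Cod A k \<Longrightarrow> Comp A l k \<in> Arr A"
  "k \<in> Arr A \<Longrightarrow> l \<in> Arr A \<Longrightarrow> Dom A l = Cod A k \<Longrightarrow> Dom A (Comp A l k) = Dom A k"
  "k \<in> Arr A \<Longrightarrow> l \<in> Arr A \<Longrightarrow> Dom A l = Cod A k \<Longrightarrow> Cod A (Comp A l k) = Cod A l"
  using A_category unfolding category_def Hom_def by auto

lemma A_tensor_simps [simp]:
  "p \<in> Obj A \<Longrightarrow> q \<in> Obj A \<Longrightarrow> TensO A p q \<in> Obj A"
  "k \<in> Arr A \<Longrightarrow> l \<in> Arr A \<Longrightarrow> TensA A k l \<in> Arr A"
  "k \<in> Arr A \<Longrightarrow> l \<in> Arr A \<Longrightarrow> Dom A (TensA A k l) = TensO A (Dom A k) (Dom A l)"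
  "k \<in> Arr A \<Longrightarrow> l \<in> Arr A \<Longrightarrow> Cod A (TensA A k l) = TensO A (Cod A k) (Cod A l)"
  using A_tensor unfolding tensor_bifunctor_def Hom_def by auto

lemma A_structure_simps [simp]:
  "Unt A \<in> Obj A"
  "p \<in> Obj A \<Longrightarrow> q \<in> Obj A \<Longrightarrow> r \<in> Obj A \<Longrightarrow> Asc A p q r \<in> Arr A"
  "p \<in> Obj A \<Longrightarrow> q \<in> Obj A \<Longrightarrow> r \<in> Obj A \<Longrightarrow> Dom A (Asc A p q r) = TensO A (TensO A p q) r"
  "p \<in> Obj A \<Longrightarrow> q \<in> Obj A \<Longrightarrow> r \<in> Obj A \<Longrightarrow> Cod A (Asc A p q r) = TensO A p (TensO A q r)"
  "p \<in> Obj A \<Longrightarrow> LUn A p \<in> Arr A" "p \<in> Obj A \<Longrightarrow> Dom A (LUn A p) = TensO A (Unt A) p"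
  "p \<in> Obj A \<Longrightarrow> Cod A (LUn A p) = p"
  "p \<in> Obj A \<Longrightarrow> RUn A p \<in> Arr A" "p \<in> Obj A \<Longrightarrow> Dom A (RUn A p) = TensO A p (Unt A)"
  "p \<in> Obj A \<Longrightarrow> Cod A (RUn A p) = p"
  "p \<in> Obj A \<Longrightarrow> q \<in> Obj A \<Longrightarrow> Brd A p q \<in> Arr A"
  "p \<in> Obj A \<Longrightarrow> q \<in> Obj A \<Longrightarrow> Dom A (Brd A p q) = TensO A p q"
  "p \<in> Obj A \<Longrightarrow> q \<in> Obj A \<Longrightarrow> Cod A (Brd A p q) = TensO A q p"
  using A_monoidal unfolding symmetric_monoidal_def Hom_def by simp_all

text \<open>
  The values and structure isomorphisms of a monoidal functor into the fibre over \<open>s\<close>, with their types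
  but without equations.
\<close>

definition tensor_data :: "'s \<Rightarrow> ('p, 'q, 'x, 'a) tfctr \<Rightarrow> bool" where
  "tensor_data s F \<longleftrightarrow> s \<in> Obj S \<and>
     (\<forall>p\<in>Obj A. fobj F p \<in> Obj X \<and> fobj \<pi> (fobj F p) = s) \<and>
     (\<forall>k\<in>Arr A. farr F k \<in> varrs s (fobj F (Dom A k)) (fobj F (Cod A k))) \<and>
     (\<forall>p\<in>Obj A. \<forall>q\<in>Obj A. Mu F p q \<in> isos s (fobj F p \<otimes> fobj F q) (fobj F (TensO A p q))) \<and>
     Eps F \<in> isos s (unit_obj s) (fobj F (Unt A))"

lemma tensor_dataD:
  assumes "tensor_data s F"
  shows "s \<in> Obj S" "p \<in> Obj A \<Longrightarrow> fobj F p \<in> Obj X" "p \<in> Obj A \<Longrightarrow> fobj \<pi> (fobj F p) = s"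
    "k \<in> Arr A \<Longrightarrow> farr F k \<in> varrs s (fobj F (Dom A k)) (fobj F (Cod A k))"
    "p \<in> Obj A \<Longrightarrow> q \<in> Obj A \<Longrightarrow> Mu F p q \<in> isos s (fobj F p \<otimes> fobj F q) (fobj F (TensO A p q))"
    "Eps F \<in> isos s (unit_obj s) (fobj F (Unt A))"
    "p \<in> Obj A \<Longrightarrow> Ident X (fobj F p) \<in> varrs s (fobj F p) (fobj F p)"
    "p \<in> Obj A \<Longrightarrow> q \<in> Obj A \<Longrightarrow> Mu F p q \<in> varrs s (fobj F p \<otimes> fobj F q) (fobj F (TensO A p q))"
    "Eps F \<in> varrs s (unit_obj s) (fobj F (Unt A))"
  using assms arrs_ident[of "fobj F p"] carts_arrs unfolding tensor_data_def by auto

fun lawful :: "('p, 'q) law \<Rightarrow> bool" where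
  "lawful (Identity p) \<longleftrightarrow> p \<in> Obj A"
| "lawful (Composition l k) \<longleftrightarrow> k \<in> Arr A \<and> l \<in> Arr A \<and> Dom A l = Cod A k"
| "lawful (Naturality k l) \<longleftrightarrow> k \<in> Arr A \<and> l \<in> Arr A"
| "lawful (Associativity p q r) \<longleftrightarrow> p \<in> Obj A \<and> q \<in> Obj A \<and> r \<in> Obj A"
| "lawful (Left_Unit p) \<longleftrightarrow> p \<in> Obj A"
| "lawful (Right_Unit p) \<longleftrightarrow> p \<in> Obj A"
| "lawful (Symmetry p q) \<longleftrightarrow> p \<in> Obj A \<and> q \<in> Obj A"

fun lhs :: "('p, 'q, 'x, 'a) tfctr \<Rightarrow> ('p, 'q) law \<Rightarrow> 'a" where
  "lhs F (Identity p) = farr F (Ident A p)"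
| "lhs F (Composition l k) = farr F (Comp A l k)"
| "lhs F (Naturality k l) = Mu F (Cod A k) (Cod A l) \<bullet> (farr F k \<odot> farr F l)"
| "lhs F (Associativity p q r) = farr F (Asc A p q r) \<bullet> Mu F (TensO A p q) r \<bullet> (Mu F p q \<odot> Ident X (fobj F r))"
| "lhs F (Left_Unit p) = farr F (LUn A p) \<bullet> Mu F (Unt A) p \<bullet> (Eps F \<odot> Ident X (fobj F p))"
| "lhs F (Right_Unit p) = farr F (RUn A p) \<bullet> Mu F p (Unt A) \<bullet> (Ident X (fobj F p) \<odot> Eps F)"
| "lhs F (Symmetry p q) = farr F (Brd A p q) \<bullet> Mu F p q"

fun rhs :: "('p, 'q, 'x, 'a) tfctr \<Rightarrow> ('p, 'q) law \<Rightarrow> 'a" where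
  "rhs F (Identity p) = Ident X (fobj F p)"
| "rhs F (Composition l k) = farr F l \<bullet> farr F k"
| "rhs F (Naturality k l) = farr F (TensA A k l) \<bullet> Mu F (Dom A k) (Dom A l)"
| "rhs F (Associativity p q r) =
     Mu F p (TensO A q r) \<bullet> (Ident X (fobj F p) \<odot> Mu F q r) \<bullet> asc (fobj F p) (fobj F q) (fobj F r)"
| "rhs F (Left_Unit p) = lun (fobj F p)"
| "rhs F (Right_Unit p) = run (fobj F p)"
| "rhs F (Symmetry p q) = Mu F q p \<bullet> brd (fobj F p) (fobj F q)"

fun law_source :: "'s \<Rightarrow> ('p, 'q, 'x, 'a) tfctr \<Rightarrow> ('p, 'q) law \<Rightarrow> 'x" where
  "law_source s F (Identity p) = fobj F p"
| "law_source s F (Composition l k) = fobj F (Dom A k)"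
| "law_source s F (Naturality k l) = fobj F (Dom A k) \<otimes> fobj F (Dom A l)"
| "law_source s F (Associativity p q r) = (fobj F p \<otimes> fobj F q) \<otimes> fobj F r"
| "law_source s F (Left_Unit p) = unit_obj s \<otimes> fobj F p"
| "law_source s F (Right_Unit p) = fobj F p \<otimes> unit_obj s"
| "law_source s F (Symmetry p q) = fobj F p \<otimes> fobj F q"

fun law_target :: "('p, 'q) law \<Rightarrow> 'p" where
  "law_target (Identity p) = p"
| "law_target (Composition l k) = Cod A l"
| "law_target (Naturality k l) = TensO A (Cod A k) (Cod A l)"
| "law_target (Associativity p q r) = TensO A p (TensO A q r)"
| "law_target (Left_Unit p) = p"
| "law_target (Right_Unit p) = p"
| "law_target (Symmetry p q) = TensO A q p"

fun law_family :: "'f \<Rightarrow> ('p \<Rightarrow> 'a) \<Rightarrow> ('p, 'q) law \<Rightarrow> 'a" where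
  "law_family f c (Identity p) = c p"
| "law_family f c (Composition l k) = c (Dom A k)"
| "law_family f c (Naturality k l) = c (Dom A k) \<odot> c (Dom A l)"
| "law_family f c (Associativity p q r) = (c p \<odot> c q) \<odot> c r"
| "law_family f c (Left_Unit p) = unit_arr f \<odot> c p"
| "law_family f c (Right_Unit p) = c p \<odot> unit_arr f"
| "law_family f c (Symmetry p q) = c p \<odot> c q"

lemma law_target: "lawful l \<Longrightarrow> law_target l \<in> Obj A"
  by (cases l) simp_all

lemma vertical_comp:
  assumes "s \<in> Obj S" "a \<in> varrs s x y" "b \<in> varrs s y z"
  shows "b \<bullet> a \<in> varrs s x z"
  using arrs_comp[OF assms(2,3)] assms(1) by simp

lemma law_sides:
  assumes F: "tensor_data s F" and l: "lawful l"
  shows "lhs F l \<in> varrs s (law_source s F l) (fobj F (law_target l))"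
    "rhs F l \<in> varrs s (law_source s F l) (fobj F (law_target l))"
proof -
  note D = tensor_dataD[OF F]
  note s = D(1)
  show "lhs F l \<in> varrs s (law_source s F l) (fobj F (law_target l))"
  proof (cases l)
    case (Naturality k l')
    with l show ?thesis
      by (auto intro!: vertical_comp[OF s tens_arrs D(8)] D(4))
  next
    case (Associativity p q r)
    have "farr F (Asc A p q r) \<in> varrs s (fobj F (TensO A (TensO A p q) r)) (fobj F (TensO A p (TensO A q r)))"
      using D(4)[of "Asc A p q r"] l Associativity by simp
    with Associativity l show ?thesis
      by (auto intro!: vertical_comp[OF s vertical_comp[OF s tens_arrs D(8)]] D(8) D(7))
  next
    case (Left_Unit p)
    have "farr F (LUn A p) \<in> varrs s (fobj F (TensO A (Unt A) p)) (fobj F p)"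
      using D(4)[of "LUn A p"] l Left_Unit by simp
    with Left_Unit l show ?thesis
      by (auto intro!: vertical_comp[OF s vertical_comp[OF s tens_arrs D(8)]] D(9) D(7))
  next
    case (Right_Unit p)
    have "farr F (RUn A p) \<in> varrs s (fobj F (TensO A p (Unt A))) (fobj F p)"
      using D(4)[of "RUn A p"] l Right_Unit by simp
    with Right_Unit l show ?thesis
      by (auto intro!: vertical_comp[OF s vertical_comp[OF s tens_arrs D(8)]] D(9) D(7))
  next
    case (Symmetry p q)
    have "farr F (Brd A p q) \<in> varrs s (fobj F (TensO A p q)) (fobj F (TensO A q p))"
      using D(4)[of "Brd A p q"] l Symmetry by simp
    with Symmetry l show ?thesis
      by (auto intro!: vertical_comp[OF s D(8)])
  next
    case (Identity p)
    with l D(4)[of "Ident A p"] show ?thesis by simp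
  next
    case (Composition l' k)
    with l D(4)[of "Comp A l' k"] show ?thesis by simp
  qed
  show "rhs F l \<in> varrs s (law_source s F l) (fobj F (law_target l))"
  proof (cases l)
    case (Naturality k l')
    have "farr F (TensA A k l') \<in> varrs s (fobj F (TensO A (Dom A k) (Dom A l'))) (fobj F (TensO A (Cod A k) (Cod A l')))"
      using D(4)[of "TensA A k l'"] l Naturality by simp
    with Naturality l show ?thesis
      by (auto intro!: vertical_comp[OF s D(8)])
  next
    case (Associativity p q r)
    with l show ?thesis
      using carts_arrs[OF structure_arrs(3)[OF s]] D(2,3)
      by (auto intro!: vertical_comp[OF s vertical_comp[OF s _ tens_arrs] D(8)] D(7) D(8))
  next
    case (Symmetry p q)
    with l show ?thesis
      using carts_arrs[OF structure_arrs(6)[OF s]] D(2,3) by (auto intro!: vertical_comp[OF s _ D(8)])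
  next
    case (Composition l' k)
    then show ?thesis
      using l D(4)[of l'] D(4)[of k] vertical_comp[OF s] by simp
  qed (use l D(2,3,7) carts_arrs[OF structure_arrs(4)[OF s]] carts_arrs[OF structure_arrs(5)[OF s]] in auto)
qed

text \<open>
  A family of cartesian arrows \<open>F' p \<rightarrow> F p\<close> over \<open>f\<close>, natural and monoidal for the tensor product of arrows
  over \<open>f\<close>. It is the same as a monoidal isomorphism \<open>F' \<rightarrow> f\<^sup>* F\<close>, by \<open>monoidal_nat_iso_iff\<close> below, but no
  pull-back functor occurs in it.
\<close>

definition tensor_family :: "'f \<Rightarrow> ('p, 'q, 'x, 'a) tfctr \<Rightarrow> ('p, 'q, 'x, 'a) tfctr \<Rightarrow> ('p \<Rightarrow> 'a) \<Rightarrow> bool" where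
  "tensor_family f F' F c \<longleftrightarrow>
     (\<forall>p\<in>Obj A. c p \<in> carts f (fobj F' p) (fobj F p)) \<and>
     (\<forall>k\<in>Arr A. c (Cod A k) \<bullet> farr F' k = farr F k \<bullet> c (Dom A k)) \<and>
     (\<forall>p\<in>Obj A. \<forall>q\<in>Obj A. c (TensO A p q) \<bullet> Mu F' p q = Mu F p q \<bullet> (c p \<odot> c q)) \<and>
     c (Unt A) \<bullet> Eps F' = Eps F \<bullet> unit_arr f"

lemma tensor_familyD:
  assumes "tensor_family f F' F c"
  shows "p \<in> Obj A \<Longrightarrow> c p \<in> carts f (fobj F' p) (fobj F p)"
    "k \<in> Arr A \<Longrightarrow> c (Cod A k) \<bullet> farr F' k = farr F k \<bullet> c (Dom A k)"
    "p \<in> Obj A \<Longrightarrow> q \<in> Obj A \<Longrightarrow> c (TensO A p q) \<bullet> Mu F' p q = Mu F p q \<bullet> (c p \<odot> c q)"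
    "c (Unt A) \<bullet> Eps F' = Eps F \<bullet> unit_arr f" "p \<in> Obj A \<Longrightarrow> c p \<in> arrs f (fobj F' p) (fobj F p)"
    "f \<in> Arr S"
proof -
  show "p \<in> Obj A \<Longrightarrow> c p \<in> carts f (fobj F' p) (fobj F p)"
    "k \<in> Arr A \<Longrightarrow> c (Cod A k) \<bullet> farr F' k = farr F k \<bullet> c (Dom A k)"
    "p \<in> Obj A \<Longrightarrow> q \<in> Obj A \<Longrightarrow> c (TensO A p q) \<bullet> Mu F' p q = Mu F p q \<bullet> (c p \<odot> c q)"
    "c (Unt A) \<bullet> Eps F' = Eps F \<bullet> unit_arr f"
    using assms unfolding tensor_family_def by blast+
  show arr: "p \<in> Obj A \<Longrightarrow> c p \<in> arrs f (fobj F' p) (fobj F p)" for p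
    using assms carts_arrs unfolding tensor_family_def by blast
  show "f \<in> Arr S"
    using arrsD(7)[OF arr[OF A_structure_simps(1)]] .
qed

lemma law_family:
  assumes c: "tensor_family f F' F c" and f: "Dom S f = s'" "Cod S f = s" and l: "lawful l"
  shows "law_family f c l \<in> carts f (law_source s' F' l) (law_source s F l)"
  using l tensor_familyD(1)[OF c] unit_arr(1)[OF tensor_familyD(6)[OF c]] f
  by (cases l) (auto intro!: tens_carts)

text \<open>
  Both sides of a law are composed of values of the functor, its structure isomorphisms and the
  structure of the fibre, and a tensor family commutes with each of them. Consequently a law that holds
  for \<open>F\<close> holds for \<open>F'\<close>, since \<open>c\<close> is cartesian; and it holds for \<open>F\<close> if it holds for all members of a
  covering family, since \<open>law_family\<close> is then jointly cancellable.
\<close>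

lemma law_natural:
  assumes F: "tensor_data s F" and F': "tensor_data s' F'" and c: "tensor_family f F' F c"
    and f: "Dom S f = s'" "Cod S f = s" and l: "lawful l"
  shows "lhs F l \<bullet> law_family f c l = c (law_target l) \<bullet> lhs F' l"
    "rhs F l \<bullet> law_family f c l = c (law_target l) \<bullet> rhs F' l"
proof -
  note C = tensor_familyD[OF c] and D = tensor_dataD[OF F] and D' = tensor_dataD[OF F']
  note s = D(1) and s' = D'(1)
  have u: "unit_arr f \<in> arrs f (unit_obj s') (unit_obj s)"
    using carts_arrs[OF unit_arr(1)[OF C(6)]] f by simp
  note cD = typing[OF C(5)]
  note FD = typing[OF D(4)] and MD = typing[OF D(8)]
  note FD' = typing[OF D'(4)] and MD' = typing[OF D'(8)]
  \<comment> \<open>interchange of vertical arrows with the family, on either side\<close>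
  have down: "(b1 \<odot> b2) \<bullet> (a1 \<odot> a2) = (b1 \<bullet> a1) \<odot> (b2 \<bullet> a2)"
    if "b1 \<in> varrs s x y" "a1 \<in> arrs f z x" "b2 \<in> varrs s x' y'" "a2 \<in> arrs f z' x'"
    for b1 a1 b2 a2 x y z x' y' z'
    using tens_comp[OF that(1,2,3,4)] by simp
  have up: "(b1 \<odot> b2) \<bullet> (a1 \<odot> a2) = (b1 \<bullet> a1) \<odot> (b2 \<bullet> a2)"
    if "b1 \<in> arrs f x y" "a1 \<in> varrs s' z x" "b2 \<in> arrs f x' y'" "a2 \<in> varrs s' z' x'"
    for b1 a1 b2 a2 x y z x' y' z'
    using tens_comp[OF that(1,2,3,4)] by simp
  have "lhs F l \<bullet> law_family f c l = c (law_target l) \<bullet> lhs F' l \<and>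
    rhs F l \<bullet> law_family f c l = c (law_target l) \<bullet> rhs F' l"
  proof (cases l)
    case (Identity p)
    with l C(2)[of "Ident A p"] show ?thesis
      by (simp add: cD)
  next
    case (Composition k2 k1)
    with l have k: "k1 \<in> Arr A" "k2 \<in> Arr A" "Dom A k2 = Cod A k1" by auto
    have "(farr F k2 \<bullet> farr F k1) \<bullet> c (Dom A k1) = farr F k2 \<bullet> c (Cod A k1) \<bullet> farr F' k1"
      by (simp add: k cD FD C(2)[OF k(1)])
    also have "\<dots> = c (Cod A k2) \<bullet> farr F' k2 \<bullet> farr F' k1"
      using chain[OF C(2)[OF k(2)], of "farr F' k1"] by (simp add: k cD FD FD')
    finally show ?thesis
      using C(2)[of "Comp A k2 k1"] k by (simp add: Composition)
  next
    case (Naturality k1 k2)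
    with l have k: "k1 \<in> Arr A" "k2 \<in> Arr A" by auto
    let ?cd = "c (Dom A k1) \<odot> c (Dom A k2)" and ?cc = "c (Cod A k1) \<odot> c (Cod A k2)"
    note t1 = tens_typing[OF C(5)[OF A_simps(1)[OF k(1)]] C(5)[OF A_simps(1)[OF k(2)]]]
      and t2 = tens_typing[OF C(5)[OF A_simps(2)[OF k(1)]] C(5)[OF A_simps(2)[OF k(2)]]]
      and t3 = tens_typing[OF D(4)[OF k(1)] D(4)[OF k(2)]] and t4 = tens_typing[OF D'(4)[OF k(1)] D'(4)[OF k(2)]]
    have e: "(farr F k1 \<odot> farr F k2) \<bullet> ?cd = ?cc \<bullet> (farr F' k1 \<odot> farr F' k2)"
      using down[OF D(4)[OF k(1)] C(5) D(4)[OF k(2)] C(5)] up[OF C(5) D'(4)[OF k(1)] C(5) D'(4)[OF k(2)]] C(2) k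
      by simp
    have "(Mu F (Cod A k1) (Cod A k2) \<bullet> (farr F k1 \<odot> farr F k2)) \<bullet> ?cd = Mu F (Cod A k1) (Cod A k2) \<bullet> ?cc \<bullet> (farr F' k1 \<odot> farr F' k2)"
      by (simp add: k t1 t2 t3 t4 MD e)
    also have "\<dots> = c (TensO A (Cod A k1) (Cod A k2)) \<bullet> Mu F' (Cod A k1) (Cod A k2) \<bullet> (farr F' k1 \<odot> farr F' k2)"
      using chain[OF C(3)[of "Cod A k1" "Cod A k2", symmetric], of "farr F' k1 \<odot> farr F' k2"] by (simp add: k t1 t2 t3 t4 MD MD' cD)
    finally have 1: "(Mu F (Cod A k1) (Cod A k2) \<bullet> (farr F k1 \<odot> farr F k2)) \<bullet> ?cd = \<dots>" .
    have "(farr F (TensA A k1 k2) \<bullet> Mu F (Dom A k1) (Dom A k2)) \<bullet> ?cd =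
        farr F (TensA A k1 k2) \<bullet> c (TensO A (Dom A k1) (Dom A k2)) \<bullet> Mu F' (Dom A k1) (Dom A k2)"
      using C(3)[of "Dom A k1" "Dom A k2"] by (simp add: k t1 MD FD)
    also have "\<dots> = c (TensO A (Cod A k1) (Cod A k2)) \<bullet> farr F' (TensA A k1 k2) \<bullet> Mu F' (Dom A k1) (Dom A k2)"
      using chain[OF C(2)[of "TensA A k1 k2"], of "Mu F' (Dom A k1) (Dom A k2)"] by (simp add: k MD' FD' FD cD)
    finally show ?thesis
      using 1 by (simp add: Naturality)
  next
    case (Associativity p q r)
    with l have o: "p \<in> Obj A" "q \<in> Obj A" "r \<in> Obj A" by auto
    note cp = C(5)[OF o(1)] and cq = C(5)[OF o(2)] and cr = C(5)[OF o(3)]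
    note opq = A_tensor_simps(1)[OF o(1,2)] and oqr = A_tensor_simps(1)[OF o(2,3)]
    note cpq = C(5)[OF opq] and cqr = C(5)[OF oqr]
    note ts = tens_typing[OF tens_arrs[OF cp cq] cr] tens_typing[OF cp tens_arrs[OF cq cr]] tens_typing[OF cpq cr] tens_typing[OF cp cqr]
      tens_typing[OF D(8)[OF o(1,2)] D(7)[OF o(3)]] tens_typing[OF D'(8)[OF o(1,2)] D'(7)[OF o(3)]]
      tens_typing[OF D(7)[OF o(1)] D(8)[OF o(2,3)]] tens_typing[OF D'(7)[OF o(1)] D'(8)[OF o(2,3)]]
    note as = carts_arrs[OF structure_arrs(3)[OF s D(2,3)[OF o(1)] D(2,3)[OF o(2)] D(2,3)[OF o(3)]]]
    note as' = carts_arrs[OF structure_arrs(3)[OF s' D'(2,3)[OF o(1)] D'(2,3)[OF o(2)] D'(2,3)[OF o(3)]]]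
    have e1: "(Mu F p q \<odot> Ident X (fobj F r)) \<bullet> ((c p \<odot> c q) \<odot> c r) =
        (c (TensO A p q) \<odot> c r) \<bullet> (Mu F' p q \<odot> Ident X (fobj F' r))"
      using down[OF D(8)[OF o(1,2)] tens_arrs[OF cp cq] D(7)[OF o(3)] cr]
        up[OF cpq D'(8)[OF o(1,2)] cr D'(7)[OF o(3)]] C(3)[OF o(1,2)] by (simp add: cD o)
    have e2: "(Ident X (fobj F p) \<odot> Mu F q r) \<bullet> (c p \<odot> c q \<odot> c r) =
        (c p \<odot> c (TensO A q r)) \<bullet> (Ident X (fobj F' p) \<odot> Mu F' q r)"
      using down[OF D(7)[OF o(1)] cp D(8)[OF o(2,3)] tens_arrs[OF cq cr]]
        up[OF cp D'(7)[OF o(1)] cqr D'(8)[OF o(2,3)]] C(3)[OF o(2,3)] by (simp add: cD o)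
    have "lhs F l \<bullet> law_family f c l = farr F (Asc A p q r) \<bullet> Mu F (TensO A p q) r \<bullet> (c (TensO A p q) \<odot> c r) \<bullet> (Mu F' p q \<odot> Ident X (fobj F' r))"
      using e1 by (simp add: Associativity o ts FD MD)
    also have "\<dots> = farr F (Asc A p q r) \<bullet> c (TensO A (TensO A p q) r) \<bullet> Mu F' (TensO A p q) r \<bullet> (Mu F' p q \<odot> Ident X (fobj F' r))"
      using chain[OF C(3)[OF opq o(3), symmetric], of "Mu F' p q \<odot> Ident X (fobj F' r)"] by (simp add: o ts FD MD MD' cD)
    also have "\<dots> = c (law_target l) \<bullet> lhs F' l"
      using chain[OF C(2)[of "Asc A p q r"], of "Mu F' (TensO A p q) r \<bullet> (Mu F' p q \<odot> Ident X (fobj F' r))"]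
      by (simp add: Associativity o ts FD FD' MD MD' cD)
    finally have 1: "lhs F l \<bullet> law_family f c l = c (law_target l) \<bullet> lhs F' l" .
    have "rhs F l \<bullet> law_family f c l = Mu F p (TensO A q r) \<bullet> (Ident X (fobj F p) \<odot> Mu F q r) \<bullet> (c p \<odot> c q \<odot> c r) \<bullet> asc (fobj F' p) (fobj F' q) (fobj F' r)"
      using asc_natural[OF cp cq cr] by (simp add: Associativity o ts MD typing[OF as])
    also have "\<dots> = Mu F p (TensO A q r) \<bullet> (c p \<odot> c (TensO A q r)) \<bullet> (Ident X (fobj F' p) \<odot> Mu F' q r) \<bullet> asc (fobj F' p) (fobj F' q) (fobj F' r)"
      using chain[OF e2, of "asc (fobj F' p) (fobj F' q) (fobj F' r)"] by (simp add: o ts MD typing[OF as'])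
    also have "\<dots> = c (law_target l) \<bullet> rhs F' l"
      using chain[OF C(3)[OF o(1) oqr, symmetric], of "(Ident X (fobj F' p) \<odot> Mu F' q r) \<bullet> asc (fobj F' p) (fobj F' q) (fobj F' r)"]
      by (simp add: Associativity o ts MD MD' cD typing[OF as'])
    finally show ?thesis
      using 1 by simp
  next
    case (Left_Unit p)
    with l have o: "p \<in> Obj A" by auto
    note cp = C(5)[OF o] and c1 = C(5)[OF A_structure_simps(1)]
    note ts = tens_typing[OF u cp] tens_typing[OF c1 cp] tens_typing[OF D(9) D(7)[OF o]] tens_typing[OF D'(9) D'(7)[OF o]]
    have e: "(Eps F \<odot> Ident X (fobj F p)) \<bullet> (unit_arr f \<odot> c p) = (c (Unt A) \<odot> c p) \<bullet> (Eps F' \<odot> Ident X (fobj F' p))"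
      using down[OF D(9) u D(7)[OF o] cp] up[OF c1 D'(9) cp D'(7)[OF o]] C(4) by (simp add: cD o)
    have "lhs F l \<bullet> law_family f c l = farr F (LUn A p) \<bullet> Mu F (Unt A) p \<bullet> (c (Unt A) \<odot> c p) \<bullet> (Eps F' \<odot> Ident X (fobj F' p))"
      using e by (simp add: Left_Unit o ts FD MD)
    also have "\<dots> = farr F (LUn A p) \<bullet> c (TensO A (Unt A) p) \<bullet> Mu F' (Unt A) p \<bullet> (Eps F' \<odot> Ident X (fobj F' p))"
      using chain[OF C(3)[OF A_structure_simps(1) o, symmetric], of "Eps F' \<odot> Ident X (fobj F' p)"] by (simp add: o ts FD MD MD' cD)
    also have "\<dots> = c (law_target l) \<bullet> lhs F' l"
      using chain[OF C(2)[of "LUn A p"], of "Mu F' (Unt A) p \<bullet> (Eps F' \<odot> Ident X (fobj F' p))"]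
      by (simp add: Left_Unit o ts FD FD' MD MD' cD)
    finally show ?thesis
      using unit_natural(1)[OF cp] by (simp add: Left_Unit)
  next
    case (Right_Unit p)
    with l have o: "p \<in> Obj A" by auto
    note cp = C(5)[OF o] and c1 = C(5)[OF A_structure_simps(1)]
    note ts = tens_typing[OF cp u] tens_typing[OF cp c1] tens_typing[OF D(7)[OF o] D(9)] tens_typing[OF D'(7)[OF o] D'(9)]
    have e: "(Ident X (fobj F p) \<odot> Eps F) \<bullet> (c p \<odot> unit_arr f) = (c p \<odot> c (Unt A)) \<bullet> (Ident X (fobj F' p) \<odot> Eps F')"
      using down[OF D(7)[OF o] cp D(9) u] up[OF cp D'(7)[OF o] c1 D'(9)] C(4) by (simp add: cD o)
    have "lhs F l \<bullet> law_family f c l = farr F (RUn A p) \<bullet> Mu F p (Unt A) \<bullet> (c p \<odot> c (Unt A)) \<bullet> (Ident X (fobj F' p) \<odot> Eps F')"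
      using e by (simp add: Right_Unit o ts FD MD)
    also have "\<dots> = farr F (RUn A p) \<bullet> c (TensO A p (Unt A)) \<bullet> Mu F' p (Unt A) \<bullet> (Ident X (fobj F' p) \<odot> Eps F')"
      using chain[OF C(3)[OF o A_structure_simps(1), symmetric], of "Ident X (fobj F' p) \<odot> Eps F'"] by (simp add: o ts FD MD MD' cD)
    also have "\<dots> = c (law_target l) \<bullet> lhs F' l"
      using chain[OF C(2)[of "RUn A p"], of "Mu F' p (Unt A) \<bullet> (Ident X (fobj F' p) \<odot> Eps F')"]
      by (simp add: Right_Unit o ts FD FD' MD MD' cD)
    finally show ?thesis
      using unit_natural(2)[OF cp] by (simp add: Right_Unit)
  next
    case (Symmetry p q)
    with l have o: "p \<in> Obj A" "q \<in> Obj A" by auto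
    note cp = C(5)[OF o(1)] and cq = C(5)[OF o(2)]
    note ts = tens_typing[OF cp cq] tens_typing[OF cq cp]
    note br = carts_arrs[OF structure_arrs(6)[OF s D(2,3)[OF o(1)] D(2,3)[OF o(2)]]]
    note br' = carts_arrs[OF structure_arrs(6)[OF s' D'(2,3)[OF o(1)] D'(2,3)[OF o(2)]]]
    have "lhs F l \<bullet> law_family f c l = farr F (Brd A p q) \<bullet> c (TensO A p q) \<bullet> Mu F' p q"
      using C(3)[OF o] by (simp add: Symmetry o ts FD MD)
    also have "\<dots> = c (law_target l) \<bullet> lhs F' l"
      using chain[OF C(2)[of "Brd A p q"], of "Mu F' p q"] by (simp add: Symmetry o ts FD FD' MD MD' cD)
    finally have 1: "lhs F l \<bullet> law_family f c l = c (law_target l) \<bullet> lhs F' l" .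
    have "rhs F l \<bullet> law_family f c l = Mu F q p \<bullet> (c q \<odot> c p) \<bullet> brd (fobj F' p) (fobj F' q)"
      using brd_natural[OF cp cq] by (simp add: Symmetry o ts MD typing[OF br])
    also have "\<dots> = c (law_target l) \<bullet> rhs F' l"
      using chain[OF C(3)[OF o(2,1), symmetric], of "brd (fobj F' p) (fobj F' q)"]
      by (simp add: Symmetry o ts MD MD' cD typing[OF br'])
    finally show ?thesis
      using 1 by simp
  qed
  then show "lhs F l \<bullet> law_family f c l = c (law_target l) \<bullet> lhs F' l"
    "rhs F l \<bullet> law_family f c l = c (law_target l) \<bullet> rhs F' l" by blast+
qed

definition obeys_laws :: "('p, 'q, 'x, 'a) tfctr \<Rightarrow> bool" where
  "obeys_laws F \<longleftrightarrow> (\<forall>l. lawful l \<longrightarrow> lhs F l = rhs F l)"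

text \<open>
  The laws are the axioms of a symmetric monoidal functor, up to bracketing of composites and the
  replacement of the tensor product of the fibre by \<open>\<odot>\<close>.
\<close>

lemma laws_in_fibre:
  assumes F: "tensor_data s F"
  shows "p \<in> Obj A \<Longrightarrow> farr F (Ident A p) = Ident (Fib B s) (fobj F p) \<longleftrightarrow> lhs F (Identity p) = rhs F (Identity p)"
    "k \<in> Arr A \<Longrightarrow> l \<in> Arr A \<Longrightarrow> farr F (Comp A l k) = Comp (Fib B s) (farr F l) (farr F k) \<longleftrightarrow>
       lhs F (Composition l k) = rhs F (Composition l k)"
    "k \<in> Arr A \<Longrightarrow> l \<in> Arr A \<Longrightarrow>
       Comp (Fib B s) (Mu F (Cod A k) (Cod A l)) (TensA (Fib B s) (farr F k) (farr F l)) =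
         Comp (Fib B s) (farr F (TensA A k l)) (Mu F (Dom A k) (Dom A l)) \<longleftrightarrow>
       lhs F (Naturality k l) = rhs F (Naturality k l)"
    "p \<in> Obj A \<Longrightarrow> q \<in> Obj A \<Longrightarrow> r \<in> Obj A \<Longrightarrow>
       Comp (Fib B s) (Comp (Fib B s) (farr F (Asc A p q r)) (Mu F (TensO A p q) r)) (TensA (Fib B s) (Mu F p q) (Ident (Fib B s) (fobj F r))) =
         Comp (Fib B s) (Comp (Fib B s) (Mu F p (TensO A q r)) (TensA (Fib B s) (Ident (Fib B s) (fobj F p)) (Mu F q r)))
           (Asc (Fib B s) (fobj F p) (fobj F q) (fobj F r)) \<longleftrightarrow>
       lhs F (Associativity p q r) = rhs F (Associativity p q r)"
    "p \<in> Obj A \<Longrightarrow>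
       Comp (Fib B s) (Comp (Fib B s) (farr F (LUn A p)) (Mu F (Unt A) p)) (TensA (Fib B s) (Eps F) (Ident (Fib B s) (fobj F p))) =
         LUn (Fib B s) (fobj F p) \<longleftrightarrow> lhs F (Left_Unit p) = rhs F (Left_Unit p)"
    "p \<in> Obj A \<Longrightarrow>
       Comp (Fib B s) (Comp (Fib B s) (farr F (RUn A p)) (Mu F p (Unt A))) (TensA (Fib B s) (Ident (Fib B s) (fobj F p)) (Eps F)) =
         RUn (Fib B s) (fobj F p) \<longleftrightarrow> lhs F (Right_Unit p) = rhs F (Right_Unit p)"
    "p \<in> Obj A \<Longrightarrow> q \<in> Obj A \<Longrightarrow>
       Comp (Fib B s) (farr F (Brd A p q)) (Mu F p q) = Comp (Fib B s) (Mu F q p) (Brd (Fib B s) (fobj F p) (fobj F q)) \<longleftrightarrow>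
       lhs F (Symmetry p q) = rhs F (Symmetry p q)"
proof -
  note D = tensor_dataD[OF F]
  note s = D(1)
  note V = tens_vertical[OF s]
  note FD = typing[OF D(4)] and MD = typing[OF D(8)]
  note S' = Fib_structure(5,6)[OF s]
  show "p \<in> Obj A \<Longrightarrow> farr F (Ident A p) = Ident (Fib B s) (fobj F p) \<longleftrightarrow> lhs F (Identity p) = rhs F (Identity p)" for p
    by (simp add: S')
  show "k \<in> Arr A \<Longrightarrow> l \<in> Arr A \<Longrightarrow> farr F (Comp A l k) = Comp (Fib B s) (farr F l) (farr F k) \<longleftrightarrow>
       lhs F (Composition l k) = rhs F (Composition l k)" for k l
    by (simp add: S')
  show "k \<in> Arr A \<Longrightarrow> l \<in> Arr A \<Longrightarrow>
       Comp (Fib B s) (Mu F (Cod A k) (Cod A l)) (TensA (Fib B s) (farr F k) (farr F l)) =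
         Comp (Fib B s) (farr F (TensA A k l)) (Mu F (Dom A k) (Dom A l)) \<longleftrightarrow>
       lhs F (Naturality k l) = rhs F (Naturality k l)" for k l
    by (simp add: S' V[OF D(4) D(4)])
  show "Comp (Fib B s) (Comp (Fib B s) (farr F (Asc A p q r)) (Mu F (TensO A p q) r)) (TensA (Fib B s) (Mu F p q) (Ident (Fib B s) (fobj F r))) =
         Comp (Fib B s) (Comp (Fib B s) (Mu F p (TensO A q r)) (TensA (Fib B s) (Ident (Fib B s) (fobj F p)) (Mu F q r)))
           (Asc (Fib B s) (fobj F p) (fobj F q) (fobj F r)) \<longleftrightarrow>
       lhs F (Associativity p q r) = rhs F (Associativity p q r)"
    if o: "p \<in> Obj A" "q \<in> Obj A" "r \<in> Obj A"
  proof -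
    note as = carts_arrs[OF structure_arrs(3)[OF s D(2,3)[OF o(1)] D(2,3)[OF o(2)] D(2,3)[OF o(3)]]]
    have e: "Asc (Fib B s) (fobj F p) (fobj F q) (fobj F r) = asc (fobj F p) (fobj F q) (fobj F r)"
      by (simp add: asc_def D(3)[OF o(1)])
    show ?thesis
      unfolding e
      by (simp add: S' V[OF D(8)[OF o(1,2)] D(7)[OF o(3)]] V[OF D(7)[OF o(1)] D(8)[OF o(2,3)]]
          tens_typing[OF D(8)[OF o(1,2)] D(7)[OF o(3)]] tens_typing[OF D(7)[OF o(1)] D(8)[OF o(2,3)]] o FD MD typing[OF as])
  qed
  show "Comp (Fib B s) (Comp (Fib B s) (farr F (LUn A p)) (Mu F (Unt A) p)) (TensA (Fib B s) (Eps F) (Ident (Fib B s) (fobj F p))) =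
         LUn (Fib B s) (fobj F p) \<longleftrightarrow> lhs F (Left_Unit p) = rhs F (Left_Unit p)" if o: "p \<in> Obj A" for p
  proof -
    have e: "LUn (Fib B s) (fobj F p) = lun (fobj F p)"
      by (simp add: lun_def D(3)[OF o])
    show ?thesis
      unfolding e by (simp add: S' V[OF D(9) D(7)[OF o]] tens_typing[OF D(9) D(7)[OF o]] o FD MD)
  qed
  show "Comp (Fib B s) (Comp (Fib B s) (farr F (RUn A p)) (Mu F p (Unt A))) (TensA (Fib B s) (Ident (Fib B s) (fobj F p)) (Eps F)) =
         RUn (Fib B s) (fobj F p) \<longleftrightarrow> lhs F (Right_Unit p) = rhs F (Right_Unit p)" if o: "p \<in> Obj A" for p
  proof -
    have e: "RUn (Fib B s) (fobj F p) = run (fobj F p)"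
      by (simp add: run_def D(3)[OF o])
    show ?thesis
      unfolding e by (simp add: S' V[OF D(7)[OF o] D(9)] tens_typing[OF D(7)[OF o] D(9)] o FD MD)
  qed
  show "Comp (Fib B s) (farr F (Brd A p q)) (Mu F p q) = Comp (Fib B s) (Mu F q p) (Brd (Fib B s) (fobj F p) (fobj F q)) \<longleftrightarrow>
       lhs F (Symmetry p q) = rhs F (Symmetry p q)" if o: "p \<in> Obj A" "q \<in> Obj A" for p q
    by (simp add: S' brd_def D(3)[OF o(1)])
qed

lemma tensor_data_iff:
  assumes s: "s \<in> Obj S"
  shows "tensor_data s F \<longleftrightarrow>
    (\<forall>p\<in>Obj A. fobj F p \<in> Obj (Fib B s)) \<and>
    (\<forall>k\<in>Arr A. farr F k \<in> Hom (Fib B s) (fobj F (Dom A k)) (fobj F (Cod A k))) \<and>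
    (\<forall>p\<in>Obj A. \<forall>q\<in>Obj A. is_iso (Fib B s) (Mu F p q) \<and>
       Mu F p q \<in> Hom (Fib B s) (TensO (Fib B s) (fobj F p) (fobj F q)) (fobj F (TensO A p q))) \<and>
    is_iso (Fib B s) (Eps F) \<and> Eps F \<in> Hom (Fib B s) (Unt (Fib B s)) (fobj F (Unt A))"
proof -
  have "(\<forall>p\<in>Obj A. \<forall>q\<in>Obj A. Mu F p q \<in> isos s (TensO (Fib B s) (fobj F p) (fobj F q)) (fobj F (TensO A p q))) \<longleftrightarrow>
     (\<forall>p\<in>Obj A. \<forall>q\<in>Obj A. Mu F p q \<in> isos s (fobj F p \<otimes> fobj F q) (fobj F (TensO A p q)))"
    if "\<forall>p\<in>Obj A. fobj F p \<in> Obj X \<and> fobj \<pi> (fobj F p) = s"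
    using that by (intro ball_cong refl) (simp add: TensO[OF s])
  then show ?thesis
    unfolding tensor_data_def is_iso_Fib[OF s] unit_obj_def[symmetric] Obj_Fib[OF s]
    unfolding Hom_Fib[OF s] using s by blast
qed

lemma symmetric_strong_monoidal_iff:
  assumes s: "s \<in> Obj S"
  shows "symmetric_strong_monoidal A (Fib B s) F \<longleftrightarrow> tensor_data s F \<and> obeys_laws F"
proof
  assume M: "symmetric_strong_monoidal A (Fib B s) F"
  note M' = M[unfolded symmetric_strong_monoidal_def is_functor_def]
  have td: "tensor_data s F"
    unfolding tensor_data_iff[OF s] using M' by simp
  note L = laws_in_fibre[OF td]
  have "lhs F l = rhs F l" if "lawful l" for l
  proof (cases l)
    case (Identity p)
    then show ?thesis using that L(1) M' by simp
  next
    case (Composition k2 k1)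
    then show ?thesis using that L(2)[of k1 k2] M' by simp
  next
    case (Naturality k1 k2)
    then have "Comp (Fib B s) (Mu F (Cod A k1) (Cod A k2)) (TensA (Fib B s) (farr F k1) (farr F k2)) =
         Comp (Fib B s) (farr F (TensA A k1 k2)) (Mu F (Dom A k1) (Dom A k2))"
      using that M' by simp
    then show ?thesis using that L(3)[of k1 k2] Naturality by simp
  next
    case (Associativity p q r)
    then have "Comp (Fib B s) (Comp (Fib B s) (farr F (Asc A p q r)) (Mu F (TensO A p q) r)) (TensA (Fib B s) (Mu F p q) (Ident (Fib B s) (fobj F r))) =
         Comp (Fib B s) (Comp (Fib B s) (Mu F p (TensO A q r)) (TensA (Fib B s) (Ident (Fib B s) (fobj F p)) (Mu F q r)))
           (Asc (Fib B s) (fobj F p) (fobj F q) (fobj F r))"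
      using that M' by simp
    then show ?thesis
      using that L(4)[of p q r] unfolding Associativity lawful.simps by blast
  next
    case (Left_Unit p)
    then have "Comp (Fib B s) (Comp (Fib B s) (farr F (LUn A p)) (Mu F (Unt A) p)) (TensA (Fib B s) (Eps F) (Ident (Fib B s) (fobj F p))) =
         LUn (Fib B s) (fobj F p)"
      using that M' by simp
    then show ?thesis
      using that L(5)[of p] unfolding Left_Unit lawful.simps by blast
  next
    case (Right_Unit p)
    then have "Comp (Fib B s) (Comp (Fib B s) (farr F (RUn A p)) (Mu F p (Unt A))) (TensA (Fib B s) (Ident (Fib B s) (fobj F p)) (Eps F)) =
         RUn (Fib B s) (fobj F p)"
      using that M' by simp
    then show ?thesis
      using that L(6)[of p] unfolding Right_Unit lawful.simps by blast
  next
    case (Symmetry p q)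
    then have "Comp (Fib B s) (farr F (Brd A p q)) (Mu F p q) = Comp (Fib B s) (Mu F q p) (Brd (Fib B s) (fobj F p) (fobj F q))"
      using that M' by simp
    then show ?thesis
      using that L(7)[of p q] unfolding Symmetry lawful.simps by blast
  qed
  with td show "tensor_data s F \<and> obeys_laws F"
    by (simp add: obeys_laws_def)
next
  assume R: "tensor_data s F \<and> obeys_laws F"
  then have td: "tensor_data s F" and law: "\<And>l. lawful l \<Longrightarrow> lhs F l = rhs F l"
    by (simp_all add: obeys_laws_def)
  note L = laws_in_fibre[OF td] and t = td[unfolded tensor_data_iff[OF s]]
  show "symmetric_strong_monoidal A (Fib B s) F"
    unfolding symmetric_strong_monoidal_def is_functor_def
  proof (intro conjI ballI impI)
    show "Comp (Fib B s) (Comp (Fib B s) (farr F (Asc A p q r)) (Mu F (TensO A p q) r)) (TensA (Fib B s) (Mu F p q) (Ident (Fib B s) (fobj F r))) =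
         Comp (Fib B s) (Comp (Fib B s) (Mu F p (TensO A q r)) (TensA (Fib B s) (Ident (Fib B s) (fobj F p)) (Mu F q r)))
           (Asc (Fib B s) (fobj F p) (fobj F q) (fobj F r))" if "p \<in> Obj A" "q \<in> Obj A" "r \<in> Obj A" for p q r
      using L(4)[OF that] law[of "Associativity p q r"] that unfolding lawful.simps by blast
    show "Comp (Fib B s) (Comp (Fib B s) (farr F (LUn A p)) (Mu F (Unt A) p)) (TensA (Fib B s) (Eps F) (Ident (Fib B s) (fobj F p))) =
         LUn (Fib B s) (fobj F p)" if "p \<in> Obj A" for p
      using L(5)[OF that] law[of "Left_Unit p"] that unfolding lawful.simps by blast
    show "Comp (Fib B s) (Comp (Fib B s) (farr F (RUn A p)) (Mu F p (Unt A))) (TensA (Fib B s) (Ident (Fib B s) (fobj F p)) (Eps F)) =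
         RUn (Fib B s) (fobj F p)" if "p \<in> Obj A" for p
      using L(6)[OF that] law[of "Right_Unit p"] that unfolding lawful.simps by blast
    show "Comp (Fib B s) (farr F (Brd A p q)) (Mu F p q) = Comp (Fib B s) (Mu F q p) (Brd (Fib B s) (fobj F p) (fobj F q))"
      if "p \<in> Obj A" "q \<in> Obj A" for p q
      using L(7)[OF that] law[of "Symmetry p q"] that unfolding lawful.simps by blast
    show "Comp (Fib B s) (Mu F (Cod A k) (Cod A l)) (TensA (Fib B s) (farr F k) (farr F l)) =
         Comp (Fib B s) (farr F (TensA A k l)) (Mu F (Dom A k) (Dom A l))" if "k \<in> Arr A" "l \<in> Arr A" for k l
      using L(3)[OF that] law[of "Naturality k l"] that unfolding lawful.simps by blast
    show "farr F (Ident A p) = Ident (Fib B s) (fobj F p)" if "p \<in> Obj A" for p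
      using L(1)[OF that] law[of "Identity p"] that by simp
    show "farr F (Comp A l k) = Comp (Fib B s) (farr F l) (farr F k)" if "k \<in> Arr A" "l \<in> Arr A" "Dom A l = Cod A k" for k l
      using L(2)[OF that(1,2)] law[of "Composition l k"] that by simp
  qed (use t in simp_all)
qed

text \<open>
  Composing with the chosen lifts of \<open>f\<close> is injective on vertical arrows, and it transforms each condition
  on \<open>\<phi>\<close> into the corresponding condition on the family; the structure isomorphism of \<open>f\<^sup>*\<close> is absorbed into
  the definition of \<open>\<odot>\<close>.
\<close>

lemma monoidal_nat_iso_iff:
  assumes f: "f \<in> Arr S" "Dom S f = s'" "Cod S f = s" and F: "tensor_data s F" and F': "tensor_data s' F'"
  shows "monoidal_nat_iso A (Fib B s') F' (comp_tfctr (Fib B s') (pull B f) F) \<phi> \<longleftrightarrow>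
    (\<forall>p\<in>Obj A. \<phi> p \<in> isos s' (fobj F' p) (pull_obj B f (fobj F p))) \<and>
    tensor_family f F' F (\<lambda>p. Clv B f (fobj F p) \<bullet> \<phi> p)" (is "?L \<longleftrightarrow> ?typed \<and> ?R")
proof -
  note D = tensor_dataD[OF F] and D' = tensor_dataD[OF F']
  note s = D(1) and s' = D'(1)
  have fI: "f \<star> Ident S s' = f"
    using f by simp
  have cl: "Clv B f (fobj F p) \<in> carts f (pull_obj B f (fobj F p)) (fobj F p)" if "p \<in> Obj A" for p
    by (rule Clv) (simp_all add: f D(2,3) that)
  have typed: "(\<forall>p\<in>Obj A. is_iso (Fib B s') (\<phi> p) \<and> \<phi> p \<in> Hom (Fib B s') (fobj F' p) (fobj (comp_tfctr (Fib B s') (pull B f) F) p)) \<longleftrightarrow> ?typed"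
    unfolding is_iso_Fib[OF s'] by (simp add: comp_tfctr_def pull_def)
  have "?L \<longleftrightarrow> ?R" if ?typed
  proof -
    note ph = that[rule_format]
    note pa = carts_arrs[OF ph]
    define c where "c p = Clv B f (fobj F p) \<bullet> \<phi> p" for p
    have c: "c p \<in> carts f (fobj F' p) (fobj F p)" if "p \<in> Obj A" for p
      using carts_comp[OF ph[OF that] cl[OF that]] by (simp add: c_def fI)
    have vc: "vert (c p) = \<phi> p" if "p \<in> Obj A" for p
      by (rule vert_eqI[OF _ _ carts_arrs[OF c[OF that]]]) (use pa[OF that] f in \<open>simp_all add: c_def\<close>)
    note clD = cart_typing[OF cl] and paD = typing[OF pa]
    note FD = typing[OF D(4)] and FD' = typing[OF D'(4)] and MD = typing[OF D(8)] and MD' = typing[OF D'(8)]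
      and ED = typing[OF D(9)] and ED' = typing[OF D'(9)]
    have cancel: "a = b \<longleftrightarrow> Clv B f (fobj F p) \<bullet> a = Clv B f (fobj F p) \<bullet> b"
      if "p \<in> Obj A" "a \<in> varrs s' x (pull_obj B f (fobj F p))" "b \<in> varrs s' x (pull_obj B f (fobj F p))" for p a b x
      using cart_cancel[OF cl[OF that(1)] that(2,3)] by metis
    have nat: "\<phi> (Cod A k) \<bullet> farr F' k = pull_arr B f (farr F k) \<bullet> \<phi> (Dom A k) \<longleftrightarrow>
        c (Cod A k) \<bullet> farr F' k = farr F k \<bullet> c (Dom A k)" if k: "k \<in> Arr A" for k
    proof -
      have Fk: "farr F k \<in> varrs (Cod S f) (fobj F (Dom A k)) (fobj F (Cod A k))"
        using D(4)[OF k] by (simp add: f)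
      note p = pull_arr[OF f(1) Fk, unfolded f(2)]
      note pD = typing[OF p(1)]
      have "\<phi> (Cod A k) \<bullet> farr F' k = pull_arr B f (farr F k) \<bullet> \<phi> (Dom A k) \<longleftrightarrow>
        Clv B f (fobj F (Cod A k)) \<bullet> \<phi> (Cod A k) \<bullet> farr F' k = Clv B f (fobj F (Cod A k)) \<bullet> pull_arr B f (farr F k) \<bullet> \<phi> (Dom A k)"
        by (rule cancel[OF _ vertical_comp[OF s' D'(4)[OF k] pa] vertical_comp[OF s' pa p(1)]]) (simp_all add: k)
      also have "Clv B f (fobj F (Cod A k)) \<bullet> pull_arr B f (farr F k) \<bullet> \<phi> (Dom A k) = farr F k \<bullet> c (Dom A k)"
        using chain[OF p(2), of "\<phi> (Dom A k)"] by (simp add: c_def k pD paD clD FD)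
      finally show ?thesis
        by (simp add: c_def k paD clD FD')
    qed
    have mu: "\<phi> (TensO A p q) \<bullet> Mu F' p q = (pull_arr B f (Mu F p q) \<bullet> PMu B f (fobj F p) (fobj F q)) \<bullet> TensA (Fib B s') (\<phi> p) (\<phi> q) \<longleftrightarrow>
        c (TensO A p q) \<bullet> Mu F' p q = Mu F p q \<bullet> (c p \<odot> c q)" if o: "p \<in> Obj A" "q \<in> Obj A" for p q
    proof -
      have M: "Mu F p q \<in> varrs (Cod S f) (fobj F p \<otimes> fobj F q) (fobj F (TensO A p q))"
        using D(8)[OF o] by (simp add: f)
      note P = pull_arr[OF f(1) M, unfolded f(2)]
      note t = tens_parts[OF carts_arrs[OF c[OF o(1)]] carts_arrs[OF c[OF o(2)]], unfolded f(2) vc[OF o(1)] vc[OF o(2)]]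
      note te = tens_eq[OF carts_arrs[OF c[OF o(1)]] carts_arrs[OF c[OF o(2)]], unfolded f(2) vc[OF o(1)] vc[OF o(2)]]
      note tD = cart_typing[OF t(1)] cart_typing[OF t(2)] typing[OF t(3)] typing[OF P(1)]
      let ?t = "TensA (Fib B s') (\<phi> p) (\<phi> q)" and ?m = "PMu B f (fobj F p) (fobj F q)"
      have "\<phi> (TensO A p q) \<bullet> Mu F' p q = pull_arr B f (Mu F p q) \<bullet> ?m \<bullet> ?t \<longleftrightarrow>
        Clv B f (fobj F (TensO A p q)) \<bullet> \<phi> (TensO A p q) \<bullet> Mu F' p q = Clv B f (fobj F (TensO A p q)) \<bullet> pull_arr B f (Mu F p q) \<bullet> ?m \<bullet> ?t"
        by (rule cancel[OF _ vertical_comp[OF s' D'(8)[OF o] pa] vertical_comp[OF s' vertical_comp[OF s' t(3) carts_arrs[OF t(2)]] P(1)]])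
          (simp_all add: o)
      also have "Clv B f (fobj F (TensO A p q)) \<bullet> pull_arr B f (Mu F p q) \<bullet> ?m \<bullet> ?t = Mu F p q \<bullet> (c p \<odot> c q)"
        using chain[OF P(2), of "?m \<bullet> ?t"] by (simp add: te o tD clD MD)
      finally show ?thesis
        by (simp add: c_def[of "TensO A p q"] o paD clD MD' tD)
    qed
    have eps: "\<phi> (Unt A) \<bullet> Eps F' = pull_arr B f (Eps F) \<bullet> PEps B f \<longleftrightarrow> c (Unt A) \<bullet> Eps F' = Eps F \<bullet> unit_arr f"
    proof -
      have E: "Eps F \<in> varrs (Cod S f) (unit_obj s) (fobj F (Unt A))"
        using D(9) by (simp add: f)
      note P = pull_arr[OF f(1) E, unfolded f(2)]
      note pe = carts_arrs[OF PEps[OF f(1)], unfolded f(2,3)]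
      have cu: "Clv B f (unit_obj s) \<in> carts f (pull_obj B f (unit_obj s)) (unit_obj s)"
        by (rule Clv) (simp_all add: f structure_arrs(1,2)[OF s])
      note tD = typing[OF P(1)] typing[OF pe] cart_typing[OF cu]
      have "\<phi> (Unt A) \<bullet> Eps F' = pull_arr B f (Eps F) \<bullet> PEps B f \<longleftrightarrow>
         Clv B f (fobj F (Unt A)) \<bullet> \<phi> (Unt A) \<bullet> Eps F' = Clv B f (fobj F (Unt A)) \<bullet> pull_arr B f (Eps F) \<bullet> PEps B f"
        by (rule cancel[OF _ vertical_comp[OF s' D'(9) pa] vertical_comp[OF s' pe P(1)]]) simp_all
      also have "Clv B f (fobj F (Unt A)) \<bullet> pull_arr B f (Eps F) \<bullet> PEps B f = Eps F \<bullet> unit_arr f"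
        using chain[OF P(2), of "PEps B f"] by (simp add: unit_arr_def f tD clD ED)
      finally show ?thesis
        by (simp add: c_def paD clD ED')
    qed
    have "?L \<longleftrightarrow> (\<forall>k\<in>Arr A. \<phi> (Cod A k) \<bullet> farr F' k = pull_arr B f (farr F k) \<bullet> \<phi> (Dom A k)) \<and>
       (\<forall>p\<in>Obj A. \<forall>q\<in>Obj A. \<phi> (TensO A p q) \<bullet> Mu F' p q =
          (pull_arr B f (Mu F p q) \<bullet> PMu B f (fobj F p) (fobj F q)) \<bullet> TensA (Fib B s') (\<phi> p) (\<phi> q)) \<and>
       \<phi> (Unt A) \<bullet> Eps F' = pull_arr B f (Eps F) \<bullet> PEps B f"
      unfolding monoidal_nat_iso_def typed using that
      by (simp add: comp_tfctr_def pull_def Fib_structure(6)[OF s'])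
    also have "\<dots> \<longleftrightarrow> ?R"
      unfolding tensor_family_def c_def[symmetric] using nat mu eps c by (simp cong: ball_cong)
    finally show ?thesis .
  qed
  moreover have "?typed" if ?L
    using that typed unfolding monoidal_nat_iso_def by simp
  ultimately show ?thesis by blast
qed

lemma functor_of_laws:
  assumes "tensor_data s F" "obeys_laws F"
  shows "is_functor A (Fib B s) F"
proof -
  have "symmetric_strong_monoidal A (Fib B s) F"
    using symmetric_strong_monoidal_iff[OF tensor_dataD(1)[OF assms(1)], of F] assms by blast
  then show ?thesis
    unfolding symmetric_strong_monoidal_def by (rule conjunct1)
qed

lemma tf_objects_iff:
  "(s, F) \<in> tf_objects \<kappa> A B \<longleftrightarrow>
     tensor_data s F \<and> obeys_laws F \<and> preserves_colimits \<kappa> A (Fib B s) F \<and> extensional_tfctr A F"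
  using symmetric_strong_monoidal_iff[of s F] tensor_dataD(1)[of s F]
  unfolding tf_objects_def tensor_functor_def by blast

section \<open>Pulling back a tensor functor\<close>

text \<open>
  The composite \<open>f\<^sup>* F\<close>. Its structure isomorphisms are obtained by factoring through the chosen lifts,
  so that these lifts form a tensor family by construction.
\<close>

definition pulled :: "'f \<Rightarrow> ('p, 'q, 'x, 'a) tfctr \<Rightarrow> ('p, 'q, 'x, 'a) tfctr" where
  "pulled f F = \<lparr>fobj = \<lambda>p\<in>Obj A. pull_obj B f (fobj F p), farr = \<lambda>k\<in>Arr A. pull_arr B f (farr F k),
     Mu = (\<lambda>p q. if p \<in> Obj A \<and> q \<in> Obj A
              then vert (Mu F p q \<bullet> (Clv B f (fobj F p) \<odot> Clv B f (fobj F q))) else undefined),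
     Eps = vert (Eps F \<bullet> unit_arr f)\<rparr>"

lemma pulled:
  assumes F: "tensor_data s F" and f: "f \<in> Arr S" "Dom S f = s'" "Cod S f = s"
  shows "tensor_data s' (pulled f F)" "tensor_family f (pulled f F) F (\<lambda>p. Clv B f (fobj F p))"
    "extensional_tfctr A (pulled f F)"
proof -
  note D = tensor_dataD[OF F]
  have s': "s' \<in> Obj S" using f by auto
  have If: "Ident S s \<star> f = f" using f D(1) by simp
  have cl: "Clv B f (fobj F p) \<in> carts f (pull_obj B f (fobj F p)) (fobj F p)" if "p \<in> Obj A" for p
    by (rule Clv) (simp_all add: f D(2,3) that)
  have mu: "Mu F p q \<bullet> (Clv B f (fobj F p) \<odot> Clv B f (fobj F q)) \<in> carts f (pull_obj B f (fobj F p) \<otimes> pull_obj B f (fobj F q)) (fobj F (TensO A p q))"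
    if "p \<in> Obj A" "q \<in> Obj A" for p q
    using carts_comp[OF tens_carts[OF cl[OF that(1)] cl[OF that(2)]] D(5)[OF that]] by (simp add: If)
  have eps: "Eps F \<bullet> unit_arr f \<in> carts f (unit_obj s') (fobj F (Unt A))"
    using carts_comp[OF unit_arr(1)[OF f(1), unfolded f(2,3)] D(6)] by (simp add: If)
  have fa: "farr F k \<in> varrs (Cod S f) (fobj F (Dom A k)) (fobj F (Cod A k))" if "k \<in> Arr A" for k
    using D(4)[OF that] by (simp add: f)
  show "tensor_data s' (pulled f F)"
    unfolding tensor_data_def
    using s' vert_cart[OF mu] vert_cart[OF eps] pull_obj[OF f(1) D(2), unfolded f] D(3) pull_arr(1)[OF f(1) fa] f(2)
    by (simp add: pulled_def)
  show "tensor_family f (pulled f F) F (\<lambda>p. Clv B f (fobj F p))"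
    unfolding tensor_family_def
    using cl vert(2)[OF carts_arrs[OF mu]] vert(2)[OF carts_arrs[OF eps]] pull_arr(2)[OF f(1) fa]
    by (simp add: pulled_def)
  show "extensional_tfctr A (pulled f F)"
    by (auto simp: extensional_tfctr_def pulled_def extensional_def)
qed

lemma laws_pulled:
  assumes F: "tensor_data s F" and F': "tensor_data s' F'" and c: "tensor_family f F' F c"
    and f: "Dom S f = s'" "Cod S f = s" and law: "obeys_laws F"
  shows "obeys_laws F'"
  unfolding obeys_laws_def
proof (intro allI impI)
  fix l assume l: "lawful l"
  have "c (law_target l) \<bullet> lhs F' l = c (law_target l) \<bullet> rhs F' l"
    using law_natural[OF F F' c f l] law l by (simp add: obeys_laws_def)
  then show "lhs F' l = rhs F' l"
    using cart_cancel[OF tensor_familyD(1)[OF c law_target[OF l]]] law_sides[OF F' l] by blast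
qed

text \<open>
  Here the assumption that the pull-back functors of \<open>B\<close> preserve colimits enters.
\<close>

lemma colimits_pulled:
  assumes F: "tensor_data s F" "obeys_laws F" and f: "f \<in> Arr S" "Dom S f = s'" "Cod S f = s"
    and pres: "preserves_colimits \<kappa> A (Fib B s) F"
  shows "preserves_colimits \<kappa> A (Fib B s') (pulled f F)"
  unfolding preserves_colimits_def
proof (intro allI impI, elim conjE)
  fix J :: "('j, 'j) cat" and D :: "('j, 'j, 'p, 'q) fctr" and x \<iota>
  assume J: "small_category \<kappa> J" and D: "is_functor J A D" and col: "is_colimit J A D x \<iota>"
  have cat: "category J" using J by (simp add: small_category_def)
  have DJ: "fobj D j \<in> Obj A" if "j \<in> Obj J" for j
    using D that by (simp add: is_functor_def)
  have DA: "farr D h \<in> Arr A" if "h \<in> Arr J" for h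
    using D that by (simp add: is_functor_def Hom_def)
  have x: "x \<in> Obj A" and io: "\<iota> j \<in> Arr A" if "j \<in> Obj J" for j
    using col that by (auto simp: is_colimit_def is_cocone_def Hom_def)
  have xo: "x \<in> Obj A"
    using col by (simp add: is_colimit_def is_cocone_def)
  have "is_colimit J (Fib B s) (comp_fctr F D) (fobj F x) (farr F \<circ> \<iota>)"
    using pres J D col unfolding preserves_colimits_def by blast
  moreover have "is_functor J (Fib B s) (comp_fctr F D)"
    by (rule is_functor_comp_fctr[OF cat D functor_of_laws[OF F]])
  ultimately have "is_colimit J (Fib B s') (comp_fctr (pull B f) (comp_fctr F D)) (fobj (pull B f) (fobj F x)) (farr (pull B f) \<circ> (farr F \<circ> \<iota>))"
    using pull_tensor_functor(2)[OF f(1)] J unfolding f preserves_colimits_def by blast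
  then have "is_colimit J (Fib B s') (comp_fctr (pull B f) (comp_fctr F D)) (fobj (pulled f F) x) (farr (pull B f) \<circ> (farr F \<circ> \<iota>))"
    by (simp add: pull_def pulled_def xo)
  then show "is_colimit J (Fib B s') (comp_fctr (pulled f F) D) (fobj (pulled f F) x) (farr (pulled f F) \<circ> \<iota>)"
    by (rule iffD1[OF is_colimit_cong[OF cat], rotated -1])
      (simp_all add: comp_fctr_def pull_def pulled_def DJ DA io)
qed

section \<open>The category of tensor functors\<close>

abbreviation "TF \<equiv> tf_cat \<kappa> A B"

text \<open>
  The cartesian family of an arrow of \<open>TF\<close>, and the arrow with a given family. Families determine
  arrows and compose memberwise, by \<open>tf_eqI\<close> and \<open>tf_comp\<close>; the isomorphism \<open>\<phi>\<close> stored in an arrow is not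
  used directly after that.
\<close>

definition ev :: "('s, 'f, 'x, 'a, 'p, 'q) tf_arr \<Rightarrow> 'p \<Rightarrow> 'a" where
  "ev m p = (case m of (X', Y, f, \<phi>) \<Rightarrow> Clv B f (fobj (snd Y) p) \<bullet> \<phi> p)"

definition mk :: "('s, 'x, 'a, 'p, 'q) tf_obj \<Rightarrow> ('s, 'x, 'a, 'p, 'q) tf_obj \<Rightarrow> 'f \<Rightarrow> ('p \<Rightarrow> 'a) \<Rightarrow> ('s, 'f, 'x, 'a, 'p, 'q) tf_arr" where
  "mk X' Y f c = (X', Y, f, \<lambda>p\<in>Obj A. vert (c p))"

lemma TF_simps [simp]:
  "Obj TF = tf_objects \<kappa> A B" "Dom TF (X', Y, f, \<phi>) = X'" "Cod TF (X', Y, f, \<phi>) = Y"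
  "Dom TF (mk X' Y f c) = X'" "Cod TF (mk X' Y f c) = Y" "farr tf_proj (mk X' Y f c) = f" "fobj tf_proj Z = fst Z"
  by (simp_all add: tf_cat_def mk_def tf_proj_def)

lemma tf_objectD:
  assumes "Y \<in> tf_objects \<kappa> A B"
  shows "fst Y \<in> Obj S" "tensor_data (fst Y) (snd Y)" "obeys_laws (snd Y)" "preserves_colimits \<kappa> A (Fib B (fst Y)) (snd Y)"
    "extensional_tfctr A (snd Y)"
  using assms tf_objects_iff[of "fst Y" "snd Y"] tensor_dataD(1) by auto

lemma tf_arrD:
  assumes m: "m \<in> Arr TF"
  shows "Dom TF m \<in> tf_objects \<kappa> A B" "Cod TF m \<in> tf_objects \<kappa> A B" "farr tf_proj m \<in> Arr S"
    "Dom S (farr tf_proj m) = fst (Dom TF m)" "Cod S (farr tf_proj m) = fst (Cod TF m)"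
    "tensor_family (farr tf_proj m) (snd (Dom TF m)) (snd (Cod TF m)) (ev m)"
    "mk (Dom TF m) (Cod TF m) (farr tf_proj m) (ev m) = m"
proof -
  obtain s' F' s F f \<phi> where e: "m = ((s', F'), (s, F), f, \<phi>)" and X: "(s', F') \<in> tf_objects \<kappa> A B"
    and Y: "(s, F) \<in> tf_objects \<kappa> A B" and f: "f \<in> Hom S s' s" and ext: "\<phi> \<in> extensional (Obj A)"
    and nat: "monoidal_nat_iso A (Fib B s') F' (comp_tfctr (Fib B s') (pull B f) F) \<phi>"
    using m by (auto simp: tf_cat_def)
  have f': "f \<in> Arr S" "Dom S f = s'" "Cod S f = s"
    using f by (simp_all add: Hom_def)
  note N = nat[unfolded monoidal_nat_iso_iff[OF f' tf_objectD(2)[OF Y, simplified] tf_objectD(2)[OF X, simplified]]]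
  have evm: "ev m = (\<lambda>p. Clv B f (fobj F p) \<bullet> \<phi> p)"
    by (simp add: ev_def e fun_eq_iff)
  have fam: "tensor_family f F' F (ev m)"
    unfolding evm using N by blast
  show "Dom TF m \<in> tf_objects \<kappa> A B" "Cod TF m \<in> tf_objects \<kappa> A B" "farr tf_proj m \<in> Arr S"
    "Dom S (farr tf_proj m) = fst (Dom TF m)" "Cod S (farr tf_proj m) = fst (Cod TF m)"
    "tensor_family (farr tf_proj m) (snd (Dom TF m)) (snd (Cod TF m)) (ev m)"
    using X Y f' fam by (simp_all add: e tf_proj_def)
  have "vert (ev m p) = \<phi> p" if "p \<in> Obj A" for p
    by (rule vert_eqI[OF _ _ tensor_familyD(5)[OF fam that]])
      (use N that f' carts_arrs in \<open>auto simp: evm\<close>)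
  then have "(\<lambda>p\<in>Obj A. vert (ev m p)) = \<phi>"
    using ext by (auto simp: fun_eq_iff extensional_def restrict_def)
  then show "mk (Dom TF m) (Cod TF m) (farr tf_proj m) (ev m) = m"
    by (simp add: e mk_def tf_proj_def)
qed

lemma ev_mk: "tensor_family f (snd X') (snd Y) c \<Longrightarrow> p \<in> Obj A \<Longrightarrow> ev (mk X' Y f c) p = c p"
  using vert(2)[OF tensor_familyD(5)] by (simp add: ev_def mk_def)

lemma mk_arr:
  assumes X': "X' \<in> tf_objects \<kappa> A B" and Y: "Y \<in> tf_objects \<kappa> A B" and f: "Dom S f = fst X'" "Cod S f = fst Y"
    and c: "tensor_family f (snd X') (snd Y) c"
  shows "mk X' Y f c \<in> Arr TF"
proof -
  note fA = tensor_familyD(6)[OF c]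
  let ?\<phi> = "\<lambda>p\<in>Obj A. vert (c p)"
  have "tensor_family f (snd X') (snd Y) (\<lambda>p. Clv B f (fobj (snd Y) p) \<bullet> ?\<phi> p)"
    using c vert(2)[OF tensor_familyD(5)[OF c]] unfolding tensor_family_def by simp
  moreover have "\<forall>p\<in>Obj A. ?\<phi> p \<in> isos (fst X') (fobj (snd X') p) (pull_obj B f (fobj (snd Y) p))"
    using vert_cart[OF tensor_familyD(1)[OF c]] f by simp
  ultimately have "monoidal_nat_iso A (Fib B (fst X')) (snd X') (comp_tfctr (Fib B (fst X')) (pull B f) (snd Y)) ?\<phi>"
    using monoidal_nat_iso_iff[OF fA f tf_objectD(2)[OF Y] tf_objectD(2)[OF X']] by blast
  then show ?thesis
    using X' Y f fA by (cases X'; cases Y) (auto simp: tf_cat_def mk_def Hom_def)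
qed

lemma tf_eqI:
  assumes m: "m \<in> Arr TF" and n: "n \<in> Arr TF" and e: "Dom TF m = Dom TF n" "Cod TF m = Cod TF n"
    "farr tf_proj m = farr tf_proj n" "\<And>p. p \<in> Obj A \<Longrightarrow> ev m p = ev n p"
  shows "m = n"
proof -
  have "mk (Dom TF m) (Cod TF m) (farr tf_proj m) (ev m) = mk (Dom TF n) (Cod TF n) (farr tf_proj n) (ev n)"
    unfolding e(1-3) using e(4) by (simp add: mk_def restrict_def fun_eq_iff)
  then show ?thesis
    using tf_arrD(7)[OF m] tf_arrD(7)[OF n] by simp
qed

lemma tensor_family_ident:
  assumes F: "tensor_data s F"
  shows "tensor_family (Ident S s) F F (\<lambda>p. Ident X (fobj F p))"
proof -
  note D = tensor_dataD[OF F]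
  note FD = typing[OF D(4)] and MD = typing[OF D(8)] and ED = typing[OF D(9)]
  have "Ident X (fobj F p) \<in> isos s (fobj F p) (fobj F p)" if "p \<in> Obj A" for p
    by (rule inverse_carts[OF D(7) D(7) D(1)]) (simp_all add: that D(2))
  then show ?thesis
    unfolding tensor_family_def by (simp add: FD MD ED tens_ident D(1,2,3) unit_arr_ident)
qed

lemma tensor_family_comp:
  assumes F: "tensor_data s F" and F': "tensor_data s' F'" and F'': "tensor_data s'' F''"
    and c: "tensor_family f F' F c" "Dom S f = s'" "Cod S f = s" and c': "tensor_family g F'' F' c'" "Dom S g = s''" "Cod S g = s'"
  shows "tensor_family (f \<star> g) F'' F (\<lambda>p. c p \<bullet> c' p)"
proof -
  note D = tensor_dataD[OF F] and D' = tensor_dataD[OF F'] and D'' = tensor_dataD[OF F'']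
  note C = tensor_familyD[OF c(1)] and C' = tensor_familyD[OF c'(1)]
  note FD = typing[OF D(4)] typing[OF D(8)] typing[OF D(9)] and FD' = typing[OF D'(4)] typing[OF D'(8)] typing[OF D'(9)]
    and FD'' = typing[OF D''(4)] typing[OF D''(8)] typing[OF D''(9)]
  note CD = typing[OF C(5)] typing[OF C'(5)]
  note u = typing[OF carts_arrs[OF unit_arr(1)[OF C(6)]], unfolded c(2,3)] typing[OF carts_arrs[OF unit_arr(1)[OF C'(6)]], unfolded c'(2,3)]
  show ?thesis
    unfolding tensor_family_def
  proof (intro conjI ballI)
    show "c p \<bullet> c' p \<in> carts (f \<star> g) (fobj F'' p) (fobj F p)" if "p \<in> Obj A" for p
      by (rule carts_comp[OF C'(1)[OF that] C(1)[OF that]])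
    show "(c (Cod A k) \<bullet> c' (Cod A k)) \<bullet> farr F'' k = farr F k \<bullet> c (Dom A k) \<bullet> c' (Dom A k)" if k: "k \<in> Arr A" for k
      using C'(2)[OF k] chain[OF C(2)[OF k], of "c' (Dom A k)"] k by (simp add: FD FD' FD'' CD)
    show "(c (TensO A p q) \<bullet> c' (TensO A p q)) \<bullet> Mu F'' p q = Mu F p q \<bullet> ((c p \<bullet> c' p) \<odot> (c q \<bullet> c' q))" if o: "p \<in> Obj A" "q \<in> Obj A" for p q
      using C'(3)[OF o] chain[OF C(3)[OF o], of "c' p \<odot> c' q"] o
      by (simp add: FD FD' FD'' CD tens_typing[OF C(5)[OF o(1)] C(5)[OF o(2)]] tens_typing[OF C'(5)[OF o(1)] C'(5)[OF o(2)]]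
          tens_comp[OF C(5)[OF o(1)] C'(5)[OF o(1)] C(5)[OF o(2)] C'(5)[OF o(2)]])
    have "(c (Unt A) \<bullet> c' (Unt A)) \<bullet> Eps F'' = Eps F \<bullet> unit_arr f \<bullet> unit_arr g"
      using C'(4) chain[OF C(4), of "unit_arr g"] by (simp add: FD FD' FD'' CD u)
    then show "(c (Unt A) \<bullet> c' (Unt A)) \<bullet> Eps F'' = Eps F \<bullet> unit_arr (f \<star> g)"
      using unit_arr_comp[OF C(6) C'(6)] c(2) c'(3) by simp
  qed
qed

text \<open>
  The factor \<open>e\<close> is natural and monoidal because the equations may be tested after composing with the
  cartesian arrows \<open>c p\<close>.
\<close>

lemma tensor_family_factor:
  assumes F: "tensor_data s F" and F': "tensor_data s' F'" and F'': "tensor_data s'' F''"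
    and c: "tensor_family f F' F c" "Dom S f = s'" "Cod S f = s" and d: "tensor_family (f \<star> h) F'' F d"
    and h: "h \<in> Arr S" "Dom S h = s''" "Cod S h = s'"
    and e: "\<And>p. p \<in> Obj A \<Longrightarrow> e p \<in> arrs h (fobj F'' p) (fobj F' p)" "\<And>p. p \<in> Obj A \<Longrightarrow> c p \<bullet> e p = d p"
  shows "tensor_family h F'' F' e"
proof -
  note D = tensor_dataD[OF F] and D' = tensor_dataD[OF F'] and D'' = tensor_dataD[OF F'']
  note C = tensor_familyD[OF c(1)] and C' = tensor_familyD[OF d]
  note FD = typing[OF D(4)] typing[OF D(8)] typing[OF D(9)] and FD' = typing[OF D'(4)] typing[OF D'(8)] typing[OF D'(9)]
    and FD'' = typing[OF D''(4)] typing[OF D''(8)] typing[OF D''(9)]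
  note CD = typing[OF C(5)] typing[OF C'(5)] typing[OF e(1)]
  note us = unit_arr(1)[OF C(6), unfolded c(2,3)] unit_arr(1)[OF h(1), unfolded h(2,3)]
  note u = cart_typing[OF us(1)] cart_typing[OF us(2)]
  have I: "h \<star> Ident S s'' = h" "Ident S s' \<star> h = h"
    using h by simp_all
  have A1: "b \<bullet> a \<in> arrs h x z" if "a \<in> varrs s'' x y" "b \<in> arrs h y z" for a b x y z
    using arrs_comp[OF that] I by simp
  have A2: "b \<bullet> a \<in> arrs h x z" if "a \<in> arrs h x y" "b \<in> varrs s' y z" for a b x y z
    using arrs_comp[OF that] I by simp
  show ?thesis
    unfolding tensor_family_def
  proof (intro conjI ballI)
    show "e p \<in> carts h (fobj F'' p) (fobj F' p)" if "p \<in> Obj A" for p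
      by (rule carts_right_factor[OF e(1)[OF that] C(1)[OF that], where k = "f \<star> h"]) (simp add: e(2)[OF that] C'(1)[OF that])
    show "e (Cod A k) \<bullet> farr F'' k = farr F' k \<bullet> e (Dom A k)" if k: "k \<in> Arr A" for k
    proof (rule cart_cancel[OF C(1) A1[OF D''(4)[OF k] e(1)] A2[OF e(1) D'(4)[OF k]]])
      show "c (Cod A k) \<bullet> e (Cod A k) \<bullet> farr F'' k = c (Cod A k) \<bullet> farr F' k \<bullet> e (Dom A k)"
        using C'(2)[OF k] chain[OF e(2)[of "Cod A k"], of "farr F'' k"] chain[OF C(2)[OF k], of "e (Dom A k)"] e(2)[of "Dom A k"] k
        by (simp add: FD FD' FD'' CD)
    qed (simp_all add: k)
    show "e (TensO A p q) \<bullet> Mu F'' p q = Mu F' p q \<bullet> (e p \<odot> e q)" if o: "p \<in> Obj A" "q \<in> Obj A" for p q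
    proof (rule cart_cancel[OF C(1) A1[OF D''(8)[OF o] e(1)] A2[OF tens_arrs[OF e(1)[OF o(1)] e(1)[OF o(2)]] D'(8)[OF o]]])
      have "c (TensO A p q) \<bullet> Mu F' p q \<bullet> (e p \<odot> e q) = Mu F p q \<bullet> (d p \<odot> d q)"
        using chain[OF C(3)[OF o], of "e p \<odot> e q"] tens_comp[OF C(5)[OF o(1)] e(1)[OF o(1)] C(5)[OF o(2)] e(1)[OF o(2)]] e(2) o
        by (simp add: FD FD' CD tens_typing[OF C(5)[OF o(1)] C(5)[OF o(2)]] tens_typing[OF e(1)[OF o(1)] e(1)[OF o(2)]])
      also have "\<dots> = c (TensO A p q) \<bullet> e (TensO A p q) \<bullet> Mu F'' p q"
        using C'(3)[OF o] chain[OF e(2)[of "TensO A p q"], of "Mu F'' p q"] o by (simp add: FD'' CD)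
      finally show "c (TensO A p q) \<bullet> e (TensO A p q) \<bullet> Mu F'' p q = c (TensO A p q) \<bullet> Mu F' p q \<bullet> (e p \<odot> e q)"
        by simp
    qed (simp_all add: o)
    show "e (Unt A) \<bullet> Eps F'' = Eps F' \<bullet> unit_arr h"
    proof (rule cart_cancel[OF C(1) A1[OF D''(9) e(1)] A2[OF carts_arrs[OF us(2)] D'(9)]])
      have "c (Unt A) \<bullet> Eps F' \<bullet> unit_arr h = Eps F \<bullet> unit_arr (f \<star> h)"
        using chain[OF C(4), of "unit_arr h"] unit_arr_comp[OF C(6) h(1)] h(3) c(2) by (simp add: FD FD' CD u)
      also have "\<dots> = c (Unt A) \<bullet> e (Unt A) \<bullet> Eps F''"
        using C'(4) chain[OF e(2)[of "Unt A"], of "Eps F''"] by (simp add: FD'' CD)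
      finally show "c (Unt A) \<bullet> e (Unt A) \<bullet> Eps F'' = c (Unt A) \<bullet> Eps F' \<bullet> unit_arr h"
        by simp
    qed simp_all
  qed
qed

lemma tf_ident:
  assumes Y: "Y \<in> tf_objects \<kappa> A B"
  shows "Ident TF Y \<in> Arr TF" "Dom TF (Ident TF Y) = Y" "Cod TF (Ident TF Y) = Y"
    "farr tf_proj (Ident TF Y) = Ident S (fst Y)" "p \<in> Obj A \<Longrightarrow> ev (Ident TF Y) p = Ident X (fobj (snd Y) p)"
proof -
  note D = tensor_dataD[OF tf_objectD(2)[OF Y]]
  note s = D(1)
  note fam = tensor_family_ident[OF tf_objectD(2)[OF Y]]
  have "vert (Ident X (fobj (snd Y) p)) = inv_arr (fib B (fst Y)) (Clv B (Ident S (fst Y)) (fobj (snd Y) p))" if "p \<in> Obj A" for p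
    using inv_arr_fibre[OF s Clv_Ident[OF s D(2,3)]] that s
    by (intro vert_eqI[OF _ _ D(7)]) (simp_all add: carts_arrs)
  then have e: "Ident TF Y = mk Y Y (Ident S (fst Y)) (\<lambda>p. Ident X (fobj (snd Y) p))"
    by (cases Y) (simp add: tf_cat_def mk_def restrict_def fun_eq_iff)
  show "Ident TF Y \<in> Arr TF" "Dom TF (Ident TF Y) = Y" "Cod TF (Ident TF Y) = Y"
    "farr tf_proj (Ident TF Y) = Ident S (fst Y)"
    unfolding e using mk_arr[OF Y Y _ _ fam] s by simp_all
  show "p \<in> Obj A \<Longrightarrow> ev (Ident TF Y) p = Ident X (fobj (snd Y) p)"
    unfolding e using ev_mk[OF fam] by simp
qed

lemma tf_comp:
  assumes m: "m \<in> Arr TF" and n: "n \<in> Arr TF" and mn: "Dom TF m = Cod TF n"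
  shows "Comp TF m n \<in> Arr TF" "Dom TF (Comp TF m n) = Dom TF n" "Cod TF (Comp TF m n) = Cod TF m"
    "farr tf_proj (Comp TF m n) = farr tf_proj m \<star> farr tf_proj n" "p \<in> Obj A \<Longrightarrow> ev (Comp TF m n) p = ev m p \<bullet> ev n p"
proof -
  note M = tf_arrD[OF m] and N = tf_arrD[OF n]
  note famN = N(6)[folded mn]
  have bN: "Cod S (farr tf_proj n) = fst (Dom TF m)"
    using N(5) mn by simp
  note fam = tensor_family_comp[OF tf_objectD(2)[OF M(2)] tf_objectD(2)[OF M(1)] tf_objectD(2)[OF N(1)] M(6) M(4,5) famN N(4) bN]
  have b: "Dom S (farr tf_proj m \<star> farr tf_proj n) = fst (Dom TF n)" "Cod S (farr tf_proj m \<star> farr tf_proj n) = fst (Cod TF m)"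
    using M(3-5) N(3-5) bN by simp_all
  have "Comp TF m n = mk (Dom TF n) (Cod TF m) (farr tf_proj m \<star> farr tf_proj n) (\<lambda>p. ev m p \<bullet> ev n p)"
  proof -
    obtain X1 Y1 f1 \<phi> where em: "m = (X1, Y1, f1, \<phi>)" by (cases m)
    obtain X2 Y2 f2 \<psi> where en: "n = (X2, Y2, f2, \<psi>)" by (cases n)
    have bm: "farr tf_proj m = f1" "farr tf_proj n = f2"
      by (simp_all add: em en tf_proj_def)
    have phi: "(\<lambda>p\<in>Obj A. vert (ev m p)) = \<phi>" "(\<lambda>p\<in>Obj A. vert (ev n p)) = \<psi>"
      using M(7) N(7) unfolding mk_def by (simp_all add: em en tf_proj_def)
    have vm: "vert (ev m p) = \<phi> p" and vn: "vert (ev n p) = \<psi> p" if "p \<in> Obj A" for p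
      unfolding phi[symmetric] using that by simp_all
    have "(can B f1 f2 (fobj (snd Y1) p) \<bullet> pull_arr B f2 (\<phi> p)) \<bullet> \<psi> p = vert (ev m p \<bullet> ev n p)" if p: "p \<in> Obj A" for p
    proof -
      have a: "ev m p \<in> arrs f1 (fobj (snd X1) p) (fobj (snd Y1) p)" "ev n p \<in> arrs f2 (fobj (snd X2) p) (fobj (snd X1) p)"
        using tensor_familyD(5)[OF M(6) p] tensor_familyD(5)[OF famN p] by (simp_all add: bm) (simp_all add: em en)
      note V = vert_comp[OF a]
      show ?thesis
        unfolding V(1) vm[OF p] vn[OF p]
        using cart_typing[OF V(2)] typing[OF V(3)[unfolded vm[OF p]]] typing[OF vert(1)[OF a(2)], unfolded vn[OF p]]
        by simp
    qed
    then show ?thesis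
      unfolding bm by (simp add: em en tf_cat_def mk_def restrict_def fun_eq_iff)
  qed
  note e = this
  show "Comp TF m n \<in> Arr TF" "Dom TF (Comp TF m n) = Dom TF n" "Cod TF (Comp TF m n) = Cod TF m"
    "farr tf_proj (Comp TF m n) = farr tf_proj m \<star> farr tf_proj n"
    unfolding e using mk_arr[OF N(1) M(2) b fam] by simp_all
  show "p \<in> Obj A \<Longrightarrow> ev (Comp TF m n) p = ev m p \<bullet> ev n p"
    unfolding e using ev_mk[OF fam] by simp
qed

lemma category_TF: "category TF"
proof -
  have ob: "Dom TF m \<in> Obj TF" "Cod TF m \<in> Obj TF" if "m \<in> Arr TF" for m
    using tf_arrD(1,2)[OF that] by simp_all
  have evD: "ev m p \<in> Arr X" "Dom X (ev m p) = fobj (snd (Dom TF m)) p" "Cod X (ev m p) = fobj (snd (Cod TF m)) p"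
    if "m \<in> Arr TF" "p \<in> Obj A" for m p
    using typing[OF tensor_familyD(5)[OF tf_arrD(6)[OF that(1)] that(2)]] by simp_all
  have id1: "Comp TF m (Ident TF (Dom TF m)) = m" if m: "m \<in> Arr TF" for m
  proof -
    note i = tf_ident[OF tf_arrD(1)[OF m]]
    note c = tf_comp[OF m i(1) i(3)[symmetric]]
    show ?thesis
      by (rule tf_eqI[OF c(1) m]) (simp_all add: c i tf_arrD(3,4)[OF m] evD[OF m])
  qed
  have id2: "Comp TF (Ident TF (Cod TF m)) m = m" if m: "m \<in> Arr TF" for m
  proof -
    note i = tf_ident[OF tf_arrD(2)[OF m]]
    note c = tf_comp[OF i(1) m i(2)]
    show ?thesis
      by (rule tf_eqI[OF c(1) m]) (simp_all add: c i tf_arrD(3,5)[OF m] evD[OF m])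
  qed
  have assoc: "Comp TF h (Comp TF g f) = Comp TF (Comp TF h g) f"
    if f: "f \<in> Arr TF" and g: "g \<in> Arr TF" "Dom TF g = Cod TF f" and h: "h \<in> Arr TF" "Dom TF h = Cod TF g" for f g h
  proof -
    note c1 = tf_comp[OF g(1) f g(2)] and c2 = tf_comp[OF h(1) g(1) h(2)]
    note c3 = tf_comp[OF h(1) c1(1) h(2)[folded c1(3)]] and c4 = tf_comp[OF c2(1) f g(2)[folded c2(2)]]
    show ?thesis
      by (rule tf_eqI[OF c3(1) c4(1)])
        (simp_all add: c1 c2 c3 c4 tf_arrD(3-5)[OF f] tf_arrD(3-5)[OF g(1)] tf_arrD(3-5)[OF h(1)] g h evD[OF f] evD[OF g(1)] evD[OF h(1)])
  qed
  show ?thesis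
    unfolding category_def Hom_def using ob tf_ident tf_comp id1 id2 assoc by simp
qed

text \<open>
  Factor memberwise. Since all arrows are cartesian, the fibres will be groupoids.
\<close>

lemma tf_cartesian:
  assumes m: "m \<in> Arr TF"
  shows "cartesian S TF tf_proj m"
  unfolding cartesian_def
proof (intro conjI ballI impI m)
  fix b h assume b: "b \<in> Arr TF" and h: "h \<in> Hom S (fobj tf_proj (Dom TF b)) (fobj tf_proj (Dom TF m))"
    and e: "Cod TF b = Cod TF m \<and> farr tf_proj m \<star> h = farr tf_proj b"
  note M = tf_arrD[OF m] and N = tf_arrD[OF b]
  have h': "h \<in> Arr S" "Dom S h = fst (Dom TF b)" "Cod S h = fst (Dom TF m)"
    using h by (auto simp: Hom_def)
  have fb: "tensor_family (farr tf_proj m \<star> h) (snd (Dom TF b)) (snd (Cod TF m)) (ev b)"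
    using N(6) e by simp
  note C = tensor_familyD[OF M(6)] and C' = tensor_familyD[OF fb]
  note Dm = tensor_dataD[OF tf_objectD(2)[OF M(1)]] and Db = tensor_dataD[OF tf_objectD(2)[OF N(1)]]
  have ex: "\<exists>d. d \<in> arrs h (fobj (snd (Dom TF b)) p) (fobj (snd (Dom TF m)) p) \<and> ev m p \<bullet> d = ev b p" if p: "p \<in> Obj A" for p
    by (rule cart_factor[OF C(1)[OF p] C'(5)[OF p] h'(1) _ _ refl]) (simp_all add: h' Dm(3) Db(3) p)
  define d where "d p = (SOME d. d \<in> arrs h (fobj (snd (Dom TF b)) p) (fobj (snd (Dom TF m)) p) \<and> ev m p \<bullet> d = ev b p)" for p
  have d: "d p \<in> arrs h (fobj (snd (Dom TF b)) p) (fobj (snd (Dom TF m)) p)" "ev m p \<bullet> d p = ev b p" if "p \<in> Obj A" for p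
    using someI_ex[OF ex[OF that]] unfolding d_def by auto
  have fam: "tensor_family h (snd (Dom TF b)) (snd (Dom TF m)) d"
    by (rule tensor_family_factor[OF tf_objectD(2)[OF M(2)] tf_objectD(2)[OF M(1)] tf_objectD(2)[OF N(1)] M(6) M(4,5) fb h'])
      (simp_all add: d)
  let ?k = "mk (Dom TF b) (Dom TF m) h d"
  have k: "?k \<in> Arr TF"
    by (rule mk_arr[OF N(1) M(1) h'(2,3) fam])
  have mk': "Comp TF m ?k = b"
  proof -
    have c: "Dom TF m = Cod TF ?k" by simp
    note cc = tf_comp[OF m k c]
    show ?thesis
      by (rule tf_eqI[OF cc(1) b]) (use e in \<open>simp_all add: cc ev_mk[OF fam] d\<close>)
  qed
  show "\<exists>!c. c \<in> Hom TF (Dom TF b) (Dom TF m) \<and> farr tf_proj c = h \<and> Comp TF m c = b"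
  proof (rule ex1I[of _ ?k])
    show "?k \<in> Hom TF (Dom TF b) (Dom TF m) \<and> farr tf_proj ?k = h \<and> Comp TF m ?k = b"
      using k mk' by (simp add: Hom_def)
    fix c assume c: "c \<in> Hom TF (Dom TF b) (Dom TF m) \<and> farr tf_proj c = h \<and> Comp TF m c = b"
    then have c': "c \<in> Arr TF" "Dom TF c = Dom TF b" "Cod TF c = Dom TF m" "farr tf_proj c = h" "Comp TF m c = b"
      by (auto simp: Hom_def)
    show "c = ?k"
    proof (rule tf_eqI[OF c'(1) k])
      fix p assume p: "p \<in> Obj A"
      have "ev m p \<bullet> ev c p = ev m p \<bullet> d p"
        using tf_comp(5)[OF m c'(1) c'(3)[symmetric] p] c'(5) d(2)[OF p] by simp
      then have "ev c p = d p"
        using cart_cancel[OF C(1)[OF p] _ d(1)[OF p]] tensor_familyD(5)[OF tf_arrD(6)[OF c'(1)] p] c' by simp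
      then show "ev c p = ev ?k p"
        using ev_mk[OF fam p] by simp
    qed (simp_all add: c')
  qed
qed

lemma fibration_TF: "fibration S TF tf_proj"
proof
  have "is_functor TF S tf_proj"
    unfolding is_functor_def Hom_def using tf_objectD(1) tf_arrD(3-5) tf_ident(4) tf_comp(4) by simp
  moreover have "\<exists>a. cartesian S TF tf_proj a \<and> Cod TF a = Y \<and> farr tf_proj a = f"
    if f: "f \<in> Arr S" and Y: "Y \<in> Obj TF" "fobj tf_proj Y = Cod S f" for f Y
  proof -
    have Y': "Y \<in> tf_objects \<kappa> A B" "Cod S f = fst Y" using Y by simp_all
    note T = tf_objectD[OF Y'(1)]
    note P = pulled[OF T(2) f refl Y'(2)]
    have X': "(Dom S f, pulled f (snd Y)) \<in> tf_objects \<kappa> A B"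
      unfolding tf_objects_iff
      using P laws_pulled[OF T(2) P(1,2) refl Y'(2) T(3)] colimits_pulled[OF T(2,3) f refl Y'(2) T(4)] by blast
    have "mk (Dom S f, pulled f (snd Y)) Y f (\<lambda>p. Clv B f (fobj (snd Y) p)) \<in> Arr TF"
      by (rule mk_arr[OF X' Y'(1)]) (simp_all add: Y'(2) P)
    then show ?thesis
      using tf_cartesian by (intro exI[of _ "mk (Dom S f, pulled f (snd Y)) Y f (\<lambda>p. Clv B f (fobj (snd Y) p))"]) simp
  qed
  ultimately show "fibred_category S TF tf_proj"
    unfolding fibred_category_def using categories(1) category_TF by blast
qed

sublocale T: fibration S TF tf_proj
  by (rule fibration_TF)

lemma T_carts: "T.carts f X' Y = T.arrs f X' Y"
  unfolding T.carts_def T.arrs_def Hom_def using tf_cartesian by blast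

lemma groupoid_fibres: "fibred_in_groupoids S TF tf_proj"
  unfolding fibred_in_groupoids_def groupoid_def
proof (intro conjI ballI)
  show "fibred_category S TF tf_proj"
    by (rule T.fibred)
  fix s assume s: "s \<in> Obj S"
  show "category (fibre S TF tf_proj s)"
    by (rule T.category_fibre[OF s])
  fix a assume "a \<in> Arr (fibre S TF tf_proj s)"
  then show "is_iso (fibre S TF tf_proj s) a"
    using T.is_iso_fibre[OF s] T_carts T.Arr_fibre[OF s] by blast
qed

lemma T_arrsD:
  assumes "m \<in> T.arrs f X' Y"
  shows "m \<in> Arr TF" "Dom TF m = X'" "Cod TF m = Y" "farr tf_proj m = f" "X' \<in> tf_objects \<kappa> A B" "Y \<in> tf_objects \<kappa> A B"
    "tensor_family f (snd X') (snd Y) (ev m)" "Dom S f = fst X'" "Cod S f = fst Y"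
  using T.arrsD[OF assms] tf_arrD[of m] by auto

lemma ev_comp:
  assumes "m \<in> T.arrs f Y Z" "n \<in> T.arrs g X' Y" "p \<in> Obj A"
  shows "ev (Comp TF m n) p = ev m p \<bullet> ev n p"
  by (rule tf_comp(5)) (simp_all add: T_arrsD[OF assms(1)] T_arrsD[OF assms(2)] assms(3))

text \<open>
  A functor preserving a colimit into the fibre over \<open>t\<close> gives a universal property for targets in other
  fibres as well: arrows over \<open>g\<close> into \<open>y\<close> are vertical arrows into \<open>g\<^sup>* y\<close>.
\<close>

lemma colimit_over_base_arrow:
  fixes J :: "('j, 'j) cat" and D :: "('j, 'j, 'p, 'q) fctr"
  assumes Z: "Z \<in> tf_objects \<kappa> A B" and J: "small_category \<kappa> J" and D: "is_functor J A D" and col: "is_colimit J A D x \<iota>"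
    and y: "y \<in> Obj X" and g: "g \<in> Arr S" "Dom S g = fst Z" "Cod S g = fobj \<pi> y"
    and k: "\<And>j. j \<in> Obj J \<Longrightarrow> k j \<in> arrs g (fobj (snd Z) (fobj D j)) y"
    and cocone: "\<And>h. h \<in> Arr J \<Longrightarrow> k (Cod J h) \<bullet> farr (snd Z) (farr D h) = k (Dom J h)"
  shows "\<exists>!m. m \<in> arrs g (fobj (snd Z) x) y \<and> (\<forall>j\<in>Obj J. m \<bullet> farr (snd Z) (\<iota> j) = k j)"
proof -
  let ?G = "snd Z" and ?t = "fst Z"
  note O = tf_objectD[OF Z] and G = tensor_dataD[OF tf_objectD(2)[OF Z]]
  have cat: "category J" using J by (simp add: small_category_def)
  have JD: "Dom J h \<in> Obj J" "Cod J h \<in> Obj J" if "h \<in> Arr J" for h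
    using cat that unfolding category_def by blast+
  have Dh: "farr D h \<in> Arr A" "Dom A (farr D h) = fobj D (Dom J h)" "Cod A (farr D h) = fobj D (Cod J h)" if "h \<in> Arr J" for h
    using D that by (simp_all add: is_functor_def Hom_def)
  have x: "x \<in> Obj A" and io: "\<And>j. j \<in> Obj J \<Longrightarrow> \<iota> j \<in> Arr A" "\<And>j. j \<in> Obj J \<Longrightarrow> Dom A (\<iota> j) = fobj D j"
    "\<And>j. j \<in> Obj J \<Longrightarrow> Cod A (\<iota> j) = x"
    using col by (simp_all add: is_colimit_def is_cocone_def Hom_def)
  have cl: "is_colimit J (Fib B ?t) (comp_fctr ?G D) (fobj ?G x) (farr ?G \<circ> \<iota>)"
    using O(4) J D col unfolding preserves_colimits_def by blast
  have t: "?t \<in> Obj S" by (rule O(1))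
  define l where "l = Clv B g y"
  define z where "z = pull_obj B g y"
  have lc: "l \<in> carts g z y"
    unfolding l_def z_def by (rule Clv) (simp_all add: g y)
  note lD = cartsD[OF lc]
  have zt: "fobj \<pi> z = ?t" using lD(8) g by simp
  have gI: "g \<star> Ident S ?t = g" using g by simp
  have vk: "vert (k j) \<in> varrs ?t (fobj ?G (fobj D j)) z" "l \<bullet> vert (k j) = k j" if "j \<in> Obj J" for j
    using vert[OF k[OF that]] by (simp_all add: g l_def z_def)
  note vD = typing[OF vk(1)]
  have "is_cocone J (Fib B ?t) (comp_fctr ?G D) z (\<lambda>j. vert (k j))"
    unfolding is_cocone_def
  proof (intro conjI ballI)
    show "z \<in> Obj (Fib B ?t)"
      using Obj_Fib[OF t] lD(5) zt by blast
    show "vert (k j) \<in> Hom (Fib B ?t) (fobj (comp_fctr ?G D) j) z" if "j \<in> Obj J" for j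
      using vk(1)[OF that] by (simp add: Hom_Fib[OF t] comp_fctr_def)
    fix h assume h: "h \<in> Arr J"
    have Gh: "farr ?G (farr D h) \<in> varrs ?t (fobj ?G (fobj D (Dom J h))) (fobj ?G (fobj D (Cod J h)))"
      using G(4)[OF Dh(1)[OF h]] by (simp add: Dh[OF h])
    have "vert (k (Cod J h)) \<bullet> farr ?G (farr D h) = vert (k (Dom J h))"
    proof (rule cart_cancel[OF lc vertical_comp[OF t Gh vk(1)] vk(1)])
      show "l \<bullet> vert (k (Cod J h)) \<bullet> farr ?G (farr D h) = l \<bullet> vert (k (Dom J h))"
        using chain[OF vk(2)[OF JD(2)[OF h]], of "farr ?G (farr D h)"] cocone[OF h] vk(2)[OF JD(1)[OF h]]
        by (simp add: vD JD h lD(1-3) typing[OF Gh])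
    qed (simp_all add: JD h)
    then show "Comp (Fib B ?t) (vert (k (Cod J h))) (farr (comp_fctr ?G D) h) = vert (k (Dom J h))"
      by (simp add: Fib_structure(6)[OF t] comp_fctr_def)
  qed
  then have "\<exists>!m. m \<in> Hom (Fib B ?t) (fobj ?G x) z \<and> (\<forall>j\<in>Obj J. Comp (Fib B ?t) m ((farr ?G \<circ> \<iota>) j) = vert (k j))"
    using cl unfolding is_colimit_def by blast
  then have ex1: "\<exists>!m. m \<in> varrs ?t (fobj ?G x) z \<and> (\<forall>j\<in>Obj J. m \<bullet> farr ?G (\<iota> j) = vert (k j))"
    unfolding Hom_Fib[OF t] Fib_structure(6)[OF t] o_apply .
  have Gi: "farr ?G (\<iota> j) \<in> varrs ?t (fobj ?G (fobj D j)) (fobj ?G x)" if "j \<in> Obj J" for j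
    using G(4)[OF io(1)[OF that]] by (simp add: io that)
  have key: "m \<bullet> farr ?G (\<iota> j) = vert (k j) \<longleftrightarrow> (l \<bullet> m) \<bullet> farr ?G (\<iota> j) = k j"
    if m: "m \<in> varrs ?t (fobj ?G x) z" and j: "j \<in> Obj J" for m j
    using cart_cancel[OF lc vertical_comp[OF t Gi[OF j] m] vk(1)[OF j]] vk(2)[OF j]
    by (auto simp: typing[OF m] lD(1-3) typing[OF Gi[OF j]])
  show ?thesis
  proof (rule ex_ex1I)
    obtain m where m: "m \<in> varrs ?t (fobj ?G x) z" "\<forall>j\<in>Obj J. m \<bullet> farr ?G (\<iota> j) = vert (k j)"
      using ex1 by blast
    have "l \<bullet> m \<in> arrs g (fobj ?G x) y"
      using arrs_comp[OF m(1) carts_arrs[OF lc]] by (simp add: gI)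
    then show "\<exists>m. m \<in> arrs g (fobj ?G x) y \<and> (\<forall>j\<in>Obj J. m \<bullet> farr ?G (\<iota> j) = k j)"
      using m key by blast
  next
    fix m m' assume A: "m \<in> arrs g (fobj ?G x) y \<and> (\<forall>j\<in>Obj J. m \<bullet> farr ?G (\<iota> j) = k j)"
      and A': "m' \<in> arrs g (fobj ?G x) y \<and> (\<forall>j\<in>Obj J. m' \<bullet> farr ?G (\<iota> j) = k j)"
    have V: "vert m \<in> varrs ?t (fobj ?G x) z" "l \<bullet> vert m = m" "vert m' \<in> varrs ?t (fobj ?G x) z" "l \<bullet> vert m' = m'"
      using vert[OF conjunct1[OF A]] vert[OF conjunct1[OF A']] by (simp_all add: g l_def z_def)
    have "\<forall>j\<in>Obj J. vert m \<bullet> farr ?G (\<iota> j) = vert (k j)" "\<forall>j\<in>Obj J. vert m' \<bullet> farr ?G (\<iota> j) = vert (k j)"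
      using key[OF V(1)] key[OF V(3)] V(2,4) A A' by simp_all
    then have "vert m = vert m'"
      using ex1 V(1,3) by blast
    then show "m = m'"
      using V by metis
  qed
qed

end

section \<open>Gluing tensor functors\<close>

locale covered_tensor_functors = tensor_functors B \<kappa> A
  for B :: "('s, 'f, 'x, 'a) fatcat" and \<kappa> :: "'j rel" and A :: "('p, 'q) atcat" +
  fixes s :: 's and \<U> :: "'f set"
  assumes is_covering: "covering (Base B) s \<U>"
begin

sublocale b: covered_fibration S X \<pi> s \<U>
  by unfold_locales (rule is_covering)

sublocale t: covered_fibration S TF tf_proj s \<U>
  by unfold_locales (rule is_covering)

lemma ev_span:
  assumes "t.span_over u v Y Z a b" "p \<in> Obj A"
  shows "b.span_over u v (fobj (snd Y) p) (fobj (snd Z) p) (ev a p) (ev b p)"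
    "a \<in> T.arrs (pr1 S u v) (Dom TF a) Y" "b \<in> T.arrs (pr2 S u v) (Dom TF a) Z"
proof -
  show a: "a \<in> T.arrs (pr1 S u v) (Dom TF a) Y" and b: "b \<in> T.arrs (pr2 S u v) (Dom TF a) Z"
    using assms(1) by (auto simp: t.span_over_def T_carts)
  note c = tensor_familyD(1)[OF T_arrsD(7)[OF a] assms(2)] tensor_familyD(1)[OF T_arrsD(7)[OF b] assms(2)]
  then show "b.span_over u v (fobj (snd Y) p) (fobj (snd Z) p) (ev a p) (ev b p)"
    using cartsD(2)[OF c(1)] by (simp add: b.span_over_def)
qed

lemma Ident_member: "u \<in> \<U> \<Longrightarrow> Ident S s \<star> u = u" "u \<in> \<U> \<Longrightarrow> u \<star> Ident S (Dom S u) = u"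
  using b.member[of u] by simp_all

text \<open>
  Compatible families of arrows out of \<open>F p\<close> glue for each object \<open>p\<close> separately. The glued arrows \<open>g p\<close> are
  cartesian because they are so locally, and the equations for a tensor family hold because they hold
  after composing with the cartesian arrows \<open>c u\<close>, their tensor products and \<open>unit_arr u\<close>, respectively.
\<close>

lemma tf_hom_descent:
  assumes hd: b.hom_descent
  shows t.hom_descent
  unfolding t.hom_descent_def
proof (intro allI impI, elim conjE)
  fix Y Y' c Z f h
  assume c: "\<forall>u\<in>\<U>. c u \<in> T.carts u (Y' u) Y" and Y: "Y \<in> Obj TF" "fobj tf_proj Y = s" and Z: "Z \<in> Obj TF"
    and f: "f \<in> Arr S" "Dom S f = s" "Cod S f = fobj tf_proj Z" and h: "\<forall>u\<in>\<U>. h u \<in> T.arrs (f \<star> u) (Y' u) Z"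
    and sp: "\<forall>u\<in>\<U>. \<forall>v\<in>\<U>. \<exists>a b. t.span_over u v (Y' u) (Y' v) a b \<and> Comp TF (c u) a = Comp TF (c v) b \<and>
      Comp TF (h u) a = Comp TF (h v) b"
  have c': "c u \<in> T.arrs u (Y' u) Y" if "u \<in> \<U>" for u
    using c that T_carts by blast
  have h': "h u \<in> T.arrs (f \<star> u) (Y' u) Z" if "u \<in> \<U>" for u
    using h that by blast
  have YO: "Y \<in> tf_objects \<kappa> A B" "fst Y = s" and ZO: "Z \<in> tf_objects \<kappa> A B" "Cod S f = fst Z"
    using Y Z f by simp_all
  define F where "F = snd Y"
  define G where "G = snd Z"
  have FD: "tensor_data s F" and GD: "tensor_data (fst Z) G"
    using tf_objectD(2)[OF YO(1)] tf_objectD(2)[OF ZO(1)] YO(2) by (simp_all add: F_def G_def)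
  note D = tensor_dataD[OF FD] and D' = tensor_dataD[OF GD]
  have cf: "tensor_family u (snd (Y' u)) F (ev (c u))" and hf: "tensor_family (f \<star> u) (snd (Y' u)) G (ev (h u))" if "u \<in> \<U>" for u
    using T_arrsD(7)[OF c'[OF that]] T_arrsD(7)[OF h'[OF that]] by (simp_all add: F_def G_def)
  have Yd: "tensor_data (Dom S u) (snd (Y' u))" if "u \<in> \<U>" for u
    using tf_objectD(2)[OF T_arrsD(5)[OF c'[OF that]]] T_arrsD(8)[OF c'[OF that]] by simp
  note C = tensor_familyD[OF cf] and H = tensor_familyD[OF hf]
  have ex1: "\<exists>!g. g \<in> arrs f (fobj F p) (fobj G p) \<and> (\<forall>u\<in>\<U>. g \<bullet> ev (c u) p = ev (h u) p)" if p: "p \<in> Obj A" for p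
  proof (rule b.hom_descent_ex1[OF hd C(1)])
    show "ev (h u) p \<in> arrs (f \<star> u) (fobj (snd (Y' u)) p) (fobj G p)" if "u \<in> \<U>" for u
      by (rule H(5)[OF that p])
    fix u v assume uv: "u \<in> \<U>" "v \<in> \<U>"
    obtain a b where ab: "t.span_over u v (Y' u) (Y' v) a b" "Comp TF (c u) a = Comp TF (c v) b" "Comp TF (h u) a = Comp TF (h v) b"
      using sp uv by blast
    note E = ev_span[OF ab(1) p]
    have "ev (c u) p \<bullet> ev a p = ev (c v) p \<bullet> ev b p"
      using ev_comp[OF c'[OF uv(1)] E(2) p] ev_comp[OF c'[OF uv(2)] E(3) p] ab(2) by simp
    moreover have "ev (h u) p \<bullet> ev a p = ev (h v) p \<bullet> ev b p"
      using ev_comp[OF h'[OF uv(1)] E(2) p] ev_comp[OF h'[OF uv(2)] E(3) p] ab(3) by simp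
    ultimately show "\<exists>a b. b.span_over u v (fobj (snd (Y' u)) p) (fobj (snd (Y' v)) p) a b \<and>
        ev (c u) p \<bullet> a = ev (c v) p \<bullet> b \<and> ev (h u) p \<bullet> a = ev (h v) p \<bullet> b"
      using E(1) by blast
  qed (simp_all add: p D(2,3) D'(2,3) f(1,2) ZO(2))
  define g where "g p = (THE g. g \<in> arrs f (fobj F p) (fobj G p) \<and> (\<forall>u\<in>\<U>. g \<bullet> ev (c u) p = ev (h u) p))" for p
  have g: "g p \<in> arrs f (fobj F p) (fobj G p)" "\<And>u. u \<in> \<U> \<Longrightarrow> g p \<bullet> ev (c u) p = ev (h u) p" if "p \<in> Obj A" for p
    using theI'[OF ex1[OF that]] unfolding g_def[symmetric] by blast+
  have fI: "f \<star> Ident S s = f" "Ident S (fst Z) \<star> f = f"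
    using f ZO(2) by simp_all
  have A1: "b \<bullet> a \<in> arrs f x z" if "a \<in> varrs s x y" "b \<in> arrs f y z" for a b x y z
    using arrs_comp[OF that] fI by simp
  have A2: "b \<bullet> a \<in> arrs f x z" if "a \<in> arrs f x y" "b \<in> varrs (fst Z) y z" for a b x y z
    using arrs_comp[OF that] fI by simp
  note FA = typing[OF D(4)] typing[OF D(8)] typing[OF D(9)] typing[OF D'(4)] typing[OF D'(8)] typing[OF D'(9)]
  note gA = typing[OF g(1)]
  have fam: "tensor_family f F G g"
    unfolding tensor_family_def
  proof (intro conjI ballI)
    show "g p \<in> carts f (fobj F p) (fobj G p)" if p: "p \<in> Obj A" for p
    proof (rule b.hom_descent_cartesian[OF hd _ D(3)[OF p] g(1)[OF p]])
      show "ev (c u) p \<in> carts u (fobj (snd (Y' u)) p) (fobj F p)" if "u \<in> \<U>" for u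
        by (rule C(1)[OF that p])
      show "g p \<bullet> ev (c u) p \<in> carts (f \<star> u) (fobj (snd (Y' u)) p) (fobj G p)" if "u \<in> \<U>" for u
        using H(1)[OF that p] g(2)[OF p that] by simp
    qed
    show "g (Cod A k) \<bullet> farr F k = farr G k \<bullet> g (Dom A k)" if k: "k \<in> Arr A" for k
    proof -
      have kd: "Dom A k \<in> Obj A" "Cod A k \<in> Obj A" using k by simp_all
      show ?thesis
      proof (rule b.hom_descent_unique[OF hd _ D(3)[OF kd(1)] A1[OF D(4)[OF k] g(1)[OF kd(2)]] A2[OF g(1)[OF kd(1)] D'(4)[OF k]]])
        show "ev (c u) (Dom A k) \<in> carts u (fobj (snd (Y' u)) (Dom A k)) (fobj F (Dom A k))" if "u \<in> \<U>" for u
          by (rule C(1)[OF that kd(1)])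
        fix u assume u: "u \<in> \<U>"
        note cA = typing[OF C(5)[OF u]] typing[OF tensor_dataD(4)[OF Yd[OF u]]]
        have "(g (Cod A k) \<bullet> farr F k) \<bullet> ev (c u) (Dom A k) = g (Cod A k) \<bullet> ev (c u) (Cod A k) \<bullet> farr (snd (Y' u)) k"
          using C(2)[OF u k] by (simp add: FA gA cA k)
        also have "\<dots> = farr G k \<bullet> ev (h u) (Dom A k)"
          using chain[OF g(2)[OF kd(2) u], of "farr (snd (Y' u)) k"] H(2)[OF u k] by (simp add: FA gA cA k)
        also have "\<dots> = (farr G k \<bullet> g (Dom A k)) \<bullet> ev (c u) (Dom A k)"
          using g(2)[OF kd(1) u] by (simp add: FA gA cA k)
        finally show "(g (Cod A k) \<bullet> farr F k) \<bullet> ev (c u) (Dom A k) = (farr G k \<bullet> g (Dom A k)) \<bullet> ev (c u) (Dom A k)" .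
      qed
    qed
    show "g (TensO A p q) \<bullet> Mu F p q = Mu G p q \<bullet> (g p \<odot> g q)" if o: "p \<in> Obj A" "q \<in> Obj A" for p q
    proof -
      have pq: "TensO A p q \<in> Obj A" using o by simp
      have oo: "fobj \<pi> (fobj F p \<otimes> fobj F q) = s"
        using tens_obj(2)[OF D(2)[OF o(1)] D(2)[OF o(2)]] D(3)[OF o(1)] D(3)[OF o(2)] by simp
      show ?thesis
      proof (rule b.hom_descent_unique[OF hd _ oo A1[OF D(8)[OF o] g(1)[OF pq]]
            A2[OF tens_arrs[OF g(1)[OF o(1)] g(1)[OF o(2)]] D'(8)[OF o]]])
        show "ev (c u) p \<odot> ev (c u) q \<in> carts u (fobj (snd (Y' u)) p \<otimes> fobj (snd (Y' u)) q) (fobj F p \<otimes> fobj F q)" if "u \<in> \<U>" for u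
          by (rule tens_carts[OF C(1)[OF that o(1)] C(1)[OF that o(2)]])
        fix u assume u: "u \<in> \<U>"
        note cp = C(5)[OF u o(1)] and cq = C(5)[OF u o(2)]
        note cA = typing[OF C(5)[OF u]] typing[OF tensor_dataD(8)[OF Yd[OF u]]] tens_typing[OF cp cq] tens_typing[OF g(1)[OF o(1)] g(1)[OF o(2)]]
        have "(g (TensO A p q) \<bullet> Mu F p q) \<bullet> (ev (c u) p \<odot> ev (c u) q) = g (TensO A p q) \<bullet> ev (c u) (TensO A p q) \<bullet> Mu (snd (Y' u)) p q"
          using C(3)[OF u o] by (simp add: FA gA cA o)
        also have "\<dots> = Mu G p q \<bullet> (ev (h u) p \<odot> ev (h u) q)"
          using chain[OF g(2)[OF pq u], of "Mu (snd (Y' u)) p q"] H(3)[OF u o] by (simp add: FA gA cA o)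
        also have "\<dots> = (Mu G p q \<bullet> (g p \<odot> g q)) \<bullet> (ev (c u) p \<odot> ev (c u) q)"
          using tens_comp[OF g(1)[OF o(1)] cp g(1)[OF o(2)] cq] g(2)[OF o(1) u] g(2)[OF o(2) u] by (simp add: FA gA cA o)
        finally show "(g (TensO A p q) \<bullet> Mu F p q) \<bullet> (ev (c u) p \<odot> ev (c u) q) = (Mu G p q \<bullet> (g p \<odot> g q)) \<bullet> (ev (c u) p \<odot> ev (c u) q)" .
      qed
    qed
    have uf: "unit_arr f \<in> arrs f (unit_obj s) (unit_obj (fst Z))"
      using carts_arrs[OF unit_arr(1)[OF f(1)]] by (simp add: f(2) ZO(2))
    note un = A_structure_simps(1)
    show "g (Unt A) \<bullet> Eps F = Eps G \<bullet> unit_arr f"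
    proof (rule b.hom_descent_unique[OF hd _ structure_arrs(2)[OF b.s] A1[OF D(9) g(1)[OF un]] A2[OF uf D'(9)]])
      show "unit_arr u \<in> carts u (unit_obj (Dom S u)) (unit_obj s)" if "u \<in> \<U>" for u
        using unit_arr(1)[OF b.member(1)[OF that]] b.member(2)[OF that] by simp
      then have uu: "unit_arr u \<in> arrs u (unit_obj (Dom S u)) (unit_obj s)" if "u \<in> \<U>" for u
        using that carts_arrs by blast
      fix u assume u: "u \<in> \<U>"
      note cA = typing[OF C(5)[OF u]] typing[OF tensor_dataD(9)[OF Yd[OF u]]] typing[OF uf] typing[OF uu[OF u]]
      have "(g (Unt A) \<bullet> Eps F) \<bullet> unit_arr u = g (Unt A) \<bullet> ev (c u) (Unt A) \<bullet> Eps (snd (Y' u))"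
        using C(4)[OF u] by (simp add: FA gA cA)
      also have "\<dots> = Eps G \<bullet> unit_arr (f \<star> u)"
        using chain[OF g(2)[OF un u], of "Eps (snd (Y' u))"] H(4)[OF u] by (simp add: FA gA cA)
      also have "\<dots> = (Eps G \<bullet> unit_arr f) \<bullet> unit_arr u"
        using unit_arr_comp[OF f(1) b.member(1)[OF u]] b.member(2)[OF u] f(2) by (simp add: FA cA)
      finally show "(g (Unt A) \<bullet> Eps F) \<bullet> unit_arr u = (Eps G \<bullet> unit_arr f) \<bullet> unit_arr u" .
    qed
  qed
  let ?g = "mk Y Z f g"
  have fam': "tensor_family f (snd Y) (snd Z) g"
    using fam by (simp add: F_def G_def)
  have gT: "?g \<in> T.arrs f Y Z"
    using mk_arr[OF YO(1) ZO(1) _ ZO(2) fam'] f(2) YO(2) by (intro T.arrsI) simp_all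
  show "\<exists>!g. g \<in> T.arrs f Y Z \<and> (\<forall>u\<in>\<U>. Comp TF g (c u) = h u)"
  proof (rule ex1I[of _ ?g])
    have "Comp TF ?g (c u) = h u" if u: "u \<in> \<U>" for u
    proof -
      note k = T_arrsD[OF T.arrs_comp[OF c'[OF u] gT]] and hh = T_arrsD[OF h'[OF u]]
      show ?thesis
        by (rule tf_eqI[OF k(1) hh(1)]) (simp_all add: k(2-4) hh(2-4) ev_comp[OF gT c'[OF u]] ev_mk[OF fam'] g u)
    qed
    with gT show "?g \<in> T.arrs f Y Z \<and> (\<forall>u\<in>\<U>. Comp TF ?g (c u) = h u)"
      by blast
    fix k assume k: "k \<in> T.arrs f Y Z \<and> (\<forall>u\<in>\<U>. Comp TF k (c u) = h u)"
    then have k': "k \<in> T.arrs f Y Z" by blast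
    note kk = T_arrsD[OF k'] and gg = T_arrsD[OF gT]
    show "k = ?g"
    proof (rule tf_eqI[OF kk(1) gg(1)])
      fix p assume p: "p \<in> Obj A"
      have "ev k p \<in> arrs f (fobj F p) (fobj G p)"
        using tensor_familyD(5)[OF kk(7) p] by (simp add: F_def G_def)
      moreover have "ev k p \<bullet> ev (c u) p = ev (h u) p" if "u \<in> \<U>" for u
        using ev_comp[OF k' c'[OF that] p] k that by simp
      ultimately have "ev k p = g p"
        using ex1[OF p] g[OF p] by blast
      then show "ev k p = ev ?g p"
        using ev_mk[OF fam' p] by simp
    qed (simp_all add: kk gg)
  qed
qed

text \<open>
  The form of gluing in which values of the glued functor on arrows and its structure isomorphisms are
  produced: \<open>x\<close> and \<open>y\<close> lie over the same object.
\<close>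

lemma glue_vertical:
  assumes hd: b.hom_descent and d: "\<And>u. u \<in> \<U> \<Longrightarrow> d u \<in> carts u (x' u) x" and x: "x \<in> Obj X" "fobj \<pi> x = s"
    and y: "y \<in> Obj X" "fobj \<pi> y = s" and h: "\<And>u. u \<in> \<U> \<Longrightarrow> h u \<in> arrs u (x' u) y"
    and sp: "\<And>u v. u \<in> \<U> \<Longrightarrow> v \<in> \<U> \<Longrightarrow> \<exists>a b. b.span_over u v (x' u) (x' v) a b \<and> d u \<bullet> a = d v \<bullet> b \<and> h u \<bullet> a = h v \<bullet> b"
  shows "\<exists>g. g \<in> varrs s x y \<and> (\<forall>u\<in>\<U>. g \<bullet> d u = h u)"
proof -
  have "\<exists>!g. g \<in> varrs s x y \<and> (\<forall>u\<in>\<U>. g \<bullet> d u = h u)"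
    by (rule b.hom_descent_ex1[OF hd d x y(1)]) (simp_all add: y b.s h Ident_member sp)
  then show ?thesis by blast
qed

text \<open>
  The following data are given: tensor functors \<open>Z u\<close> over the members \<open>u\<close> of the covering, glued on overlaps
  by the tensor functors in the sources of the spans \<open>a u v\<close>, \<open>b u v\<close>, and for each object \<open>p\<close> an object \<open>y p\<close>
  glued from the values at \<open>p\<close> through cartesian arrows \<open>c u p\<close>. The remaining constituents of a tensor
  functor with values \<open>y p\<close> are the unique ones that make each \<open>c u\<close> a tensor family.
\<close>

context
  fixes Z :: "'f \<Rightarrow> ('s, 'x, 'a, 'p, 'q) tf_obj" and a b :: "'f \<Rightarrow> 'f \<Rightarrow> ('s, 'f, 'x, 'a, 'p, 'q) tf_arr"
    and y :: "'p \<Rightarrow> 'x" and c :: "'f \<Rightarrow> 'p \<Rightarrow> 'a"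
  assumes hd: b.hom_descent
    and sp: "\<And>u v. u \<in> \<U> \<Longrightarrow> v \<in> \<U> \<Longrightarrow> t.span_over u v (Z u) (Z v) (a u v) (b u v)"
    and y: "\<And>p. p \<in> Obj A \<Longrightarrow> y p \<in> Obj X" "\<And>p. p \<in> Obj A \<Longrightarrow> fobj \<pi> (y p) = s"
    and c: "\<And>u p. u \<in> \<U> \<Longrightarrow> p \<in> Obj A \<Longrightarrow> c u p \<in> carts u (fobj (snd (Z u)) p) (y p)"
    and ceq: "\<And>u v p. u \<in> \<U> \<Longrightarrow> v \<in> \<U> \<Longrightarrow> p \<in> Obj A \<Longrightarrow> c u p \<bullet> ev (a u v) p = c v p \<bullet> ev (b u v) p"
begin

lemma members:
  assumes "u \<in> \<U>"
  shows "Z u \<in> tf_objects \<kappa> A B" "fst (Z u) = Dom S u" "tensor_data (Dom S u) (snd (Z u))" "obeys_laws (snd (Z u))"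
proof -
  have s: "t.span_over u u (Z u) (Z u) (a u u) (b u u)"
    by (rule sp[OF assms assms])
  note E = T_arrsD[OF ev_span(2)[OF s A_structure_simps(1)]]
  show "Z u \<in> tf_objects \<kappa> A B" "fst (Z u) = Dom S u"
    using E(6,9) b.overlap(4)[OF assms assms] by simp_all
  then show "tensor_data (Dom S u) (snd (Z u))" "obeys_laws (snd (Z u))"
    using tf_objectD(2,3)[of "Z u"] by simp_all
qed

lemma legs:
  assumes uv: "u \<in> \<U>" "v \<in> \<U>"
  defines "P \<equiv> snd (Dom TF (a u v))"
  shows "tensor_data (Dom S (pr1 S u v)) P" "Dom TF (a u v) \<in> tf_objects \<kappa> A B"
    "tensor_family (pr1 S u v) P (snd (Z u)) (ev (a u v))" "tensor_family (pr2 S u v) P (snd (Z v)) (ev (b u v))"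
    "p \<in> Obj A \<Longrightarrow> b.span_over u v (fobj (snd (Z u)) p) (fobj (snd (Z v)) p) (ev (a u v) p) (ev (b u v) p)"
    "fst (Dom TF (a u v)) = Dom S (pr1 S u v)"
proof -
  note E = ev_span[OF sp[OF uv] A_structure_simps(1)]
  note L = T_arrsD[OF E(2)] and R = T_arrsD[OF E(3)]
  show "Dom TF (a u v) \<in> tf_objects \<kappa> A B" "tensor_family (pr1 S u v) P (snd (Z u)) (ev (a u v))"
     "tensor_family (pr2 S u v) P (snd (Z v)) (ev (b u v))" "fst (Dom TF (a u v)) = Dom S (pr1 S u v)"
    using L(5,7,8) R(7) by (simp_all add: P_def)
  then show "tensor_data (Dom S (pr1 S u v)) P"
    using tf_objectD(2)[of "Dom TF (a u v)"] by (simp add: P_def)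
  show "p \<in> Obj A \<Longrightarrow> b.span_over u v (fobj (snd (Z u)) p) (fobj (snd (Z v)) p) (ev (a u v) p) (ev (b u v) p)"
    by (rule ev_span(1)[OF sp[OF uv]])
qed

text \<open>
  In this and the next two lemmas, the local arrows are compatible on an overlap because the legs of
  the span are tensor families out of the same tensor functor.
\<close>

lemma glue_arrow:
  assumes k: "k \<in> Arr A"
  shows "\<exists>g. g \<in> varrs s (y (Dom A k)) (y (Cod A k)) \<and> (\<forall>u\<in>\<U>. g \<bullet> c u (Dom A k) = c u (Cod A k) \<bullet> farr (snd (Z u)) k)"
proof -
  have kd: "Dom A k \<in> Obj A" "Cod A k \<in> Obj A" using k by simp_all
  show ?thesis
  proof (rule glue_vertical[OF hd c[OF _ kd(1)] y(1)[OF kd(1)] y(2)[OF kd(1)] y(1)[OF kd(2)] y(2)[OF kd(2)]])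
    show "c u (Cod A k) \<bullet> farr (snd (Z u)) k \<in> arrs u (fobj (snd (Z u)) (Dom A k)) (y (Cod A k))" if "u \<in> \<U>" for u
      using arrs_comp[OF tensor_dataD(4)[OF members(3)[OF that] k] carts_arrs[OF c[OF that kd(2)]]] by (simp add: Ident_member that)
    fix u v assume uv: "u \<in> \<U>" "v \<in> \<U>"
    note L = legs[OF uv]
    note La = tensor_familyD[OF L(3)] and Lb = tensor_familyD[OF L(4)]
    note D = typing[OF tensor_dataD(4)[OF members(3)[OF uv(1)]]] typing[OF tensor_dataD(4)[OF members(3)[OF uv(2)]]]
      typing[OF tensor_dataD(4)[OF L(1)]] typing[OF La(5)] typing[OF Lb(5)]
      cart_typing[OF c[OF uv(1)]] cart_typing[OF c[OF uv(2)]]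
    have "(c u (Cod A k) \<bullet> farr (snd (Z u)) k) \<bullet> ev (a u v) (Dom A k) = c u (Cod A k) \<bullet> ev (a u v) (Cod A k) \<bullet> farr (snd (Dom TF (a u v))) k"
      using La(2)[OF k] by (simp add: D k)
    also have "\<dots> = c v (Cod A k) \<bullet> ev (b u v) (Cod A k) \<bullet> farr (snd (Dom TF (a u v))) k"
      using chain[OF ceq[OF uv kd(2)], of "farr (snd (Dom TF (a u v))) k"] by (simp add: D k)
    also have "\<dots> = (c v (Cod A k) \<bullet> farr (snd (Z v)) k) \<bullet> ev (b u v) (Dom A k)"
      using Lb(2)[OF k] by (simp add: D k)
    finally show "\<exists>a b. b.span_over u v (fobj (snd (Z u)) (Dom A k)) (fobj (snd (Z v)) (Dom A k)) a b \<and>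
        c u (Dom A k) \<bullet> a = c v (Dom A k) \<bullet> b \<and>
        (c u (Cod A k) \<bullet> farr (snd (Z u)) k) \<bullet> a = (c v (Cod A k) \<bullet> farr (snd (Z v)) k) \<bullet> b"
      using L(5)[OF kd(1)] ceq[OF uv kd(1)] by blast
  qed
qed

lemma glue_Mu:
  assumes o: "p \<in> Obj A" "q \<in> Obj A"
  shows "\<exists>g. g \<in> isos s (y p \<otimes> y q) (y (TensO A p q)) \<and>
     (\<forall>u\<in>\<U>. g \<bullet> (c u p \<odot> c u q) = c u (TensO A p q) \<bullet> Mu (snd (Z u)) p q)"
proof -
  have pq: "TensO A p q \<in> Obj A" using o by simp
  have oo: "y p \<otimes> y q \<in> Obj X" "fobj \<pi> (y p \<otimes> y q) = s"
    using tens_obj[OF y(1)[OF o(1)] y(1)[OF o(2)]] y(2)[OF o(1)] y(2)[OF o(2)] by simp_all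
  have cc: "c u p \<odot> c u q \<in> carts u (fobj (snd (Z u)) p \<otimes> fobj (snd (Z u)) q) (y p \<otimes> y q)" if "u \<in> \<U>" for u
    by (rule tens_carts[OF c[OF that o(1)] c[OF that o(2)]])
  have h: "c u (TensO A p q) \<bullet> Mu (snd (Z u)) p q \<in> carts u (fobj (snd (Z u)) p \<otimes> fobj (snd (Z u)) q) (y (TensO A p q))" if "u \<in> \<U>" for u
    using carts_comp[OF tensor_dataD(5)[OF members(3)[OF that] o] c[OF that pq]] by (simp add: Ident_member that)
  have "\<exists>g. g \<in> varrs s (y p \<otimes> y q) (y (TensO A p q)) \<and>
     (\<forall>u\<in>\<U>. g \<bullet> (c u p \<odot> c u q) = c u (TensO A p q) \<bullet> Mu (snd (Z u)) p q)"
  proof (rule glue_vertical[OF hd cc oo y(1)[OF pq] y(2)[OF pq] carts_arrs[OF h]])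
    fix u v assume uv: "u \<in> \<U>" "v \<in> \<U>"
    note L = legs[OF uv]
    note La = tensor_familyD[OF L(3)] and Lb = tensor_familyD[OF L(4)]
    let ?P = "snd (Dom TF (a u v))"
    let ?aa = "ev (a u v) p \<odot> ev (a u v) q" and ?bb = "ev (b u v) p \<odot> ev (b u v) q"
    note cu = carts_arrs[OF c[OF uv(1) o(1)]] carts_arrs[OF c[OF uv(1) o(2)]]
      and cv = carts_arrs[OF c[OF uv(2) o(1)]] carts_arrs[OF c[OF uv(2) o(2)]]
    note D = typing[OF tensor_dataD(8)[OF members(3)[OF uv(1)]]] typing[OF tensor_dataD(8)[OF members(3)[OF uv(2)]]]
      typing[OF tensor_dataD(8)[OF L(1)]] typing[OF La(5)] typing[OF Lb(5)]
      cart_typing[OF c[OF uv(1)]] cart_typing[OF c[OF uv(2)]]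
      tens_typing[OF La(5)[OF o(1)] La(5)[OF o(2)]] tens_typing[OF Lb(5)[OF o(1)] Lb(5)[OF o(2)]]
    have "b.span_over u v (fobj (snd (Z u)) p \<otimes> fobj (snd (Z u)) q) (fobj (snd (Z v)) p \<otimes> fobj (snd (Z v)) q) ?aa ?bb"
      using tens_carts[OF La(1)[OF o(1)] La(1)[OF o(2)]] tens_carts[OF Lb(1)[OF o(1)] Lb(1)[OF o(2)]]
      by (simp add: b.span_over_def D)
    moreover have "(c u p \<odot> c u q) \<bullet> ?aa = (c v p \<odot> c v q) \<bullet> ?bb"
      using tens_comp[OF cu(1) La(5)[OF o(1)] cu(2) La(5)[OF o(2)]] tens_comp[OF cv(1) Lb(5)[OF o(1)] cv(2) Lb(5)[OF o(2)]]
        ceq[OF uv o(1)] ceq[OF uv o(2)] by simp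
    moreover have "(c u (TensO A p q) \<bullet> Mu (snd (Z u)) p q) \<bullet> ?aa = (c v (TensO A p q) \<bullet> Mu (snd (Z v)) p q) \<bullet> ?bb"
    proof -
      have "(c u (TensO A p q) \<bullet> Mu (snd (Z u)) p q) \<bullet> ?aa = c u (TensO A p q) \<bullet> ev (a u v) (TensO A p q) \<bullet> Mu ?P p q"
        using La(3)[OF o] by (simp add: D o)
      also have "\<dots> = c v (TensO A p q) \<bullet> ev (b u v) (TensO A p q) \<bullet> Mu ?P p q"
        using chain[OF ceq[OF uv pq], of "Mu ?P p q"] by (simp add: D o)
      also have "\<dots> = (c v (TensO A p q) \<bullet> Mu (snd (Z v)) p q) \<bullet> ?bb"
        using Lb(3)[OF o] by (simp add: D o)
      finally show ?thesis .
    qed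
    ultimately show "\<exists>a b. b.span_over u v (fobj (snd (Z u)) p \<otimes> fobj (snd (Z u)) q) (fobj (snd (Z v)) p \<otimes> fobj (snd (Z v)) q) a b \<and>
        (c u p \<odot> c u q) \<bullet> a = (c v p \<odot> c v q) \<bullet> b \<and>
        (c u (TensO A p q) \<bullet> Mu (snd (Z u)) p q) \<bullet> a = (c v (TensO A p q) \<bullet> Mu (snd (Z v)) p q) \<bullet> b"
      by blast
  qed
  then obtain g where g: "g \<in> varrs s (y p \<otimes> y q) (y (TensO A p q))"
    "\<And>u. u \<in> \<U> \<Longrightarrow> g \<bullet> (c u p \<odot> c u q) = c u (TensO A p q) \<bullet> Mu (snd (Z u)) p q" by blast
  have "g \<in> isos s (y p \<otimes> y q) (y (TensO A p q))"
    by (rule b.hom_descent_cartesian[OF hd cc oo(2) g(1)]) (simp_all add: g(2) h Ident_member)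
  then show ?thesis using g(2) by blast
qed

lemma glue_Eps:
  shows "\<exists>g. g \<in> isos s (unit_obj s) (y (Unt A)) \<and> (\<forall>u\<in>\<U>. g \<bullet> unit_arr u = c u (Unt A) \<bullet> Eps (snd (Z u)))"
proof -
  note un = A_structure_simps(1)
  note us = structure_arrs(1,2)[OF b.s]
  have cc: "unit_arr u \<in> carts u (unit_obj (Dom S u)) (unit_obj s)" if "u \<in> \<U>" for u
    using unit_arr(1)[OF b.member(1)[OF that]] b.member(2)[OF that] by simp
  have h: "c u (Unt A) \<bullet> Eps (snd (Z u)) \<in> carts u (unit_obj (Dom S u)) (y (Unt A))" if "u \<in> \<U>" for u
    using carts_comp[OF tensor_dataD(6)[OF members(3)[OF that]] c[OF that un]] by (simp add: Ident_member that)
  have "\<exists>g. g \<in> varrs s (unit_obj s) (y (Unt A)) \<and> (\<forall>u\<in>\<U>. g \<bullet> unit_arr u = c u (Unt A) \<bullet> Eps (snd (Z u)))"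
  proof (rule glue_vertical[OF hd cc us y(1)[OF un] y(2)[OF un] carts_arrs[OF h]])
    fix u v assume uv: "u \<in> \<U>" "v \<in> \<U>"
    note o = b.overlap[OF uv] and L = legs[OF uv]
    note La = tensor_familyD[OF L(3)] and Lb = tensor_familyD[OF L(4)]
    let ?P = "snd (Dom TF (a u v))"
    have p: "unit_arr (pr1 S u v) \<in> carts (pr1 S u v) (unit_obj (Dom S (pr1 S u v))) (unit_obj (Dom S u))"
      "unit_arr (pr2 S u v) \<in> carts (pr2 S u v) (unit_obj (Dom S (pr1 S u v))) (unit_obj (Dom S v))"
      using unit_arr(1)[OF o(1)] unit_arr(1)[OF o(2)] by (simp_all add: o)
    note D = typing[OF tensor_dataD(9)[OF members(3)[OF uv(1)]]] typing[OF tensor_dataD(9)[OF members(3)[OF uv(2)]]]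
      typing[OF tensor_dataD(9)[OF L(1)]] typing[OF La(5)] typing[OF Lb(5)]
      cart_typing[OF c[OF uv(1)]] cart_typing[OF c[OF uv(2)]]
      cart_typing[OF p(1)] cart_typing[OF p(2)]
    have "b.span_over u v (unit_obj (Dom S u)) (unit_obj (Dom S v)) (unit_arr (pr1 S u v)) (unit_arr (pr2 S u v))"
      using p by (simp add: b.span_over_def D)
    moreover have "unit_arr u \<bullet> unit_arr (pr1 S u v) = unit_arr v \<bullet> unit_arr (pr2 S u v)"
      using unit_arr_comp[OF b.member(1)[OF uv(1)] o(1,4)] unit_arr_comp[OF b.member(1)[OF uv(2)] o(2,5)] o(6) by simp
    moreover have "(c u (Unt A) \<bullet> Eps (snd (Z u))) \<bullet> unit_arr (pr1 S u v) = (c v (Unt A) \<bullet> Eps (snd (Z v))) \<bullet> unit_arr (pr2 S u v)"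
    proof -
      have "(c u (Unt A) \<bullet> Eps (snd (Z u))) \<bullet> unit_arr (pr1 S u v) = c u (Unt A) \<bullet> ev (a u v) (Unt A) \<bullet> Eps ?P"
        using La(4) by (simp add: D)
      also have "\<dots> = c v (Unt A) \<bullet> ev (b u v) (Unt A) \<bullet> Eps ?P"
        using chain[OF ceq[OF uv un], of "Eps ?P"] by (simp add: D)
      also have "\<dots> = (c v (Unt A) \<bullet> Eps (snd (Z v))) \<bullet> unit_arr (pr2 S u v)"
        using Lb(4) by (simp add: D)
      finally show ?thesis .
    qed
    ultimately show "\<exists>a b. b.span_over u v (unit_obj (Dom S u)) (unit_obj (Dom S v)) a b \<and> unit_arr u \<bullet> a = unit_arr v \<bullet> b \<and>
        (c u (Unt A) \<bullet> Eps (snd (Z u))) \<bullet> a = (c v (Unt A) \<bullet> Eps (snd (Z v))) \<bullet> b"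
      by blast
  qed
  then obtain g where g: "g \<in> varrs s (unit_obj s) (y (Unt A))"
    "\<And>u. u \<in> \<U> \<Longrightarrow> g \<bullet> unit_arr u = c u (Unt A) \<bullet> Eps (snd (Z u))" by blast
  have "g \<in> isos s (unit_obj s) (y (Unt A))"
    by (rule b.hom_descent_cartesian[OF hd cc us(2) g(1)]) (simp_all add: g(2) h Ident_member)
  then show ?thesis using g(2) by blast
qed

definition glued :: "('p, 'q, 'x, 'a) tfctr" where
  "glued = \<lparr>fobj = \<lambda>p\<in>Obj A. y p,
     farr = \<lambda>k\<in>Arr A. SOME g. g \<in> varrs s (y (Dom A k)) (y (Cod A k)) \<and>
       (\<forall>u\<in>\<U>. g \<bullet> c u (Dom A k) = c u (Cod A k) \<bullet> farr (snd (Z u)) k),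
     Mu = (\<lambda>p q. if p \<in> Obj A \<and> q \<in> Obj A
       then SOME g. g \<in> isos s (y p \<otimes> y q) (y (TensO A p q)) \<and>
         (\<forall>u\<in>\<U>. g \<bullet> (c u p \<odot> c u q) = c u (TensO A p q) \<bullet> Mu (snd (Z u)) p q)
       else undefined),
     Eps = (SOME g. g \<in> isos s (unit_obj s) (y (Unt A)) \<and> (\<forall>u\<in>\<U>. g \<bullet> unit_arr u = c u (Unt A) \<bullet> Eps (snd (Z u))))\<rparr>"

lemma glued:
  shows "tensor_data s glued" "u \<in> \<U> \<Longrightarrow> tensor_family u (snd (Z u)) glued (c u)" "extensional_tfctr A glued"
    "p \<in> Obj A \<Longrightarrow> fobj glued p = y p"
proof -
  have F: "farr glued k \<in> varrs s (y (Dom A k)) (y (Cod A k)) \<and>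
       (\<forall>u\<in>\<U>. farr glued k \<bullet> c u (Dom A k) = c u (Cod A k) \<bullet> farr (snd (Z u)) k)" if "k \<in> Arr A" for k
    using someI_ex[OF glue_arrow[OF that]] that by (simp add: glued_def)
  have M: "Mu glued p q \<in> isos s (y p \<otimes> y q) (y (TensO A p q)) \<and>
         (\<forall>u\<in>\<U>. Mu glued p q \<bullet> (c u p \<odot> c u q) = c u (TensO A p q) \<bullet> Mu (snd (Z u)) p q)" if "p \<in> Obj A" "q \<in> Obj A" for p q
    using someI_ex[OF glue_Mu[OF that]] that by (simp add: glued_def)
  have E: "Eps glued \<in> isos s (unit_obj s) (y (Unt A)) \<and> (\<forall>u\<in>\<U>. Eps glued \<bullet> unit_arr u = c u (Unt A) \<bullet> Eps (snd (Z u)))"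
    using someI_ex[OF glue_Eps] by (simp add: glued_def)
  have O: "fobj glued p = y p" if "p \<in> Obj A" for p
    using that by (simp add: glued_def)
  then show "p \<in> Obj A \<Longrightarrow> fobj glued p = y p" .
  show "tensor_data s glued"
    unfolding tensor_data_def using F M E y b.s by (simp add: O)
  show "tensor_family u (snd (Z u)) glued (c u)" if "u \<in> \<U>" for u
    unfolding tensor_family_def using F M E c that by (simp add: O)
  show "extensional_tfctr A glued"
    by (auto simp: extensional_tfctr_def glued_def extensional_def)
qed

lemma glued_laws: "obeys_laws glued"
  unfolding obeys_laws_def
proof (intro allI impI)
  fix l assume l: "lawful l"
  note side = law_sides[OF glued(1) l]
  have su: "Dom S u = Dom S u" "Cod S u = s" if "u \<in> \<U>" for u
    using b.member[OF that] by simp_all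
  show "lhs glued l = rhs glued l"
  proof (rule b.hom_descent_unique[OF hd law_family[OF glued(2) su l] vertD(7)[OF side(1) b.s] side])
    fix u assume u: "u \<in> \<U>"
    show "lhs glued l \<bullet> law_family u (c u) l = rhs glued l \<bullet> law_family u (c u) l"
      using law_natural[OF glued(1) members(3)[OF u] glued(2)[OF u] su[OF u] l] members(4)[OF u] l
      by (simp add: obeys_laws_def)
  qed
qed

text \<open>
  A cocone on the glued values restricts to a cocone on the values of each \<open>Z u\<close>, which has a unique
  factorisation \<open>m u\<close> through the colimit. On an overlap \<open>m u\<close> and \<open>m v\<close> agree, since the tensor functor
  there preserves the colimit as well and both restrict to the factorisation of the restricted cocone.
  So the \<open>m u\<close> glue, and by \<open>hom_descent_unique\<close> the glued arrow is the factorisation of the cocone.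
\<close>

lemma glued_colimits: "preserves_colimits \<kappa> A (Fib B s) glued"
  unfolding preserves_colimits_def
proof (intro allI impI, elim conjE)
  fix J :: "('j, 'j) cat" and D :: "('j, 'j, 'p, 'q) fctr" and x \<iota>
  assume J: "small_category \<kappa> J" and D: "is_functor J A D" and col: "is_colimit J A D x \<iota>"
  have cat: "category J" using J by (simp add: small_category_def)
  have JD: "Dom J h \<in> Obj J" "Cod J h \<in> Obj J" if "h \<in> Arr J" for h
    using cat that unfolding category_def by blast+
  have Dj: "fobj D j \<in> Obj A" if "j \<in> Obj J" for j
    using D that by (simp add: is_functor_def)
  have Dh: "farr D h \<in> Arr A" "Dom A (farr D h) = fobj D (Dom J h)" "Cod A (farr D h) = fobj D (Cod J h)" if "h \<in> Arr J" for h
    using D that by (simp_all add: is_functor_def Hom_def)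
  have x: "x \<in> Obj A" and io: "\<And>j. j \<in> Obj J \<Longrightarrow> \<iota> j \<in> Arr A" "\<And>j. j \<in> Obj J \<Longrightarrow> Dom A (\<iota> j) = fobj D j"
    "\<And>j. j \<in> Obj J \<Longrightarrow> Cod A (\<iota> j) = x"
    using col by (simp_all add: is_colimit_def is_cocone_def Hom_def)
  note G = tensor_dataD[OF glued(1)]
  have Gf: "is_functor A (Fib B s) glued"
    by (rule functor_of_laws[OF glued(1) glued_laws])
  have co: "is_cocone J (Fib B s) (comp_fctr glued D) (fobj glued x) (farr glued \<circ> \<iota>)"
    using functor_preserves_cocones[OF cat D Gf] col by (simp add: is_colimit_def)
  show "is_colimit J (Fib B s) (comp_fctr glued D) (fobj glued x) (farr glued \<circ> \<iota>)"
    unfolding is_colimit_def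
  proof (intro conjI co allI impI)
    fix w k assume "is_cocone J (Fib B s) (comp_fctr glued D) w k"
    then have w: "w \<in> Obj X" "fobj \<pi> w = s" and k: "\<And>j. j \<in> Obj J \<Longrightarrow> k j \<in> varrs s (fobj glued (fobj D j)) w"
      and kh: "\<And>h. h \<in> Arr J \<Longrightarrow> k (Cod J h) \<bullet> farr glued (farr D h) = k (Dom J h)"
      unfolding is_cocone_def Hom_Fib[OF b.s] Obj_Fib[OF b.s] Fib_structure(6)[OF b.s] by (simp_all add: comp_fctr_def)
    note kA = typing[OF k] and GA = typing[OF G(4)]
    have Gi: "farr glued (\<iota> j) \<in> varrs s (fobj glued (fobj D j)) (fobj glued x)" if "j \<in> Obj J" for j
      using G(4)[OF io(1)[OF that]] by (simp add: io that)
    \<comment> \<open>a cocone over the base object restricts to a cocone over any base arrow \<open>g\<close> carrying a family to the glued functor\<close>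
    have ex1: "\<exists>!m. m \<in> arrs g (fobj (snd W) x) w \<and> (\<forall>j\<in>Obj J. m \<bullet> farr (snd W) (\<iota> j) = k j \<bullet> e (fobj D j))"
      if W: "W \<in> tf_objects \<kappa> A B" and e: "tensor_family g (snd W) glued e" and g: "Dom S g = fst W" "Cod S g = s" for W g e
    proof (rule colimit_over_base_arrow[OF W J D col w(1)])
      note EF = tensor_familyD[OF e] and WD = tensor_dataD[OF tf_objectD(2)[OF W]]
      show gA: "g \<in> Arr S" by (rule EF(6))
      show "k j \<bullet> e (fobj D j) \<in> arrs g (fobj (snd W) (fobj D j)) w" if "j \<in> Obj J" for j
        using arrs_comp[OF EF(5)[OF Dj[OF that]] k[OF that]] gA g by simp
      fix h assume h: "h \<in> Arr J"
      note A' = typing[OF EF(5)] typing[OF WD(4)]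
      have "(k (Cod J h) \<bullet> e (fobj D (Cod J h))) \<bullet> farr (snd W) (farr D h) = k (Cod J h) \<bullet> farr glued (farr D h) \<bullet> e (fobj D (Dom J h))"
        using EF(2)[OF Dh(1)[OF h]] by (simp add: A' kA JD Dj Dh h)
      also have "\<dots> = k (Dom J h) \<bullet> e (fobj D (Dom J h))"
        using chain[OF kh[OF h], of "e (fobj D (Dom J h))"] by (simp add: A' kA GA JD Dj Dh h)
      finally show "(k (Cod J h) \<bullet> e (fobj D (Cod J h))) \<bullet> farr (snd W) (farr D h) = k (Dom J h) \<bullet> e (fobj D (Dom J h))" .
    qed (simp_all add: g w)
    have su: "Dom S u = fst (Z u)" "Cod S u = s" if "u \<in> \<U>" for u
      using b.member[OF that] members(2)[OF that] by simp_all
    define m where "m u = (THE m. m \<in> arrs u (fobj (snd (Z u)) x) w \<and> (\<forall>j\<in>Obj J. m \<bullet> farr (snd (Z u)) (\<iota> j) = k j \<bullet> c u (fobj D j)))" for u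
    have mex: "\<exists>!m. m \<in> arrs u (fobj (snd (Z u)) x) w \<and> (\<forall>j\<in>Obj J. m \<bullet> farr (snd (Z u)) (\<iota> j) = k j \<bullet> c u (fobj D j))" if "u \<in> \<U>" for u
      by (rule ex1[OF members(1)[OF that] glued(2)[OF that] su[OF that]])
    have m: "m u \<in> arrs u (fobj (snd (Z u)) x) w" "\<And>j. j \<in> Obj J \<Longrightarrow> m u \<bullet> farr (snd (Z u)) (\<iota> j) = k j \<bullet> c u (fobj D j)" if "u \<in> \<U>" for u
      using theI'[OF mex[OF that]] unfolding m_def[symmetric] by blast+
    have cx: "c u x \<in> carts u (fobj (snd (Z u)) x) (fobj glued x)" if "u \<in> \<U>" for u
      using c[OF that x] by (simp add: glued(4)[OF x])
    have gx: "fobj glued x \<in> Obj X" "fobj \<pi> (fobj glued x) = s"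
      using G(2,3) x by simp_all
    have key: "(\<forall>j\<in>Obj J. g \<bullet> farr glued (\<iota> j) = k j) \<longleftrightarrow> (\<forall>u\<in>\<U>. g \<bullet> c u x = m u)"
      if g: "g \<in> varrs s (fobj glued x) w" for g
    proof -
      note gA = typing[OF g]
      have sw: "(g \<bullet> c u x) \<bullet> farr (snd (Z u)) (\<iota> j) = (g \<bullet> farr glued (\<iota> j)) \<bullet> c u (fobj D j)" if u: "u \<in> \<U>" and j: "j \<in> Obj J" for u j
        using tensor_familyD(2)[OF glued(2)[OF u] io(1)[OF j]]
        by (simp add: io j x gA typing[OF Gi[OF j]] cart_typing[OF cx[OF u]]
            typing[OF tensor_dataD(4)[OF members(3)[OF u] io(1)[OF j]]] typing[OF tensor_familyD(5)[OF glued(2)[OF u] Dj[OF j]]])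
      show ?thesis
      proof (intro iffI ballI)
        fix u assume A': "\<forall>j\<in>Obj J. g \<bullet> farr glued (\<iota> j) = k j" and u: "u \<in> \<U>"
        have "g \<bullet> c u x \<in> arrs u (fobj (snd (Z u)) x) w"
          using arrs_comp[OF carts_arrs[OF cx[OF u]] g] by (simp add: Ident_member u)
        moreover have "\<forall>j\<in>Obj J. (g \<bullet> c u x) \<bullet> farr (snd (Z u)) (\<iota> j) = k j \<bullet> c u (fobj D j)"
          using sw[OF u] A' by simp
        ultimately show "g \<bullet> c u x = m u"
          using mex[OF u] m[OF u] by blast
      next
        fix j assume A': "\<forall>u\<in>\<U>. g \<bullet> c u x = m u" and j: "j \<in> Obj J"
        have gi: "g \<bullet> farr glued (\<iota> j) \<in> varrs s (fobj glued (fobj D j)) w"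
          by (rule vertical_comp[OF b.s Gi[OF j] g])
        show "g \<bullet> farr glued (\<iota> j) = k j"
        proof (rule b.hom_descent_unique[OF hd _ G(3)[OF Dj[OF j]] gi k[OF j]])
          show "c u (fobj D j) \<in> carts u (fobj (snd (Z u)) (fobj D j)) (fobj glued (fobj D j))" if "u \<in> \<U>" for u
            by (rule tensor_familyD(1)[OF glued(2)[OF that] Dj[OF j]])
          show "(g \<bullet> farr glued (\<iota> j)) \<bullet> c u (fobj D j) = k j \<bullet> c u (fobj D j)" if "u \<in> \<U>" for u
            using sw[OF that j] A' m(2)[OF that j] that by simp
        qed
      qed
    qed
    have gex: "\<exists>!g. g \<in> varrs s (fobj glued x) w \<and> (\<forall>u\<in>\<U>. g \<bullet> c u x = m u)"
    proof (rule b.hom_descent_ex1[OF hd cx gx w(1)])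
      show "m u \<in> arrs (Ident S s \<star> u) (fobj (snd (Z u)) x) w" if "u \<in> \<U>" for u
        using m(1)[OF that] by (simp add: Ident_member that)
      fix u v assume uv: "u \<in> \<U>" "v \<in> \<U>"
      note o = b.overlap[OF uv] and L = legs[OF uv]
      note La = tensor_familyD[OF L(3)] and Lb = tensor_familyD[OF L(4)]
      let ?W = "Dom TF (a u v)"
      have fam: "tensor_family (u \<star> pr1 S u v) (snd ?W) glued (\<lambda>p. c u p \<bullet> ev (a u v) p)"
        by (rule tensor_family_comp[OF glued(1) members(3)[OF uv(1)] L(1) glued(2)[OF uv(1)] refl _ L(3)])
          (simp_all add: b.member uv o)
      have gW: "Dom S (u \<star> pr1 S u v) = fst ?W" "Cod S (u \<star> pr1 S u v) = s"
        using b.member[OF uv(1)] o(1,4) L(6) by simp_all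
      note wex = ex1[OF L(2) fam gW]
      have WD: "farr (snd ?W) (\<iota> j) \<in> varrs (Dom S (pr1 S u v)) (fobj (snd ?W) (fobj D j)) (fobj (snd ?W) x)" if "j \<in> Obj J" for j
        using tensor_dataD(4)[OF L(1) io(1)[OF that]] by (simp add: io that)
      have test: "(m t \<bullet> e x) \<bullet> farr (snd ?W) (\<iota> j) = k j \<bullet> c t (fobj D j) \<bullet> e (fobj D j)"
        if t: "t \<in> \<U>" and e: "tensor_family q (snd ?W) (snd (Z t)) e" and j: "j \<in> Obj J" for t e q j
      proof -
        note EF = tensor_familyD[OF e]
        note D' = typing[OF m(1)[OF t]] typing[OF EF(5)[OF x]] typing[OF EF(5)[OF Dj[OF j]]] typing[OF WD[OF j]]
          typing[OF tensor_dataD(4)[OF members(3)[OF t] io(1)[OF j]]] kA[OF j] typing[OF tensor_familyD(5)[OF glued(2)[OF t] Dj[OF j]]]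
        have "(m t \<bullet> e x) \<bullet> farr (snd ?W) (\<iota> j) = m t \<bullet> farr (snd (Z t)) (\<iota> j) \<bullet> e (fobj D j)"
          using EF(2)[OF io(1)[OF j]] by (simp add: D' io j)
        also have "\<dots> = k j \<bullet> c t (fobj D j) \<bullet> e (fobj D j)"
          using chain[OF m(2)[OF t j], of "e (fobj D j)"] by (simp add: D' io j)
        finally show ?thesis .
      qed
      have "m u \<bullet> ev (a u v) x \<in> arrs (u \<star> pr1 S u v) (fobj (snd ?W) x) w"
        "m v \<bullet> ev (b u v) x \<in> arrs (u \<star> pr1 S u v) (fobj (snd ?W) x) w"
        using arrs_comp[OF La(5)[OF x] m(1)[OF uv(1)]] arrs_comp[OF Lb(5)[OF x] m(1)[OF uv(2)]] o(6) by simp_all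
      moreover have "\<forall>j\<in>Obj J. (m u \<bullet> ev (a u v) x) \<bullet> farr (snd ?W) (\<iota> j) = k j \<bullet> c u (fobj D j) \<bullet> ev (a u v) (fobj D j)"
        "\<forall>j\<in>Obj J. (m v \<bullet> ev (b u v) x) \<bullet> farr (snd ?W) (\<iota> j) = k j \<bullet> c u (fobj D j) \<bullet> ev (a u v) (fobj D j)"
        using test[OF uv(1) L(3)] test[OF uv(2) L(4)] ceq[OF uv Dj] by simp_all
      ultimately have "m u \<bullet> ev (a u v) x = m v \<bullet> ev (b u v) x"
        using wex by blast
      then show "\<exists>a b. b.span_over u v (fobj (snd (Z u)) x) (fobj (snd (Z v)) x) a b \<and> c u x \<bullet> a = c v x \<bullet> b \<and> m u \<bullet> a = m v \<bullet> b"
        using L(5)[OF x] ceq[OF uv x] by blast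
    qed (simp_all add: b.s w)
    have "\<exists>!g. g \<in> varrs s (fobj glued x) w \<and> (\<forall>j\<in>Obj J. g \<bullet> farr glued (\<iota> j) = k j)"
      using gex key by (metis (no_types, lifting))
    then show "\<exists>!g. g \<in> Hom (Fib B s) (fobj glued x) w \<and> (\<forall>j\<in>Obj J. Comp (Fib B s) g ((farr glued \<circ> \<iota>) j) = k j)"
      unfolding Hom_Fib[OF b.s] Fib_structure(6)[OF b.s] o_apply .
  qed
qed

lemma glued_descends:
  "\<exists>Y k. Y \<in> Obj TF \<and> fobj tf_proj Y = s \<and> (\<forall>u\<in>\<U>. k u \<in> T.carts u (Z u) Y) \<and>
     (\<forall>u\<in>\<U>. \<forall>v\<in>\<U>. Comp TF (k u) (a u v) = Comp TF (k v) (b u v))"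
proof -
  let ?Y = "(s, glued)" and ?k = "\<lambda>u. mk (Z u) (s, glued) u (c u)"
  have Y: "?Y \<in> tf_objects \<kappa> A B"
    unfolding tf_objects_iff using glued(1,3) glued_laws glued_colimits by blast
  have fam: "tensor_family u (snd (Z u)) (snd ?Y) (c u)" if "u \<in> \<U>" for u
    using glued(2)[OF that] by simp
  have k: "?k u \<in> T.arrs u (Z u) ?Y" if "u \<in> \<U>" for u
    using mk_arr[OF members(1)[OF that] Y _ _ fam[OF that]] b.member[OF that] members(2)[OF that]
    by (intro T.arrsI) simp_all
  have "Comp TF (?k u) (a u v) = Comp TF (?k v) (b u v)" if uv: "u \<in> \<U>" "v \<in> \<U>" for u v
  proof -
    note E = ev_span(2,3)[OF sp[OF uv] A_structure_simps(1)]
    note l = T_arrsD[OF T.arrs_comp[OF E(1) k[OF uv(1)]]] and r = T_arrsD[OF T.arrs_comp[OF E(2) k[OF uv(2)]]]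
    show ?thesis
    proof (rule tf_eqI[OF l(1) r(1)])
      fix p assume p: "p \<in> Obj A"
      show "ev (Comp TF (?k u) (a u v)) p = ev (Comp TF (?k v) (b u v)) p"
        using ev_comp[OF k[OF uv(1)] E(1) p] ev_comp[OF k[OF uv(2)] E(2) p] ceq[OF uv p]
        by (simp add: ev_mk[OF fam[OF uv(1)] p] ev_mk[OF fam[OF uv(2)] p])
    qed (simp_all add: l r b.overlap(6)[OF uv])
  qed
  then show ?thesis
    using Y k T_carts by (intro exI[of _ ?Y] exI[of _ ?k]) simp
qed

end

text \<open>
  Evaluating the spans and the cocycle condition at an object \<open>p\<close> of \<open>A\<close> gives gluing data in \<open>B\<close>; the
  objects glued from them are the values of the functor to be found.
\<close>

lemma tf_obj_descent:
  assumes hd: b.hom_descent and od: b.obj_descent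
  shows t.obj_descent
  unfolding t.obj_descent_def
proof (intro allI impI, elim conjE)
  fix Z a b
  assume sp: "\<forall>u\<in>\<U>. \<forall>v\<in>\<U>. t.span_over u v (Z u) (Z v) (a u v) (b u v)" and co: "t.cocycle Z a b"
  have "\<exists>yc. fst yc \<in> Obj X \<and> fobj \<pi> (fst yc) = s \<and> (\<forall>u\<in>\<U>. snd yc u \<in> carts u (fobj (snd (Z u)) p) (fst yc)) \<and>
     (\<forall>u\<in>\<U>. \<forall>v\<in>\<U>. snd yc u \<bullet> ev (a u v) p = snd yc v \<bullet> ev (b u v) p)" if p: "p \<in> Obj A" for p
  proof -
    have fac: "b.factors (ev (a u v) p) (ev (b u v) p) (ev \<alpha> p) (ev \<beta> p)"
      if uv: "u \<in> \<U>" "v \<in> \<U>" and f: "t.factors (a u v) (b u v) \<alpha> \<beta>" for u v \<alpha> \<beta>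
    proof -
      note E = ev_span(2,3)[OF sp[rule_format, OF uv] p]
      obtain z where z: "z \<in> Arr TF" "Cod TF z = Dom TF (a u v)" "Comp TF (a u v) z = \<alpha>" "Comp TF (b u v) z = \<beta>"
        using f by (auto simp: t.factors_def)
      have zT: "z \<in> T.arrs (farr tf_proj z) (Dom TF z) (Dom TF (a u v))"
        using z by (intro T.arrsI) simp_all
      note zf = tensor_familyD(5)[OF T_arrsD(7)[OF zT] p]
      have "Dom X (ev (a u v) p) = fobj (snd (Dom TF (a u v))) p"
        using arrsD(2)[OF tensor_familyD(5)[OF T_arrsD(7)[OF E(1)] p]] .
      then show ?thesis
        unfolding b.factors_def using arrsD(1,3)[OF zf] ev_comp[OF E(1) zT p] ev_comp[OF E(2) zT p] z(3,4) by auto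
    qed
    have "b.cocycle (\<lambda>u. fobj (snd (Z u)) p) (\<lambda>u v. ev (a u v) p) (\<lambda>u v. ev (b u v) p)"
      unfolding b.cocycle_def
    proof (intro ballI)
      fix u v w assume uvw: "u \<in> \<U>" "v \<in> \<U>" "w \<in> \<U>"
      obtain q1 q2 q3 where q: "fprod3 S u v w = (q1, q2, q3)"
        by (metis prod_cases3)
      obtain W \<alpha> \<beta> \<gamma> where A': "\<alpha> \<in> T.carts q1 W (Z u)" "\<beta> \<in> T.carts q2 W (Z v)" "\<gamma> \<in> T.carts q3 W (Z w)"
        and F: "t.factors (a u v) (b u v) \<alpha> \<beta>" "t.factors (a v w) (b v w) \<beta> \<gamma>" "t.factors (a u w) (b u w) \<alpha> \<gamma>"
        using co[unfolded t.cocycle_def, rule_format, OF uvw] q by auto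
      note AT = tensor_familyD(1)[OF T_arrsD(7)[OF T.carts_arrs[OF A'(1)]] p]
        tensor_familyD(1)[OF T_arrsD(7)[OF T.carts_arrs[OF A'(2)]] p]
        tensor_familyD(1)[OF T_arrsD(7)[OF T.carts_arrs[OF A'(3)]] p]
      show "case fprod3 S u v w of (q1, q2, q3) \<Rightarrow>
        \<exists>z \<alpha> \<beta> \<gamma>. \<alpha> \<in> carts q1 z (fobj (snd (Z u)) p) \<and> \<beta> \<in> carts q2 z (fobj (snd (Z v)) p) \<and> \<gamma> \<in> carts q3 z (fobj (snd (Z w)) p) \<and>
         b.factors (ev (a u v) p) (ev (b u v) p) \<alpha> \<beta> \<and> b.factors (ev (a v w) p) (ev (b v w) p) \<beta> \<gamma> \<and>
         b.factors (ev (a u w) p) (ev (b u w) p) \<alpha> \<gamma>"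
        unfolding q using AT fac[OF uvw(1,2) F(1)] fac[OF uvw(2,3) F(2)] fac[OF uvw(1,3) F(3)] by auto
    qed
    moreover have "\<forall>u\<in>\<U>. \<forall>v\<in>\<U>. b.span_over u v (fobj (snd (Z u)) p) (fobj (snd (Z v)) p) (ev (a u v) p) (ev (b u v) p)"
      using ev_span(1)[OF sp[rule_format] p] by blast
    ultimately obtain y c where "y \<in> Obj X" "fobj \<pi> y = s" "\<forall>u\<in>\<U>. c u \<in> carts u (fobj (snd (Z u)) p) y"
      "\<forall>u\<in>\<U>. \<forall>v\<in>\<U>. c u \<bullet> ev (a u v) p = c v \<bullet> ev (b u v) p"
      using od[unfolded b.obj_descent_def, rule_format,
          of "\<lambda>u. fobj (snd (Z u)) p" "\<lambda>u v. ev (a u v) p" "\<lambda>u v. ev (b u v) p"] by blast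
    then show ?thesis
      by (intro exI[of _ "(y, c)"]) simp
  qed
  then obtain yc where yc: "\<And>p. p \<in> Obj A \<Longrightarrow> fst (yc p) \<in> Obj X \<and> fobj \<pi> (fst (yc p)) = s \<and>
     (\<forall>u\<in>\<U>. snd (yc p) u \<in> carts u (fobj (snd (Z u)) p) (fst (yc p))) \<and>
     (\<forall>u\<in>\<U>. \<forall>v\<in>\<U>. snd (yc p) u \<bullet> ev (a u v) p = snd (yc p) v \<bullet> ev (b u v) p)"
    by metis
  show "\<exists>y c. y \<in> Obj TF \<and> fobj tf_proj y = s \<and> (\<forall>u\<in>\<U>. c u \<in> T.carts u (Z u) y) \<and>
     (\<forall>u\<in>\<U>. \<forall>v\<in>\<U>. Comp TF (c u) (a u v) = Comp TF (c v) (b u v))"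
    by (rule glued_descends[OF hd, where y = "\<lambda>p. fst (yc p)" and c = "\<lambda>u p. snd (yc p) u"])
      (use sp yc in \<open>simp_all\<close>)
qed

end

section \<open>Prestacks and stacks of tensor functors\<close>

theorem theorem2p4:
  fixes \<kappa> :: "'j rel"
    and S :: "('s, 'f) cat"
    and Cov :: "'s \<Rightarrow> 'f set set"
    and B :: "('s, 'f, 'x, 'a) fatcat"
    and A :: "('p, 'q) atcat"
  assumes "Cinfinite \<kappa>"
    and "grothendieck_topology S Cov"
    and "fibred_in_abelian_tensor_categories \<kappa> S B"
    and "abelian_tensor_category \<kappa> A"
  shows "((\<forall>s\<in>Obj S. \<forall>\<U>\<in>Cov s. fully_faithful (fib B s) (DD B \<U>) (delta B \<U>))
            \<longrightarrow> prestack S Cov (tf_cat \<kappa> A B) tf_proj) \<and>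
         ((\<forall>s\<in>Obj S. \<forall>\<U>\<in>Cov s. fully_faithful (fib B s) (DD B \<U>) (delta B \<U>) \<and>
              essentially_surjective (fib B s) (DD B \<U>) (delta B \<U>))
            \<longrightarrow> stack S Cov (tf_cat \<kappa> A B) tf_proj)"
proof -
  have base: "Base B = S"
    using assms(3) by (simp add: fibred_in_abelian_tensor_categories_def)
  interpret tensor_functors B \<kappa> A
    using assms(3,4) by unfold_locales (simp_all add: base fibred_in_abelian_tensor_categories_def)
  have top: "grothendieck_topology (Base B) Cov"
    using assms(2) by (simp add: base)
  have cov: "covered_tensor_functors B \<kappa> A s \<U>" "covered_cloven_fibration B s \<U>"
    if "s \<in> Obj (Base B)" "\<U> \<in> Cov s" for s \<U>
    using covering_of_topology[OF top that] by unfold_locales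
  have hom: "covered_fibration.hom_descent (Base B) TF tf_proj s \<U>"
    "covered_fibration.hom_descent (Base B) (Tot B) (Proj B) s \<U>"
    if "s \<in> Obj (Base B)" "\<U> \<in> Cov s" "fully_faithful (fib B s) (DD B \<U>) (delta B \<U>)" for s \<U>
    using covered_tensor_functors.tf_hom_descent[OF cov(1)[OF that(1,2)]]
      covered_cloven_fibration.hom_descent_of_fully_faithful[OF cov(2)[OF that(1,2)] that(3)] by blast+
  have obj: "covered_fibration.obj_descent (Base B) TF tf_proj s \<U>"
    if "s \<in> Obj (Base B)" "\<U> \<in> Cov s" "fully_faithful (fib B s) (DD B \<U>) (delta B \<U>)"
      "essentially_surjective (fib B s) (DD B \<U>) (delta B \<U>)" for s \<U>
    using covered_tensor_functors.tf_obj_descent[OF cov(1)[OF that(1,2)] hom(2)[OF that(1-3)]]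
      covered_cloven_fibration.obj_descent_of_essentially_surjective[OF cov(2)[OF that(1,2)] that(4)] by blast
  have pre: "prestack (Base B) Cov TF tf_proj"
    if "\<forall>s\<in>Obj (Base B). \<forall>\<U>\<in>Cov s. fully_faithful (fib B s) (DD B \<U>) (delta B \<U>)"
    using T.prestackI[OF top groupoid_fibres] hom(1) that by blast
  have "stack (Base B) Cov TF tf_proj"
    if "\<forall>s\<in>Obj (Base B). \<forall>\<U>\<in>Cov s. fully_faithful (fib B s) (DD B \<U>) (delta B \<U>) \<and>
              essentially_surjective (fib B s) (DD B \<U>) (delta B \<U>)"
    using T.stackI[OF top pre] obj that by blast
  with pre show ?thesis
    unfolding base by blast
qed

end
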